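(* Let $N\in\mathbb{Z}_{\geq1}$, $\gamma>1$, $\theta>0$, and let $p$ and $q$ satisfy $$\frac{N(\gamma-1)}{\theta}<p<\infty,\quad \gamma\leq p,\quad \gamma<q<\infty\quad\text{and}\quad \frac{\theta}{\gamma-1}-\frac{\theta}{q}-\frac{N}{p}=0.$$ Let $\mu\in\mathcal{S}'(\mathbb{R}^N)$ and assume that, for some $T>0$, a function $u(x,t)\in L^q(0,T;L^p(\mathbb{R}^N))$ satisfies the integral equation $$u(x,t)=S(t)\mu(x)+\int_0^tS(t-\tau)\left[|u|^{\gamma-1}u(\cdot,\tau)\right](x)\,d\tau$$ for a.e. $(x,t)\in\mathbb{R}^N\times(0,T)$. Then $\mu$ must be an element of the inhomogeneous Besov space $$B^{-\theta/q,q}_p(\mathbb{R}^N)=B^{N/p-\theta/(\gamma-1),q}_{Nq(\gamma-1)/\theta(q-\gamma+1)}(\mathbb{R}^N).$$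
   Context: $S(t)f=\mathcal{F}^{-1}[\exp(-t|\xi|^\theta)\mathcal{F}f]$ for $t>0$, $f\in\mathcal{S}'(\mathbb{R}^N)$. The integral equation is the mild form of the Cauchy problem $\partial_tu+(-\Delta)^{\theta/2}u=|u|^{\gamma-1}u$, $u(\cdot,0)=\mu$. Let $\zeta\in C_c^\infty([0,\infty);\mathbb{R})$ with $0\le\zeta\le1$, $\zeta\equiv1$ for $t\le3/2$, $\operatorname{supp}\zeta\subset[0,5/3)$; $\varphi_{(0)}(\xi)=\zeta(|\xi|)$, $\varphi_0(\xi)=\zeta(|\xi|)-\zeta(2|\xi|)$, $\varphi_j(\xi)=\varphi_0(2^{-j}\xi)$; $\Delta_0f=\mathcal{F}^{-1}[\varphi_{(0)}\mathcal{F}f]$, $\Delta_jf=\mathcal{F}^{-1}[\varphi_j\mathcal{F}f]$ for $j\ge1$. The inhomogeneous Besov space $B^{s,r}_p(\mathbb{R}^N)$ (regularity $s$, integrability $p$, summability $r$) is the set of $f\in\mathcal{S}'(\mathbb{R}^N)$ with $\left\|\{2^{sj}\|\Delta_jf\|_{L^p}\}_{j\ge0}\right\|_{\ell^r}<\infty$. In $B^{N/p-\theta/(\gamma-1),q}_{Nq(\gamma-1)/\theta(q-\gamma+1)}$ the integrability exponent is $\frac{Nq(\gamma-1)}{\theta(q-\gamma+1)}$.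
   Formalization: For θ not an even integer, exp(-t|ξ|^θ)Fμ is undefined for general μ in S'; S(t)μ is read as the limit in S', as ε→0+, of S(t)[η(εx)μ], assumed to exist for a.e. t and to be independent of the cutoff η (smooth, compactly supported, equal to 1 near 0). *)

theory Defs
  imports "HOL-Analysis.Analysis"
begin

section \<open>Schwartz functions and tempered distributions on \<open>\<real>\<^sup>N\<close>\<close>

text \<open>Space dimension: \<open>N = CARD('n)\<close>. Functions and distributions are complex valued.\<close>

primrec iter_partial :: "'n::finite list \<Rightarrow> (real^'n \<Rightarrow> complex) \<Rightarrow> (real^'n \<Rightarrow> complex)" where
  "iter_partial [] f = f"
| "iter_partial (i # is) f = (\<lambda>x. frechet_derivative (iter_partial is f) (at x) (axis i 1))"

definition schwartz :: "(real^'n::finite \<Rightarrow> complex) \<Rightarrow> bool" where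
  "schwartz \<phi> \<longleftrightarrow>
     (\<forall>is. (\<forall>x. iter_partial is \<phi> differentiable (at x)) \<and>
           (\<forall>k::nat. bounded (range (\<lambda>x. (1 + norm x) ^ k *\<^sub>R iter_partial is \<phi> x))))"

definition schwartz_norm :: "nat \<Rightarrow> (real^'n::finite \<Rightarrow> complex) \<Rightarrow> real" where
  "schwartz_norm k \<phi> =
     Sup {(1 + norm x) ^ k * norm (iter_partial is \<phi> x) | is x. length is \<le> k}"

text \<open>A distribution is represented by a total function on all maps \<open>\<real>\<^sup>N \<Rightarrow> \<complex>\<close>;
  only its values on Schwartz functions are meaningful.\<close>

type_synonym 'n dist = "(real^'n \<Rightarrow> complex) \<Rightarrow> complex"

definition tempered :: "'n::finite dist \<Rightarrow> bool" where
  "tempered f \<longleftrightarrow>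
     (\<forall>\<phi> \<psi>. schwartz \<phi> \<longrightarrow> schwartz \<psi> \<longrightarrow> f (\<lambda>x. \<phi> x + \<psi> x) = f \<phi> + f \<psi>) \<and>
     (\<forall>c \<phi>. schwartz \<phi> \<longrightarrow> f (\<lambda>x. c * \<phi> x) = c * f \<phi>) \<and>
     (\<exists>C k. \<forall>\<phi>. schwartz \<phi> \<longrightarrow> norm (f \<phi>) \<le> C * schwartz_norm k \<phi>)"

definition regular_dist :: "(real^'n::finite \<Rightarrow> complex) \<Rightarrow> 'n dist" where
  "regular_dist g = (\<lambda>\<phi>. \<integral>x. g x * \<phi> x \<partial>lebesgue)"

definition represents :: "(real^'n::finite \<Rightarrow> complex) \<Rightarrow> 'n dist \<Rightarrow> bool" where
  "represents g f \<longleftrightarrow>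
     (\<forall>\<phi>. schwartz \<phi> \<longrightarrow> integrable lebesgue (\<lambda>x. g x * \<phi> x) \<and> f \<phi> = regular_dist g \<phi>)"


section \<open>Fourier transform and Fourier multipliers\<close>

definition fourier :: "(real^'n::finite \<Rightarrow> complex) \<Rightarrow> (real^'n \<Rightarrow> complex)" where
  "fourier \<phi> = (\<lambda>\<xi>. \<integral>x. cis (- (x \<bullet> \<xi>)) * \<phi> x \<partial>lborel)"

definition inv_fourier :: "(real^'n::finite \<Rightarrow> complex) \<Rightarrow> (real^'n \<Rightarrow> complex)" where
  "inv_fourier \<phi> = (\<lambda>x. (\<integral>\<xi>. cis (x \<bullet> \<xi>) * \<phi> \<xi> \<partial>lborel) / complex_of_real ((2 * pi) ^ CARD('n)))"

definition dist_fourier :: "'n::finite dist \<Rightarrow> 'n dist" where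
  "dist_fourier f = (\<lambda>\<phi>. f (fourier \<phi>))"

definition dist_inv_fourier :: "'n::finite dist \<Rightarrow> 'n dist" where
  "dist_inv_fourier f = (\<lambda>\<phi>. f (inv_fourier \<phi>))"

definition dist_mult :: "(real^'n::finite \<Rightarrow> complex) \<Rightarrow> 'n dist \<Rightarrow> 'n dist" where
  "dist_mult m f = (\<lambda>\<phi>. f (\<lambda>x. m x * \<phi> x))"

definition multiplier :: "(real^'n::finite \<Rightarrow> complex) \<Rightarrow> 'n dist \<Rightarrow> 'n dist" where
  "multiplier m f = dist_inv_fourier (dist_mult m (dist_fourier f))"


section \<open>The semigroup \<open>S(t)\<close>\<close>

definition space_cutoff :: "(real^'n::finite \<Rightarrow> complex) \<Rightarrow> bool" where
  "space_cutoff \<eta> \<longleftrightarrow>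
     schwartz \<eta> \<and> bounded {x. \<eta> x \<noteq> 0} \<and> (\<exists>r>0. \<forall>x\<in>ball 0 r. \<eta> x = 1)"

text \<open>The symbol \<open>exp (-t|\<xi>|\<^sup>\<theta>)\<close> is not smooth at \<open>\<xi> = 0\<close> unless \<open>\<theta>\<close> is an even integer, so
  its product with the Fourier transform of a tempered distribution \<open>f\<close> need not exist.
  If \<open>f\<close> is multiplied by a compactly supported smooth cutoff first, its Fourier transform is a
  smooth function of polynomial growth and the product is unproblematic: after unfolding
  \<open>multiplier\<close>, the distribution \<open>f\<close> is evaluated at a smooth compactly supported function.
  \<open>S(t)f\<close> is the limit in \<open>S'\<close> when the cutoffs \<open>\<eta>(\<epsilon>x)\<close> are removed, required to exist and to
  be the same for all \<open>\<eta>\<close>. For even \<open>\<theta>\<close> the limit always exists and is the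
  usual \<open>F\<^sup>-\<^sup>1[exp (-t|\<xi>|\<^sup>\<theta>) F f]\<close>. The value \<open>S(t)f(x)\<close> is that of the (unique)
  continuous representative.\<close>

definition has_semigroup_value ::
    "real \<Rightarrow> real \<Rightarrow> 'n::finite dist \<Rightarrow> (real^'n \<Rightarrow> complex) \<Rightarrow> bool" where
  "has_semigroup_value \<theta> t f g \<longleftrightarrow>
     continuous_on UNIV g \<and>
     (\<forall>\<phi>. schwartz \<phi> \<longrightarrow>
        integrable lebesgue (\<lambda>x. g x * \<phi> x) \<and>
        (\<forall>\<eta>. space_cutoff \<eta> \<longrightarrow>
          ((\<lambda>\<epsilon>. multiplier (\<lambda>\<xi>. complex_of_real (exp (- t * norm \<xi> powr \<theta>)))
                  (dist_mult (\<lambda>x. \<eta> (\<epsilon> *\<^sub>R x)) f) \<phi>)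
            \<longlongrightarrow> regular_dist g \<phi>) (at_right 0)))"

definition semigroup_defined :: "real \<Rightarrow> real \<Rightarrow> 'n::finite dist \<Rightarrow> bool" where
  "semigroup_defined \<theta> t f \<longleftrightarrow> (\<exists>g. has_semigroup_value \<theta> t f g)"

definition frac_semigroup :: "real \<Rightarrow> real \<Rightarrow> 'n::finite dist \<Rightarrow> (real^'n \<Rightarrow> complex)" where
  "frac_semigroup \<theta> t f = (THE g. has_semigroup_value \<theta> t f g)"


section \<open>Lebesgue spaces and the integral equation\<close>

definition in_Lp :: "real \<Rightarrow> (real^'n::finite \<Rightarrow> complex) \<Rightarrow> bool" where
  "in_Lp p g \<longleftrightarrow>
     g \<in> borel_measurable lebesgue \<and> integrable lebesgue (\<lambda>x. norm (g x) powr p)"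

definition Lp_norm :: "real \<Rightarrow> (real^'n::finite \<Rightarrow> complex) \<Rightarrow> real" where
  "Lp_norm p g = (\<integral>x. norm (g x) powr p \<partial>lebesgue) powr (1 / p)"

definition in_Lq_Lp :: "real \<Rightarrow> real \<Rightarrow> real \<Rightarrow> (real^'n::finite \<Rightarrow> real \<Rightarrow> complex) \<Rightarrow> bool" where
  "in_Lq_Lp q T p u \<longleftrightarrow>
     (\<lambda>(x, t). u x t) \<in> borel_measurable (lebesgue_on (UNIV \<times> {0<..<T})) \<and>
     (AE t in lebesgue_on {0<..<T}. in_Lp p (\<lambda>x. u x t)) \<and>
     integrable (lebesgue_on {0<..<T}) (\<lambda>t. Lp_norm p (\<lambda>x. u x t) powr q)"

text \<open>For \<open>u \<in> L\<^sup>q(0,T;L\<^sup>p)\<close> with exponents as in the theorem, the semigroup inside the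
  integral is always defined and the integral converges absolutely at almost every \<open>(x,t)\<close>;
  only the existence of \<open>S(t)\<mu>\<close> has to be asked for.\<close>

definition mild_solution ::
    "real \<Rightarrow> real \<Rightarrow> real \<Rightarrow> 'n::finite dist \<Rightarrow> (real^'n \<Rightarrow> real \<Rightarrow> complex) \<Rightarrow> bool" where
  "mild_solution \<theta> \<gamma> T \<mu> u \<longleftrightarrow>
     (AE (x, t) in lebesgue_on (UNIV \<times> {0<..<T}).
        semigroup_defined \<theta> t \<mu> \<and>
        u x t = frac_semigroup \<theta> t \<mu> x
          + (\<integral>\<tau>. frac_semigroup \<theta> (t - \<tau>)
                  (regular_dist (\<lambda>y. complex_of_real (norm (u y \<tau>) powr (\<gamma> - 1)) * u y \<tau>)) x
             \<partial>lebesgue_on {0<..<t}))"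


section \<open>Inhomogeneous Besov spaces\<close>

text \<open>Since \<open>\<zeta>\<close> is constant on \<open>[0, 3/2]\<close>, smoothness on the open half line is
  smoothness on \<open>[0, \<infinity>)\<close>.\<close>

definition lp_cutoff :: "(real \<Rightarrow> real) \<Rightarrow> bool" where
  "lp_cutoff \<zeta> \<longleftrightarrow>
     (\<forall>k. \<forall>t>0. (deriv ^^ k) \<zeta> differentiable (at t)) \<and>
     (\<forall>t\<ge>0. 0 \<le> \<zeta> t \<and> \<zeta> t \<le> 1) \<and>
     (\<forall>t. 0 \<le> t \<and> t \<le> 3/2 \<longrightarrow> \<zeta> t = 1) \<and>
     closure {t. 0 \<le> t \<and> \<zeta> t \<noteq> 0} \<subseteq> {0..<5/3}"

definition lp_symbol :: "(real \<Rightarrow> real) \<Rightarrow> nat \<Rightarrow> real^'n::finite \<Rightarrow> complex" where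
  "lp_symbol \<zeta> j \<xi> = complex_of_real
     (if j = 0 then \<zeta> (norm \<xi>)
      else \<zeta> (norm ((1 / 2 ^ j) *\<^sub>R \<xi>)) - \<zeta> (2 * norm ((1 / 2 ^ j) *\<^sub>R \<xi>)))"

definition lp_block :: "(real \<Rightarrow> real) \<Rightarrow> nat \<Rightarrow> 'n::finite dist \<Rightarrow> 'n dist" where
  "lp_block \<zeta> j f = multiplier (lp_symbol \<zeta> j) f"

text \<open>\<open>besov_space \<zeta> s p r\<close> is \<open>B\<^sup>s\<^sup>,\<^sup>r\<^sub>p\<close> (regularity \<open>s\<close>, integrability \<open>p\<close>, summability \<open>r\<close>),
  for finite \<open>p\<close> and \<open>r\<close>.\<close>

definition besov_space :: "(real \<Rightarrow> real) \<Rightarrow> real \<Rightarrow> real \<Rightarrow> real \<Rightarrow> 'n::finite dist set" where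
  "besov_space \<zeta> s p r =
     {f. tempered f \<and>
         (\<exists>g. (\<forall>j. in_Lp p (g j) \<and> represents (g j) (lp_block \<zeta> j f)) \<and>
              summable (\<lambda>j. (2 powr (s * real j) * Lp_norm p (g j)) powr r))}"

end

theory Submission
  imports Defs "HOL-Probability.Probability"
begin

text \<open>For almost every \<open>t\<close> the equation gives \<open>S(t)\<mu> = u(t) - \<integral>\<^sub>0\<^sup>t S(t - \<tau>)f(\<tau>) d\<tau>\<close> with
  \<open>f = |u|\<^sup>\<gamma>\<^sup>-\<^sup>1u\<close>, and both terms are small in the mean at infinity. For such traces the symbol can be inverted on
  test functions \<open>\<omega>\<close>: \<open>\<mu>(F\<omega>) = \<integral> S(t)\<mu> \<cdot> F(exp(t|\<xi>|\<^sup>\<theta>) \<omega>)\<close>. This is clear when \<open>\<omega>\<close> vanishes near the origin; the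
  difference of the two sides is therefore a combination of derivatives of \<open>\<omega>\<close> at \<open>0\<close>, that is, a polynomial,
  and the definition of \<open>S(t)\<mu>\<close> as a limit of cut-offs forces its homogeneous parts to vanish one after another.

  Hence \<open>\<Delta>\<^sub>j\<mu> = \<kappa>\<^sub>j(t) * u(t) - \<integral>\<^sub>0\<^sup>t \<kappa>\<^sub>j(\<tau>) * f(\<tau>) d\<tau>\<close>, where \<open>\<kappa>\<^sub>j(\<tau>)\<close> has symbol \<open>exp(\<tau>|\<xi>|\<^sup>\<theta>) \<phi>\<^sub>j\<close> and is
  bounded by an \<open>L\<^sup>1\<close>-normalised bump of width \<open>2\<^sup>-\<^sup>j\<close> as long as \<open>\<tau> \<le> 2\<^sup>-\<^sup>\<theta>\<^sup>j\<close>. Young's inequality bounds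
  \<open>\<parallel>\<Delta>\<^sub>j\<mu>\<parallel>\<^sub>p\<close> by \<open>\<parallel>u(t)\<parallel>\<^sub>p + 2\<^sup>j\<^sup>N\<^sup>(\<^sup>\<gamma>\<^sup>-\<^sup>1\<^sup>)\<^sup>/\<^sup>p \<integral>\<^sub>0\<^sup>t \<parallel>u(\<tau>)\<parallel>\<^sub>p\<^sup>\<gamma> d\<tau>\<close>. Choosing \<open>t = t\<^sub>j\<close> of size \<open>2\<^sup>-\<^sup>\<theta>\<^sup>j\<close> with \<open>\<parallel>u(t\<^sub>j)\<parallel>\<^sub>p\<close> at
  most its mean makes the first term summable, and Hardy's inequality handles the second.\<close>

text \<open>The obstacle is the singularity of |xi|^th at the origin. A test function multiplied by
  the symbol of S(t), or by its inverse, is smooth only away from 0, so its Fourier transform is in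
  general not a Schwartz function and a tempered distribution cannot be applied to it directly. What
  survives is decay slightly faster than |x|^(-N), recorded in \<open>prof\<close>. This profile is
  integrable and reproduces itself under convolution, so kernel estimates can be composed. Kernel
  bounds come from cutting frequency space into dyadic annuli, where the symbol is smooth and
  scaling moves the dyadic factor into the time variable. The scaling relation between the exponents
  enters the estimates only at the end: it makes N(gamma - 1)q/p equal to theta(q - gamma + 1), so
  the dyadic factor of the nonlinear term is exactly the power of the time scale in Hardy's
  inequality. Hardy is applied with exponent q/gamma to the function ||u(t)||_p^gamma, which is why
  gamma < q is strict.\<close>

abbreviation L1 :: "('a::euclidean_space => 'b::{banach, second_countable_topology}) => bool" where
  "L1 \<equiv> integrable lborel"

abbreviation pointwise_times (infixl "\<odot>" 70) where
  "f \<odot> g \<equiv> \<lambda>x. f x * g x"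

section \<open>Smooth functions\<close>

definition partial :: "'n::finite => (real^'n => complex) => (real^'n => complex)" where
 "partial i f = (\<lambda>x. frechet_derivative f (at x) (axis i 1))"

lemma iter_partial_Cons: "iter_partial (i # is) f = partial i (iter_partial is f)"
 by (simp add: partial_def)

text \<open>\<open>iter_partial\<close> adds derivatives on the outside. Moving the last index to
  the inside is what inductions need that replace the function by one of its derivatives; they run
  over the list from the right.\<close>

lemma iter_partial_snoc: "iter_partial (is @ [i]) f = iter_partial is (partial i f)"
 by (induction "is") (simp_all add: partial_def)

lemma partial_eqI:
 assumes "(f has_derivative D) (at x)"
 shows "partial i f x = D (axis i 1)"
 using frechet_derivative_at[OF assms] by (simp add: partial_def)

lemma has_derivative_partial:
 fixes f :: "real^'n::finite => complex"
 assumes "f differentiable (at x)"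
 shows "(f has_derivative (\<lambda>h. \<Sum>i\<in>UNIV. h $ i *\<^sub>R partial i f x)) (at x)"
proof -
 from assms obtain D where D: "(f has_derivative D) (at x)"
  by (auto simp: differentiable_def)
 interpret bounded_linear D using D by (rule has_derivative_bounded_linear)
 have "D h = (\<Sum>i\<in>UNIV. h $ i *\<^sub>R partial i f x)" for h
 proof -
  have "D h = D (\<Sum>i\<in>UNIV. h $ i *\<^sub>R axis i 1)"
   by (simp add: basis_expansion scalar_mult_eq_scaleR[symmetric])
  also have "... = (\<Sum>i\<in>UNIV. h $ i *\<^sub>R partial i f x)"
   by (simp add: sum scaleR partial_eqI[OF D])
  finally show ?thesis .
 qed
 then have "D = (\<lambda>h. \<Sum>i\<in>UNIV. h $ i *\<^sub>R partial i f x)" by auto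
 with D show ?thesis by simp
qed

lemma differentiable_cong_open:
 fixes f g :: "real^'n::finite => complex"
 assumes "open S" "x \<in> S" "!!y. y \<in> S ==> f y = g y" "f differentiable (at x)"
 shows "g differentiable (at x)"
 using assms has_derivative_transform_within_open unfolding differentiable_def by blast

text \<open>The two functions have the same set of derivatives at \<open>x\<close>, possibly empty,
  so the choice made in \<open>frechet_derivative\<close> is the same for both.\<close>

lemma partial_cong_open:
 fixes f g :: "real^'n::finite => complex"
 assumes S: "open S" "x \<in> S" and eq: "!!y. y \<in> S ==> f y = g y"
 shows "partial i f x = partial i g x"
proof -
 have "(f has_derivative D) (at x) \<longleftrightarrow> (g has_derivative D) (at x)" for D
  using has_derivative_transform_within_open[of f D x UNIV S g]
   has_derivative_transform_within_open[of g D x UNIV S f] S eq by auto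
 then show ?thesis by (simp add: partial_def frechet_derivative_def)
qed

lemma iter_partial_cong_open:
 fixes f g :: "real^'n::finite => complex"
 assumes S: "open S" and eq: "!!y. y \<in> S ==> f y = g y" and "x \<in> S"
 shows "iter_partial is f x = iter_partial is g x"
 using \<open>x \<in> S\<close>
proof (induction "is" arbitrary: x)
 case (Cons i "is")
 then show ?case unfolding iter_partial_Cons
  by (intro partial_cong_open[OF S]) auto
qed (use eq in auto)

lemma partial_add:
 assumes "f differentiable (at x)" "g differentiable (at x)"
 shows "partial i (\<lambda>y. f y + g y) x = partial i f x + partial i g x"
 using partial_eqI[OF has_derivative_add[OF has_derivative_partial[OF assms(1)] has_derivative_partial[OF assms(2)]]]
 by (simp add: axis_def if_distrib[where f="\<lambda>c. c *\<^sub>R _"] sum.delta cong: if_cong)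

lemma partial_mult:
 assumes "f differentiable (at x)" "g differentiable (at x)"
 shows "partial i (f \<odot> g) x = partial i f x * g x + f x * partial i g x"
 using partial_eqI[OF has_derivative_mult[OF has_derivative_partial[OF assms(1)] has_derivative_partial[OF assms(2)]]]
 by (simp add: axis_def if_distrib[where f="\<lambda>c. c *\<^sub>R _"] sum.delta cong: if_cong)

lemma partial_const [simp]: "partial i (\<lambda>y. c) = (\<lambda>y. 0)"
 by (rule ext) (simp add: partial_eqI[OF has_derivative_const])

text \<open>\<open>Q\<close> carries a size condition through all derivatives: the trivial predicate
  gives smoothness, \<open>rapid\<close> the Schwartz functions, \<open>slow\<close> their
  multipliers. The recursion peels a derivative off the inside, so one induction with the product
  rule serves all three.\<close>

primrec smooth_upto :: "((real^'n::finite => complex) => bool) => nat => (real^'n) set => (real^'n => complex) => bool" where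
 "smooth_upto Q 0 S f \<longleftrightarrow> Q f \<and> (\<forall>x\<in>S. f differentiable (at x))"
| "smooth_upto Q (Suc n) S f \<longleftrightarrow> Q f \<and> (\<forall>x\<in>S. f differentiable (at x)) \<and> (\<forall>i. smooth_upto Q n S (partial i f))"

lemma smooth_upto_0: "smooth_upto Q n S f ==> Q f \<and> (\<forall>x\<in>S. f differentiable (at x))"
 by (cases n) auto

lemma smooth_upto_Suc: "smooth_upto Q (Suc n) S f ==> smooth_upto Q n S f"
 by (induction n arbitrary: f) auto

lemma smooth_upto_iter:
 "smooth_upto Q n S f \<longleftrightarrow> (\<forall>is. length is <= n --> Q (iter_partial is f) \<and> (\<forall>x\<in>S. iter_partial is f differentiable (at x)))"
proof (induction n arbitrary: f)
 case 0
 then show ?case by auto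
next
 case (Suc n)
 show ?case
 proof
  assume L: "smooth_upto Q (Suc n) S f"
  show "\<forall>is. length is <= Suc n --> Q (iter_partial is f) \<and> (\<forall>x\<in>S. iter_partial is f differentiable (at x))"
  proof (intro allI impI)
   fix "is" :: "'a list" assume "length is <= Suc n"
   then show "Q (iter_partial is f) \<and> (\<forall>x\<in>S. iter_partial is f differentiable (at x))"
   proof (cases "is" rule: rev_exhaust)
    case (snoc js j)
    then have "length js <= n" using \<open>length is <= Suc n\<close> by simp
    with Suc[of "partial j f"] L snoc show ?thesis by (auto simp: iter_partial_snoc)
   qed (use L in auto)
  qed
 next
  assume R: "\<forall>is. length is <= Suc n --> Q (iter_partial is f) \<and> (\<forall>x\<in>S. iter_partial is f differentiable (at x))"
  have "smooth_upto Q n S (partial i f)" for i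
   unfolding Suc iter_partial_snoc[symmetric] using R by auto
  moreover have "Q f \<and> (\<forall>x\<in>S. f differentiable (at x))" using R[rule_format, of "[]"] by auto
  ultimately show "smooth_upto Q (Suc n) S f" by simp
 qed
qed

text \<open>The sum and product rules identify derivatives only on the open set \<open>S\<close>. A
  predicate that sees values outside \<open>S\<close> could not be transported along such
  identities.\<close>

definition loc_pred :: "((real^'n::finite => complex) => bool) => (real^'n) set => bool" where
 "loc_pred Q S \<longleftrightarrow> open S \<and> (\<forall>f g. (\<forall>x\<in>S. f x = g x) --> Q f --> Q g)"

lemma loc_pred_UNIV [simp]: "loc_pred Q UNIV"
 unfolding loc_pred_def by (auto simp: fun_eq_iff[symmetric])

lemma loc_pred_True [simp]: "open S ==> loc_pred (\<lambda>_. True) S"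
 by (auto simp: loc_pred_def)

lemma smooth_upto_cong:
 assumes L: "loc_pred Q S" and eq: "!!x. x \<in> S ==> f x = g x" and f: "smooth_upto Q n S f"
 shows "smooth_upto Q n S g"
 using eq f
proof (induction n arbitrary: f g)
 case 0
 then have "Q f" by simp
 then have "Q g" using L 0(1) unfolding loc_pred_def by blast
 moreover have "g differentiable (at x)" if "x \<in> S" for x
  by (rule differentiable_cong_open[OF _ that, of f g]) (use 0 L that in \<open>auto simp: loc_pred_def\<close>)
 ultimately show ?case by simp
next
 case (Suc n)
 have S: "open S" using L by (simp add: loc_pred_def)
 have "Q f" using Suc.prems by simp
 then have Qg: "Q g" using L Suc.prems(1) unfolding loc_pred_def by blast
 have "smooth_upto Q n S (partial i g)" for i
 proof (rule Suc.IH[of "partial i f"])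
  show "partial i f x = partial i g x" if "x \<in> S" for x
   using Suc.prems(1) by (rule partial_cong_open[OF S that])
 qed (use Suc.prems(2) in simp)
 moreover have "g differentiable (at x)" if "x \<in> S" for x
  using differentiable_cong_open[OF S that Suc.prems(1)] Suc.prems(2) that by simp
 ultimately show ?case using Qg unfolding smooth_upto.simps by blast
qed

lemma smooth_upto_add:
 assumes L: "loc_pred Q S" and Q: "!!f g. Q f ==> Q g ==> Q (\<lambda>x. f x + g x)"
  and "smooth_upto Q n S f" "smooth_upto Q n S g"
 shows "smooth_upto Q n S (\<lambda>x. f x + g x)"
 using assms(3,4)
proof (induction n arbitrary: f g)
 case (Suc n)
 have "smooth_upto Q n S (partial i (\<lambda>x. f x + g x))" for i
  by (rule smooth_upto_cong[OF L _ Suc.IH[of "partial i f" "partial i g"]])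
   (use Suc.prems in \<open>auto simp: partial_add\<close>)
 then show ?case using Suc.prems Q by auto
qed (use Q in auto)

text \<open>Closure of \<open>Q3\<close> under sums absorbs the two terms of the product rule. Three
  predicates allow mixed products such as slow times rapid.\<close>

lemma smooth_upto_mult:
 assumes L: "loc_pred Q3 S"
  and Q: "!!f g. Q1 f ==> Q2 g ==> Q3 (f \<odot> g)"
  and Q3: "!!f g. Q3 f ==> Q3 g ==> Q3 (\<lambda>x. f x + g x)"
  and "smooth_upto Q1 n S f" "smooth_upto Q2 n S g"
 shows "smooth_upto Q3 n S (f \<odot> g)"
 using assms(4,5)
proof (induction n arbitrary: f g)
 case (Suc n)
 have "smooth_upto Q3 n S (partial i (f \<odot> g))" for i
 proof (rule smooth_upto_cong[OF L])
  show "smooth_upto Q3 n S (\<lambda>x. partial i f x * g x + f x * partial i g x)"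
   by (intro smooth_upto_add[OF L Q3] Suc.IH) (use Suc.prems smooth_upto_Suc in auto)
 qed (use Suc.prems in \<open>auto simp: partial_mult\<close>)
 then show ?case using Suc.prems Q by auto
qed (use Q in auto)

definition smooth_on :: "(real^'n::finite) set => (real^'n => complex) => bool" where
 "smooth_on S f \<longleftrightarrow> (\<forall>is. \<forall>x\<in>S. iter_partial is f differentiable (at x))"

lemma smooth_on_upto: "smooth_on S f \<longleftrightarrow> (\<forall>n. smooth_upto (\<lambda>_. True) n S f)"
 unfolding smooth_upto_iter smooth_on_def by auto

lemma smooth_on_partial: "smooth_on S f ==> smooth_on S (partial i f)"
 unfolding smooth_on_def iter_partial_snoc[symmetric] by blast

lemma smooth_on_iter_partial: "smooth_on S f ==> smooth_on S (iter_partial is f)"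
 by (induction "is") (auto simp: iter_partial_Cons smooth_on_partial simp del: iter_partial.simps(2))

lemma smooth_on_differentiable: "smooth_on S f ==> x \<in> S ==> f differentiable (at x)"
 unfolding smooth_on_def by (metis iter_partial.simps(1))

lemma smooth_on_continuous: "smooth_on UNIV f ==> continuous_on UNIV f"
 by (metis differentiable_imp_continuous_within continuous_at_imp_continuous_on smooth_on_differentiable UNIV_I)

lemma smooth_on_cong:
 "open S ==> (!!x. x \<in> S ==> f x = g x) ==> smooth_on S f ==> smooth_on S g"
 unfolding smooth_on_upto using smooth_upto_cong[of "\<lambda>_. True" S f g] by auto

lemma smooth_on_subset: "smooth_on S f ==> T \<subseteq> S ==> smooth_on T f"
 unfolding smooth_on_def by auto

lemma smooth_on_Un: "smooth_on S f ==> smooth_on T f ==> smooth_on (S \<union> T) f"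
 unfolding smooth_on_def by auto

lemma smooth_on_add:
 "open S ==> smooth_on S f ==> smooth_on S g ==> smooth_on S (\<lambda>x. f x + g x)"
 unfolding smooth_on_upto by (auto intro: smooth_upto_add)

lemma smooth_on_mult:
 "open S ==> smooth_on S f ==> smooth_on S g ==> smooth_on S (f \<odot> g)"
 unfolding smooth_on_upto using smooth_upto_mult[of "\<lambda>_. True" S "\<lambda>_. True" "\<lambda>_. True"] by auto

lemma smooth_on_const [simp]: "smooth_on S (\<lambda>x. c)"
proof -
 have "smooth_upto (\<lambda>_. True) n S (\<lambda>x. c)" for n by (induction n arbitrary: c) auto
 then show ?thesis by (simp add: smooth_on_upto)
qed

lemma smooth_on_uminus: "open S ==> smooth_on S f ==> smooth_on S (\<lambda>x. - f x)"
 using smooth_on_mult[of S "\<lambda>_. - 1" f] by simp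

lemma smooth_on_diff:
 "open S ==> smooth_on S f ==> smooth_on S g ==> smooth_on S (\<lambda>x. f x - g x)"
 using smooth_on_add[of S f "\<lambda>x. - g x"] smooth_on_uminus by auto

lemma smooth_on_sum:
 "open S ==> (!!a. a \<in> A ==> smooth_on S (f a)) ==> smooth_on S (\<lambda>x. \<Sum>a\<in>A. f a x)"
 by (induction A rule: infinite_finite_induct) (auto intro: smooth_on_add)

lemma has_derivative_coord: "((\<lambda>x::real^'n::finite. complex_of_real (x $ i)) has_derivative (\<lambda>h. of_real (h $ i))) (at x)"
 by (intro has_derivative_of_real bounded_linear.has_derivative[OF bounded_linear_vec_nth] has_derivative_ident)

lemma partial_coord: "partial j (\<lambda>x. complex_of_real (x $ i)) = (\<lambda>x. if i = j then 1 else 0)"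
 by (rule ext) (simp add: partial_eqI[OF has_derivative_coord] axis_def)

lemma smooth_on_coord [simp]: "smooth_on S (\<lambda>x. complex_of_real (x $ i))"
proof -
 have "smooth_upto (\<lambda>_. True) n S (\<lambda>x. complex_of_real (x $ i))" for n
  using has_derivative_coord
  by (cases n) (auto simp: partial_coord differentiable_def smooth_on_const[unfolded smooth_on_upto, rule_format])
 then show ?thesis by (simp add: smooth_on_upto)
qed

lemma has_derivative_dilate:
 fixes f :: "real^'n::finite => complex"
 assumes "f differentiable (at (c *\<^sub>R x))"
 shows "((\<lambda>x. f (c *\<^sub>R x)) has_derivative (\<lambda>h. \<Sum>i\<in>UNIV. (c * h $ i) *\<^sub>R partial i f (c *\<^sub>R x))) (at x)"
proof -
 have "((\<lambda>x. c *\<^sub>R x) has_derivative (\<lambda>h. c *\<^sub>R h)) (at x)"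
  by (auto intro!: derivative_eq_intros)
 from has_derivative_compose[OF this, of f "\<lambda>h. \<Sum>i\<in>UNIV. h $ i *\<^sub>R partial i f (c *\<^sub>R x)"]
  has_derivative_partial[OF assms]
 show ?thesis by simp
qed

lemma partial_dilate:
 fixes f :: "real^'n::finite => complex"
 assumes "f differentiable (at (c *\<^sub>R x))"
 shows "partial i (\<lambda>x. f (c *\<^sub>R x)) x = of_real c * partial i f (c *\<^sub>R x)"
proof -
 have "(\<Sum>j\<in>UNIV. (c * axis i 1 $ j) *\<^sub>R partial j f (c *\<^sub>R x)) = (\<Sum>j\<in>UNIV. if j = i then c *\<^sub>R partial i f (c *\<^sub>R x) else 0)"
  by (rule sum.cong) (auto simp: axis_def)
 then show ?thesis using partial_eqI[OF has_derivative_dilate[OF assms]]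
  by (simp add: scaleR_conv_of_real)
qed

lemma differentiable_dilate:
 fixes f :: "real^'n::finite => complex"
 assumes "f differentiable (at (c *\<^sub>R x))"
 shows "(\<lambda>x. f (c *\<^sub>R x)) differentiable (at x)"
 using has_derivative_dilate[OF assms] by (auto simp: differentiable_def)

lemma iter_partial_dilate:
 fixes f :: "real^'n::finite => complex"
 assumes "smooth_on UNIV f"
 shows "iter_partial is (\<lambda>x. f (c *\<^sub>R x)) = (\<lambda>x. of_real c ^ length is * iter_partial is f (c *\<^sub>R x))"
proof (induction "is")
 case (Cons i "is")
 have d: "(\<lambda>x. iter_partial is f (c *\<^sub>R x)) differentiable (at x)" for x
  by (intro differentiable_dilate smooth_on_differentiable[OF smooth_on_iter_partial[OF assms]]) simp
 show ?case unfolding iter_partial_Cons Cons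
  by (rule ext, subst partial_mult[OF _ d])
   (auto simp: partial_dilate smooth_on_differentiable[OF smooth_on_iter_partial[OF assms]])
qed simp

lemma smooth_on_dilate:
 assumes "smooth_on UNIV f" shows "smooth_on UNIV (\<lambda>x. f (c *\<^sub>R x))"
 unfolding smooth_on_def iter_partial_dilate[OF assms]
 by (intro allI ballI differentiable_mult differentiable_const differentiable_dilate
    smooth_on_differentiable[OF smooth_on_iter_partial[OF assms]]) simp

lemma iter_partial_support:
 fixes f :: "real^'n::finite => complex"
 assumes "{x. f x \<noteq> 0} \<subseteq> K" "closed K"
 shows "{x. iter_partial is f x \<noteq> 0} \<subseteq> K"
proof -
 have z: "iter_partial is (\<lambda>_::real^'n. 0) = (\<lambda>_. 0)"
  by (induction "is") (auto simp: iter_partial_Cons simp del: iter_partial.simps(2))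
 show ?thesis
  using iter_partial_cong_open[of "-K" f "\<lambda>_. 0" _ "is"] assms z by (auto simp: fun_eq_iff)
qed

lemma open_minus_zero [simp]: "open (-{0::'a::{t1_space,zero}})"
 by (simp add: open_Compl)

lemma smooth_upto_mult_smooth:
 "open S ==> smooth_on S a ==> smooth_upto (\<lambda>_. True) n S f ==> smooth_upto (\<lambda>_. True) n S (a \<odot> f)"
 using smooth_upto_mult[of "\<lambda>_. True" S "\<lambda>_. True" "\<lambda>_. True" n a f] by (auto simp: smooth_on_upto)

text \<open>Since each partial derivative is a smooth multiple of \<open>f\<close>,
  differentiability of order n passes to order n + 1. This replaces explicit formulas for the higher
  derivatives of an exponential.\<close>

lemma smooth_on_exp_ode:
 fixes f :: "real^'n::finite => complex"
 assumes S: "open S" and d: "!!x. x \<in> S ==> f differentiable (at x)"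
  and p: "!!i x. x \<in> S ==> partial i f x = a i x * f x" and a: "!!i. smooth_on S (a i)"
 shows "smooth_on S f"
proof -
 have "smooth_upto (\<lambda>_. True) n S f" for n
 proof (induction n)
  case (Suc n)
  have "smooth_upto (\<lambda>_. True) n S (partial i f)" for i
  proof (rule smooth_upto_cong)
   show "smooth_upto (\<lambda>_. True) n S (a i \<odot> f)"
    by (rule smooth_upto_mult_smooth[OF S a Suc])
  qed (use S p in auto)
  then show ?case using d by simp
 qed (use d in auto)
 then show ?thesis by (simp add: smooth_on_upto)
qed

section \<open>Radial functions away from the origin\<close>

lemma has_derivative_radial:
 fixes x :: "real^'n::finite"
 assumes "x \<noteq> 0" "(h has_real_derivative h') (at (norm x))"
 shows "((\<lambda>x. complex_of_real (h (norm x))) has_derivative (\<lambda>v. of_real (h' * (v \<bullet> sgn x)))) (at x)"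
proof -
 have "(h has_derivative (\<lambda>v. h' * v)) (at (norm x))" using assms(2) by (simp add: has_field_derivative_def)
 from has_derivative_compose[OF has_derivative_norm[OF assms(1)] this]
 show ?thesis by (intro has_derivative_of_real)
qed

lemma partial_radial:
 fixes x :: "real^'n::finite"
 assumes "x \<noteq> 0" "(h has_real_derivative h') (at (norm x))"
 shows "partial i (\<lambda>x. complex_of_real (h (norm x))) x = of_real (h' * x $ i / norm x)"
 by (simp add: partial_eqI[OF has_derivative_radial[OF assms]] inner_axis' sgn_div_norm field_simps)

lemma differentiable_radial:
 fixes x :: "real^'n::finite"
 assumes "x \<noteq> 0" "(h has_real_derivative h') (at (norm x))"
 shows "(\<lambda>x. complex_of_real (h (norm x))) differentiable (at x)"
 using has_derivative_radial[OF assms] by (auto simp: differentiable_def)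

text \<open>Differentiating |x|^c gives c x_i |x|^(c - 2). The family over all exponents is closed
  under this, so the induction on the order runs for all \<open>c\<close> at once.\<close>

lemma smooth_on_norm_powr:
 "smooth_on (-{0}) (\<lambda>x::real^'n::finite. complex_of_real (norm x powr c))"
proof -
 have "smooth_upto (\<lambda>_. True) n (-{0}) (\<lambda>x::real^'n. complex_of_real (norm x powr c))" for n
 proof (induction n arbitrary: c)
  case 0
  show ?case by (auto intro!: differentiable_radial[of _ "\<lambda>t. t powr c"] derivative_eq_intros)
 next
  case (Suc n)
  have "smooth_upto (\<lambda>_. True) n (-{0}) (partial i (\<lambda>x::real^'n. complex_of_real (norm x powr c)))" for i
  proof (rule smooth_upto_cong)
   show "smooth_upto (\<lambda>_. True) n (-{0}) (\<lambda>x::real^'n. (of_real c * of_real (x $ i)) * of_real (norm x powr (c - 2)))"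
    by (intro smooth_upto_mult_smooth Suc smooth_on_mult) auto
   fix x :: "real^'n" assume "x \<in> -{0}"
   then have x: "x \<noteq> 0" by simp
   have "((\<lambda>t. t powr c) has_real_derivative c * norm x powr (c - 1)) (at (norm x))"
    using x by (auto intro!: derivative_eq_intros simp: powr_diff)
   from partial_radial[OF x this, of i]
   have "partial i (\<lambda>x. complex_of_real (norm x powr c)) x = of_real (c * norm x powr (c - 1) * x $ i / norm x)" .
   also have "norm x powr (c - 2) = norm x powr (c - 1) / norm x"
    using x by (simp add: powr_diff power2_eq_square)
   then have "of_real (c * norm x powr (c - 1) * x $ i / norm x) = of_real c * of_real (x $ i) * complex_of_real (norm x powr (c - 2))"
    by simp
   finally show "of_real c * of_real (x $ i) * complex_of_real (norm x powr (c - 2)) = partial i (\<lambda>x. complex_of_real (norm x powr c)) x" by simp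
  qed auto
  moreover have "(\<lambda>x::real^'n. complex_of_real (norm x powr c)) differentiable (at x)" if "x \<noteq> 0" for x
   using that by (auto intro!: differentiable_radial[of _ "\<lambda>t. t powr c"] derivative_eq_intros)
  ultimately show ?case by simp
 qed
 then show ?thesis by (simp add: smooth_on_upto)
qed

text \<open>Each partial derivative is the smooth factor x_i / |x| times the radial function of the
  next derivative of \<open>h\<close>, so the induction treats all derivatives of \<open>h\<close>
  simultaneously.\<close>

lemma smooth_on_radial:
 fixes h :: "real => real"
 assumes h: "!!k t. t > 0 ==> (deriv ^^ k) h differentiable (at t)"
 shows "smooth_on (-{0}) (\<lambda>x::real^'n::finite. complex_of_real (h (norm x)))"
proof -
 have D: "((deriv ^^ k) h has_real_derivative (deriv ^^ Suc k) h (norm x)) (at (norm x))" if "x \<noteq> 0" for x :: "real^'n" and k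
  using h[of "norm x" k] that by (simp add: DERIV_deriv_iff_real_differentiable)
 have "smooth_upto (\<lambda>_. True) n (-{0}) (\<lambda>x::real^'n. complex_of_real ((deriv ^^ k) h (norm x)))" for n k
 proof (induction n arbitrary: k)
  case 0
  show ?case using differentiable_radial[OF _ D] by auto
 next
  case (Suc n)
  have "smooth_upto (\<lambda>_. True) n (-{0}) (partial i (\<lambda>x::real^'n. complex_of_real ((deriv ^^ k) h (norm x))))" for i
  proof (rule smooth_upto_cong)
   show "smooth_upto (\<lambda>_. True) n (-{0}) (\<lambda>x::real^'n. (of_real (x $ i) * of_real (norm x powr (-1))) * of_real ((deriv ^^ Suc k) h (norm x)))"
    by (intro smooth_upto_mult_smooth Suc smooth_on_mult smooth_on_norm_powr) auto
   fix x :: "real^'n" assume "x \<in> -{0}"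
   then have x: "x \<noteq> 0" by simp
   show "of_real (x $ i) * of_real (norm x powr (-1)) * of_real ((deriv ^^ Suc k) h (norm x)) = partial i (\<lambda>x. complex_of_real ((deriv ^^ k) h (norm x))) x"
    unfolding partial_radial[OF x D[OF x]] using x by (simp add: powr_minus divide_inverse)
  qed auto
  then show ?case using differentiable_radial[OF _ D] by auto
 qed
 from this[of _ 0] show ?thesis by (simp add: smooth_on_upto)
qed

lemma smooth_on_exp_norm_powr:
 "smooth_on (-{0}) (\<lambda>x::real^'n::finite. complex_of_real (exp (s * norm x powr th)))"
proof (rule smooth_on_exp_ode[where a="\<lambda>i x. of_real (s * th) * (of_real (x $ i) * of_real (norm x powr (th - 2)))"])
 fix x :: "real^'n" assume "x \<in> -{0}"
 then have x: "x \<noteq> 0" by simp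
 have D: "((\<lambda>t. exp (s * t powr th)) has_real_derivative exp (s * norm x powr th) * (s * (th * norm x powr (th - 1)))) (at (norm x))"
  using x by (auto intro!: derivative_eq_intros simp: powr_diff)
 show "(\<lambda>x::real^'n::finite. complex_of_real (exp (s * norm x powr th))) differentiable (at x)"
  using differentiable_radial[OF x D] .
 have "norm x powr (th - 2) = norm x powr (th - 1) / norm x"
  using x by (simp add: powr_diff power2_eq_square)
 then show "partial i (\<lambda>x. complex_of_real (exp (s * norm x powr th))) x =
   of_real (s * th) * (of_real (x $ i) * of_real (norm x powr (th - 2))) * of_real (exp (s * norm x powr th))" for i
  unfolding partial_radial[OF x D] by simp
qed (auto intro!: smooth_on_mult smooth_on_norm_powr)

section \<open>The radial cut-off\<close>

definition radial_cut :: "(real => real) => real^'n::finite => complex" where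
 "radial_cut ze x = of_real (ze (norm x))"

lemma lp_cutoff_bounds: "lp_cutoff ze ==> 0 <= t ==> 0 <= ze t \<and> ze t <= 1"
 by (simp add: lp_cutoff_def)

lemma lp_cutoff_one: "lp_cutoff ze ==> 0 <= t ==> t <= 3/2 ==> ze t = 1"
 by (simp add: lp_cutoff_def)

lemma lp_cutoff_zero:
 assumes "lp_cutoff ze" "t >= 5/3" shows "ze t = 0"
proof (rule ccontr)
 assume "ze t \<noteq> 0"
 then have "t \<in> closure {t. 0 <= t \<and> ze t \<noteq> 0}" using assms(2) by (intro closure_subset[THEN subsetD]) auto
 with assms show False by (auto simp: lp_cutoff_def)
qed

lemma radial_cut_one: "lp_cutoff ze ==> norm x <= 3/2 ==> radial_cut ze x = 1"
 by (simp add: radial_cut_def lp_cutoff_one)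

lemma radial_cut_zero: "lp_cutoff ze ==> norm x >= 5/3 ==> radial_cut ze x = 0"
 by (simp add: radial_cut_def lp_cutoff_zero)

lemma norm_radial_cut_le: "lp_cutoff ze ==> norm (radial_cut ze x) <= 1"
 using lp_cutoff_bounds[of ze "norm x"] by (simp add: radial_cut_def)

text \<open>The singularity of \<open>f\<close> at the origin is multiplied by zero on a whole ball.
  That ball and the complement of the origin are open and cover the space.\<close>

lemma smooth_on_vanishing:
 fixes f g :: "real^'n::finite => complex"
 assumes "smooth_on (-{0}) f" "smooth_on UNIV g" "r > 0" "!!x. norm x < r ==> g x = 0"
 shows "smooth_on UNIV (f \<odot> g)"
proof -
 have "smooth_on (-{0}) (f \<odot> g)"
  using assms(1) smooth_on_subset[OF assms(2), of "-{0}"] by (intro smooth_on_mult) auto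
 moreover have "smooth_on (ball 0 r) (f \<odot> g)"
  by (rule smooth_on_cong[of _ "\<lambda>_. 0"]) (use assms in \<open>auto simp: dist_norm\<close>)
 ultimately have "smooth_on (-{0} \<union> ball 0 r) (f \<odot> g)" by (rule smooth_on_Un)
 moreover have "-{0} \<union> ball 0 r = (UNIV :: (real^'n) set)" using assms(3) by auto
 ultimately show ?thesis by simp
qed

lemma smooth_radial_cut:
 assumes "lp_cutoff ze" shows "smooth_on UNIV (radial_cut ze :: real^'n::finite => complex)"
proof -
 have "smooth_on (-{0}) (radial_cut ze :: real^'n => complex)"
  unfolding radial_cut_def[abs_def] using assms by (intro smooth_on_radial) (auto simp: lp_cutoff_def)
 moreover have "smooth_on (ball 0 1) (radial_cut ze :: real^'n => complex)"
  by (rule smooth_on_cong[of _ "\<lambda>_. 1"]) (use assms in \<open>auto simp: dist_norm radial_cut_one\<close>)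
 ultimately have "smooth_on (-{0} \<union> ball 0 1) (radial_cut ze :: real^'n => complex)" by (rule smooth_on_Un)
 moreover have "-{0} \<union> ball 0 1 = (UNIV :: (real^'n) set)" by auto
 ultimately show ?thesis by simp
qed

section \<open>Compactly supported smooth functions\<close>

definition test_fun :: "(real^'n::finite => complex) => bool" where
 "test_fun om \<longleftrightarrow> smooth_on UNIV om \<and> bounded {x. om x \<noteq> 0}"

lemma test_fun_mult: "smooth_on UNIV f ==> test_fun om ==> test_fun (f \<odot> om)"
 unfolding test_fun_def by (auto intro: smooth_on_mult bounded_subset)

lemma test_fun_mult': "smooth_on UNIV f ==> test_fun om ==> test_fun (om \<odot> f)"
 using test_fun_mult[of f om] by (simp add: mult.commute)

lemma test_fun_add: "test_fun f ==> test_fun g ==> test_fun (\<lambda>x. f x + g x)"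
 unfolding test_fun_def
 by (auto intro!: smooth_on_add intro: bounded_subset[of "{x. f x \<noteq> 0} \<union> {x. g x \<noteq> 0}"])

lemma test_fun_cmult: "test_fun f ==> test_fun (\<lambda>x. c * f x)"
 by (rule test_fun_mult) auto

lemma test_fun_diff: "test_fun f ==> test_fun g ==> test_fun (\<lambda>x. f x - g x)"
 using test_fun_add[of f "\<lambda>x. -1 * g x"] test_fun_cmult[of g "-1"] by simp

lemma test_fun_bound: assumes "test_fun om" obtains R where "R > 0" "!!x. norm x >= R ==> om x = 0"
proof -
 from assms obtain B where "!!x. om x \<noteq> 0 ==> norm x <= B" unfolding test_fun_def bounded_iff by auto
 then show ?thesis by (intro that[of "max 1 (B + 1)"]) force+
qed

lemma test_funI: "smooth_on UNIV om ==> (!!x. norm x >= R ==> om x = 0) ==> test_fun om"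
 unfolding test_fun_def bounded_iff by (metis (mono_tags, lifting) mem_Collect_eq nle_le)

lemma test_fun_iter_partial: assumes "test_fun om" shows "test_fun (iter_partial is om)"
proof -
 obtain R where R: "R > 0" "!!x. norm x >= R ==> om x = 0" using test_fun_bound[OF assms] by blast
 have "{x. om x \<noteq> 0} \<subseteq> cball 0 R" using R(2) by force
 from iter_partial_support[OF this, of "is"]
 have "bounded {x. iter_partial is om x \<noteq> 0}" using bounded_subset bounded_cball by blast
 then show ?thesis using assms smooth_on_iter_partial unfolding test_fun_def by blast
qed

lemma test_fun_partial: "test_fun om ==> test_fun (partial i om)"
 using test_fun_iter_partial[of om "[i]"] by (simp add: partial_def)

lemma test_fun_sup: assumes "test_fun om" obtains C where "C >= 0" "!!x. norm (om x) <= C"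
proof -
 obtain R where R: "R > 0" "!!x. norm x >= R ==> om x = 0" using test_fun_bound[OF assms] by blast
 have "compact (om ` cball 0 R)"
  using assms smooth_on_continuous[of om] by (intro compact_continuous_image) (auto simp: test_fun_def intro: continuous_on_subset)
 then obtain C where C: "!!x. norm x <= R ==> norm (om x) <= C" by (force dest!: compact_imp_bounded simp: bounded_iff)
 have "norm (om x) <= max C 0" for x
 proof (cases "norm x <= R")
  case False then show ?thesis using R(2)[of x] by simp
 qed (use C[of x] in simp)
 then show ?thesis by (intro that[of "max C 0"]) auto
qed

lemma test_fun_dilate: assumes "test_fun om" "c \<noteq> 0" shows "test_fun (\<lambda>x. om (c *\<^sub>R x))"
proof -
 obtain R where R: "R > 0" "!!x. norm x >= R ==> om x = 0" using test_fun_bound[OF assms(1)] by blast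
 show ?thesis
 proof (rule test_funI[of _ "R / \<bar>c\<bar>"])
  show "smooth_on UNIV (\<lambda>x. om (c *\<^sub>R x))" using assms(1) by (simp add: smooth_on_dilate test_fun_def)
  show "om (c *\<^sub>R x) = 0" if "R / \<bar>c\<bar> <= norm x" for x
   using that assms(2) by (intro R(2)) (simp add: field_simps)
 qed
qed

lemma test_fun_radial_cut: "lp_cutoff ze ==> test_fun (radial_cut ze)"
 by (rule test_funI[of _ "5/3"]) (auto simp: smooth_radial_cut radial_cut_zero)

section \<open>Schwartz functions\<close>

definition rapid :: "(real^'n::finite => complex) => bool" where
 "rapid f \<longleftrightarrow> (\<forall>k::nat. \<exists>C. \<forall>x. (1 + norm x) ^ k * norm (f x) <= C)"

definition slow :: "(real^'n::finite => complex) => bool" where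
 "slow f \<longleftrightarrow> (\<exists>k::nat. \<exists>C\<ge>0. \<forall>x. norm (f x) <= C * (1 + norm x) ^ k)"

lemma rapid_add: assumes "rapid f" "rapid g" shows "rapid (\<lambda>x. f x + g x)"
 unfolding rapid_def
proof
 fix k
 from assms obtain C D where "!!x. (1 + norm x) ^ k * norm (f x) <= C" "!!x. (1 + norm x) ^ k * norm (g x) <= D"
  unfolding rapid_def by meson
 then have "(1 + norm x) ^ k * norm (f x + g x) <= C + D" for x
  using mult_left_mono[OF norm_triangle_ineq[of "f x" "g x"], of "(1 + norm x) ^ k"]
  by (smt (verit, best) distrib_left norm_ge_zero zero_le_power)
 then show "\<exists>C. \<forall>x. (1 + norm x) ^ k * norm (f x + g x) <= C" by blast
qed

lemma rapid_slow: assumes "slow f" "rapid g" shows "rapid (f \<odot> g)"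
 unfolding rapid_def
proof
 fix k
 from assms(1) obtain l C where f: "C >= 0" "!!x. norm (f x) <= C * (1 + norm x) ^ l" unfolding slow_def by auto
 from assms(2) obtain D where g: "!!x. (1 + norm x) ^ (k + l) * norm (g x) <= D" unfolding rapid_def by meson
 have "(1 + norm x) ^ k * norm (f x * g x) <= C * D" for x
 proof -
  have "(1 + norm x) ^ k * norm (f x * g x) <= (1 + norm x) ^ k * (C * (1 + norm x) ^ l * norm (g x))"
   unfolding norm_mult by (intro mult_left_mono mult_right_mono f) auto
  also have "... = C * ((1 + norm x) ^ (k + l) * norm (g x))" by (simp add: power_add mult_ac)
  also have "... <= C * D" by (intro mult_left_mono g f)
  finally show ?thesis .
 qed
 then show "\<exists>C. \<forall>x. (1 + norm x) ^ k * norm (f x * g x) <= C" by blast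
qed

lemma all_length_le_iff: "(\<forall>n is. length is <= n --> P is) \<longleftrightarrow> (\<forall>is. P is)"
 by auto

lemma schwartz_upto: "schwartz ph \<longleftrightarrow> (\<forall>n. smooth_upto rapid n UNIV ph)"
proof -
 have "bounded (range (\<lambda>x. (1 + norm x) ^ k *\<^sub>R f x)) \<longleftrightarrow> (\<exists>C. \<forall>x. (1 + norm x) ^ k * norm (f x) <= C)"
  for f :: "real^'a => complex" and k
  unfolding bounded_iff by (auto simp: abs_of_nonneg)
 then show ?thesis unfolding smooth_upto_iter schwartz_def rapid_def by (simp add: all_length_le_iff) blast
qed

definition slow_smooth :: "(real^'n::finite => complex) => bool" where
 "slow_smooth f \<longleftrightarrow> (\<forall>n. smooth_upto slow n UNIV f)"

lemma schwartz_mult_slow: "slow_smooth f ==> schwartz ph ==> schwartz (f \<odot> ph)"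
 unfolding slow_smooth_def schwartz_upto
 by (auto intro!: smooth_upto_mult[of rapid UNIV slow rapid] rapid_slow rapid_add)

lemma slow_const [simp]: "slow (\<lambda>x. c)"
 unfolding slow_def by (intro exI[of _ 0] exI[of _ "norm c"]) auto

lemma slow_smooth_const [simp]: "slow_smooth (\<lambda>x::real^'n::finite. c)"
proof -
 have "smooth_upto slow n UNIV (\<lambda>x::real^'n. c)" for n by (induction n arbitrary: c) auto
 then show ?thesis by (simp add: slow_smooth_def)
qed

lemma slow_coord [simp]: "slow (\<lambda>x. complex_of_real (x $ i))"
 unfolding slow_def by (intro exI[of _ 1] exI[of _ 1]) (auto intro: order_trans[OF component_le_norm_cart])

lemma slow_smooth_coord [simp]: "slow_smooth (\<lambda>x::real^'n::finite. complex_of_real (x $ i))"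
proof -
 have "smooth_upto slow n UNIV (\<lambda>x::real^'n. complex_of_real (x $ i))" for n
  using slow_smooth_const[unfolded slow_smooth_def] smooth_on_differentiable[OF smooth_on_coord[of UNIV i]]
  by (cases n) (auto simp: partial_coord)
 then show ?thesis by (simp add: slow_smooth_def)
qed

lemma schwartz_add: "schwartz f ==> schwartz g ==> schwartz (\<lambda>x. f x + g x)"
 unfolding schwartz_upto by (auto intro!: smooth_upto_add rapid_add)

lemma schwartz_cmult: "schwartz f ==> schwartz (\<lambda>x. c * f x)"
 by (rule schwartz_mult_slow) auto

lemma schwartz_diff: "schwartz f ==> schwartz g ==> schwartz (\<lambda>x. f x - g x)"
 using schwartz_add[of f "\<lambda>x. -1 * g x"] schwartz_cmult[of g "-1"] by simp

lemma schwartz_coord: "schwartz f ==> schwartz (\<lambda>x. of_real (x $ i) * f x)"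
 by (rule schwartz_mult_slow) auto

lemma schwartz_partial: "schwartz f ==> schwartz (partial i f)"
 unfolding schwartz_def iter_partial_snoc[symmetric] by blast

lemma schwartz_iter_partial: "schwartz f ==> schwartz (iter_partial is f)"
 by (induction "is") (auto simp: iter_partial_Cons schwartz_partial simp del: iter_partial.simps(2))

lemma schwartz_smooth: "schwartz f ==> smooth_on UNIV f"
 unfolding schwartz_def smooth_on_def by blast

lemma schwartz_rapid: "schwartz f ==> rapid f"
 unfolding schwartz_upto using smooth_upto_0 by blast

lemma rapid_test_fun: assumes "test_fun om" shows "rapid om"
 unfolding rapid_def
proof
 fix k
 obtain R where R: "R > 0" "!!x. norm x >= R ==> om x = 0" using test_fun_bound[OF assms] by blast
 obtain C where C: "C >= 0" "!!x. norm (om x) <= C" using test_fun_sup[OF assms] by blast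
 have "(1 + norm x) ^ k * norm (om x) <= (1 + R) ^ k * C" for x
 proof (cases "norm x >= R")
  case True then show ?thesis using R C(1) by simp
 next
  case False then show ?thesis using C R(1) by (intro mult_mono power_mono) auto
 qed
 then show "\<exists>C. \<forall>x. (1 + norm x) ^ k * norm (om x) <= C" by blast
qed

lemma schwartz_test_fun: assumes "test_fun om" shows "schwartz om"
 unfolding schwartz_upto smooth_upto_iter
 using rapid_test_fun[OF test_fun_iter_partial[OF assms]] test_fun_iter_partial[OF assms]
 by (auto simp: test_fun_def intro: smooth_on_differentiable)

lemma rapid_imp_slow: assumes "rapid f" shows "slow f"
proof -
 from assms obtain C where "!!x. norm (f x) <= C" unfolding rapid_def by (metis mult_1 power_0)
 then have "!!x. norm (f x) <= max C 0" by (meson max.coboundedI1)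
 then show ?thesis unfolding slow_def by (intro exI[of _ 0] exI[of _ "max C 0"]) auto
qed

lemma slow_smooth_schwartz: "schwartz f ==> slow_smooth f"
 unfolding schwartz_upto slow_smooth_def smooth_upto_iter using rapid_imp_slow by blast

subsection \<open>Schwartz norms\<close>

lemma finite_lists_le: "finite {is :: 'n::finite list. length is <= k}"
 using finite_lists_length_le[of "UNIV :: 'n set" k] by simp

lemma schwartz_norm_le:
 fixes ph :: "real^'n::finite => complex"
 assumes "!!is x. length is <= k ==> (1 + norm x) ^ k * norm (iter_partial is ph x) <= B"
 shows "schwartz_norm k ph <= B"
 unfolding schwartz_norm_def
proof (rule cSup_least)
 have "(1 + norm 0) ^ k * norm (iter_partial [] ph 0) \<in> {(1 + norm x) ^ k * norm (iter_partial is ph x) |is x. length is <= k}"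
  by (force intro!: exI[of _ "[]"] exI[of _ "0 :: real^'n"] simp del: iter_partial.simps)
 then show "{(1 + norm x) ^ k * norm (iter_partial is ph x) |is x. length is <= k} \<noteq> {}" by blast
qed (use assms in auto)

text \<open>A supremum of reals needs an upper bound: there are finitely many index lists of length
  at most \<open>k\<close>, so the bounds for the single derivatives have a maximum.\<close>

lemma schwartz_norm_ge:
 fixes ph :: "real^'n::finite => complex"
 assumes "schwartz ph" "length is <= k"
 shows "(1 + norm x) ^ k * norm (iter_partial is ph x) <= schwartz_norm k ph"
proof -
 have "\<exists>C. \<forall>x. (1 + norm x) ^ k * norm (iter_partial js ph x) <= C" for js
  using schwartz_rapid[OF schwartz_iter_partial[OF assms(1)]] unfolding rapid_def by blast
 then obtain C where C: "!!js x. (1 + norm x) ^ k * norm (iter_partial js ph x) <= C js" by metis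
 have fin: "finite (C ` {js. length js <= k})" using finite_lists_le by blast
 have "bdd_above {(1 + norm x) ^ k * norm (iter_partial is ph x) |is x. length is <= k}"
 proof (rule bdd_aboveI[of _ "Max (C ` {js. length js <= k})"])
  fix y assume "y \<in> {(1 + norm x) ^ k * norm (iter_partial is ph x) |is x. length is <= k}"
  then obtain js x where y: "y = (1 + norm x) ^ k * norm (iter_partial js ph x)" "length js <= k" by blast
  have "C js <= Max (C ` {js. length js <= k})" using fin y(2) by (intro Max_ge) auto
  with C[where js=js and x=x] y(1) show "y <= Max (C ` {js. length js <= k})" by linarith
 qed
 then show ?thesis unfolding schwartz_norm_def using assms(2) by (intro cSup_upper) auto
qed

lemma schwartz_norm_nonneg: "schwartz ph ==> 0 <= schwartz_norm k ph"
 using schwartz_norm_ge[of ph "[]" k 0] by simp (meson norm_ge_zero order_trans)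

lemma schwartz_norm_mono:
 assumes "schwartz ph" "k <= l" shows "schwartz_norm k ph <= schwartz_norm l ph"
proof (rule schwartz_norm_le)
 fix "is" :: "'a list" and x assume "length is <= k"
 then have "(1 + norm x) ^ l * norm (iter_partial is ph x) <= schwartz_norm l ph"
  using assms by (intro schwartz_norm_ge) auto
 moreover have "(1 + norm x) ^ k * norm (iter_partial is ph x) <= (1 + norm x) ^ l * norm (iter_partial is ph x)"
  using assms(2) by (intro mult_right_mono power_increasing) auto
 ultimately show "(1 + norm x) ^ k * norm (iter_partial is ph x) <= schwartz_norm l ph" by linarith
qed

lemma schwartz_norm_partial:
 assumes "schwartz ph" shows "schwartz_norm k (partial i ph) <= schwartz_norm (Suc k) ph"
proof (rule schwartz_norm_le)
 fix "is" :: "'a list" and x assume "length is <= k"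
 then have "(1 + norm x) ^ Suc k * norm (iter_partial (is @ [i]) ph x) <= schwartz_norm (Suc k) ph"
  using assms by (intro schwartz_norm_ge) auto
 moreover have "(1 + norm x) ^ k * norm (iter_partial is (partial i ph) x) <= (1 + norm x) ^ Suc k * norm (iter_partial is (partial i ph) x)"
  by (intro mult_right_mono power_increasing) auto
 ultimately show "(1 + norm x) ^ k * norm (iter_partial is (partial i ph) x) <= schwartz_norm (Suc k) ph"
  unfolding iter_partial_snoc by linarith
qed

lemma iter_partial_add:
 fixes f g :: "real^'n::finite => complex"
 assumes "smooth_on UNIV f" "smooth_on UNIV g"
 shows "iter_partial is (\<lambda>x. f x + g x) = (\<lambda>x. iter_partial is f x + iter_partial is g x)"
proof (induction "is")
 case (Cons i "is")
 show ?case unfolding iter_partial_Cons Cons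
  using smooth_on_differentiable[OF smooth_on_iter_partial[OF assms(1)]] smooth_on_differentiable[OF smooth_on_iter_partial[OF assms(2)]]
  by (simp add: partial_add fun_eq_iff)
qed simp

lemma iter_partial_cmult:
 fixes f :: "real^'n::finite => complex"
 assumes "smooth_on UNIV f"
 shows "iter_partial is (\<lambda>x. c * f x) = (\<lambda>x. c * iter_partial is f x)"
proof (induction "is")
 case (Cons i "is")
 show ?case unfolding iter_partial_Cons Cons
  using smooth_on_differentiable[OF smooth_on_iter_partial[OF assms]]
  by (simp add: partial_mult fun_eq_iff)
qed simp

lemma partial_mult_smooth:
 fixes f g :: "real^'n::finite => complex"
 assumes "smooth_on UNIV f" "smooth_on UNIV g"
 shows "partial i (f \<odot> g) = (\<lambda>x. partial i f x * g x + f x * partial i g x)"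
 using assms by (simp add: fun_eq_iff partial_mult smooth_on_differentiable)

lemma partial_dilate_smooth:
 fixes f :: "real^'n::finite => complex"
 assumes "smooth_on UNIV f"
 shows "partial i (\<lambda>x. f (c *\<^sub>R x)) = (\<lambda>x. of_real c * partial i f (c *\<^sub>R x))"
 using assms by (simp add: fun_eq_iff partial_dilate smooth_on_differentiable)

text \<open>Moving a derivative past x_j leaves at most one term without x_j, so m derivatives
  produce the factor 1 + m. The order grows by one for the weight of x_j and by one for every
  derivative absorbed into the function.\<close>

lemma schwartz_norm_coord:
 fixes ph :: "real^'n::finite => complex"
 assumes "schwartz ph"
 shows "schwartz_norm k (\<lambda>x. of_real (x $ j) * ph x) <= (1 + real k) * schwartz_norm (2 * k + 1) ph"
proof (rule schwartz_norm_le)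
 fix "is" :: "'n list" and x :: "real^'n" assume l: "length is <= k"
 have main: "(1 + norm x) ^ k * norm (iter_partial is (\<lambda>x. of_real (x $ j) * ph x) x)
  <= (1 + length is) * schwartz_norm (k + 1 + length is) ph" using assms
 proof (induction "is" arbitrary: ph rule: rev_induct)
  case Nil
  have "(1 + norm x) ^ k * norm (of_real (x $ j) * ph x) <= (1 + norm x) ^ k * ((1 + norm x) * norm (ph x))"
   using component_le_norm_cart[of x j] by (intro mult_left_mono) (simp_all add: norm_mult mult_right_mono)
  also have "... <= schwartz_norm (k + 1) ph" using schwartz_norm_ge[OF Nil, of "[]" "k+1" x] by (simp add: mult_ac)
  finally show ?case by simp
 next
  case (snoc i "is")
  have s: "smooth_on UNIV ph" "smooth_on UNIV (partial i ph)"
   using snoc.prems by (auto intro: schwartz_smooth schwartz_partial)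
  have e: "iter_partial (is @ [i]) (\<lambda>x. of_real (x $ j) * ph x) x =
   iter_partial is (\<lambda>x. of_real (x $ j) * partial i ph x) x + (if j = i then iter_partial is ph x else 0)"
  proof -
   have "partial i (\<lambda>x. of_real (x $ j) * ph x) = (\<lambda>x. of_real (x $ j) * partial i ph x + (if j = i then 1 else 0) * ph x)"
    by (subst partial_mult_smooth) (use s in \<open>auto simp: partial_coord\<close>)
   then show ?thesis unfolding iter_partial_snoc
    using iter_partial_add[of "\<lambda>x. of_real (x $ j) * partial i ph x" "\<lambda>x. (if j = i then 1 else 0) * ph x" "is"]
     smooth_on_mult[OF _ _ s(1), of "\<lambda>_. if j = i then 1 else 0"] smooth_on_mult[OF _ _ s(2), of "\<lambda>x. of_real (x $ j)"]
     iter_partial_cmult[OF s(1), of "is" "if j = i then 1 else 0"]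
    by auto
  qed
  have "(1 + norm x) ^ k * norm (iter_partial is ph x) <= schwartz_norm (k + 2 + length is) ph"
  proof -
   have "(1 + norm x) ^ k * norm (iter_partial is ph x) <= (1 + norm x) ^ (k + 2 + length is) * norm (iter_partial is ph x)"
    by (intro mult_right_mono power_increasing) auto
   also have "... <= schwartz_norm (k + 2 + length is) ph" by (intro schwartz_norm_ge snoc.prems) auto
   finally show ?thesis .
  qed
  moreover have "(1 + norm x) ^ k * norm (iter_partial is (\<lambda>x. of_real (x $ j) * partial i ph x) x)
    <= (1 + length is) * schwartz_norm (k + 2 + length is) ph"
  proof -
   have "(1 + norm x) ^ k * norm (iter_partial is (\<lambda>x. of_real (x $ j) * partial i ph x) x)
     <= (1 + length is) * schwartz_norm (k + 1 + length is) (partial i ph)"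
    by (rule snoc.IH[OF schwartz_partial[OF snoc.prems]])
   also have "... <= (1 + length is) * schwartz_norm (Suc (k + 1 + length is)) ph"
    by (intro mult_left_mono schwartz_norm_partial snoc.prems) auto
   finally show ?thesis by (simp add: numeral_2_eq_2)
  qed
  moreover have "0 <= schwartz_norm (k + 2 + length is) ph" by (rule schwartz_norm_nonneg[OF snoc.prems])
  moreover have "(1 + norm x) ^ k * norm (iter_partial (is @ [i]) (\<lambda>x. of_real (x $ j) * ph x) x) \<le>
   (1 + norm x) ^ k * norm (iter_partial is (\<lambda>x. of_real (x $ j) * partial i ph x) x) + (1 + norm x) ^ k * norm (iter_partial is ph x)"
   unfolding e distrib_left[symmetric] by (intro mult_left_mono order_trans[OF norm_triangle_ineq]) auto
  ultimately show ?case by (simp add: algebra_simps)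
 qed
 also have "... <= (1 + real k) * schwartz_norm (2 * k + 1) ph"
  using l by (intro mult_mono schwartz_norm_mono assms schwartz_norm_nonneg) auto
 finally show "(1 + norm x) ^ k * norm (iter_partial is (\<lambda>x. of_real (x $ j) * ph x) x) <= (1 + real k) * schwartz_norm (2 * k + 1) ph" .
qed

text \<open>Where Ph(ep x) is not zero one has r <= ep (1 + |x|), so one more power of the weight,
  harmless for a Schwartz function, is worth a factor \<open>ep\<close>. Derivatives falling on the
  dilated factor keep it zero near the origin and bring a further ep <= 1; the induction therefore
  runs over both functions.\<close>

lemma schwartz_cutoff_bound:
 fixes Ph ps :: "real^'n::finite => complex"
 assumes "smooth_on UNIV Ph" "!!is. \<exists>C. \<forall>x. norm (iter_partial is Ph x) <= C"
  and r: "r > 0" and "!!x. norm x < r ==> Ph x = 0" and "schwartz ps"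
 shows "\<exists>C\<ge>0. \<forall>ep x. 0 < ep --> ep <= 1 -->
  (1 + norm x) ^ k * norm (iter_partial is (\<lambda>x. Ph (ep *\<^sub>R x) * ps x) x) <= C * ep"
 using assms(1,2,4,5)
proof (induction "is" arbitrary: Ph ps rule: rev_induct)
 case Nil
 obtain C where C: "!!x. norm (Ph x) <= C" using Nil(2)[of "[]"] by auto
 have C0: "C >= 0" using C[of 0] norm_ge_zero order_trans by blast
 obtain D where D: "!!x. (1 + norm x) ^ (k + 1) * norm (ps x) <= D"
  using schwartz_rapid[OF Nil(4)] unfolding rapid_def by blast
 have D0: "D >= 0" using D[of 0] by simp (meson norm_ge_zero order_trans)
 have "(1 + norm x) ^ k * norm (Ph (ep *\<^sub>R x) * ps x) <= C * D / r * ep" if e: "0 < ep" for ep x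
 proof (cases "norm (ep *\<^sub>R x) < r")
  case True
  then show ?thesis using Nil(3) C0 D0 r e by simp
 next
  case False
  then have "r <= ep * (1 + norm x)" using e by (simp add: distrib_left)
  then have "(1 + norm x) ^ k * norm (ps x) * r <= (1 + norm x) ^ k * norm (ps x) * (ep * (1 + norm x))"
   by (intro mult_left_mono) auto
  also have "... = ep * ((1 + norm x) ^ (k + 1) * norm (ps x))" by simp
  also have "... <= ep * D" using e by (intro mult_left_mono D) auto
  finally have "(1 + norm x) ^ k * norm (ps x) <= ep * D / r" using r by (simp add: field_simps)
  then have "C * ((1 + norm x) ^ k * norm (ps x)) <= C * (ep * D / r)" using C0 by (intro mult_left_mono) auto
  moreover have "(1 + norm x) ^ k * norm (Ph (ep *\<^sub>R x) * ps x) <= C * ((1 + norm x) ^ k * norm (ps x))"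
   using mult_right_mono[OF C[of "ep *\<^sub>R x"], of "(1 + norm x) ^ k * norm (ps x)"] by (simp add: norm_mult mult_ac)
  ultimately show ?thesis by (simp add: mult_ac)
 qed
 then show ?case using C0 D0 r by (intro exI[of _ "C * D / r"]) auto
next
 case (snoc i "is")
 have p: "iter_partial (is @ [i]) (\<lambda>x. Ph (ep *\<^sub>R x) * ps x) x =
  iter_partial is (\<lambda>x. Ph (ep *\<^sub>R x) * partial i ps x) x + of_real ep * iter_partial is (\<lambda>x. partial i Ph (ep *\<^sub>R x) * ps x) x" for ep x
 proof -
  have s: "smooth_on UNIV ps" "smooth_on UNIV (partial i ps)" "smooth_on UNIV (\<lambda>x. Ph (ep *\<^sub>R x))" "smooth_on UNIV (\<lambda>x. partial i Ph (ep *\<^sub>R x))"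
   using snoc.prems by (auto intro: schwartz_smooth schwartz_partial smooth_on_dilate smooth_on_partial)
  have "partial i (\<lambda>x. Ph (ep *\<^sub>R x) * ps x) = (\<lambda>x. Ph (ep *\<^sub>R x) * partial i ps x + of_real ep * (partial i Ph (ep *\<^sub>R x) * ps x))"
   unfolding partial_mult_smooth[OF s(3,1)] partial_dilate_smooth[OF snoc.prems(1)] by (simp add: fun_eq_iff)
  then show ?thesis unfolding iter_partial_snoc using s
   by (simp add: iter_partial_add iter_partial_cmult smooth_on_mult)
 qed
 obtain C1 where C1: "C1 >= 0" "!!ep x. 0 < ep ==> ep <= 1 ==>
   (1 + norm x) ^ k * norm (iter_partial is (\<lambda>x. Ph (ep *\<^sub>R x) * partial i ps x) x) <= C1 * ep"
  using snoc.IH[OF snoc.prems(1,2,3) schwartz_partial[OF snoc.prems(4), of i]] by auto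
 have "\<exists>C\<ge>0. \<forall>ep x. 0 < ep --> ep <= 1 -->
   (1 + norm x) ^ k * norm (iter_partial is (\<lambda>x. partial i Ph (ep *\<^sub>R x) * ps x) x) <= C * ep"
 proof (rule snoc.IH)
  show "smooth_on UNIV (partial i Ph)" using snoc.prems by (simp add: smooth_on_partial)
  show "\<exists>C. \<forall>x. cmod (iter_partial is (partial i Ph) x) <= C" for "is"
   using snoc.prems(2) unfolding iter_partial_snoc[symmetric] by blast
  show "partial i Ph x = 0" if "norm x < r" for x
   using partial_cong_open[of "ball 0 r" x Ph "\<lambda>_. 0" i] snoc.prems(3) that by simp
  show "schwartz ps" by fact
 qed
 then obtain C2 where C2: "C2 >= 0" "!!ep x. 0 < ep ==> ep <= 1 ==>
   (1 + norm x) ^ k * norm (iter_partial is (\<lambda>x. partial i Ph (ep *\<^sub>R x) * ps x) x) <= C2 * ep" by auto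
 have "(1 + norm x) ^ k * norm (iter_partial (is @ [i]) (\<lambda>x. Ph (ep *\<^sub>R x) * ps x) x) <= (C1 + C2) * ep"
  if e: "0 < ep" "ep <= 1" for ep x
 proof -
  have "(1 + norm x) ^ k * norm (iter_partial (is @ [i]) (\<lambda>x. Ph (ep *\<^sub>R x) * ps x) x)
   <= (1 + norm x) ^ k * norm (iter_partial is (\<lambda>x. Ph (ep *\<^sub>R x) * partial i ps x) x)
   + ep * ((1 + norm x) ^ k * norm (iter_partial is (\<lambda>x. partial i Ph (ep *\<^sub>R x) * ps x) x))"
   unfolding p using mult_left_mono[OF norm_triangle_ineq, of "(1 + norm x) ^ k"] e
   by (smt (verit) abs_of_pos distrib_left mult.left_commute norm_ge_zero norm_mult norm_of_real zero_le_power)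
  also have "... <= C1 * ep + 1 * (C2 * ep)"
   using C1(2)[OF e, of x] mult_mono[OF e(2) C2(2)[OF e, of x]] e by (intro add_mono) auto
  finally show ?thesis by (simp add: algebra_simps)
 qed
 then show ?case using C1(1) C2(1) by (intro exI[of _ "C1 + C2"]) auto
qed

section \<open>Limits along tempered distributions\<close>

lemma tempered_add: "tempered \<mu> ==> schwartz f ==> schwartz g ==> \<mu> (\<lambda>x. f x + g x) = \<mu> f + \<mu> g"
 unfolding tempered_def by blast

lemma tempered_cmult: "tempered \<mu> ==> schwartz f ==> \<mu> (\<lambda>x. c * f x) = c * \<mu> f"
 unfolding tempered_def by blast

lemma tempered_diff:
 assumes "tempered \<mu>" "schwartz f" "schwartz g" shows "\<mu> (\<lambda>x. f x - g x) = \<mu> f - \<mu> g"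
 using tempered_add[OF assms(1,2) schwartz_cmult[OF assms(3), of "-1"]] tempered_cmult[OF assms(1,3), of "-1"] by simp

text \<open>A tempered distribution is controlled by finitely many derivatives, so bounds obtained
  for each derivative separately, with unrelated constants, can be summed into one.\<close>

lemma tempered_small:
 fixes f :: "'a => real^'n::finite => complex"
 assumes T: "tempered \<mu>"
  and f: "\<forall>\<^sub>F a in F. schwartz (f a)"
  and b: "!!k is. \<exists>C\<ge>0. \<forall>\<^sub>F a in F. \<forall>x. (1 + norm x) ^ k * norm (iter_partial is (f a) x) <= C * e a"
  and e: "(e \<longlongrightarrow> 0) F"
 shows "((\<lambda>a. \<mu> (f a)) \<longlongrightarrow> 0) F"
proof -
 obtain C k where C: "!!ph. schwartz ph ==> norm (\<mu> ph) <= C * schwartz_norm k ph"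
  using T unfolding tempered_def by blast
 have "\<forall>is. \<exists>C. C >= 0 \<and> (\<forall>\<^sub>F a in F. \<forall>x. (1 + norm x) ^ k * norm (iter_partial is (f a) x) <= C * e a)"
  using b[of k] by blast
 from choice[OF this] obtain D where D: "!!is. D is >= 0" "!!is. \<forall>\<^sub>F a in F. \<forall>x. (1 + norm x) ^ k * norm (iter_partial is (f a) x) <= D is * e a"
  by blast
 define M where "M = (\<Sum>is\<in>{is::'n list. length is <= k}. D is)"
 have M0: "M >= 0" unfolding M_def by (intro sum_nonneg D)
 have "\<forall>\<^sub>F a in F. \<forall>is\<in>{is. length is <= k}. \<forall>x. (1 + norm x) ^ k * norm (iter_partial is (f a) x) <= D is * e a"
  using D(2) by (intro eventually_ball_finite finite_lists_le) auto
 then have "\<forall>\<^sub>F a in F. norm (\<mu> (f a)) <= \<bar>C\<bar> * (M * \<bar>e a\<bar>)"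
  using f
 proof eventually_elim
  case (elim a)
  have "schwartz_norm k (f a) <= M * \<bar>e a\<bar>"
  proof (rule schwartz_norm_le)
   fix "is" :: "'n list" and x assume l: "length is <= k"
   have "(1 + norm x) ^ k * norm (iter_partial is (f a) x) <= D is * e a" using elim(1) l by blast
   also have "... <= D is * \<bar>e a\<bar>" by (intro mult_left_mono D) auto
   also have "D is <= M" unfolding M_def using l D finite_lists_le by (intro member_le_sum) auto
   then have "D is * \<bar>e a\<bar> <= M * \<bar>e a\<bar>" by (intro mult_right_mono) auto
   finally show "(1 + norm x) ^ k * norm (iter_partial is (f a) x) <= M * \<bar>e a\<bar>" .
  qed
  moreover have "norm (\<mu> (f a)) <= \<bar>C\<bar> * schwartz_norm k (f a)"
   using C[OF elim(2)] schwartz_norm_nonneg[OF elim(2)] by (meson abs_ge_self mult_right_mono order_trans)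
  ultimately show ?case by (meson abs_ge_zero mult_left_mono order_trans)
 qed
 moreover have "((\<lambda>a. \<bar>C\<bar> * (M * \<bar>e a\<bar>)) \<longlongrightarrow> 0) F"
  using tendsto_mult_right_zero[OF tendsto_mult_right_zero[OF tendsto_rabs_zero[OF e]]] by simp
 ultimately show ?thesis by (rule Lim_null_comparison)
qed

lemma test_fun_iter_partial_bounded: "test_fun om ==> \<exists>C. \<forall>x. norm (iter_partial is om x) <= C"
 using test_fun_sup[OF test_fun_iter_partial] by metis

lemma space_cutoff_test_fun: "space_cutoff et ==> test_fun et"
 by (simp add: space_cutoff_def test_fun_def schwartz_smooth)

lemma space_cutoff_radial_cut: "lp_cutoff ze ==> space_cutoff (radial_cut ze)"
 using test_fun_radial_cut[of ze] unfolding space_cutoff_def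
 by (auto simp: schwartz_test_fun test_fun_def radial_cut_one intro!: exI[of _ "1::real"])

text \<open>The error has the factor et(ep x) - 1, which vanishes for |ep x| < r;
  \<open>schwartz_cutoff_bound\<close> makes it O(ep) in every seminorm.\<close>

lemma tempered_cutoff:
 fixes et ps :: "real^'n::finite => complex"
 assumes T: "tempered \<mu>" and et: "space_cutoff et" and ps: "schwartz ps"
 shows "((\<lambda>ep. \<mu> (\<lambda>x. et (ep *\<^sub>R x) * ps x)) \<longlongrightarrow> \<mu> ps) (at_right 0)"
proof -
 have t: "test_fun et" using et by (rule space_cutoff_test_fun)
 obtain r where r: "r > 0" "!!x. norm x < r ==> et x = 1" using et unfolding space_cutoff_def by auto
 have s: "schwartz (\<lambda>x. et (ep *\<^sub>R x) * ps x)" if "ep > 0" for ep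
  by (intro schwartz_mult_slow slow_smooth_schwartz schwartz_test_fun test_fun_dilate t ps) (use that in auto)
 have sm: "smooth_on UNIV et" using t by (simp add: test_fun_def)
 have "iter_partial is (\<lambda>x. et x - 1) = (\<lambda>x. iter_partial is et x + (if is = [] then -1 else 0))" for "is"
 proof (induction "is")
  case (Cons i "is")
  show ?case unfolding iter_partial_Cons Cons
   by (rule ext, subst partial_add) (auto intro: smooth_on_differentiable[OF smooth_on_iter_partial[OF sm]])
 qed auto
 moreover have "\<exists>C. \<forall>x. norm (iter_partial is et x + c) <= C" for "is" c
  using test_fun_iter_partial_bounded[OF t, of "is"] norm_triangle_ineq
  by (metis add_right_mono order_trans)
 ultimately have b: "\<exists>C. \<forall>x. norm (iter_partial is (\<lambda>x. et x - 1) x) <= C" for "is" by simp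
 have "((\<lambda>ep. \<mu> (\<lambda>x. (et (ep *\<^sub>R x) - 1) * ps x)) \<longlongrightarrow> 0) (at_right 0)"
 proof (rule tempered_small[OF T, where e="\<lambda>ep. ep"])
  have "schwartz (\<lambda>x. et (ep *\<^sub>R x) * ps x - ps x)" if "ep > 0" for ep using schwartz_diff s that ps by blast
  then show "\<forall>\<^sub>F ep in at_right 0. schwartz (\<lambda>x. (et (ep *\<^sub>R x) - 1) * ps x)"
   by (auto simp: eventually_at_right_field algebra_simps intro!: exI[of _ 1])
  fix k "is"
  have "smooth_on UNIV (\<lambda>x. et x - 1)" using sm by (intro smooth_on_diff) auto
  from schwartz_cutoff_bound[OF this b r(1) _ ps, of k "is"] r(2)
  obtain C where "C >= 0" "!!ep x. 0 < ep ==> ep <= 1 ==>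
   (1 + norm x) ^ k * norm (iter_partial is (\<lambda>x. (et (ep *\<^sub>R x) - 1) * ps x) x) <= C * ep" by auto
  then show "\<exists>C\<ge>0. \<forall>\<^sub>F ep in at_right 0. \<forall>x. (1 + norm x) ^ k * norm (iter_partial is (\<lambda>x. (et (ep *\<^sub>R x) - 1) * ps x) x) <= C * ep"
   by (intro exI[of _ C]) (auto simp: eventually_at_right_field intro!: exI[of _ 1])
  show "((\<lambda>ep. ep) \<longlongrightarrow> 0) (at_right (0::real))" by simp
 qed
 moreover have "\<forall>\<^sub>F ep in at_right 0. \<mu> (\<lambda>x. (et (ep *\<^sub>R x) - 1) * ps x) = \<mu> (\<lambda>x. et (ep *\<^sub>R x) * ps x) - \<mu> ps"
  using tempered_diff[OF T s ps] by (auto simp: eventually_at_right_field algebra_simps intro!: exI[of _ 1])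
 ultimately have "((\<lambda>ep. \<mu> (\<lambda>x. et (ep *\<^sub>R x) * ps x) - \<mu> ps) \<longlongrightarrow> 0) (at_right 0)"
  by (rule Lim_transform_eventually)
 then show ?thesis by (rule Lim_null[THEN iffD2])
qed

section \<open>Integration on \<open>\<real>\<^sup>N\<close>\<close>

lemma nn_integral_affine:
 fixes f :: "real^'n::finite => ennreal"
 assumes [measurable]: "f \<in> borel_measurable borel" and c: "c \<noteq> 0"
 shows "(\<integral>\<^sup>+x. f (t + c *\<^sub>R x) \<partial>lborel) = ennreal (1 / \<bar>c\<bar> ^ CARD('n)) * (\<integral>\<^sup>+x. f x \<partial>lborel)"
proof -
 have "(\<integral>\<^sup>+x. f x \<partial>lborel) = ennreal (\<bar>c\<bar> ^ CARD('n)) * (\<integral>\<^sup>+x. f (t + c *\<^sub>R x) \<partial>lborel)"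
  by (subst lborel_affine[OF c, of t]) (simp add: nn_integral_density nn_integral_distr nn_integral_cmult)
 then show ?thesis using c by (simp add: mult.assoc[symmetric] ennreal_mult[symmetric])
qed

lemma has_bochner_integral_affine:
 fixes f :: "real^'n::finite => 'b::{banach, second_countable_topology}"
 assumes c: "c \<noteq> 0" and f: "has_bochner_integral lborel f I"
 shows "has_bochner_integral lborel (\<lambda>x. f (t + c *\<^sub>R x)) ((1 / \<bar>c\<bar> ^ CARD('n)) *\<^sub>R I)"
proof -
 have [measurable]: "f \<in> borel_measurable borel" using f by (auto simp: has_bochner_integral_iff)
 let ?D = "distr lborel borel (\<lambda>x. t + c *\<^sub>R x)"
 have D: "lborel = density ?D (\<lambda>_. ennreal (\<bar>c\<bar>^CARD('n)))" using lborel_affine[OF c, of t] by simp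
 have "integrable (density ?D (\<lambda>_. ennreal (\<bar>c\<bar>^CARD('n)))) f" using f D by (simp add: has_bochner_integral_iff)
 then have "integrable ?D (\<lambda>x. \<bar>c\<bar>^CARD('n) *\<^sub>R f x)" by (subst (asm) integrable_density) auto
 then have 1: "L1 (\<lambda>x. \<bar>c\<bar>^CARD('n) *\<^sub>R f (t + c *\<^sub>R x))" by (subst (asm) integrable_distr_eq) auto
 have "I = integral\<^sup>L (density ?D (\<lambda>_. ennreal (\<bar>c\<bar>^CARD('n)))) f" using f D by (simp add: has_bochner_integral_iff)
 also have "... = integral\<^sup>L ?D (\<lambda>x. \<bar>c\<bar>^CARD('n) *\<^sub>R f x)" by (subst integral_density) auto
 also have "... = (LBINT x. \<bar>c\<bar>^CARD('n) *\<^sub>R f (t + c *\<^sub>R x))" by (subst integral_distr) auto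
 finally have "has_bochner_integral lborel (\<lambda>x. \<bar>c\<bar>^CARD('n) *\<^sub>R f (t + c *\<^sub>R x)) I"
  using 1 by (simp add: has_bochner_integral_iff)
 from has_bochner_integral_scaleR_right[OF this, of "1 / \<bar>c\<bar> ^ CARD('n)"] show ?thesis using c by simp
qed

lemma integrable_affine:
 fixes f :: "real^'n::finite => 'b::{banach, second_countable_topology}"
 shows "c \<noteq> 0 ==> L1 f ==> L1 (\<lambda>x. f (t + c *\<^sub>R x))"
 using has_bochner_integral_affine by (metis has_bochner_integral_iff)

lemma integral_affine:
 fixes f :: "real^'n::finite => 'b::{banach, second_countable_topology}"
 assumes "c \<noteq> 0" "L1 f"
 shows "(LBINT x. f (t + c *\<^sub>R x)) = (1 / \<bar>c\<bar> ^ CARD('n)) *\<^sub>R (LBINT x. f x)"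
 using has_bochner_integral_affine[OF assms(1) has_bochner_integral_integrable[OF assms(2)]]
 by (simp add: has_bochner_integral_iff)

lemma integrable_translate_minus:
 fixes f :: "real^'n::finite => 'b::{banach, second_countable_topology}"
 shows "L1 f ==> L1 (\<lambda>y. f (x - y))"
 using integrable_affine[of "-1" f x] by simp

lemma integral_translate_minus:
 fixes f :: "real^'n::finite => 'b::{banach, second_countable_topology}"
 shows "L1 f ==> (LBINT y. f (x - y)) = (LBINT y. f y)"
 using integral_affine[of "-1" f x] by simp

subsection \<open>The decay profile\<close>

definition decay :: "real => real^'n::finite => real" where
 "decay a x = (1 + norm x) powr (- a)"

lemma one_plus_norm_pos [simp]: "0 < 1 + norm x"
 by (simp add: add_pos_nonneg)

lemma one_plus_norm_nonzero [simp]: "1 + norm x \<noteq> 0"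
 using one_plus_norm_pos[of x] by linarith

lemma decay_pos [simp]: "0 < decay a x"
 by (simp add: decay_def)

lemma decay_nonneg [simp]: "0 <= decay a x"
 by (simp add: decay_def)

lemma decay_measurable [measurable]: "decay a \<in> borel_measurable borel"
 unfolding decay_def[abs_def] by measurable

lemma decay_le_one: "a >= 0 ==> decay a x <= 1"
 using powr_mono[of "-a" 0 "1 + norm x"] by (simp add: decay_def)

lemma decay_mono: "a <= b ==> decay b x <= decay a x"
 unfolding decay_def by (rule powr_mono) auto

lemma decay_minus [simp]: "decay a (- x) = decay a x"
 by (simp add: decay_def)

lemma decay_commute: "decay a (x - y) = decay a (y - x)"
 by (simp add: decay_def norm_minus_commute)

lemma decay_power: "decay (real k) x = 1 / (1 + norm x) ^ k"
 unfolding decay_def by (simp add: powr_minus powr_realpow divide_inverse)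

lemma nn_integral_decay_1dim:
 assumes "b > 1"
 shows "(\<integral>\<^sup>+t. ennreal ((1 + \<bar>t\<bar>) powr (- b)) \<partial>lborel) < \<infinity>"
proof -
 let ?f = "\<lambda>t::real. (1 + \<bar>t\<bar>) powr (- b)"
 have lim: "((\<lambda>t. - ((1 + t) powr (1 - b)) / (b - 1)) \<longlongrightarrow> 0) at_top"
 proof -
  have "((\<lambda>t::real. (1 + t) powr (1 - b)) \<longlongrightarrow> 0) at_top"
   using assms by (intro tendsto_neg_powr filterlim_tendsto_add_at_top[OF tendsto_const] filterlim_ident) auto
  from tendsto_mult_right[OF this, of "- 1 / (b - 1)"] show ?thesis by (simp add: mult.commute)
 qed
 have h: "(\<integral>\<^sup>+t. ennreal (?f t) * indicator {0..} t \<partial>lborel) = ennreal (0 - (- ((1 + 0) powr (1 - b)) / (b - 1)))"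
 proof (rule nn_integral_FTC_atLeast[OF _ _ _ lim])
  show "?f \<in> borel_measurable borel" by measurable
  fix t :: real assume t: "0 <= t"
  have "((\<lambda>t. (1 + t) powr (1 - b)) has_real_derivative (1 - b) * (1 + t) powr (1 - b - of_nat 1) * 1) (at t)"
   using t by (intro DERIV_fun_powr) (auto intro!: derivative_eq_intros)
  from DERIV_cdivide[OF DERIV_minus[OF this], of "b - 1"]
  have "((\<lambda>t. - ((1 + t) powr (1 - b)) / (b - 1)) has_real_derivative - ((1 - b) * (1 + t) powr (1 - b - 1)) / (b - 1)) (at t)"
   by simp
  also have "- ((1 - b) * (1 + t) powr (1 - b - 1)) / (b - 1) = ?f t"
   using assms t by (simp add: field_simps)
  finally show "((\<lambda>t. - ((1 + t) powr (1 - b)) / (b - 1)) has_real_derivative ?f t) (at t)" .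
 qed auto
 have "(\<integral>\<^sup>+t. ennreal (?f t) \<partial>lborel) <= (\<integral>\<^sup>+t. ennreal (?f t) * indicator {0..} t + ennreal (?f (0 + -1 * t)) * indicator {0..} (0 + -1 * t) \<partial>lborel)"
  by (intro nn_integral_mono) (auto simp: indicator_def)
 also have "... = (\<integral>\<^sup>+t. ennreal (?f t) * indicator {0..} t \<partial>lborel) + (\<integral>\<^sup>+t. ennreal (?f (0 + -1 * t)) * indicator {0..} (0 + -1 * t) \<partial>lborel)"
  by (intro nn_integral_add) auto
 also have "(\<integral>\<^sup>+t. ennreal (?f (0 + -1 * t)) * indicator {0..} (0 + -1 * t) \<partial>lborel) = (\<integral>\<^sup>+t. ennreal (?f t) * indicator {0..} t \<partial>lborel)"
  using nn_integral_real_affine[of "\<lambda>t. ennreal (?f t) * indicator {0..} t" "-1" 0] by simp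
 also have "(\<integral>\<^sup>+t. ennreal (?f t) * indicator {0..} t \<partial>lborel) + (\<integral>\<^sup>+t. ennreal (?f t) * indicator {0..} t \<partial>lborel) < \<infinity>"
  unfolding h by (simp add: less_top[symmetric])
 finally show ?thesis .
qed

text \<open>Each coordinate is at most |x|, hence the profile is below the product over the N
  coordinates of (1 + |x_b|)^(-a/N). Tonelli leaves one-dimensional integrals with exponent a/N >
  1.\<close>

lemma integrable_decay:
 fixes a :: real
 assumes a: "a > CARD('n)"
 shows "L1 (decay a :: real^'n::finite => real)"
proof (rule integrableI_nonneg)
 let ?N = "real CARD('n)"
 have N: "?N > 0" by simp
 have pw: "decay a x <= (\<Prod>b\<in>Basis. (1 + \<bar>x \<bullet> b\<bar>) powr (- a / ?N))" for x :: "real^'n"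
 proof -
  have "(\<Prod>b\<in>(Basis :: (real^'n) set). (1 + norm x) powr (- a / ?N)) <= (\<Prod>b\<in>Basis. (1 + \<bar>x \<bullet> b\<bar>) powr (- a / ?N))"
   using a N by (intro prod_mono) (auto intro!: powr_mono2' Basis_le_norm simp: divide_nonneg_pos)
  moreover have "(\<Prod>b\<in>(Basis :: (real^'n) set). (1 + norm x) powr (- a / ?N)) = decay a x"
  proof -
   have "(\<Prod>b\<in>(Basis :: (real^'n) set). (1 + norm x) powr (- a / ?N)) = ((1 + norm x) powr (- a / ?N)) powr ?N"
    by (subst powr_realpow) (auto simp: add_pos_nonneg)
   then show ?thesis using N by (simp add: powr_powr decay_def)
  qed
  ultimately show ?thesis by simp
 qed
 have "(\<integral>\<^sup>+x. ennreal (decay a (x::real^'n)) \<partial>lborel) <= (\<integral>\<^sup>+x. (\<Prod>b\<in>Basis. ennreal ((1 + \<bar>(x::real^'n) \<bullet> b\<bar>) powr (- a / ?N))) \<partial>lborel)"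
  unfolding prod_ennreal[OF powr_ge_zero] by (intro nn_integral_mono ennreal_leI pw)
 also have "... = (\<Prod>b\<in>(Basis :: (real^'n) set). (\<integral>\<^sup>+t. ennreal ((1 + \<bar>t\<bar>) powr (- a / ?N)) \<partial>lborel))"
  by (rule nn_integral_lborel_prod) auto
 also have "... < \<infinity>"
  using nn_integral_decay_1dim[of "a / ?N"] a N by (simp add: power_less_top_ennreal)
 finally show "(\<integral>\<^sup>+x. ennreal (decay a (x::real^'n)) \<partial>lborel) < \<infinity>" .
qed auto

text \<open>Peetre's inequality 1 + |x| <= (1 + |h|)(1 + |x + h|), raised to the power -a.\<close>

lemma decay_translate:
 assumes "a >= 0" shows "decay a (x + h) <= (1 + norm h) powr a * decay a x"
proof -
 have "norm x <= norm h + norm (x + h)" using norm_triangle_ineq4[of "x + h" h] by simp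
 moreover have "0 <= norm h * norm (x + h)" by simp
 ultimately have "1 + norm x <= (1 + norm h) * (1 + norm (x + h))" unfolding distrib_left distrib_right by linarith
 then have "((1 + norm h) * (1 + norm (x + h))) powr (- a) <= (1 + norm x) powr (- a)"
  using assms by (intro powr_mono2') (auto simp: add_pos_nonneg)
 then have "(1 + norm h) powr (- a) * decay a (x + h) <= decay a x"
  unfolding decay_def by (subst (asm) powr_mult) (auto simp: add_nonneg_nonneg)
 then have "(1 + norm h) powr a * ((1 + norm h) powr (- a) * decay a (x + h)) <= (1 + norm h) powr a * decay a x"
  by (intro mult_left_mono) auto
 moreover have "(1 + norm h) powr a * (1 + norm h) powr (- a) = 1"
  by (subst powr_add[symmetric]) (auto simp: add_nonneg_eq_0_iff)
 ultimately show ?thesis by (simp add: mult.assoc[symmetric])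
qed

text \<open>At every y either |y| or |x - y| is at least |x|/2, so one of the two factors is at most
  2^a times the profile at \<open>x\<close>, and the other one is integrated.\<close>

lemma decay_convolve:
 fixes x :: "real^'n::finite" and a :: real
 assumes a: "a > CARD('n)"
 shows "L1 (\<lambda>y. decay a (x - y) * decay a y)"
  and "(LBINT y. decay a (x - y) * decay a y) <= 2 * 2 powr a * (LBINT y. decay a (y::real^'n)) * decay a x"
proof -
 have a0: "a >= 0" using a of_nat_0_le_iff[of "CARD('n)"] by linarith
 have i: "L1 (decay a :: real^'n => real)" by (rule integrable_decay[OF a])
 have i': "L1 (\<lambda>y. decay a (x - y))" by (rule integrable_translate_minus[OF i])
 show I: "L1 (\<lambda>y. decay a (x - y) * decay a y)"
  by (rule Bochner_Integration.integrable_bound[OF i]) (use decay_le_one[OF a0] in \<open>auto simp: mult_left_le_one_le\<close>)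
 have half: "decay a y <= 2 powr a * decay a x" if "norm y >= norm x / 2" for y :: "real^'n"
 proof -
  have "decay a y <= ((1 + norm x) / 2) powr (- a)"
   unfolding decay_def using that a0 by (intro powr_mono2') (auto simp: add_pos_nonneg)
  also have "... = 2 powr a * decay a x"       unfolding decay_def by (subst powr_divide) (simp_all add: powr_minus_divide)
  finally show ?thesis .
 qed
 have b: "decay a (x - y) * decay a y <= 2 powr a * decay a x * (decay a (x - y) + decay a y)" for y
 proof (cases "norm y >= norm x / 2")
  case True
  have "decay a (x - y) * decay a y <= decay a (x - y) * (2 powr a * decay a x)"
   using half[OF True] by (intro mult_left_mono) auto
  also have "... <= 2 powr a * decay a x * (decay a (x - y) + decay a y)" by (simp add: algebra_simps)
  finally show ?thesis .
 next
  case False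
  then have "norm (x - y) >= norm x / 2" using norm_triangle_ineq2[of x y] by linarith
  then have "decay a (x - y) * decay a y <= (2 powr a * decay a x) * decay a y"
   using half by (intro mult_right_mono) auto
  also have "... <= 2 powr a * decay a x * (decay a (x - y) + decay a y)" by (simp add: algebra_simps)
  finally show ?thesis .
 qed
 have "(LBINT y. decay a (x - y) * decay a y) <= (LBINT y. 2 powr a * decay a x * (decay a (x - y) + decay a y))"
  by (intro integral_mono I Bochner_Integration.integrable_mult_right Bochner_Integration.integrable_add i i' b)
 also have "... = 2 powr a * decay a x * ((LBINT y. decay a (x - y)) + (LBINT y. decay a (y::real^'n)))"
  using i i' by simp
 also have "(LBINT y. decay a (x - y)) = (LBINT y. decay a (y::real^'n))"
  by (rule integral_translate_minus[OF i])
 finally show "(LBINT y. decay a (x - y) * decay a y) <= 2 * 2 powr a * (LBINT y. decay a (y::real^'n)) * decay a x"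
  by (simp add: mult_ac)
qed

lemma rapid_decay:
 fixes f :: "real^'n::finite => complex"
 assumes "rapid f" obtains C where "C >= 0" "!!x. norm (f x) <= C * decay (real k) x"
proof -
 from assms obtain C where C: "!!x. (1 + norm x) ^ k * norm (f x) <= C" unfolding rapid_def by blast
 have "norm (f x) <= C * decay (real k) x" for x
 proof -
  have "(1 + norm x) ^ k > 0" by (simp add: add_pos_nonneg)
  then show ?thesis using C[of x] by (simp add: decay_power field_simps)
 qed
 moreover have "C >= 0" using C[of 0] by simp (meson norm_ge_zero order_trans)
 ultimately show ?thesis using that by blast
qed

lemma rapid_decay':
 fixes f :: "real^'n::finite => complex"
 assumes "rapid f" obtains C where "C >= 0" "!!x. norm (f x) <= C * decay a x"
proof -
 obtain C where C: "C >= 0" "!!x. norm (f x) <= C * decay (real (nat \<lceil>a\<rceil>)) x" using rapid_decay[OF assms] by blast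
 moreover have "C * decay (real (nat \<lceil>a\<rceil>)) x <= C * decay a x" for x :: "real^'n"
  using C(1) by (intro mult_left_mono decay_mono) linarith+
 ultimately show ?thesis using that by (meson order_trans)
qed

lemma integrable_decay_bound:
 fixes f :: "real^'n::finite => 'b::{banach, second_countable_topology}" and a :: real
 assumes [measurable]: "f \<in> borel_measurable borel" and "a > CARD('n)" "!!x. norm (f x) <= C * decay a x"
 shows "L1 f"
proof (rule Bochner_Integration.integrable_bound)
 show "L1 (\<lambda>x::real^'n. C * decay a x)" using integrable_decay[OF assms(2)] by simp
 show "AE x in lborel. norm (f x) <= norm (C * decay a x)" using assms(3) by (auto intro: order_trans[OF _ abs_ge_self])
qed auto

lemma rapid_integrable:
 fixes f :: "real^'n::finite => complex"
 assumes "rapid f" "f \<in> borel_measurable borel" shows "L1 f"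
proof -
 obtain C where "C >= 0" "!!x. norm (f x) <= C * decay (real (CARD('n) + 1)) x" using rapid_decay[OF assms(1)] by blast
 then show ?thesis using integrable_decay_bound[of f "real (CARD('n) + 1)" C] assms(2) by simp
qed

lemma schwartz_measurable: "schwartz f ==> f \<in> borel_measurable borel"
 by (intro borel_measurable_continuous_onI smooth_on_continuous schwartz_smooth)

lemma schwartz_integrable: "schwartz f ==> L1 f"
 by (intro rapid_integrable schwartz_rapid schwartz_measurable)

subsection \<open>Integrals of partial derivatives\<close>

lemma partial_difference_bound:
 fixes f :: "real^'n::finite => complex"
 assumes d: "!!x. f differentiable (at x)" and h: "0 < h"
 shows "\<exists>s. 0 < s \<and> s < h \<and> norm (f (x + h *\<^sub>R axis i 1) - f x) <= h * norm (partial i f (x + s *\<^sub>R axis i 1))"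
proof -
 have D: "((\<lambda>s. f (x + s *\<^sub>R axis i 1)) has_derivative (\<lambda>v. v *\<^sub>R partial i f (x + s *\<^sub>R axis i 1))) (at s)" for s
 proof -
  have "((\<lambda>s. x + s *\<^sub>R axis i 1) has_derivative (\<lambda>v. v *\<^sub>R axis i 1)) (at s)"
   by (auto intro!: derivative_eq_intros)
  from has_derivative_compose[OF this has_derivative_partial[OF d]]
  have "((\<lambda>s. f (x + s *\<^sub>R axis i 1)) has_derivative (\<lambda>v. \<Sum>j\<in>UNIV. (v *\<^sub>R axis i 1) $ j *\<^sub>R partial j f (x + s *\<^sub>R axis i 1))) (at s)" .
  moreover have "(\<Sum>j\<in>UNIV. (v *\<^sub>R axis i 1) $ j *\<^sub>R partial j f y) = v *\<^sub>R partial i f y" for v y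
  proof -
   have "(\<Sum>j\<in>UNIV. (v *\<^sub>R axis i 1) $ j *\<^sub>R partial j f y) = (\<Sum>j\<in>UNIV. if j = i then v *\<^sub>R partial i f y else 0)"
    by (rule sum.cong) (auto simp: axis_def)
   then show ?thesis by simp
  qed
  ultimately show ?thesis by simp
 qed
 have "continuous_on {0..h} (\<lambda>s. f (x + s *\<^sub>R axis i 1))"
  using D has_derivative_continuous by (intro continuous_at_imp_continuous_on) blast
 from mvt_general[OF h this, of "\<lambda>s v. v *\<^sub>R partial i f (x + s *\<^sub>R axis i 1)"] D h
 show ?thesis by auto
qed

lemma partial_difference_limit:
 fixes f :: "real^'n::finite => complex"
 assumes d: "f differentiable (at x)"
 shows "(\<lambda>n. real (Suc n) *\<^sub>R (f (x + (1 / real (Suc n)) *\<^sub>R axis i 1) - f x)) \<longlonglongrightarrow> partial i f x"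
proof -
 obtain D where D: "(f has_derivative D) (at x)" using d by (auto simp: differentiable_def)
 have "((\<lambda>s. x + s *\<^sub>R axis i 1) has_derivative (\<lambda>v. v *\<^sub>R axis i 1)) (at 0)"
  by (auto intro!: derivative_eq_intros)
 let ?h = "\<lambda>n. (1 / real (Suc n)) *\<^sub>R axis i 1 :: real^'n"
 have "((\<lambda>h. norm (f (x + h) - f x - D h) / norm h) \<longlongrightarrow> 0) (at 0)"
  using D by (simp add: has_derivative_at)
 moreover have "filterlim ?h (at 0) sequentially"
 proof -
  have "?h \<longlonglongrightarrow> 0 *\<^sub>R axis i 1"
   by (intro tendsto_scaleR LIMSEQ_inverse_real_of_nat[unfolded inverse_eq_divide] tendsto_const)
  then show ?thesis unfolding filterlim_at by simp
 qed
 ultimately have "(\<lambda>n. norm (f (x + ?h n) - f x - D (?h n)) / norm (?h n)) \<longlonglongrightarrow> 0"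
  by (rule filterlim_compose)
 moreover have "norm (f (x + ?h n) - f x - D (?h n)) / norm (?h n) = norm (real (Suc n) *\<^sub>R (f (x + ?h n) - f x) - partial i f x)" for n
 proof -
  have "D (?h n) = (1 / real (Suc n)) *\<^sub>R partial i f x"
   using partial_eqI[OF D] linear_cmul[OF has_derivative_linear[OF D]] by auto
  then have "real (Suc n) *\<^sub>R (f (x + ?h n) - f x) - partial i f x = real (Suc n) *\<^sub>R (f (x + ?h n) - f x - D (?h n))"
   by (simp add: scaleR_right_diff_distrib del: of_nat_Suc)
  then show ?thesis by (simp del: of_nat_Suc)
 qed
 ultimately have "(\<lambda>n. norm (real (Suc n) *\<^sub>R (f (x + ?h n) - f x) - partial i f x)) \<longlonglongrightarrow> 0" by simp
 then show ?thesis using LIM_zero_cancel tendsto_norm_zero_iff by blast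
qed

text \<open>Only differentiability is available, so the derivative is obtained as a pointwise limit
  of measurable difference quotients.\<close>

lemma partial_measurable:
 fixes f :: "real^'n::finite => complex"
 assumes d: "!!x. f differentiable (at x)"
 shows "partial i f \<in> borel_measurable borel"
proof (rule borel_measurable_LIMSEQ_metric)
 have "continuous_on UNIV f" using d differentiable_imp_continuous_within continuous_at_imp_continuous_on by blast
 then have [measurable]: "f \<in> borel_measurable borel" by (rule borel_measurable_continuous_onI)
 show "(\<lambda>x. real (Suc n) *\<^sub>R (f (x + (1 / real (Suc n)) *\<^sub>R axis i 1) - f x)) \<in> borel_measurable borel" for n
  by measurable
qed (rule partial_difference_limit[OF d])

text \<open>By translation invariance every difference quotient of \<open>f\<close> has integral 0,
  and these quotients converge to the derivative. The mean value theorem bounds them by the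
  derivative at a point at distance at most 1, which \<open>decay_translate\<close> brings back to
  \<open>x\<close> at the price of 2^a.\<close>

lemma integral_partial:
 fixes f :: "real^'n::finite => complex" and a :: real
 assumes d: "!!x. f differentiable (at x)" and f: "L1 f"
  and a: "a > CARD('n)" and b: "!!x. norm (partial i f x) <= C * decay a x"
 shows "L1 (partial i f)" and "(LBINT x. partial i f x) = 0"
proof -
 have a0: "a >= 0" using a of_nat_0_le_iff[of "CARD('n)"] by linarith
 have C0: "C >= 0" using b[of 0] decay_pos[of a 0] by (smt (verit) mult_neg_pos norm_ge_zero)
 have m: "partial i f \<in> borel_measurable borel" by (rule partial_measurable[OF d])
 show "L1 (partial i f)" by (rule integrable_decay_bound[OF m a b])
 let ?h = "\<lambda>n. (1 / real (Suc n)) *\<^sub>R axis i 1 :: real^'n"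
 let ?q = "\<lambda>n x. real (Suc n) *\<^sub>R (f (x + ?h n) - f x)"
 have tr: "L1 (\<lambda>x. f (x + ?h n))" "(LBINT x. f (x + ?h n)) = (LBINT x. f x)" for n
  using integrable_affine[of 1 f "?h n"] integral_affine[of 1 f "?h n"] f by (simp_all add: add.commute)
 have "(\<lambda>n. LBINT x. ?q n x) \<longlonglongrightarrow> (LBINT x. partial i f x)"
 proof (rule integral_dominated_convergence[where w="\<lambda>x. C * 2 powr a * decay a x"])
  show "partial i f \<in> borel_measurable lborel" using m by simp
  show "?q n \<in> borel_measurable lborel" for n
   using f by (auto intro!: borel_measurable_integrable tr)
  show "L1 (\<lambda>x::real^'n. C * 2 powr a * decay a x)" using integrable_decay[OF a] by simp
  show "AE x in lborel. (\<lambda>n. ?q n x) \<longlonglongrightarrow> partial i f x" using partial_difference_limit[OF d] by auto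
  fix n
  have "norm (?q n x) <= C * 2 powr a * decay a x" for x
  proof -
   have p: "0 < 1 / real (Suc n)" by simp
   obtain s where s: "0 < s" "s < 1 / real (Suc n)"
    "norm (f (x + ?h n) - f x) <= 1 / real (Suc n) * norm (partial i f (x + s *\<^sub>R axis i 1))"
    using partial_difference_bound[OF d p] by blast
   have "1 / real (Suc n) <= 1" by simp
   then have s1: "s <= 1" using s(2) by linarith
   have "norm (?q n x) = real (Suc n) * norm (f (x + ?h n) - f x)" by simp
   also have "... <= real (Suc n) * (1 / real (Suc n) * norm (partial i f (x + s *\<^sub>R axis i 1)))"
    by (intro mult_left_mono s(3)) simp
   also have "... = norm (partial i f (x + s *\<^sub>R axis i 1))" by simp
   also have "... <= C * decay a (x + s *\<^sub>R axis i 1)" by (rule b)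
   also have "... <= C * ((1 + norm (s *\<^sub>R axis i 1 :: real^'n)) powr a * decay a x)"
    by (intro mult_left_mono decay_translate a0 C0)
   also have "... <= C * (2 powr a * decay a x)"
    using s(1) s1 a0 C0 by (intro mult_left_mono mult_right_mono powr_mono2) auto
   finally show ?thesis by (simp add: mult_ac)
  qed
  then show "AE x in lborel. norm (?q n x) <= C * 2 powr a * decay a x" by auto
 qed
 moreover have "(LBINT x. ?q n x) = 0" for n
  using tr[of n] f by simp
 ultimately have "(\<lambda>n::nat. 0) \<longlonglongrightarrow> (LBINT x. partial i f x)" by simp
 from LIMSEQ_unique[OF this tendsto_const] show "(LBINT x. partial i f x) = 0" .
qed

section \<open>The Fourier transform\<close>

lemma norm_integral_le:
 fixes f :: "'a => 'b::{banach, second_countable_topology}"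
 assumes "integrable M f" "integrable M g" "!!x. norm (f x) <= g x"
 shows "norm (integral\<^sup>L M f) <= integral\<^sup>L M g"
 by (rule order_trans[OF integral_norm_bound integral_mono]) (use assms in auto)

lemma cis_measurable [measurable]: "f \<in> borel_measurable M ==> (\<lambda>x. cis (f x)) \<in> borel_measurable M"
 unfolding cis_conv_exp by measurable

lemma cis_mult_integrable:
 fixes f :: "real^'n::finite => complex"
 assumes "L1 f" and [measurable]: "g \<in> borel_measurable borel"
 shows "L1 (\<lambda>x. cis (g x) * f x)"
proof (rule Bochner_Integration.integrable_bound[OF assms(1)])
 show "(\<lambda>x. cis (g x) * f x) \<in> borel_measurable lborel" using assms by measurable
qed (auto simp: norm_mult)

lemma fourier_integrable:
 fixes f :: "real^'n::finite => complex"
 shows "L1 f ==> L1 (\<lambda>x. cis (- (x \<bullet> xi)) * f x)"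
 by (rule cis_mult_integrable) auto

lemma norm_fourier_le:
 fixes f :: "real^'n::finite => complex"
 shows "norm (fourier f xi) <= (LBINT x. norm (f x))"
proof -
 have "norm (fourier f xi) <= (LBINT x. norm (cis (- (x \<bullet> xi)) * f x))"
  unfolding fourier_def by (rule integral_norm_bound)
 then show ?thesis by (simp add: norm_mult)
qed

lemma fourier_add:
 fixes f g :: "real^'n::finite => complex"
 assumes "L1 f" "L1 g"
 shows "fourier (\<lambda>x. f x + g x) = (\<lambda>xi. fourier f xi + fourier g xi)"
 unfolding fourier_def using fourier_integrable[OF assms(1)] fourier_integrable[OF assms(2)]
 by (simp add: distrib_left)

lemma fourier_cmult: "fourier (\<lambda>x. c * f x) = (\<lambda>xi. c * fourier f xi)"
 unfolding fourier_def by (simp add: mult.left_commute)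

lemma fourier_sum:
 fixes f :: "'i => real^'n::finite => complex"
 assumes "!!i. i \<in> I ==> L1 (f i)"
 shows "fourier (\<lambda>x. \<Sum>i\<in>I. f i x) = (\<lambda>xi. \<Sum>i\<in>I. fourier (f i) xi)"
 unfolding fourier_def using fourier_integrable[OF assms]
 by (simp add: sum_distrib_left)

lemma inv_fourier_eq: "inv_fourier f x = fourier f (- x) / of_real ((2 * pi) ^ CARD('n))"
 for f :: "real^'n::finite => complex"
 by (simp add: inv_fourier_def fourier_def inner_commute)

lemma continuous_fourier:
 fixes f :: "real^'n::finite => complex"
 assumes f: "L1 f" shows "continuous_on UNIV (fourier f)"
proof (rule continuous_on_sequentiallyI)
 fix u :: "nat => real^'n" and a assume u: "u \<longlonglongrightarrow> a"
 have [measurable]: "f \<in> borel_measurable borel" using f by auto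
 show "(\<lambda>n. fourier f (u n)) \<longlonglongrightarrow> fourier f a" unfolding fourier_def
 proof (rule integral_dominated_convergence[where w="\<lambda>x. norm (f x)"])
  show "AE x in lborel. (\<lambda>n. cis (- (x \<bullet> u n)) * f x) \<longlonglongrightarrow> cis (- (x \<bullet> a)) * f x"
   using u by (auto intro!: tendsto_intros simp: cis_conv_exp)
 qed (use f in \<open>auto simp: norm_mult\<close>)
qed

lemma fourier_measurable [measurable]:
 fixes f :: "real^'n::finite => complex"
 shows "L1 f ==> fourier f \<in> borel_measurable borel"
 by (intro borel_measurable_continuous_onI continuous_fourier)

lemma norm_cis_taylor: "norm (cis t - 1 - \<i> * of_real t) <= t\<^sup>2"
proof -
 have "norm (iexp t - (\<Sum>k\<le>1. (\<i> * t)^k / fact k)) <= \<bar>t\<bar>^2 / fact 2"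
  using iexp_approx1[of t 1] by (simp add: numeral_2_eq_2)
 then have "norm (cis t - 1 - \<i> * of_real t) <= t\<^sup>2 / 2" by (simp add: cis_conv_exp algebra_simps)
 then show ?thesis by (smt (verit) field_sum_of_halves zero_le_power2)
qed

text \<open>The second moment comes from the quadratic remainder of \<open>cis\<close>: the error of
  the linear approximation is at most |h|^2 times that moment.\<close>

lemma fourier_has_derivative:
 fixes f :: "real^'n::finite => complex"
 assumes [measurable]: "f \<in> borel_measurable borel" and f2: "L1 (\<lambda>x. (1 + norm x)^2 * norm (f x))"
 shows "fourier f differentiable (at xi)"
  and "partial i (fourier f) xi = fourier (\<lambda>x. - \<i> * of_real (x $ i) * f x) xi"
proof -
 have f0: "L1 f"
 proof (rule Bochner_Integration.integrable_bound[OF f2])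
  have "1 <= (1 + norm x)^2" for x :: "real^'n" by (simp add: one_le_power)
  then show "AE x in lborel. norm (f x) <= norm ((1 + norm x)^2 * norm (f x))"
   by (auto simp: norm_mult mult_left_le_one_le intro!: mult_right_mono[of 1 "(1 + norm _)^2", simplified])
 qed auto
 have fi: "L1 (\<lambda>x. - \<i> * of_real (x $ i) * f x)" for i
 proof (rule Bochner_Integration.integrable_bound[OF f2])
  have "\<bar>x $ i\<bar> <= (1 + norm x)^2" for x :: "real^'n"
   using component_le_norm_cart[of x i] by (simp add: power2_eq_square algebra_simps) (smt (verit) mult_nonneg_nonneg norm_ge_zero)
  then show "AE x in lborel. norm (- \<i> * of_real (x $ i) * f x) <= norm ((1 + norm x)^2 * norm (f x))"
   by (auto simp: norm_mult intro!: mult_right_mono)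
 qed auto
 let ?D = "\<lambda>h. \<Sum>i\<in>UNIV. h $ i *\<^sub>R fourier (\<lambda>x. - \<i> * of_real (x $ i) * f x) xi"
 let ?M = "LBINT x. (1 + norm x)^2 * norm (f x)"
 have M0: "?M >= 0" by (intro integral_nonneg_AE) auto
 have D: "?D h = (LBINT x. - \<i> * of_real (x \<bullet> h) * (cis (- (x \<bullet> xi)) * f x))"
  and Di: "L1 (\<lambda>x. - \<i> * of_real (x \<bullet> h) * (cis (- (x \<bullet> xi)) * f x))" for h
 proof -
  have I: "L1 (\<lambda>x. h $ i *\<^sub>R (cis (- (x \<bullet> xi)) * (- \<i> * of_real (x $ i) * f x)))" for i
   by (intro integrable_scaleR_right fourier_integrable fi)
  have e: "(\<Sum>i\<in>UNIV. h $ i *\<^sub>R (cis (- (x \<bullet> xi)) * (- \<i> * of_real (x $ i) * f x))) = - \<i> * of_real (x \<bullet> h) * (cis (- (x \<bullet> xi)) * f x)" for x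
   by (simp add: inner_vec_def sum_distrib_left sum_distrib_right scaleR_conv_of_real mult_ac)
  have "?D h = (LBINT x. (\<Sum>i\<in>UNIV. h $ i *\<^sub>R (cis (- (x \<bullet> xi)) * (- \<i> * of_real (x $ i) * f x))))"
   unfolding fourier_def by (subst Bochner_Integration.integral_sum) (use I in auto)
  then show "?D h = (LBINT x. - \<i> * of_real (x \<bullet> h) * (cis (- (x \<bullet> xi)) * f x))" unfolding e .
  show "L1 (\<lambda>x. - \<i> * of_real (x \<bullet> h) * (cis (- (x \<bullet> xi)) * f x))"
   unfolding e[symmetric] by (intro Bochner_Integration.integrable_sum I)
 qed
 have b: "norm (fourier f (xi + h) - fourier f xi - ?D h) <= (norm h)\<^sup>2 * ?M" for h
 proof -
  have "fourier f (xi + h) - fourier f xi - ?D h = (LBINT x. cis (- (x \<bullet> (xi + h))) * f x - cis (- (x \<bullet> xi)) * f x - - \<i> * of_real (x \<bullet> h) * (cis (- (x \<bullet> xi)) * f x))"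
   unfolding D unfolding fourier_def
   by (simp only: Bochner_Integration.integral_diff[OF fourier_integrable[OF f0] fourier_integrable[OF f0]]
     Bochner_Integration.integral_diff[OF Bochner_Integration.integrable_diff[OF fourier_integrable[OF f0] fourier_integrable[OF f0]] Di[of h]])
  also have "norm ... <= (LBINT x. (norm h)\<^sup>2 * ((1 + norm x)^2 * norm (f x)))"
  proof (rule norm_integral_le)
   show "L1 (\<lambda>x. cis (- (x \<bullet> (xi + h))) * f x - cis (- (x \<bullet> xi)) * f x - - \<i> * of_real (x \<bullet> h) * (cis (- (x \<bullet> xi)) * f x))"
    by (intro Bochner_Integration.integrable_diff fourier_integrable f0 Di)
   show "L1 (\<lambda>x. (norm h)\<^sup>2 * ((1 + norm x)^2 * norm (f x)))" using f2 by simp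
   fix x
   have "cis (- (x \<bullet> (xi + h))) = cis (- (x \<bullet> xi)) * cis (- (x \<bullet> h))" by (simp add: cis_mult inner_add_right)
   then have "cis (- (x \<bullet> (xi + h))) * f x - cis (- (x \<bullet> xi)) * f x - - \<i> * of_real (x \<bullet> h) * (cis (- (x \<bullet> xi)) * f x)
    = (cis (- (x \<bullet> h)) - 1 - \<i> * of_real (- (x \<bullet> h))) * (cis (- (x \<bullet> xi)) * f x)"
    by (simp add: algebra_simps)
   then have "norm (cis (- (x \<bullet> (xi + h))) * f x - cis (- (x \<bullet> xi)) * f x - - \<i> * of_real (x \<bullet> h) * (cis (- (x \<bullet> xi)) * f x))
    <= (x \<bullet> h)\<^sup>2 * norm (f x)"
    using norm_cis_taylor[of "- (x \<bullet> h)"] by (simp add: norm_mult mult_right_mono)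
   also have "(x \<bullet> h)\<^sup>2 <= (norm h)\<^sup>2 * (1 + norm x)\<^sup>2"
   proof -
    have "\<bar>x \<bullet> h\<bar> <= norm h * (1 + norm x)"
     using Cauchy_Schwarz_ineq2[of x h] by (simp add: algebra_simps) (smt (verit) norm_ge_zero)
    then have "\<bar>x \<bullet> h\<bar>\<^sup>2 <= (norm h * (1 + norm x))\<^sup>2" by (intro power_mono) auto
    then show ?thesis by (simp add: power_mult_distrib)
   qed
   finally show "norm (cis (- (x \<bullet> (xi + h))) * f x - cis (- (x \<bullet> xi)) * f x - - \<i> * of_real (x \<bullet> h) * (cis (- (x \<bullet> xi)) * f x))
    <= (norm h)\<^sup>2 * ((1 + norm x)^2 * norm (f x))" by (simp add: mult_right_mono mult.assoc[symmetric])
  qed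
  finally show ?thesis by simp
 qed
 have "(fourier f has_derivative ?D) (at xi)"
  unfolding has_derivative_at
 proof
  show "bounded_linear ?D"
   by (intro bounded_linear_sum bounded_linear_scaleR_const bounded_linear_vec_nth)
  show "(\<lambda>h. norm (fourier f (xi + h) - fourier f xi - ?D h) / norm h) \<midarrow>0\<rightarrow> 0"
  proof (rule Lim_null_comparison)
   show "\<forall>\<^sub>F h in at 0. norm (norm (fourier f (xi + h) - fourier f xi - ?D h) / norm h) <= norm h * ?M"
    unfolding eventually_at using b
    by (intro exI[of _ 1]) (auto simp: divide_le_eq power2_eq_square mult_ac)
   show "((\<lambda>h. norm h * ?M) \<longlongrightarrow> 0) (at (0::real^'n))"
    by (rule tendsto_mult_left_zero[OF tendsto_norm_zero[OF tendsto_ident_at]])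
  qed
 qed
 then show "fourier f differentiable (at xi)" "partial i (fourier f) xi = fourier (\<lambda>x. - \<i> * of_real (x $ i) * f x) xi"
  by (auto simp: differentiable_def partial_eqI axis_def if_distrib[where f="\<lambda>c. c *\<^sub>R _"] cong: if_cong)
qed

lemma partial_cis:
 fixes xi :: "real^'n::finite"
 shows "(\<lambda>x. cis (- (x \<bullet> xi))) differentiable (at x)"
  and "partial i (\<lambda>x. cis (- (x \<bullet> xi))) x = - \<i> * of_real (xi $ i) * cis (- (x \<bullet> xi))"
proof -
 have D: "((\<lambda>x. cis (- (x \<bullet> xi))) has_derivative (\<lambda>h. - (h \<bullet> xi) *\<^sub>R (\<i> * cis (- (x \<bullet> xi))))) (at x)"
 proof -
  have "(cis has_derivative (\<lambda>t. t *\<^sub>R (\<i> * cis (- (x \<bullet> xi))))) (at (- (x \<bullet> xi)))"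
   using has_derivative_compose[OF has_derivative_mult_right[OF has_derivative_of_real[OF has_derivative_ident]] DERIV_exp[unfolded has_field_derivative_def], of "\<i>" "- (x \<bullet> xi)" UNIV]
   unfolding cis_conv_exp by (simp add: scaleR_conv_of_real mult_ac)
  then show ?thesis
   using has_derivative_compose[of "\<lambda>x. - (x \<bullet> xi)" "\<lambda>h. - (h \<bullet> xi)" x UNIV cis] by (auto intro!: derivative_eq_intros)
 qed
 show "(\<lambda>x. cis (- (x \<bullet> xi))) differentiable (at x)" using D by (auto simp: differentiable_def)
 show "partial i (\<lambda>x. cis (- (x \<bullet> xi))) x = - \<i> * of_real (xi $ i) * cis (- (x \<bullet> xi))"
  by (simp add: partial_eqI[OF D] inner_axis' scaleR_conv_of_real)
qed

text \<open>\<open>integral_partial\<close> is applied to the product of \<open>f\<close> with the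
  character; the two terms of the product rule integrate to the two sides.\<close>

lemma fourier_partial:
 fixes f :: "real^'n::finite => complex" and a :: real
 assumes d: "!!x. f differentiable (at x)" and a: "a > CARD('n)"
  and b0: "!!x. norm (f x) <= C * decay a x" and b: "!!x. norm (partial i f x) <= C * decay a x"
 shows "fourier (partial i f) xi = \<i> * of_real (xi $ i) * fourier f xi"
proof -
 have "continuous_on UNIV f" using d differentiable_imp_continuous_within continuous_at_imp_continuous_on by blast
 then have [measurable]: "f \<in> borel_measurable borel" by (rule borel_measurable_continuous_onI)
 have f: "L1 f" by (rule integrable_decay_bound[OF _ a b0]) auto
 have p: "L1 (partial i f)" by (rule integrable_decay_bound[OF partial_measurable[OF d] a b])
 let ?g = "\<lambda>x. cis (- (x \<bullet> xi)) * f x"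
 have pg: "partial i ?g x = - \<i> * of_real (xi $ i) * (cis (- (x \<bullet> xi)) * f x) + cis (- (x \<bullet> xi)) * partial i f x" for x
  by (subst partial_mult[OF partial_cis(1) d]) (simp add: partial_cis(2))
 have "(LBINT x. partial i ?g x) = 0"
 proof (rule integral_partial(2)[where C="(\<bar>xi $ i\<bar> + 1) * C"])
  show "?g differentiable (at x)" for x by (intro differentiable_mult partial_cis(1) d)
  show "L1 ?g" by (rule fourier_integrable[OF f])
  fix x
  have "norm (partial i ?g x) <= \<bar>xi $ i\<bar> * norm (f x) + norm (partial i f x)"
   unfolding pg by (rule order_trans[OF norm_triangle_ineq]) (simp add: norm_mult)
  also have "... <= \<bar>xi $ i\<bar> * (C * decay a x) + C * decay a x"
   by (intro add_mono mult_left_mono b0 b) auto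
  finally show "norm (partial i ?g x) <= (\<bar>xi $ i\<bar> + 1) * C * decay a x" by (simp add: algebra_simps)
 qed (rule a)
 also have "(LBINT x. partial i ?g x) = - \<i> * of_real (xi $ i) * fourier f xi + fourier (partial i f) xi"
  unfolding pg fourier_def using fourier_integrable[OF f, of xi] fourier_integrable[OF p, of xi] by simp
 finally show ?thesis by (simp add: algebra_simps)
qed

lemma fourier_partial_schwartz:
 fixes f :: "real^'n::finite => complex"
 assumes "schwartz f"
 shows "fourier (partial i f) xi = \<i> * of_real (xi $ i) * fourier f xi"
proof -
 let ?a = "real (CARD('n) + 1)"
 obtain C1 where C1: "C1 >= 0" "!!x. norm (f x) <= C1 * decay ?a x"
  using rapid_decay[OF schwartz_rapid[OF assms]] by blast
 obtain C2 where C2: "C2 >= 0" "!!x. norm (partial i f x) <= C2 * decay ?a x"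
  using rapid_decay[OF schwartz_rapid[OF schwartz_partial[OF assms]]] by blast
 have le: "C1 * decay ?a x <= (C1 + C2) * decay ?a x" "C2 * decay ?a x <= (C1 + C2) * decay ?a x" for x :: "real^'n"
  using C1(1) C2(1) by (auto intro!: mult_right_mono)
 show ?thesis
 proof (rule fourier_partial[where a="?a" and C="C1 + C2"])
  show "norm (f x) <= (C1 + C2) * decay ?a x" for x by (rule order_trans[OF C1(2) le(1)])
  show "norm (partial i f x) <= (C1 + C2) * decay ?a x" for x by (rule order_trans[OF C2(2) le(2)])
 qed (auto intro: smooth_on_differentiable[OF schwartz_smooth[OF assms]])
qed

subsection \<open>Inversion\<close>

definition gauss :: "real^'n::finite => complex" where
 "gauss x = of_real (exp (- (norm x)\<^sup>2 / 2))"

lemma norm_gauss: "norm (gauss x) = exp (- (norm x)\<^sup>2 / 2)"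
 by (simp add: gauss_def)

lemma rapid_gauss: "rapid gauss"
 unfolding rapid_def
proof
 fix k :: nat
 have e: "r ^ k <= fact k * exp r" if "r >= 0" for r :: real
 proof -
  have "(\<Sum>n\<in>{k}. r ^ n /\<^sub>R fact n) <= exp r"
   unfolding exp_def using that by (intro sum_le_suminf summable_exp_generic) auto
  then show ?thesis by (simp add: field_simps)
 qed
 have "(1 + norm x) ^ k * norm (gauss x) <= fact k * exp 2" for x :: "real^'n"
 proof -
  have "(1 + norm x) ^ k * norm (gauss x) <= fact k * exp (1 + norm x) * exp (- (norm x)\<^sup>2 / 2)"
   unfolding norm_gauss by (intro mult_right_mono e) auto
  also have "... = fact k * exp (1 + norm x - (norm x)\<^sup>2 / 2)" by (simp add: exp_add[symmetric])
  also have "... <= fact k * exp 2"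
   using zero_le_power2[of "norm x - 1"] by (intro mult_left_mono) (auto simp: power2_diff)
  finally show ?thesis .
 qed
 then show "\<exists>C. \<forall>x. (1 + norm x) ^ k * norm (gauss x :: complex) <= C" by blast
qed

lemma has_derivative_gauss: "(gauss has_derivative (\<lambda>h. of_real (- (x \<bullet> h) * exp (- (norm x)\<^sup>2 / 2)))) (at x)"
 unfolding gauss_def[abs_def] dot_square_norm[symmetric]
 by (intro has_derivative_of_real) (auto intro!: derivative_eq_intros simp: inner_commute)

lemma partial_gauss: "partial i gauss x = - of_real (x $ i) * gauss x"
 by (simp add: partial_eqI[OF has_derivative_gauss] inner_axis gauss_def)

lemma gauss_differentiable: "gauss differentiable (at x)"
 using has_derivative_gauss by (auto simp: differentiable_def)

lemma gauss_measurable [measurable]: "gauss \<in> borel_measurable borel"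
 unfolding gauss_def[abs_def] by measurable

lemma gauss_integrable: "L1 gauss"
 by (rule rapid_integrable[OF rapid_gauss gauss_measurable])

lemma rapid_coord_mult: "rapid f ==> rapid (\<lambda>x. of_real (x $ i) * f x)"
 by (rule rapid_slow) auto

lemma integral_gauss: "(LBINT x. gauss (x::real^'n::finite)) = of_real (sqrt (2 * pi) ^ CARD('n))"
proof -
 have 1: "(\<integral>\<^sup>+t. ennreal (exp (- t\<^sup>2 / 2)) \<partial>lborel) = ennreal (sqrt (2 * pi))"
 proof -
  have "has_bochner_integral lborel (\<lambda>t::real. exp (- t\<^sup>2 / 2)) (sqrt (2 * pi))"
  proof -
   have "has_bochner_integral lborel (\<lambda>x. std_normal_density x) 1"
    using integral_normal_moment_even[of "1::real" 0 0] std_normal_moment_even[of 0] by simp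
   then have "has_bochner_integral lborel (\<lambda>x. sqrt (2 * pi) * std_normal_density x) (sqrt (2 * pi) * 1)"
    by (rule has_bochner_integral_mult_right)
   then show ?thesis by (simp add: std_normal_density_def)
  qed
  then show ?thesis
   by (subst nn_integral_eq_integral) (auto simp: has_bochner_integral_iff)
 qed
 have "(\<integral>\<^sup>+x. ennreal (exp (- (norm (x::real^'n))\<^sup>2 / 2)) \<partial>lborel) = (\<integral>\<^sup>+x. (\<Prod>b\<in>Basis. ennreal (exp (- ((x::real^'n) \<bullet> b)\<^sup>2 / 2))) \<partial>lborel)"
 proof (rule nn_integral_cong)
  fix x :: "real^'n"
  have "(norm x)\<^sup>2 = (\<Sum>b\<in>Basis. (x \<bullet> b)\<^sup>2)"
   unfolding dot_square_norm[symmetric] by (subst euclidean_inner) (simp add: power2_eq_square)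
  then show "ennreal (exp (- (norm x)\<^sup>2 / 2)) = (\<Prod>b\<in>Basis. ennreal (exp (- (x \<bullet> b)\<^sup>2 / 2)))"
   by (simp add: prod_ennreal exp_sum[symmetric] sum_negf sum_divide_distrib)
 qed
 also have "... = (\<Prod>b\<in>(Basis::(real^'n) set). ennreal (sqrt (2 * pi)))"
  by (subst nn_integral_lborel_prod) (auto simp: 1[simplified])
 also have "... = ennreal (sqrt (2 * pi) ^ CARD('n))" by (simp add: ennreal_power)
 finally have "has_bochner_integral lborel (\<lambda>x::real^'n. exp (- (norm x)\<^sup>2 / 2)) (sqrt (2 * pi) ^ CARD('n))"
  by (intro has_bochner_integral_nn_integral) auto
 then show ?thesis unfolding gauss_def
  by (subst integral_complex_of_real) (simp add: has_bochner_integral_iff)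
qed

text \<open>The transform exchanges differentiation and multiplication by coordinates, so the
  transform of the Gaussian satisfies the same first-order system as the Gaussian. The quotient of
  the two has derivative zero, and its value at 0 is the Gaussian integral.\<close>

lemma fourier_gauss:
 fixes xi :: "real^'n::finite"
 shows "fourier gauss xi = of_real (sqrt (2 * pi) ^ CARD('n)) * gauss xi"
proof -
 let ?a = "real (CARD('n) + 1)"
 have 2: "L1 (\<lambda>x::real^'n. (1 + norm x)^2 * norm (gauss x))"
 proof -
  obtain C where C: "C >= 0" "!!x::real^'n. norm (gauss x) <= C * decay (real (CARD('n) + 3)) x"
   using rapid_decay[OF rapid_gauss] by blast
  have "norm ((1 + norm x)^2 * norm (gauss x)) <= C * decay ?a x" for x :: "real^'n"
  proof -
   have "norm ((1 + norm x)^2 * norm (gauss x)) <= (1 + norm x)^2 * (C * decay (real (CARD('n) + 3)) x)"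
    using C(2)[of x] by (simp add: abs_mult)
   also have "... = C * decay ?a x"
   proof -
    have "(1 + norm x) ^ (CARD('n) + 3) = (1 + norm x)^2 * (1 + norm x) ^ (CARD('n) + 1)"
     by (simp add: eval_nat_numeral)
    moreover have "(1 + norm x)^2 \<noteq> 0" by simp
    ultimately show ?thesis unfolding decay_power by (simp del: power_Suc power_eq_0_iff)
   qed
   finally show ?thesis .
  qed
  then show ?thesis by (intro integrable_decay_bound[where a="?a" and C=C]) auto
 qed
 obtain C1 where C1: "C1 >= 0" "!!x::real^'n. norm (gauss x) <= C1 * decay ?a x"
  using rapid_decay[OF rapid_gauss] by blast
 have p: "partial i (fourier gauss) xi = - of_real (xi $ i) * fourier gauss xi" for i and xi :: "real^'n"
 proof -
  obtain C2 where C2: "C2 >= 0" "!!x::real^'n. norm (of_real (x $ i) * gauss x) <= C2 * decay ?a x"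
   using rapid_decay[OF rapid_coord_mult[OF rapid_gauss]] by blast
  have le: "C1 * decay ?a x <= (C1 + C2) * decay ?a x" "C2 * decay ?a x <= (C1 + C2) * decay ?a x" for x :: "real^'n"
   using C1(1) C2(1) by (auto intro!: mult_right_mono)
  have "partial i (fourier gauss) xi = fourier (\<lambda>x. - \<i> * of_real (x $ i) * gauss x) xi"
   by (rule fourier_has_derivative(2)[OF _ 2]) simp
  also have "(\<lambda>x. - \<i> * of_real (x $ i) * gauss x) = (\<lambda>x. \<i> * partial i gauss x)" by (simp add: partial_gauss mult.assoc)
  also have "fourier ... xi = \<i> * fourier (partial i gauss) xi" by (simp add: fourier_cmult)
  also have "fourier (partial i gauss) xi = \<i> * of_real (xi $ i) * fourier gauss xi"
  proof (rule fourier_partial[where a="?a" and C="C1 + C2"])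
   show "norm (gauss x) <= (C1 + C2) * decay ?a x" for x :: "real^'n" using C1(2)[of x] le(1)[of x] by linarith
   show "norm (partial i gauss x) <= (C1 + C2) * decay ?a x" for x :: "real^'n"
    using order_trans[OF C2(2)[of x] le(2)[of x]] by (simp add: partial_gauss norm_mult)
  qed (auto simp: gauss_differentiable)
  finally show ?thesis by (simp add: mult.assoc[symmetric])
 qed
 let ?H = "\<lambda>xi::real^'n. fourier gauss xi * of_real (exp ((norm xi)\<^sup>2 / 2))"
 have "(?H has_derivative (\<lambda>h. 0)) (at xi)" for xi :: "real^'n"
 proof -
  have d: "fourier gauss differentiable (at xi)" by (rule fourier_has_derivative(1)[OF _ 2]) simp
  have e: "((\<lambda>xi::real^'n. complex_of_real (exp ((norm xi)\<^sup>2 / 2))) has_derivative (\<lambda>h. of_real ((xi \<bullet> h) * exp ((norm xi)\<^sup>2 / 2)))) (at xi)"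
   unfolding dot_square_norm[symmetric]
   by (intro has_derivative_of_real) (auto intro!: derivative_eq_intros simp: inner_commute)
  have "(\<Sum>i\<in>UNIV. h $ i *\<^sub>R partial i (fourier gauss) xi) = - of_real (xi \<bullet> h) * fourier gauss xi" for h
   by (simp add: p inner_vec_def sum_distrib_right sum_distrib_left sum_negf scaleR_conv_of_real mult_ac)
  with has_derivative_mult[OF has_derivative_partial[OF d] e] show ?thesis by (simp add: algebra_simps)
 qed
 then obtain c where c: "!!xi. ?H xi = c"
  using has_derivative_zero_constant[of UNIV ?H] by (metis UNIV_I convex_UNIV has_derivative_at_withinI)
 have "c = of_real (sqrt (2 * pi) ^ CARD('n))"
  using c[of 0] integral_gauss[where 'n='n] by (simp add: fourier_def)
 moreover have "fourier gauss xi = c * gauss xi"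
  using c[of xi] by (simp add: gauss_def exp_minus field_simps)
 ultimately show ?thesis by simp
qed

lemma integrable_pairI:
 fixes F :: "'a::euclidean_space \<times> 'b::euclidean_space => 'c::{banach, second_countable_topology}"
 assumes [measurable]: "F \<in> borel_measurable (lborel \<Otimes>\<^sub>M lborel)"
  and "(\<integral>\<^sup>+x. \<integral>\<^sup>+y. ennreal (norm (F (x, y))) \<partial>lborel \<partial>lborel) < \<infinity>"
 shows "integrable (lborel \<Otimes>\<^sub>M lborel) F"
proof (rule integrableI_bounded)
 have "(\<integral>\<^sup>+z. ennreal (norm (F z)) \<partial>(lborel \<Otimes>\<^sub>M lborel)) = (\<integral>\<^sup>+x. \<integral>\<^sup>+y. ennreal (norm (F (x, y))) \<partial>lborel \<partial>lborel)"
  by (rule lborel.nn_integral_fst[symmetric]) measurable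
 then show "(\<integral>\<^sup>+z. ennreal (norm (F z)) \<partial>(lborel \<Otimes>\<^sub>M lborel)) < \<infinity>" using assms(2) by simp
qed measurable

lemma integrable_pair_bound:
 fixes F :: "'a::euclidean_space \<times> 'b::euclidean_space => 'c::{banach, second_countable_topology}"
 assumes "F \<in> borel_measurable (lborel \<Otimes>\<^sub>M lborel)" and f: "L1 f" and g: "L1 g"
  and b: "!!x y. norm (F (x, y)) <= norm (f x :: complex) * norm (g y :: complex)"
 shows "integrable (lborel \<Otimes>\<^sub>M lborel) F"
proof (rule integrable_pairI[OF assms(1)])
 have [measurable]: "f \<in> borel_measurable borel" "g \<in> borel_measurable borel" using f g by auto
 have "(\<integral>\<^sup>+x. \<integral>\<^sup>+y. ennreal (norm (F (x, y))) \<partial>lborel \<partial>lborel) <= (\<integral>\<^sup>+x. \<integral>\<^sup>+y. ennreal (norm (f x)) * ennreal (norm (g y)) \<partial>lborel \<partial>lborel)"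
  using b by (intro nn_integral_mono) (simp add: ennreal_mult[symmetric])
 also have "... = (\<integral>\<^sup>+x. ennreal (norm (f x)) \<partial>lborel) * (\<integral>\<^sup>+y. ennreal (norm (g y)) \<partial>lborel)"
  by (simp add: nn_integral_cmult nn_integral_multc)
 also have "... < \<infinity>"
 proof -
  have "(\<integral>\<^sup>+x. ennreal (norm (f x)) \<partial>lborel) < \<infinity>" "(\<integral>\<^sup>+y. ennreal (norm (g y)) \<partial>lborel) < \<infinity>"
   using f g by (simp_all add: integrable_iff_bounded)
  then show ?thesis by (simp add: ennreal_mult_less_top)
 qed
 finally show "(\<integral>\<^sup>+x. \<integral>\<^sup>+y. ennreal (norm (F (x, y))) \<partial>lborel \<partial>lborel) < \<infinity>" .
qed

text \<open>The inverse integral is regularised by gauss(e xi). Fubini and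
  \<open>fourier_gauss\<close> turn it into an average of b(x + e z) under the Gaussian. Both sides
  converge as e tends to 0, dominated by the integrable transform and by the bound
  \<open>B\<close>.\<close>

theorem fourier_inversion:
 fixes b :: "real^'n::finite => complex"
 assumes c: "continuous_on UNIV b" and B: "!!x. norm (b x) <= B"
  and b: "L1 b" and fb: "L1 (fourier b)"
 shows "inv_fourier (fourier b) x = b x"
proof -
 let ?e = "\<lambda>n. 1 / real (Suc n)"
 let ?c = "complex_of_real (sqrt (2 * pi) ^ CARD('n))"
 have [measurable]: "b \<in> borel_measurable borel" "fourier b \<in> borel_measurable borel" using b fb by auto
 have e0: "?e n > 0" for n by simp
 have elim: "?e \<longlonglongrightarrow> 0" using LIMSEQ_inverse_real_of_nat by (simp add: inverse_eq_divide)
 have gc: "continuous_on UNIV (gauss :: real^'n => complex)"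
  using gauss_differentiable differentiable_imp_continuous_within continuous_at_imp_continuous_on by blast
 have g1: "norm (gauss x) <= 1" for x :: "real^'n" by (simp add: norm_gauss)
 have gi: "L1 (\<lambda>xi::real^'n. gauss (?e n *\<^sub>R xi))" for n
  using integrable_affine[of "?e n" gauss 0] gauss_integrable e0[of n] by simp
 let ?L = "\<lambda>n. LBINT xi. cis (x \<bullet> xi) * fourier b xi * gauss (?e n *\<^sub>R xi)"
 have "?L n = ?c * (LBINT z. b (x + ?e n *\<^sub>R z) * gauss z)" for n
 proof -
  let ?F = "\<lambda>xi y. cis (x \<bullet> xi) * (cis (- (y \<bullet> xi)) * b y) * gauss (?e n *\<^sub>R xi)"
  have int: "integrable (lborel \<Otimes>\<^sub>M lborel) (\<lambda>(xi, y). ?F xi y)"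
  proof (rule integrable_pair_bound[OF _ gi[of n] b])
   show "(\<lambda>(xi, y). ?F xi y) \<in> borel_measurable (lborel \<Otimes>\<^sub>M lborel)" by measurable
  qed (auto simp: norm_mult)
  have "?L n = (LBINT xi. (LBINT y. ?F xi y))"
   unfolding fourier_def by simp
  also have "... = (LBINT y. (LBINT xi. ?F xi y))"
   by (rule lborel_pair.Fubini_integral[OF int, symmetric])
  also have "... = (LBINT y. b y * ((1 / ?e n ^ CARD('n)) *\<^sub>R (?c * gauss ((1 / ?e n) *\<^sub>R (y - x)))))"
  proof (rule Bochner_Integration.integral_cong[OF refl])
   fix y
   have "(LBINT xi. ?F xi y) = (LBINT xi. b y * (cis (- (0 + ?e n *\<^sub>R xi) \<bullet> ((1 / ?e n) *\<^sub>R (y - x))) * gauss (0 + ?e n *\<^sub>R xi)))"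
   proof (rule Bochner_Integration.integral_cong[OF refl])
    fix xi
    have "cis (x \<bullet> xi) * cis (- (y \<bullet> xi)) = cis (- (0 + ?e n *\<^sub>R xi) \<bullet> ((1 / ?e n) *\<^sub>R (y - x)))"
     using e0[of n] by (simp add: cis_mult inner_diff_right inner_commute del: of_nat_Suc)
    then show "?F xi y = b y * (cis (- (0 + ?e n *\<^sub>R xi) \<bullet> ((1 / ?e n) *\<^sub>R (y - x))) * gauss (0 + ?e n *\<^sub>R xi))"
     by (simp only: add_0_left mult_ac)
   qed
   also have "... = b y * (LBINT xi. (cis (- ((0 + ?e n *\<^sub>R xi) \<bullet> ((1 / ?e n) *\<^sub>R (y - x)))) * gauss (0 + ?e n *\<^sub>R xi)))"
    by (simp only: inner_minus_left integral_mult_right_zero)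
   also have "(LBINT xi. (cis (- ((0 + ?e n *\<^sub>R xi) \<bullet> ((1 / ?e n) *\<^sub>R (y - x)))) * gauss (0 + ?e n *\<^sub>R xi)))
     = (1 / \<bar>?e n\<bar> ^ CARD('n)) *\<^sub>R (LBINT et. cis (- (et \<bullet> ((1 / ?e n) *\<^sub>R (y - x)))) * gauss et)"
    using e0[of n] by (intro integral_affine fourier_integrable gauss_integrable) auto
   also have "(LBINT et. cis (- (et \<bullet> ((1 / ?e n) *\<^sub>R (y - x)))) * gauss et) = ?c * gauss ((1 / ?e n) *\<^sub>R (y - x))"
    using fourier_gauss[of "(1 / ?e n) *\<^sub>R (y - x)"] by (simp only: fourier_def)
   finally show "(LBINT xi. ?F xi y) = b y * ((1 / ?e n ^ CARD('n)) *\<^sub>R (?c * gauss ((1 / ?e n) *\<^sub>R (y - x))))" by simp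
  qed
  also have "... = (1 / ?e n ^ CARD('n)) *\<^sub>R (LBINT y. ?c * (b y * gauss ((1 / ?e n) *\<^sub>R (y - x))))"
   by (subst integral_scaleR_right[symmetric]) (simp only: scaleR_conv_of_real mult_ac)
  also have "... = (LBINT z. ?c * (b (x + ?e n *\<^sub>R z) * gauss ((1 / ?e n) *\<^sub>R (x + ?e n *\<^sub>R z - x))))"
  proof (subst integral_affine[where f="\<lambda>y. ?c * (b y * gauss ((1 / ?e n) *\<^sub>R (y - x)))" and c="?e n" and t=x])
   show "L1 (\<lambda>y. ?c * (b y * gauss ((1 / ?e n) *\<^sub>R (y - x))))"
   proof (rule Bochner_Integration.integrable_bound[OF integrable_mult_right[OF b, of ?c]])
    show "AE y in lborel. norm (?c * (b y * gauss ((1 / ?e n) *\<^sub>R (y - x)))) <= norm (?c * b y)"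
     using g1 by (auto simp: norm_mult intro!: mult_left_mono mult_left_le)
   qed measurable
  qed (use e0[of n] in auto)
  also have "... = ?c * (LBINT z. b (x + ?e n *\<^sub>R z) * gauss z)"
   using e0[of n] by (simp del: of_nat_Suc)
  finally show ?thesis .
 qed
 moreover have "?L \<longlonglongrightarrow> (LBINT xi. cis (x \<bullet> xi) * fourier b xi * gauss (0 *\<^sub>R xi))"
 proof (rule integral_dominated_convergence[where w="\<lambda>xi. norm (fourier b xi)"])
  show "AE xi in lborel. (\<lambda>n. cis (x \<bullet> xi) * fourier b xi * gauss (?e n *\<^sub>R xi)) \<longlonglongrightarrow> cis (x \<bullet> xi) * fourier b xi * gauss (0 *\<^sub>R xi)"
   by (intro AE_I2 tendsto_mult tendsto_const continuous_on_tendsto_compose[OF gc] tendsto_scaleR elim) auto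
  show "AE xi in lborel. norm (cis (x \<bullet> xi) * fourier b xi * gauss (?e n *\<^sub>R xi)) <= norm (fourier b xi)" for n
   using g1 by (auto simp: norm_mult intro!: mult_left_le)
 qed (use fb in auto)
 moreover have "(\<lambda>n. ?c * (LBINT z. b (x + ?e n *\<^sub>R z) * gauss z)) \<longlonglongrightarrow> ?c * (LBINT z. b (x + 0 *\<^sub>R z) * gauss z)"
 proof (intro tendsto_mult tendsto_const integral_dominated_convergence[where w="\<lambda>z. B * norm (gauss z)"])
  show "AE z in lborel. (\<lambda>n. b (x + ?e n *\<^sub>R z) * gauss z) \<longlonglongrightarrow> b (x + 0 *\<^sub>R z) * gauss z"
   by (intro AE_I2 tendsto_mult tendsto_const continuous_on_tendsto_compose[OF c] tendsto_add tendsto_scaleR elim) auto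
  show "AE z in lborel. norm (b (x + ?e n *\<^sub>R z) * gauss z) <= B * norm (gauss z)" for n
   using B by (auto simp: norm_mult intro!: mult_right_mono)
  show "L1 (\<lambda>z::real^'n. B * norm (gauss z))" using integrable_norm[OF gauss_integrable] by (intro integrable_mult_right)
 qed auto
 ultimately have "(LBINT xi. cis (x \<bullet> xi) * fourier b xi * gauss (0 *\<^sub>R xi)) = ?c * (LBINT z. b (x + 0 *\<^sub>R z) * gauss z)"
  by (simp only: LIMSEQ_unique)
 then have "(LBINT xi. cis (x \<bullet> xi) * fourier b xi) = ?c * (b x * ?c)"
  by (simp add: gauss_def[of 0] integral_gauss)
 also have "... = of_real ((2 * pi) ^ CARD('n)) * b x"
 proof -
  have "sqrt (2 * pi) ^ CARD('n) * sqrt (2 * pi) ^ CARD('n) = (2 * pi) ^ CARD('n)"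
   by (subst power_mult_distrib[symmetric]) simp
  then have "?c * ?c = of_real ((2 * pi) ^ CARD('n))" by (simp only: of_real_mult[symmetric])
  moreover have "?c * (b x * ?c) = (?c * ?c) * b x" by (simp only: mult_ac)
  ultimately show ?thesis by simp
 qed
 finally show ?thesis unfolding inv_fourier_def by simp
qed

corollary fourier_inv_fourier:
 fixes b :: "real^'n::finite => complex"
 assumes "continuous_on UNIV b" "!!x. norm (b x) <= B" "L1 b" "L1 (fourier b)"
 shows "fourier (inv_fourier b) x = b x"
proof -
 have "fourier (inv_fourier b) x = (LBINT y. (\<lambda>xi. cis (x \<bullet> xi) * fourier b xi / of_real ((2 * pi) ^ CARD('n))) (0 + (-1) *\<^sub>R y))"
  unfolding fourier_def[of "inv_fourier b"] inv_fourier_eq by (simp add: inner_commute)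
 also have "... = (LBINT xi. cis (x \<bullet> xi) * fourier b xi / of_real ((2 * pi) ^ CARD('n)))"
  by (subst integral_affine) (use assms(4) in \<open>auto intro!: integrable_divide cis_mult_integrable\<close>)
 also have "... = inv_fourier (fourier b) x" by (simp add: inv_fourier_def)
 also have "... = b x" by (rule fourier_inversion[OF assms])
 finally show ?thesis .
qed

text \<open>\<open>multiplier\<close> evaluates a distribution at functions of this form; here they
  become integrals against the kernel F^(-1) a, so that estimates on kernels apply.\<close>

lemma fourier_mult_inv_fourier:
 fixes a ph :: "real^'n::finite => complex"
 assumes a: "L1 a" and ph: "L1 ph"
 shows "fourier (a \<odot> inv_fourier ph) x = (LBINT y. inv_fourier a (y - x) * ph y)"
proof -
 let ?k = "complex_of_real ((2 * pi) ^ CARD('n))"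
 let ?F = "\<lambda>xi y. cis (- (xi \<bullet> x)) * a xi * (cis (xi \<bullet> y) * ph y) / ?k"
 have [measurable]: "a \<in> borel_measurable borel" "ph \<in> borel_measurable borel" using a ph by auto
 have int: "integrable (lborel \<Otimes>\<^sub>M lborel) (\<lambda>(xi, y). ?F xi y)"
 proof (rule integrable_pair_bound[OF _ a integrable_divide[OF ph, of ?k]])
  show "(\<lambda>(xi, y). ?F xi y) \<in> borel_measurable (lborel \<Otimes>\<^sub>M lborel)" by measurable
 qed (auto simp: norm_mult norm_divide)
 have "fourier (a \<odot> inv_fourier ph) x = (LBINT xi. (LBINT y. ?F xi y))"
  unfolding fourier_def inv_fourier_def
  by (intro Bochner_Integration.integral_cong refl) (simp add: mult.assoc)
 also have "... = (LBINT y. (LBINT xi. ?F xi y))"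
  by (rule lborel_pair.Fubini_integral[OF int, symmetric])
 also have "... = (LBINT y. inv_fourier a (y - x) * ph y)"
 proof (rule Bochner_Integration.integral_cong[OF refl])
  fix y
  have "?F xi y = cis ((y - x) \<bullet> xi) * a xi * (ph y / ?k)" for xi
  proof -
   have "cis ((y - x) \<bullet> xi) = cis (- (xi \<bullet> x)) * cis (xi \<bullet> y)" by (simp add: cis_mult inner_diff_left inner_commute[of xi])
   then show ?thesis by (simp add: mult_ac)
  qed
  then show "(LBINT xi. ?F xi y) = inv_fourier a (y - x) * ph y"
   by (simp only: integral_mult_left_zero) (simp add: inv_fourier_def)
 qed
 finally show ?thesis .
qed

subsection \<open>The Fourier transform on Schwartz functions\<close>

lemma schwartz_moment_integrable:
 fixes ph :: "real^'n::finite => complex"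
 assumes "schwartz ph" shows "L1 (\<lambda>x. (1 + norm x)^2 * norm (ph x))"
proof -
 have [measurable]: "ph \<in> borel_measurable borel" using assms by (rule schwartz_measurable)
 have "rapid (\<lambda>x. of_real ((1 + norm x)^2) * ph x)"
 proof (rule rapid_slow[OF _ schwartz_rapid[OF assms]])
  show "slow (\<lambda>x::real^'n. complex_of_real ((1 + norm x)^2))"
   unfolding slow_def norm_of_real by (intro exI[of _ 2] exI[of _ 1]) auto
 qed
 then have "L1 (\<lambda>x. of_real ((1 + norm x)^2) * ph x)" by (rule rapid_integrable) measurable
 from integrable_norm[OF this] show ?thesis by (simp only: norm_mult norm_of_real abs_of_nonneg zero_le_power2)
qed

lemma fourier_schwartz_differentiable: "schwartz ph ==> fourier ph differentiable (at xi)"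
 by (rule fourier_has_derivative(1)) (auto intro: schwartz_measurable schwartz_moment_integrable)

lemma partial_fourier_schwartz:
 "schwartz ph ==> partial i (fourier ph) = fourier (\<lambda>x. - \<i> * (of_real (x $ i) * ph x))"
 by (rule ext, subst fourier_has_derivative(2))
  (auto intro: schwartz_measurable schwartz_moment_integrable simp: mult.assoc)

lemma schwartz_norm_cmult:
 fixes ph :: "real^'n::finite => complex"
 assumes "schwartz ph" shows "schwartz_norm k (\<lambda>x. c * ph x) <= norm c * schwartz_norm k ph"
proof (rule schwartz_norm_le)
 fix "is" :: "'n list" and x assume "length is <= k"
 then show "(1 + norm x) ^ k * norm (iter_partial is (\<lambda>x. c * ph x) x) <= norm c * schwartz_norm k ph"
  using mult_left_mono[OF schwartz_norm_ge[OF assms, of "is" k x], of "norm c"]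
  by (simp add: iter_partial_cmult[OF schwartz_smooth[OF assms]] norm_mult mult_ac)
qed

text \<open>One factor 1 + |xi| is at most 1 plus the sum of the |xi_i|, and each xi_i turns into a
  derivative of \<open>ph\<close>. The constant is uniform in \<open>ph\<close>, as the transform of
  a tempered distribution requires.\<close>

lemma fourier_schwartz_bound:
 "\<exists>C m. C >= 0 \<and> (\<forall>ph :: real^'n::finite => complex. \<forall>xi. schwartz ph --> (1 + norm xi) ^ l * norm (fourier ph xi) <= C * schwartz_norm m ph)"
proof (induction l)
 case 0
 let ?m = "CARD('n) + 1"
 let ?I = "LBINT x. decay (real ?m) (x :: real^'n)"
 have "norm (fourier ph xi) <= ?I * schwartz_norm ?m ph" if s: "schwartz ph" for ph :: "real^'n => complex" and xi
 proof -
  have pw: "norm (ph x) <= decay (real ?m) x * schwartz_norm ?m ph" for x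
  proof -
   have "(1 + norm x) ^ ?m > 0" by simp
   then show ?thesis using schwartz_norm_ge[OF s, of "[]" ?m x] unfolding decay_power
    by (simp add: pos_le_divide_eq mult.commute del: power_Suc)
  qed
  have "(LBINT x. norm (ph x)) <= (LBINT x. decay (real ?m) (x :: real^'n) * schwartz_norm ?m ph)"
   by (intro integral_mono integrable_norm[OF schwartz_integrable[OF s]] integrable_mult_left[OF integrable_decay] pw) simp
  then show ?thesis using norm_fourier_le[of ph xi] by simp
 qed
 moreover have "?I >= 0" by (intro integral_nonneg_AE) auto
 ultimately show ?case by (auto intro!: exI[of _ ?I] exI[of _ ?m])
next
 case (Suc l)
 then obtain C m where C: "C >= 0" "!!(ph :: real^'n => complex) xi. schwartz ph ==> (1 + norm xi) ^ l * norm (fourier ph xi) <= C * schwartz_norm m ph" by blast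
 have "(1 + norm xi) ^ Suc l * norm (fourier ph xi) <= (C * (1 + real CARD('n))) * schwartz_norm (Suc m) ph"
  if s: "schwartz ph" for ph :: "real^'n => complex" and xi
 proof -
  have "norm xi <= (\<Sum>i\<in>UNIV. \<bar>xi $ i\<bar>)" by (rule norm_le_l1_cart)
  then have "(1 + norm xi) ^ Suc l * norm (fourier ph xi) <= (1 + norm xi) ^ l * ((1 + (\<Sum>i\<in>UNIV. \<bar>xi $ i\<bar>)) * norm (fourier ph xi))"
   by (simp add: mult.assoc mult.left_commute[of "1 + norm xi"] mult_left_mono mult_right_mono)
  also have "... = (1 + norm xi) ^ l * norm (fourier ph xi) + (\<Sum>i\<in>UNIV. (1 + norm xi) ^ l * norm (fourier (partial i ph) xi))"
   unfolding fourier_partial_schwartz[OF s]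
   by (simp add: norm_mult distrib_left distrib_right sum_distrib_left sum_distrib_right mult.assoc)
  also have "... <= C * schwartz_norm (Suc m) ph + (\<Sum>i\<in>(UNIV::'n set). C * schwartz_norm (Suc m) ph)"
  proof (intro add_mono sum_mono)
   show "(1 + norm xi) ^ l * norm (fourier ph xi) <= C * schwartz_norm (Suc m) ph"
    using C(2)[OF s, of xi] mult_left_mono[OF schwartz_norm_mono[OF s, of m "Suc m"] C(1)] by simp
   show "(1 + norm xi) ^ l * norm (fourier (partial i ph) xi) <= C * schwartz_norm (Suc m) ph" for i
    using C(2)[OF schwartz_partial[OF s], of xi i] mult_left_mono[OF schwartz_norm_partial[OF s, of m i] C(1)] by simp
  qed
  also have "... = (C * (1 + real CARD('n))) * schwartz_norm (Suc m) ph" by (simp add: algebra_simps)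
  finally show ?thesis .
 qed
 then show ?case using C(1) by (intro exI[of _ "C * (1 + real CARD('n))"] exI[of _ "Suc m"]) auto
qed

text \<open>A derivative of the transform is the transform of a coordinate multiple, whose seminorms
  are controlled by \<open>schwartz_norm_coord\<close>; the induction is on the number of
  derivatives.\<close>

lemma fourier_iter_bound:
 "\<exists>C m. C >= 0 \<and> (\<forall>ph :: real^'n::finite => complex. \<forall>xi is. schwartz ph --> length is = k -->
  iter_partial is (fourier ph) differentiable (at xi) \<and>
  (1 + norm xi) ^ l * norm (iter_partial is (fourier ph) xi) <= C * schwartz_norm m ph)"
proof (induction k)
 case 0
 obtain C m where C: "C >= 0" "!!(ph :: real^'n => complex) xi. schwartz ph ==> (1 + norm xi) ^ l * norm (fourier ph xi) <= C * schwartz_norm m ph"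
  using fourier_schwartz_bound[of l, where 'n='n] by blast
 then show ?case using fourier_schwartz_differentiable by (intro exI[of _ C] exI[of _ m]) auto
next
 case (Suc k)
 then obtain C m where C: "C >= 0" "!!(ph :: real^'n => complex) xi is. schwartz ph ==> length is = k ==>
  iter_partial is (fourier ph) differentiable (at xi) \<and> (1 + norm xi) ^ l * norm (iter_partial is (fourier ph) xi) <= C * schwartz_norm m ph" by blast
 have "iter_partial is (fourier ph) differentiable (at xi) \<and> (1 + norm xi) ^ l * norm (iter_partial is (fourier ph) xi) <= (C * (1 + real m)) * schwartz_norm (2 * m + 1) ph"
  if s: "schwartz ph" and l: "length is = Suc k" for ph :: "real^'n => complex" and xi "is"
 proof -
  obtain js j where is_eq: "is = js @ [j]" using l by (cases "is" rule: rev_exhaust) auto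
  let ?ps = "\<lambda>x. of_real (x $ j) * ph x"
  have ps: "schwartz ?ps" using s by (rule schwartz_coord)
  have e: "iter_partial is (fourier ph) = iter_partial js (fourier (\<lambda>x. - \<i> * ?ps x))"
   unfolding is_eq iter_partial_snoc partial_fourier_schwartz[OF s] ..
  have "schwartz_norm m (\<lambda>x. - \<i> * ?ps x) <= (1 + real m) * schwartz_norm (2 * m + 1) ph"
   using schwartz_norm_cmult[OF ps, of m "- \<i>"] schwartz_norm_coord[OF s, of m j] by simp
  then have "C * schwartz_norm m (\<lambda>x. - \<i> * ?ps x) <= C * ((1 + real m) * schwartz_norm (2 * m + 1) ph)"
   by (intro mult_left_mono C)
  then show ?thesis unfolding e
   using C(2)[OF schwartz_cmult[OF ps, of "- \<i>"], of js xi] l is_eq by (simp add: mult.assoc)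
 qed
 then show ?case using C(1) by (intro exI[of _ "C * (1 + real m)"] exI[of _ "2 * m + 1"]) auto
qed

lemma schwartz_fourier:
 fixes ph :: "real^'n::finite => complex"
 assumes "schwartz ph" shows "schwartz (fourier ph)"
 unfolding schwartz_upto smooth_upto_iter
proof (intro allI impI)
 fix n and "is" :: "'n list"
 have D: "iter_partial is (fourier ph) differentiable (at xi)" for xi
 proof -
  obtain C m where "\<forall>ph :: real^'n => complex. \<forall>xi js. schwartz ph --> length js = length is -->
    iter_partial js (fourier ph) differentiable (at xi) \<and>
    (1 + norm xi) ^ 0 * norm (iter_partial js (fourier ph) xi) <= C * schwartz_norm m ph"
   using fourier_iter_bound[of "length is" 0, where 'n='n] by (elim exE conjE)
  then show ?thesis using assms by simp
 qed
 have "rapid (iter_partial is (fourier ph))"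
  unfolding rapid_def
 proof
  fix l
  obtain C m where "\<forall>ph :: real^'n => complex. \<forall>xi js. schwartz ph --> length js = length is -->
    iter_partial js (fourier ph) differentiable (at xi) \<and>
    (1 + norm xi) ^ l * norm (iter_partial js (fourier ph) xi) <= C * schwartz_norm m ph"
   using fourier_iter_bound[of "length is" l, where 'n='n] by (elim exE conjE)
  then have "(1 + norm xi) ^ l * norm (iter_partial is (fourier ph) xi) <= C * schwartz_norm m ph" for xi
   using assms by simp
  then show "\<exists>C. \<forall>x. (1 + norm x) ^ l * norm (iter_partial is (fourier ph) x) <= C" by blast
 qed
 with D show "rapid (iter_partial is (fourier ph)) \<and> (\<forall>x\<in>UNIV. iter_partial is (fourier ph) differentiable at x)" by blast
qed

lemma schwartz_norm_fourier:
 "\<exists>C m. C >= 0 \<and> (\<forall>ph :: real^'n::finite => complex. schwartz ph --> schwartz_norm k (fourier ph) <= C * schwartz_norm m ph)"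
proof -
 have "\<forall>l. \<exists>C m. C >= 0 \<and> (\<forall>ph :: real^'n => complex. \<forall>xi is. schwartz ph --> length is = l -->
  (1 + norm xi) ^ k * norm (iter_partial is (fourier ph) xi) <= C * schwartz_norm m ph)"
 proof
  fix l
  obtain C m where C: "C >= 0" "\<forall>ph :: real^'n => complex. \<forall>xi js. schwartz ph --> length js = l -->
    iter_partial js (fourier ph) differentiable (at xi) \<and>
    (1 + norm xi) ^ k * norm (iter_partial js (fourier ph) xi) <= C * schwartz_norm m ph"
   using fourier_iter_bound[of l k, where 'n='n] by (elim exE conjE)
  then show "\<exists>C m. C >= 0 \<and> (\<forall>ph :: real^'n => complex. \<forall>xi is. schwartz ph --> length is = l -->
  (1 + norm xi) ^ k * norm (iter_partial is (fourier ph) xi) <= C * schwartz_norm m ph)"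
   by (intro exI[of _ C] exI[of _ m]) simp
 qed
 from choice[OF this] obtain C where "\<forall>l. \<exists>m. C l >= (0::real) \<and> (\<forall>ph :: real^'n => complex. \<forall>xi is. schwartz ph --> length is = l -->
  (1 + norm xi) ^ k * norm (iter_partial is (fourier ph) xi) <= C l * schwartz_norm m ph)" by blast
 from choice[OF this] obtain m where C: "!!l. C l >= (0::real)" "!!l (ph :: real^'n => complex) xi is. schwartz ph ==> length is = l ==>
  (1 + norm xi) ^ k * norm (iter_partial is (fourier ph) xi) <= C l * schwartz_norm (m l) ph" by blast
 \<comment> \<open>Sums dominate each of the finitely many constants and orders, one for each number
   of derivatives.\<close>
 let ?C = "\<Sum>l\<le>k. C l" and ?m = "\<Sum>l\<le>k. m l"
 have "schwartz_norm k (fourier ph) <= ?C * schwartz_norm ?m ph" if s: "schwartz ph" for ph :: "real^'n => complex"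
 proof (rule schwartz_norm_le)
  fix "is" :: "'n list" and x :: "real^'n" assume l: "length is <= k"
  have "(1 + norm x) ^ k * norm (iter_partial is (fourier ph) x) <= C (length is) * schwartz_norm (m (length is)) ph"
   by (rule C(2)[OF s refl])
  also have "... <= ?C * schwartz_norm ?m ph"
   using l C(1) by (intro mult_mono schwartz_norm_mono s schwartz_norm_nonneg member_le_sum sum_nonneg) auto
  finally show "(1 + norm x) ^ k * norm (iter_partial is (fourier ph) x) <= ?C * schwartz_norm ?m ph" .
 qed
 moreover have "?C >= 0" using C(1) by (intro sum_nonneg) auto
 ultimately show ?thesis by blast
qed

lemma tempered_dist_fourier:
 fixes \<mu> :: "'n::finite dist"
 assumes "tempered \<mu>" shows "tempered (dist_fourier \<mu>)"
proof -
 obtain C k where C: "!!ph. schwartz ph ==> norm (\<mu> ph) <= C * schwartz_norm k ph"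
  using assms unfolding tempered_def by blast
 obtain D m where D: "D >= 0" "!!ph :: real^'n => complex. schwartz ph ==> schwartz_norm k (fourier ph) <= D * schwartz_norm m ph"
  using schwartz_norm_fourier by blast
 have "norm (\<mu> (fourier ph)) <= (\<bar>C\<bar> * D) * schwartz_norm m ph" if s: "schwartz ph" for ph
 proof -
  have "norm (\<mu> (fourier ph)) <= \<bar>C\<bar> * schwartz_norm k (fourier ph)"
   using C[OF schwartz_fourier[OF s]] schwartz_norm_nonneg[OF schwartz_fourier[OF s], of k]
   by (meson abs_ge_self mult_right_mono order_trans)
  also have "... <= \<bar>C\<bar> * (D * schwartz_norm m ph)" by (intro mult_left_mono D s) auto
  finally show ?thesis by (simp add: mult.assoc)
 qed
 then show ?thesis unfolding tempered_def dist_fourier_def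
  using tempered_add[OF assms schwartz_fourier schwartz_fourier] tempered_cmult[OF assms schwartz_fourier]
  by (auto simp: fourier_add schwartz_integrable fourier_cmult)
qed

lemma schwartz_reflect:
 fixes ph :: "real^'n::finite => complex"
 assumes "schwartz ph" shows "schwartz (\<lambda>x. ph (- x))"
proof -
 have e: "iter_partial is (\<lambda>x. ph (- x)) = (\<lambda>x. (-1) ^ length is * iter_partial is ph (- x))" for "is"
  using iter_partial_dilate[OF schwartz_smooth[OF assms], of "is" "-1"] by simp
 have sm: "smooth_on UNIV (\<lambda>x. ph (- x))"
  using smooth_on_dilate[OF schwartz_smooth[OF assms], of "-1"] by simp
 have "rapid (iter_partial is (\<lambda>x. ph (- x)))" for "is"
  unfolding rapid_def
 proof
  fix k
  obtain C where C: "!!x. (1 + norm x) ^ k * norm (iter_partial is ph x) <= C"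
   using schwartz_rapid[OF schwartz_iter_partial[OF assms]] unfolding rapid_def by blast
  show "\<exists>C. \<forall>x. (1 + norm x) ^ k * norm (iter_partial is (\<lambda>x. ph (- x)) x) <= C"
   using C[of "- _"] unfolding e by (auto simp: norm_mult norm_power)
 qed
 then show ?thesis unfolding schwartz_upto smooth_upto_iter using sm by (simp add: smooth_on_def)
qed

lemma schwartz_inv_fourier:
 fixes ph :: "real^'n::finite => complex"
 assumes "schwartz ph" shows "schwartz (inv_fourier ph)"
 unfolding inv_fourier_eq[abs_def]
 using schwartz_cmult[OF schwartz_reflect[OF schwartz_fourier[OF assms]], of "inverse (of_real ((2 * pi) ^ CARD('n)))"]
 by (simp add: divide_inverse mult.commute)

lemma schwartz_bounded: assumes "schwartz ph" obtains C where "!!x. norm (ph x) <= C"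
 using schwartz_rapid[OF assms] unfolding rapid_def by (metis mult_1 power_0)

lemma inv_fourier_fourier_schwartz:
 fixes ph :: "real^'n::finite => complex"
 assumes "schwartz ph" shows "inv_fourier (fourier ph) = ph"
proof -
 obtain C where "!!x. norm (ph x) <= C" using schwartz_bounded[OF assms] by blast
 then show ?thesis
  using assms by (intro ext fourier_inversion[where B=C])
   (auto intro: schwartz_integrable schwartz_fourier smooth_on_continuous schwartz_smooth)
qed

lemma fourier_inv_fourier_schwartz:
 fixes ph :: "real^'n::finite => complex"
 assumes "schwartz ph" shows "fourier (inv_fourier ph) = ph"
proof -
 obtain C where "!!x. norm (ph x) <= C" using schwartz_bounded[OF assms] by blast
 then show ?thesis
  using assms by (intro ext fourier_inv_fourier[where B=C])
   (auto intro: schwartz_integrable schwartz_fourier smooth_on_continuous schwartz_smooth)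
qed

section \<open>Kernel bounds\<close>

text \<open>The sign is that of growth: \<open>heat th (- t)\<close> is the symbol of S(t), and
  \<open>heat th t\<close> is its inverse, which is used only together with a frequency
  cut-off.\<close>

definition heat :: "real => real => real^'n::finite => complex" where
 "heat th s xi = of_real (exp (s * norm xi powr th))"

lemma norm_heat: "norm (heat th s xi) = exp (s * norm xi powr th)"
 by (simp add: heat_def)

lemma heat_0 [simp]: "heat th 0 xi = 1"
 by (simp add: heat_def)

lemma heat_add: "heat th (s + t) xi = heat th s xi * heat th t xi"
 by (simp add: heat_def distrib_right exp_add)

lemma heat_minus [simp]: "heat th s (- xi) = heat th s xi"
 by (simp add: heat_def)

lemma heat_cancel [simp]: "heat th (- s) xi * heat th s xi = 1" "heat th s xi * heat th (- s) xi = 1"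
 by (simp_all add: heat_add[symmetric])

lemma heat_scale: "th > 0 ==> c > 0 ==> heat th s (c *\<^sub>R xi) = heat th (s * c powr th) xi"
 by (simp add: heat_def powr_mult mult_ac)

lemma heat_measurable [measurable]: "heat th s \<in> borel_measurable borel"
 unfolding heat_def[abs_def] by measurable

lemma heat_continuous: "th > 0 ==> continuous_on UNIV (heat th s)"
 unfolding heat_def[abs_def] by (intro continuous_intros continuous_on_powr') auto

lemma smooth_on_heat: "smooth_on (-{0}) (heat th s)"
 unfolding heat_def[abs_def] by (rule smooth_on_exp_norm_powr)

lemma partial_heat:
 fixes x :: "real^'n::finite"
 assumes "x \<noteq> 0"
 shows "partial i (heat th s) x = of_real (s * th) * of_real (x $ i) * of_real (norm x powr (th - 2)) * heat th s x"
proof -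
 have "((\<lambda>t. exp (s * t powr th)) has_real_derivative exp (s * norm x powr th) * (s * (th * norm x powr (th - 1)))) (at (norm x))"
  using assms by (auto intro!: derivative_eq_intros simp: powr_diff)
 from partial_radial[OF assms this, of i]
 have "partial i (heat th s) x = of_real (exp (s * norm x powr th) * (s * (th * norm x powr (th - 1))) * x $ i / norm x)"
  unfolding heat_def[abs_def] .
 moreover have "norm x powr (th - 2) = norm x powr (th - 1) / norm x"
  using assms by (simp add: powr_diff power2_eq_square)
 ultimately show ?thesis by (simp add: heat_def)
qed

text \<open>On this class, multiplication by symbols that are singular only at the origin stays
  within the test functions.\<close>

definition annular :: "(real^'n::finite => complex) => bool" where
 "annular b \<longleftrightarrow> test_fun b \<and> (\<exists>r>0. \<forall>xi. norm xi < r --> b xi = 0)"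

lemma annular_mult:
 assumes "smooth_on (-{0}) f" "annular b" shows "annular (f \<odot> b)"
proof -
 obtain r where r: "r > 0" "!!xi. norm xi < r ==> b xi = 0" using assms(2) by (auto simp: annular_def)
 have "smooth_on UNIV (f \<odot> b)"
  by (rule smooth_on_vanishing[OF assms(1) _ r]) (use assms(2) in \<open>auto simp: annular_def test_fun_def\<close>)
 moreover have "bounded {xi. f xi * b xi \<noteq> 0}"
  using assms(2) by (auto simp: annular_def test_fun_def intro: bounded_subset)
 ultimately show ?thesis using r by (auto simp: annular_def test_fun_def)
qed

lemma annular_partial:
 assumes "annular b" shows "annular (partial i b)"
proof -
 obtain r where r: "r > 0" "!!xi. norm xi < r ==> b xi = 0" using assms(1) by (auto simp: annular_def)
 have "partial i b xi = 0" if "norm xi < r" for xi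
  using partial_cong_open[of "ball 0 r" xi b "\<lambda>_. 0" i] that r(2) by simp
 then show ?thesis using assms r(1) test_fun_partial by (auto simp: annular_def)
qed

lemma annular_test_fun: "annular b ==> test_fun b"
 by (simp add: annular_def)

lemma annular_heat: "annular b ==> annular (heat th s \<odot> b)"
 by (rule annular_mult[OF smooth_on_heat])

lemma norm_add_of_real_mult: "z = a + of_real s * b ==> norm z <= norm a + \<bar>s\<bar> * norm (b :: complex)"
 using norm_triangle_ineq[of a "of_real s * b"] by (simp add: norm_mult)

lemma two_powr_less_one: "x < 0 ==> 2 powr x < (1::real)"
 using powr_less_mono[of x 0 2] by simp

text \<open>The factor that appears, besides \<open>s\<close>, when a derivative of
  \<open>heat th s\<close> times \<open>b\<close> falls on the exponential. It is annular again, so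
  the step can be iterated.\<close>

definition heat_weight :: "real => 'n => (real^'n::finite => complex) => real^'n => complex" where
 "heat_weight th i b xi = of_real th * of_real (xi $ i) * of_real (norm xi powr (th - 2)) * b xi"

lemma annular_heat_weight: "annular b ==> annular (heat_weight th i b)"
 unfolding heat_weight_def[abs_def]
 by (intro annular_mult smooth_on_mult smooth_on_norm_powr) auto

lemma partial_heat_mult:
 assumes "annular b"
 shows "partial i (heat th s \<odot> b) = (\<lambda>xi. heat th s xi * partial i b xi + of_real s * (heat th s xi * heat_weight th i b xi))"
proof
 fix xi :: "real^'a"
 have sb: "smooth_on UNIV b" using assms by (simp add: annular_def test_fun_def)
 show "partial i (heat th s \<odot> b) xi = heat th s xi * partial i b xi + of_real s * (heat th s xi * heat_weight th i b xi)"
 proof (cases "xi = 0")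
  case True
  obtain r where r: "r > 0" "!!xi. norm xi < r ==> b xi = 0" using assms(1) by (auto simp: annular_def)
  have "partial i (heat th s \<odot> b) xi = 0" "partial i b xi = 0"
   using partial_cong_open[of "ball 0 r" xi "heat th s \<odot> b" "\<lambda>_. 0" i] partial_cong_open[of "ball 0 r" xi b "\<lambda>_. 0" i] r True by simp_all
  then show ?thesis using r True by (simp add: heat_weight_def)
 next
  case False
  then show ?thesis
   by (subst partial_mult[OF smooth_on_differentiable[OF smooth_on_heat] smooth_on_differentiable[OF sb]])
    (auto simp: partial_heat heat_weight_def algebra_simps)
 qed
qed

lemma test_fun_integrable: "test_fun b ==> L1 b"
 by (intro schwartz_integrable schwartz_test_fun)

lemma fourier_moment_step:
 fixes f :: "real^'n::finite => complex"
 assumes "schwartz f"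
 shows "(1 + norm x) ^ Suc m * norm (fourier f x) \<le>
  (1 + norm x) ^ m * norm (fourier f x) + (\<Sum>i\<in>UNIV. (1 + norm x) ^ m * norm (fourier (partial i f) x))"
proof -
 have "norm x <= (\<Sum>i\<in>UNIV. \<bar>x $ i\<bar>)" by (rule norm_le_l1_cart)
 then have "(1 + norm x) ^ Suc m * norm (fourier f x) <= (1 + norm x) ^ m * ((1 + (\<Sum>i\<in>UNIV. \<bar>x $ i\<bar>)) * norm (fourier f x))"
  by (simp add: mult.assoc mult.left_commute[of "1 + norm x"] mult_left_mono mult_right_mono)
 also have "... = (1 + norm x) ^ m * norm (fourier f x) + (\<Sum>i\<in>UNIV. (1 + norm x) ^ m * norm (fourier (partial i f) x))"
  unfolding fourier_partial_schwartz[OF assms]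
  by (simp add: norm_mult distrib_left distrib_right sum_distrib_left sum_distrib_right mult.assoc)
 finally show ?thesis .
qed

text \<open>On the support |xi| >= r, so for negative \<open>s\<close> the symbol is at most exp(-
  r^th |s|). Each power of the weight costs one derivative of the symbol, which falls on
  \<open>b\<close> or brings down a factor \<open>s\<close>; this is the origin of (1 +
  |s|)^m.\<close>

lemma annular_heat_bound_aux:
 fixes b :: "real^'n::finite => complex"
 assumes th: "th > 0" and S: "S >= 0" and r: "r > 0" and "test_fun b" "!!xi. norm xi < r ==> b xi = 0"
 shows "\<exists>C\<ge>0. \<forall>s\<le>S. \<forall>x. (1 + norm x) ^ m * norm (fourier (heat th s \<odot> b) x)
  <= C * ((1 + \<bar>s\<bar>) ^ m * exp (- (r powr th * \<bar>s\<bar>)))"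
 using assms(4,5)
proof (induction m arbitrary: b)
 case 0
 obtain R where R: "R > 0" "!!xi. norm xi >= R ==> b xi = 0" using test_fun_bound[OF 0(1)] by blast
 let ?k = "r powr th"
 \<comment> \<open>The first term covers the growth for 0 <= s <= S up to the outer radius
   \<open>R\<close>, the second undoes the factor exp(- k |s|) there.\<close>
 let ?M = "exp (S * R powr th + S * ?k)"
 let ?I = "LBINT xi. norm (b xi)"
 have bi: "L1 b" by (rule test_fun_integrable[OF 0(1)])
 have "norm (fourier (heat th s \<odot> b) x) <= ?M * ?I * exp (- (?k * \<bar>s\<bar>))" if s: "s <= S" for s x
 proof -
  have e: "norm (heat th s xi * b xi) <= (?M * exp (- (?k * \<bar>s\<bar>))) * norm (b xi)" for xi
  proof (cases "r <= norm xi \<and> norm xi < R")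
   case False then show ?thesis using 0(2) R(2) by (cases "norm xi < r") auto
  next
   case True
   have rk: "?k <= norm xi powr th" "norm xi powr th <= R powr th" using True r th by (auto intro!: powr_mono2)
   have "s * norm xi powr th <= S * R powr th + S * ?k - ?k * \<bar>s\<bar>"
   proof (cases "s >= 0")
    case True
    then have "s * norm xi powr th <= S * R powr th" "?k * s <= S * ?k" using rk s by (auto intro!: mult_mono simp: mult.commute)
    then show ?thesis using True by simp
   next
    case False
    then have "s * norm xi powr th <= s * ?k" using rk by (intro mult_left_mono_neg) auto
    moreover have "0 <= S * R powr th" "0 <= S * ?k" using S by auto
    moreover have "?k * \<bar>s\<bar> = - (s * ?k)" using False by simp
    ultimately show ?thesis by linarith
   qed
   then have "exp (s * norm xi powr th) <= ?M * exp (- (?k * \<bar>s\<bar>))" by (simp add: exp_add[symmetric])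
   then show ?thesis unfolding norm_mult norm_heat by (intro mult_right_mono) auto
  qed
  have "norm (fourier (heat th s \<odot> b) x) <= (LBINT xi. norm (heat th s xi * b xi))"
   by (rule norm_fourier_le)
  also have "... <= (LBINT xi. (?M * exp (- (?k * \<bar>s\<bar>))) * norm (b xi))"
  proof (rule integral_mono)
   have "annular b" using 0 r by (auto simp: annular_def)
   then show "L1 (\<lambda>xi. norm (heat th s xi * b xi))"
    by (intro integrable_norm test_fun_integrable annular_test_fun annular_heat)
  qed (use bi e in auto)
  also have "... = ?M * ?I * exp (- (?k * \<bar>s\<bar>))" by simp
  finally show ?thesis .
 qed
 moreover have "?I >= 0" by (intro integral_nonneg_AE) auto
 ultimately show ?case by (intro exI[of _ "?M * ?I"]) auto
next
 case (Suc m)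
 let ?e = "\<lambda>s m. (1 + \<bar>s\<bar>) ^ m * exp (- (r powr th * \<bar>s\<bar>))"
 have ab: "annular b" using Suc.prems r by (auto simp: annular_def)
 have an: "test_fun (partial i b)" "!!xi. norm xi < r ==> partial i b xi = 0"
  "test_fun (heat_weight th i b)" "!!xi. norm xi < r ==> heat_weight th i b xi = 0" for i
  using Suc.prems partial_cong_open[of "ball 0 r" _ b "\<lambda>_. 0" i] annular_test_fun[OF annular_heat_weight[OF ab]]
  by (auto simp: test_fun_partial heat_weight_def)
 obtain C0 where C0: "C0 >= 0" "!!s x. s <= S ==> (1 + norm x) ^ m * norm (fourier (heat th s \<odot> b) x) <= C0 * ?e s m"
  using Suc.IH[OF Suc.prems] by blast
 have "\<forall>i. \<exists>C. C >= 0 \<and> (\<forall>s\<le>S. \<forall>x. (1 + norm x) ^ m * norm (fourier (heat th s \<odot> partial i b) x) <= C * ?e s m)"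
  using Suc.IH[OF an(1,2)] by blast
 from choice[OF this] obtain C1 where C1: "!!i. C1 i >= 0"
  "!!i s x. s <= S ==> (1 + norm x) ^ m * norm (fourier (heat th s \<odot> partial i b) x) <= C1 i * ?e s m" by blast
 have "\<forall>i. \<exists>C. C >= 0 \<and> (\<forall>s\<le>S. \<forall>x. (1 + norm x) ^ m * norm (fourier (heat th s \<odot> heat_weight th i b) x) <= C * ?e s m)"
  using Suc.IH[OF an(3,4)] by blast
 from choice[OF this] obtain C2 where C2: "!!i. C2 i >= 0"
  "!!i s x. s <= S ==> (1 + norm x) ^ m * norm (fourier (heat th s \<odot> heat_weight th i b) x) <= C2 i * ?e s m" by blast
 let ?C = "C0 + (\<Sum>i\<in>UNIV. C1 i + C2 i)"
 have "(1 + norm x) ^ Suc m * norm (fourier (heat th s \<odot> b) x) <= ?C * ?e s (Suc m)" if s: "s <= S" for s x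
 proof -
  have sch: "schwartz (heat th s \<odot> b)"
   by (intro schwartz_test_fun annular_test_fun annular_heat ab)
  have i1: "L1 (heat th s \<odot> partial i b)" "L1 (heat th s \<odot> heat_weight th i b)" for i
   by (intro test_fun_integrable annular_test_fun annular_heat annular_partial annular_heat_weight ab)+
  have p: "(1 + norm x) ^ m * norm (fourier (partial i (heat th s \<odot> b)) x) <= (C1 i + C2 i) * ?e s (Suc m)" for i
  proof -
   have "fourier (partial i (heat th s \<odot> b)) x = fourier (heat th s \<odot> partial i b) x + of_real s * fourier (heat th s \<odot> heat_weight th i b) x"
    unfolding partial_heat_mult[OF ab] by (subst fourier_add) (use i1 in \<open>auto simp: fourier_cmult\<close>)
   then have "norm (fourier (partial i (heat th s \<odot> b)) x) <= norm (fourier (heat th s \<odot> partial i b) x) + \<bar>s\<bar> * norm (fourier (heat th s \<odot> heat_weight th i b) x)"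
    by (rule norm_add_of_real_mult)
   then have "(1 + norm x) ^ m * norm (fourier (partial i (heat th s \<odot> b)) x) <= (1 + norm x) ^ m * (norm (fourier (heat th s \<odot> partial i b) x) + \<bar>s\<bar> * norm (fourier (heat th s \<odot> heat_weight th i b) x))"
    by (intro mult_left_mono) auto
   also have "... = (1 + norm x) ^ m * norm (fourier (heat th s \<odot> partial i b) x) + \<bar>s\<bar> * ((1 + norm x) ^ m * norm (fourier (heat th s \<odot> heat_weight th i b) x))"
    by (simp add: algebra_simps)
   also have "... <= C1 i * ?e s m + \<bar>s\<bar> * (C2 i * ?e s m)"
    by (intro add_mono mult_left_mono C1 C2 s) auto
   also have "... <= (C1 i + C2 i) * ((1 + \<bar>s\<bar>) * ?e s m)"
    using C1(1)[of i] C2(1)[of i] by (simp add: algebra_simps)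
   finally show ?thesis by (simp add: mult_ac)
  qed
  have "(1 + norm x) ^ Suc m * norm (fourier (heat th s \<odot> b) x) <= C0 * ?e s m + (\<Sum>i\<in>UNIV. (C1 i + C2 i) * ?e s (Suc m))"
   by (rule order_trans[OF fourier_moment_step[OF sch]]) (intro add_mono sum_mono p C0 s)
  also have "C0 * ?e s m <= C0 * ?e s (Suc m)"
   using C0(1) by (intro mult_left_mono mult_right_mono power_increasing) auto
  finally show ?thesis by (simp add: distrib_right sum_distrib_right)
 qed
 moreover have "?C >= 0" using C0 C1 C2 by (intro add_nonneg_nonneg sum_nonneg) auto
 ultimately show ?case by blast
qed

lemma power_le_fact_exp: "r >= 0 ==> (r::real) ^ k <= fact k * exp r"
proof -
 assume "r >= 0"
 then have "(\<Sum>n\<in>{k}. r ^ n /\<^sub>R fact n) <= exp r"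
  unfolding exp_def by (intro sum_le_suminf summable_exp_generic) auto
 then show ?thesis by (simp add: field_simps)
qed

lemma power_exp_bounded: assumes "\<kappa> > 0" shows "\<exists>C\<ge>0. \<forall>t\<ge>0. (1 + t) ^ k * exp (- (\<kappa> * t)) <= (C::real)"
proof -
 have "(1 + t) ^ k * exp (- (\<kappa> * t)) <= fact k * exp \<kappa> / \<kappa> ^ k" if "t >= 0" for t
 proof -
  have "(\<kappa> * (1 + t)) ^ k <= fact k * exp (\<kappa> * (1 + t))" using assms that by (intro power_le_fact_exp) auto
  moreover have "exp (\<kappa> * (1 + t)) = exp \<kappa> * exp (\<kappa> * t)" by (simp add: distrib_left exp_add)
  ultimately have "(1 + t) ^ k * \<kappa> ^ k <= fact k * exp \<kappa> * exp (\<kappa> * t)"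
   unfolding power_mult_distrib by (simp add: mult_ac)
  then have "(1 + t) ^ k <= fact k * exp \<kappa> * exp (\<kappa> * t) / \<kappa> ^ k"
   using assms by (subst pos_le_divide_eq) auto
  then have "(1 + t) ^ k <= fact k * exp \<kappa> / \<kappa> ^ k * exp (\<kappa> * t)" by simp
  then have "(1 + t) ^ k * exp (- (\<kappa> * t)) <= fact k * exp \<kappa> / \<kappa> ^ k * exp (\<kappa> * t) * exp (- (\<kappa> * t))"
   by (intro mult_right_mono) auto
  then show ?thesis by (simp add: mult.assoc exp_add[symmetric])
 qed
 moreover have "0 <= fact k * exp \<kappa> / \<kappa> ^ k" using assms by auto
 ultimately show ?thesis by blast
qed

text \<open>The exponential in |s| absorbs (1 + |s|)^(m + L), so any power can be gained as s tends
  to minus infinity.\<close>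

lemma annular_heat_bound:
 fixes b :: "real^'n::finite => complex"
 assumes th: "th > 0" and S: "S >= 0" and b: "annular b"
 shows "\<exists>C\<ge>0. \<forall>s\<le>S. \<forall>x. norm (fourier (heat th s \<odot> b) x) <= C * decay (real m) x / (1 + \<bar>s\<bar>) ^ L"
proof -
 obtain r where r: "r > 0" "!!xi. norm xi < r ==> b xi = 0" using b by (auto simp: annular_def)
 obtain C where C: "C >= 0" "!!s x. s <= S ==> (1 + norm x) ^ m * norm (fourier (heat th s \<odot> b) x) <= C * ((1 + \<bar>s\<bar>) ^ m * exp (- (r powr th * \<bar>s\<bar>)))"
  using annular_heat_bound_aux[OF th S r(1) annular_test_fun[OF b] r(2), of m] by blast
 have "r powr th > 0" using r by simp
 then obtain D where D: "D >= 0" "!!t. t >= 0 ==> (1 + t) ^ (m + L) * exp (- (r powr th * t)) <= D"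
  using power_exp_bounded[of "r powr th" "m + L"] by blast
 have "norm (fourier (heat th s \<odot> b) x) <= (C * D) * decay (real m) x / (1 + \<bar>s\<bar>) ^ L" if s: "s <= S" for s x
 proof -
  have "(1 + \<bar>s\<bar>) ^ m * exp (- (r powr th * \<bar>s\<bar>)) <= D / (1 + \<bar>s\<bar>) ^ L"
   using D(2)[of "\<bar>s\<bar>"] by (simp add: pos_le_divide_eq power_add mult_ac add_pos_nonneg)
  then have "C * ((1 + \<bar>s\<bar>) ^ m * exp (- (r powr th * \<bar>s\<bar>))) <= C * (D / (1 + \<bar>s\<bar>) ^ L)"
   using C(1) by (rule mult_left_mono)
  with C(2)[OF s, of x] have "(1 + norm x) ^ m * norm (fourier (heat th s \<odot> b) x) <= C * (D / (1 + \<bar>s\<bar>) ^ L)" by linarith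
  then have "norm (fourier (heat th s \<odot> b) x) <= (C * (D / (1 + \<bar>s\<bar>) ^ L)) / (1 + norm x) ^ m"
   by (subst pos_le_divide_eq) (auto simp: mult.commute)
  then show ?thesis by (simp add: decay_power mult_ac)
 qed
 then show ?thesis using C(1) D(1) by (intro exI[of _ "C * D"]) auto
qed

text \<open>The factor |s| comes from writing heat(s) - 1 as the integral over sigma in [0,1] of s
  |xi|^th heat(sigma s), to which \<open>annular_heat_bound\<close> applies with constants uniform
  in sigma.\<close>

lemma annular_heat_diff_bound:
 fixes b :: "real^'n::finite => complex"
 assumes th: "th > 0" and S: "S >= 0" and b: "annular b"
 shows "\<exists>C\<ge>0. \<forall>s. \<bar>s\<bar> <= S --> (\<forall>x. norm (fourier (\<lambda>xi. (heat th s xi - 1) * b xi) x) <= C * \<bar>s\<bar> * decay (real m) x)"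
proof -
 let ?b = "\<lambda>xi. of_real (norm xi powr th) * b xi"
 have ab: "annular ?b" by (intro annular_mult smooth_on_norm_powr b)
 obtain C where C: "C >= 0" "!!s x. s <= S ==> norm (fourier (heat th s \<odot> ?b) x) <= C * decay (real m) x / (1 + \<bar>s\<bar>) ^ 0"
  using annular_heat_bound[OF th S ab, of m 0] by blast
 obtain R where R: "R > 0" "!!xi. norm xi >= R ==> b xi = 0" using test_fun_bound[OF annular_test_fun[OF b]] by blast
 have bi: "L1 ?b" by (rule test_fun_integrable[OF annular_test_fun[OF ab]])
 have "b \<in> borel_measurable borel" using test_fun_integrable[OF annular_test_fun[OF b]] by auto
 note [measurable] = this
 have "norm (fourier (\<lambda>xi. (heat th s xi - 1) * b xi) x) <= C * \<bar>s\<bar> * decay (real m) x" if s: "\<bar>s\<bar> <= S" for s x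
 proof -
  let ?F = "\<lambda>\<sigma> xi. indicator {0..1::real} \<sigma> *\<^sub>R (of_real s * (cis (- (xi \<bullet> x)) * (heat th (\<sigma> * s) xi * ?b xi)))"
  have \<sigma>s: "\<bar>\<sigma> * s\<bar> <= S" if "\<sigma> \<in> {0..1}" for \<sigma>
   using that s mult_mono[of \<sigma> 1 "\<bar>s\<bar>" S] by (simp add: abs_mult)
  have I: "integrable (lborel \<Otimes>\<^sub>M lborel) (case_prod ?F)"
  proof (rule integrable_pair_bound[where f="\<lambda>\<sigma>. of_real (indicator {0..1} \<sigma>)" and g="\<lambda>xi. of_real (S * exp (S * R powr th)) * ?b xi"])
   show "L1 (\<lambda>\<sigma>. complex_of_real (indicator {0..1::real} \<sigma>))" by (intro integrable_of_real) simp
   show "L1 (\<lambda>xi. of_real (S * exp (S * R powr th)) * ?b xi)" by (rule integrable_mult_right[OF bi])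
   show "case_prod ?F \<in> borel_measurable (lborel \<Otimes>\<^sub>M lborel)" unfolding heat_def case_prod_beta by measurable
   fix \<sigma> xi
   show "norm (case_prod ?F (\<sigma>, xi)) <= norm (complex_of_real (indicator {0..1} \<sigma>)) * norm (of_real (S * exp (S * R powr th)) * ?b xi)"
   proof (cases "\<sigma> \<in> {0..1} \<and> norm xi < R")
    case True
    have "\<sigma> * s * norm xi powr th <= \<bar>\<sigma> * s\<bar> * norm xi powr th" by (intro mult_right_mono) auto
    also have "... <= S * R powr th" using True th \<sigma>s[of \<sigma>] by (intro mult_mono powr_mono2) auto
    finally have "\<bar>s\<bar> * exp (\<sigma> * s * norm xi powr th) <= S * exp (S * R powr th)" using s by (intro mult_mono) auto
    from mult_right_mono[OF this, of "norm (?b xi)"] S True show ?thesis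
     by (simp add: norm_mult norm_heat mult.assoc)
   qed (use R(2) in auto)
  qed
  have ftc: "(LBINT \<sigma>. ?F \<sigma> xi) = cis (- (xi \<bullet> x)) * ((heat th s xi - 1) * b xi)" for xi
  proof -
   have "(LBINT \<sigma>. indicator {0..1} \<sigma> *\<^sub>R (of_real (s * norm xi powr th) * heat th (\<sigma> * s) xi)) = heat th (1 * s) xi - heat th (0 * s) xi"
   proof (rule integral_FTC_Icc)
    show "((\<lambda>\<sigma>. heat th (\<sigma> * s) xi) has_vector_derivative of_real (s * norm xi powr th) * heat th (\<sigma> * s) xi) (at \<sigma> within {0..1})" for \<sigma>
     unfolding heat_def of_real_mult[symmetric] by (rule has_vector_derivative_of_real) (auto intro!: derivative_eq_intros)
    show "continuous_on {0..1} (\<lambda>\<sigma>. of_real (s * norm xi powr th) * heat th (\<sigma> * s) xi)"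
     unfolding heat_def by (intro continuous_intros)
   qed simp
   from arg_cong[OF this, of "\<lambda>c. c * (cis (- (xi \<bullet> x)) * b xi)"]
   show ?thesis unfolding integral_mult_left_zero[symmetric] by (simp add: mult_ac scaleR_conv_of_real)
  qed
  have in1: "(LBINT xi. ?F \<sigma> xi) = indicator {0..1} \<sigma> *\<^sub>R (of_real s * fourier (heat th (\<sigma> * s) \<odot> ?b) x)" for \<sigma>
   unfolding fourier_def by simp
  have "fourier (\<lambda>xi. (heat th s xi - 1) * b xi) x = (LBINT \<sigma>. (LBINT xi. ?F \<sigma> xi))"
   using lborel_pair.Fubini_integral[OF I] unfolding ftc fourier_def .
  also have "norm ... <= (LBINT \<sigma>. indicator {0..1::real} \<sigma> * (\<bar>s\<bar> * (C * decay (real m) x)))"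
  proof (rule norm_integral_le)
   show "L1 (\<lambda>\<sigma>. LBINT xi. ?F \<sigma> xi)" using lborel_pair.integrable_fst'[OF I] by simp
   show "norm (LBINT xi. ?F \<sigma> xi) <= indicator {0..1} \<sigma> * (\<bar>s\<bar> * (C * decay (real m) x))" for \<sigma>
    unfolding in1 using C(2)[OF abs_le_D1[OF \<sigma>s], of \<sigma> x] by (auto simp: indicator_def norm_mult mult_left_mono)
  qed (intro integrable_mult_left, simp)
  also have "... = C * \<bar>s\<bar> * decay (real m) x" by simp
  finally show ?thesis .
 qed
 then show ?thesis using C(1) by blast
qed

subsection \<open>Dyadic summation\<close>

text \<open>The gain of the kernels over the critical decay \<open>|x|\<^sup>-\<^sup>N\<close> is limited by the singularity
  of \<open>|\<xi>|\<^sup>\<theta>\<close> at the origin; any exponent strictly between \<open>0\<close> and \<open>\<theta>\<close> would do, and one that is at most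
  \<open>1\<close> lets rapidly decaying pieces be summed with the polynomial weight of order \<open>N + 1\<close>.\<close>

definition prof :: "real => real^'n::finite => real" where
 "prof th x = decay (real CARD('n) + min (th / 2) 1) x"

lemma prof_pos [simp]: "0 < prof th x" and prof_nonneg [simp]: "0 <= prof th x"
 by (simp_all add: prof_def)

lemma prof_measurable [measurable]: "prof th \<in> borel_measurable borel"
 unfolding prof_def[abs_def] by measurable

lemma prof_le_one: "th > 0 ==> prof th x <= 1"
 unfolding prof_def by (intro decay_le_one) auto

lemma integrable_prof: "th > 0 ==> L1 (prof th)"
 unfolding prof_def[abs_def] by (intro integrable_decay) auto

lemma prof_minus [simp]: "prof th (- x) = prof th x"
 by (simp add: prof_def)

lemma prof_commute: "prof th (x - y) = prof th (y - x)"
 by (simp add: prof_def decay_commute)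

lemma decay_le_prof: "decay (real (CARD('n) + 1)) x <= prof th (x :: real^'n::finite)"
 unfolding prof_def by (intro decay_mono) auto

lemma prof_convolve:
 fixes x :: "real^'n::finite"
 assumes "th > 0"
 shows "L1 (\<lambda>y. prof th (x - y) * prof th y)"
  and "\<exists>C\<ge>0. \<forall>x::real^'n. (LBINT y. prof th (x - y) * prof th y) <= C * prof th x"
proof -
 have a: "real CARD('n) + min (th / 2) 1 > real CARD('n)" using assms by simp
 show "L1 (\<lambda>y. prof th (x - y) * prof th y)"
  unfolding prof_def by (rule decay_convolve(1)[OF a])
 show "\<exists>C\<ge>0. \<forall>x::real^'n. (LBINT y. prof th (x - y) * prof th y) <= C * prof th x"
  unfolding prof_def using decay_convolve(2)[OF a]
  by (intro exI[of _ "2 * 2 powr (real CARD('n) + min (th / 2) 1) * (LBINT y. decay (real CARD('n) + min (th / 2) 1) (y::real^'n))"])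
   (auto intro!: mult_nonneg_nonneg integral_nonneg_AE)
qed

lemma prof_translate:
 fixes x h :: "real^'n::finite"
 assumes "th > 0"
 shows "prof th (x + h) <= (1 + norm h) powr (real CARD('n) + min (th / 2) 1) * prof th x"
 unfolding prof_def using assms by (intro decay_translate) auto

lemma decay_scale:
 assumes a: "a >= 0" and c: "0 < c" "c <= 1"
 shows "decay a (c *\<^sub>R x) <= (1 / c) powr a * decay a x"
proof -
 have "(c * (1 + norm x)) powr (- a) >= (1 + c * norm x) powr (- a)"
 proof (rule powr_mono2')
  show "0 < c * (1 + norm x)" using c by (intro mult_pos_pos) auto
  show "c * (1 + norm x) <= 1 + c * norm x" using c by (simp add: distrib_left)
 qed (use a in auto)
 moreover have "(c * (1 + norm x)) powr (- a) = (1 / c) powr a * (1 + norm x) powr (- a)"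
  using c by (simp add: powr_mult powr_divide powr_minus_divide)
 ultimately show ?thesis using c by (simp add: decay_def)
qed

lemma decay_scale_ge: "a >= 0 ==> c >= 1 ==> decay a (c *\<^sub>R x) <= decay a x"
 unfolding decay_def by (intro powr_mono2') (auto simp: mult_le_cancel_right1)

lemma rapid_prof:
 fixes f :: "real^'n::finite => complex"
 assumes "rapid f" obtains C where "C >= 0" "!!x. norm (f x) <= C * prof th x"
 unfolding prof_def using rapid_decay'[OF assms] by blast

lemma fourier_scale:
 fixes a :: "real^'n::finite => complex"
 assumes c: "c \<noteq> 0" and a: "L1 a"
 shows "fourier (\<lambda>xi. a (c *\<^sub>R xi)) x = (1 / \<bar>c\<bar> ^ CARD('n)) *\<^sub>R fourier a ((1 / c) *\<^sub>R x)"
proof -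
 have "fourier (\<lambda>xi. a (c *\<^sub>R xi)) x = (LBINT xi. cis (- ((0 + c *\<^sub>R xi) \<bullet> ((1 / c) *\<^sub>R x))) * a (0 + c *\<^sub>R xi))"
  unfolding fourier_def using c by simp
 also have "... = (1 / \<bar>c\<bar> ^ CARD('n)) *\<^sub>R (LBINT et. cis (- (et \<bullet> ((1 / c) *\<^sub>R x))) * a et)"
  by (intro integral_affine c fourier_integrable a)
 finally show ?thesis by (simp add: fourier_def)
qed

text \<open>The function phi_0 of the dyadic decomposition; it vanishes for |xi| <= 3/4.\<close>

definition ann :: "(real => real) => real^'n::finite => complex" where
 "ann ze xi = radial_cut ze xi - radial_cut ze (2 *\<^sub>R xi)"

lemma annular_ann:
 assumes "lp_cutoff ze" shows "annular (ann ze :: real^'n::finite => complex)"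
proof -
 have "test_fun (\<lambda>xi::real^'n. radial_cut ze (2 *\<^sub>R xi))" using assms by (intro test_fun_dilate test_fun_radial_cut) auto
 then have "test_fun (ann ze :: real^'n => complex)" unfolding ann_def[abs_def] by (intro test_fun_diff test_fun_radial_cut assms)
 moreover have "ann ze xi = 0" if "norm xi < 3/4" for xi :: "real^'n"
  using that assms by (simp add: ann_def radial_cut_one)
 ultimately show ?thesis unfolding annular_def by (intro conjI exI[of _ "3/4"]) auto
qed

text \<open>The annuli shrink towards the origin here and grow outwards in
  \<open>cut_telescope_up\<close>: the first sum resolves the singularity at 0, the second the high
  frequencies.\<close>

lemma cut_telescope_down: "radial_cut ze xi = radial_cut ze (2 ^ n *\<^sub>R xi) + (\<Sum>k<n. ann ze (2 ^ k *\<^sub>R xi))"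
 by (induction n) (auto simp: ann_def)

lemma cut_telescope_up: "radial_cut ze ((1/2) ^ n *\<^sub>R xi) = radial_cut ze xi + (\<Sum>j<n. ann ze ((1/2) ^ Suc j *\<^sub>R xi))"
 by (induction n) (auto simp: ann_def)

lemma heat_mult_integrable:
 fixes b :: "real^'n::finite => complex"
 assumes th: "th > 0" and b: "test_fun b"
 shows "L1 (heat th s \<odot> b)"
proof -
 obtain R where R: "R > 0" "!!xi. norm xi >= R ==> b xi = 0" using test_fun_bound[OF b] by blast
 have bi: "L1 b" by (rule test_fun_integrable[OF b])
 then have [measurable]: "b \<in> borel_measurable borel" by auto
 show ?thesis
 proof (rule Bochner_Integration.integrable_bound[OF integrable_mult_right[OF integrable_norm[OF bi], of "exp (\<bar>s\<bar> * R powr th)"]])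
  have "norm (heat th s xi * b xi) <= exp (\<bar>s\<bar> * R powr th) * norm (b xi)" for xi
  proof (cases "norm xi < R")
   case True
   have "s * norm xi powr th <= \<bar>s\<bar> * R powr th" using True th by (intro mult_mono powr_mono2) auto
   then show ?thesis by (simp add: norm_mult norm_heat mult_right_mono)
  qed (use R in auto)
  then show "AE x in lborel. norm (heat th s x * b x) <= norm (exp (\<bar>s\<bar> * R powr th) * norm (b x))" by simp
 qed measurable
qed

lemma geometric_sum_bound: "0 <= rh ==> rh < 1 ==> (\<Sum>k<n. rh ^ k) <= 1 / (1 - rh :: real)"
 by (subst sum_gp_strict) (auto simp: divide_right_mono)

text \<open>The symbol is not smooth at 0, so dyadic pieces near the origin are summed. On the
  annulus of size 2^(-k) rescaling turns \<open>s\<close> into s 2^(-k th). Subtracting 1 makes the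
  piece proportional to that number, while spreading the profile to width 2^k costs 2^(k delta) with
  delta = min(th/2, 1) < th, so the series is geometric. The subtracted cut-off has a Schwartz
  transform.\<close>

lemma kernel_bound_low:
 assumes ze: "lp_cutoff ze" and th: "th > 0" and S: "S >= 0"
 shows "\<exists>C\<ge>0. \<forall>s. \<bar>s\<bar> <= S --> (\<forall>x::real^'n::finite. norm (fourier (heat th s \<odot> radial_cut ze) x) <= C * prof th x)"
proof -
 let ?N = "CARD('n)" and ?\<delta> = "min (th / 2) 1"
 let ?cut = "radial_cut ze :: real^'n => complex" and ?ann = "ann ze :: real^'n => complex"
 let ?rh = "2 powr (?\<delta> - th)"
 have rh: "0 <= ?rh" "?rh < 1" using th by (auto intro!: two_powr_less_one simp: min_def)
 have tc: "test_fun ?cut" by (rule test_fun_radial_cut[OF ze])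
 have tci: "L1 ?cut" by (rule test_fun_integrable[OF tc])
 have an: "annular ?ann" by (rule annular_ann[OF ze])
 obtain A where A: "A >= 0" "!!s x. \<bar>s\<bar> <= S ==> norm (fourier (\<lambda>xi. (heat th s xi - 1) * ?ann xi) x) <= A * \<bar>s\<bar> * decay (real (?N + 1)) x"
  using annular_heat_diff_bound[OF th S an, of "?N + 1"] by blast
 have A': "norm (fourier (\<lambda>xi. (heat th s xi - 1) * ?ann xi) x) <= A * \<bar>s\<bar> * decay (?N + ?\<delta>) x" if s: "\<bar>s\<bar> <= S" for s x
  using A(1) by (intro order_trans[OF A(2)[OF s]] mult_left_mono decay_mono) auto
 obtain B where B: "B >= 0" "!!x. norm (fourier ?cut x) <= B * prof th x"
  using rapid_prof[OF schwartz_rapid[OF schwartz_fourier[OF schwartz_test_fun[OF tc]]]] by blast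
 let ?C1 = "A * S / (1 - ?rh)"
 have main: "norm (fourier (\<lambda>xi. (heat th s xi - 1) * ?cut xi) x) <= ?C1 * prof th x" if s: "\<bar>s\<bar> <= S" for s x
 proof -
  let ?D = "1 + exp (S * (5/3) powr th)"
  let ?I = "LBINT xi. norm (?cut xi)"
  have di: "L1 (\<lambda>xi. (heat th s xi - 1) * b xi)" if "test_fun b" for b :: "real^'n => complex"
   using Bochner_Integration.integrable_diff[OF heat_mult_integrable[OF th that, of s] test_fun_integrable[OF that]]
   by (simp add: left_diff_distrib)
  have td: "test_fun (\<lambda>xi. ?cut (2 ^ n *\<^sub>R xi))" "test_fun (\<lambda>xi. ?ann (2 ^ n *\<^sub>R xi))" for n
   by (intro test_fun_dilate tc annular_test_fun[OF an]; simp)+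
  have trm: "norm (fourier (\<lambda>xi. (heat th s xi - 1) * ?ann (2 ^ k *\<^sub>R xi)) x) <= A * S * ?rh ^ k * prof th x" for k
  proof -
   let ?c = "2 ^ k :: real" and ?\<sigma> = "s * (1 / 2 ^ k) powr th"
   have c0: "?c > 0" "?c >= 1" by auto
   have h: "heat th s xi = heat th ?\<sigma> (?c *\<^sub>R xi)" for xi :: "real^'n"
    using c0 th by (simp add: heat_scale powr_mult[symmetric] mult.assoc)
   have p1: "(1 / ?c) powr th <= 1" using th by (intro powr_le1) auto
   have \<sigma>: "\<bar>?\<sigma>\<bar> <= S" using s p1 S by (simp add: abs_mult) (meson abs_ge_zero mult_left_le order_trans powr_ge_zero)
   have "norm (fourier (\<lambda>xi. (heat th s xi - 1) * ?ann (?c *\<^sub>R xi)) x) = norm (fourier (\<lambda>xi. (\<lambda>et. (heat th ?\<sigma> et - 1) * ?ann et) (?c *\<^sub>R xi)) x)"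
    using h by simp
   also have "... = (1 / ?c ^ ?N) * norm (fourier (\<lambda>et. (heat th ?\<sigma> et - 1) * ?ann et) ((1 / ?c) *\<^sub>R x))"
   proof (subst fourier_scale)
    show "L1 (\<lambda>et. (heat th ?\<sigma> et - 1) * ?ann et)"
     using Bochner_Integration.integrable_diff[OF heat_mult_integrable[OF th annular_test_fun[OF an], of ?\<sigma>] test_fun_integrable[OF annular_test_fun[OF an]]]
     by (simp add: left_diff_distrib)
   qed auto
   also have "... <= (1 / ?c ^ ?N) * (A * \<bar>?\<sigma>\<bar> * decay (?N + ?\<delta>) ((1 / ?c) *\<^sub>R x))"
    by (intro mult_left_mono A' \<sigma>) auto
   also have "... <= (1 / ?c ^ ?N) * (A * (S * (1 / ?c) powr th) * (?c powr (?N + ?\<delta>) * decay (?N + ?\<delta>) x))"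
   proof (intro mult_left_mono mult_mono)
    show "\<bar>?\<sigma>\<bar> <= S * (1 / ?c) powr th" using s by (simp add: abs_mult mult_right_mono)
    show "decay (?N + ?\<delta>) ((1 / ?c) *\<^sub>R x) <= ?c powr (?N + ?\<delta>) * decay (?N + ?\<delta>) x"
     using decay_scale[of "?N + ?\<delta>" "1 / ?c" x] c0 th by simp
   qed (use A(1) S in auto)
   also have "... = A * S * ((1 / ?c ^ ?N) * (1 / ?c) powr th * ?c powr (?N + ?\<delta>)) * prof th x"
    by (simp add: prof_def mult_ac)
   also have "(1 / ?c ^ ?N) * (1 / ?c) powr th * ?c powr (?N + ?\<delta>) = ?rh ^ k"
   proof -
    have "1 / ?c ^ ?N = ?c powr (- real ?N)" using c0 by (simp add: powr_minus_divide powr_realpow)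
    moreover have "(1 / ?c) powr th = ?c powr (- th)" using c0 by (simp add: powr_divide powr_minus_divide)
    ultimately have "(1 / ?c ^ ?N) * (1 / ?c) powr th * ?c powr (?N + ?\<delta>) = ?c powr (- real ?N + - th + (?N + ?\<delta>))"
     by (simp only: powr_add)
    also have "... = (2 powr real k) powr (?\<delta> - th)" by (simp add: powr_realpow)
    also have "... = ?rh ^ k" by (simp add: powr_powr mult.commute powr_realpow[symmetric])
    finally show ?thesis .
   qed
   finally show ?thesis .
  qed
  \<comment> \<open>The remaining ball of radius about 2^(-n) has measure of order 2^(-nN) and a
    bounded symbol, so it disappears in the limit.\<close>
  have rest: "norm (fourier (\<lambda>xi. (heat th s xi - 1) * ?cut (2 ^ n *\<^sub>R xi)) x) <= ?D * ?I * (1 / 2 ^ ?N) ^ n" for n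
  proof -
   let ?c = "2 ^ n :: real"
   have c1: "?c >= 1" by simp
   have pw: "norm ((heat th s xi - 1) * ?cut (?c *\<^sub>R xi)) <= ?D * norm (?cut (?c *\<^sub>R xi))" for xi
   proof (cases "norm (?c *\<^sub>R xi) < 5/3")
    case False then show ?thesis using radial_cut_zero[OF ze, of "?c *\<^sub>R xi"] by simp
   next
    case True
    have "norm xi <= ?c * norm xi" using c1 by (simp add: mult_le_cancel_right1)
    then have "norm xi <= 5/3" using True by simp
    then have "norm xi powr th <= (5/3) powr th" using th by (intro powr_mono2) auto
    then have "s * norm xi powr th <= S * (5/3) powr th" using s S by (intro mult_mono) auto
    then have "norm (heat th s xi - 1) <= ?D"
     using norm_triangle_ineq4[of "heat th s xi" 1] by (simp add: norm_heat) (smt (verit) exp_le_cancel_iff)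
    then show ?thesis unfolding norm_mult by (intro mult_right_mono) auto
   qed
   have "norm (fourier (\<lambda>xi. (heat th s xi - 1) * ?cut (?c *\<^sub>R xi)) x) <= (LBINT xi. norm ((heat th s xi - 1) * ?cut (?c *\<^sub>R xi)))"
    by (rule norm_fourier_le)
   also have "... <= (LBINT xi. ?D * norm (?cut (0 + ?c *\<^sub>R xi)))"
   proof (rule integral_mono)
    show "L1 (\<lambda>xi. norm ((heat th s xi - 1) * ?cut (?c *\<^sub>R xi)))" by (rule integrable_norm[OF di[OF td(1)]])
    show "L1 (\<lambda>xi. ?D * norm (?cut (0 + ?c *\<^sub>R xi)))"
     using test_fun_integrable[OF td(1)[of n]] by simp
   qed (use pw in simp)
   also have "... = ?D * ((1 / \<bar>?c\<bar> ^ ?N) *\<^sub>R ?I)"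
    by (subst integral_mult_right_zero, subst integral_affine) (use tci in auto)
   also have "... = ?D * ?I * (1 / 2 ^ ?N) ^ n"
    by (simp add: power_divide power_mult[symmetric] mult.commute)
   finally show ?thesis .
  qed
  have bd: "norm (fourier (\<lambda>xi. (heat th s xi - 1) * ?cut xi) x) <= ?C1 * prof th x + ?D * ?I * (1 / 2 ^ ?N) ^ n" for n
  proof -
   have "(\<lambda>xi. (heat th s xi - 1) * ?cut xi) = (\<lambda>xi. (heat th s xi - 1) * ?cut (2 ^ n *\<^sub>R xi) + (\<Sum>k<n. (heat th s xi - 1) * ?ann (2 ^ k *\<^sub>R xi)))"
    by (subst cut_telescope_down[of ze _ n]) (simp add: distrib_left sum_distrib_left)
   then have "fourier (\<lambda>xi. (heat th s xi - 1) * ?cut xi) x = fourier (\<lambda>xi. (heat th s xi - 1) * ?cut (2 ^ n *\<^sub>R xi)) x + (\<Sum>k<n. fourier (\<lambda>xi. (heat th s xi - 1) * ?ann (2 ^ k *\<^sub>R xi)) x)"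
    by (simp add: fourier_add fourier_sum di td)
   then have 1: "norm (fourier (\<lambda>xi. (heat th s xi - 1) * ?cut xi) x) <= ?D * ?I * (1 / 2 ^ ?N) ^ n + (\<Sum>k<n. A * S * ?rh ^ k * prof th x)"
    by (simp only:) (intro norm_triangle_mono rest sum_norm_le trm)
   have 2: "(\<Sum>k<n. A * S * ?rh ^ k * prof th x) = A * S * prof th x * (\<Sum>k<n. ?rh ^ k)"
    by (subst sum_distrib_left) (intro sum.cong refl, simp only: mult_ac)
   have 3: "A * S * prof th x * (\<Sum>k<n. ?rh ^ k) <= A * S * prof th x * (1 / (1 - ?rh))"
    using A(1) S by (intro mult_left_mono geometric_sum_bound rh) auto
   have 4: "A * S * prof th x * (1 / (1 - ?rh)) = ?C1 * prof th x" by simp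
   show ?thesis using 1 2 3 4 by linarith
  qed
  have "(\<lambda>n. ?C1 * prof th x + ?D * ?I * (1 / 2 ^ ?N) ^ n) \<longlonglongrightarrow> ?C1 * prof th x + ?D * ?I * 0"
   by (intro tendsto_intros LIMSEQ_power_zero) (auto simp: one_less_power)
  from LIMSEQ_le_const[OF this, of "norm (fourier (\<lambda>xi. (heat th s xi - 1) * ?cut xi) x)"] bd show ?thesis by auto
 qed
 have "norm (fourier (heat th s \<odot> ?cut) x) <= (?C1 + B) * prof th x" if s: "\<bar>s\<bar> <= S" for s x
 proof -
  have "L1 (\<lambda>xi. (heat th s xi - 1) * ?cut xi)"
   using Bochner_Integration.integrable_diff[OF heat_mult_integrable[OF th tc, of s] tci] by (simp add: left_diff_distrib)
  from fourier_add[OF this tci] have "fourier (heat th s \<odot> ?cut) x = fourier (\<lambda>xi. (heat th s xi - 1) * ?cut xi) x + fourier ?cut x"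
   by (simp add: algebra_simps fun_eq_iff)
  also have "norm ... <= ?C1 * prof th x + B * prof th x" by (intro norm_triangle_mono main s B)
  finally show ?thesis by (simp add: distrib_right)
 qed
 moreover have "?C1 + B >= 0" using A(1) S rh B(1) by simp
 ultimately show ?thesis by blast
qed

lemma prof_scale:
 assumes "th > 0" "c > 0"
 shows "\<exists>C\<ge>0. \<forall>x::real^'n::finite. prof th (c *\<^sub>R x) <= C * prof th x"
proof (cases "c <= 1")
 case True
 then show ?thesis using decay_scale[of "real CARD('n) + min (th / 2) 1" c] assms
  by (intro exI[of _ "(1 / c) powr (real CARD('n) + min (th / 2) 1)"]) (auto simp: prof_def)
next
 case False
 then show ?thesis using decay_scale_ge[of "real CARD('n) + min (th / 2) 1" c] assms
  by (intro exI[of _ 1]) (auto simp: prof_def)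
qed

lemma norm_inv_fourier: "norm (inv_fourier a x) <= norm (fourier a (- x))"
 for a :: "real^'n::finite => complex"
proof -
 have "1 <= (2 * pi) ^ CARD('n)" using pi_ge_two by (intro one_le_power) linarith
 then have n: "norm (complex_of_real ((2 * pi) ^ CARD('n))) >= 1" unfolding norm_of_real by linarith
 have "norm (fourier a (- x)) / norm (complex_of_real ((2 * pi) ^ CARD('n))) <= norm (fourier a (- x)) / 1"
  by (rule divide_left_mono) (use n in auto)
 then show ?thesis unfolding inv_fourier_eq norm_divide by simp
qed

text \<open>A dilated cut-off equal to 1 on the support of \<open>om\<close> may be inserted. The
  transform of the product is then the convolution of a kernel from \<open>kernel_bound_low\<close>
  with a Schwartz function, and \<open>prof\<close> reproduces itself under convolution.\<close>

lemma kernel_bound_test_fun: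
 fixes om :: "real^'n::finite => complex"
 assumes ze: "lp_cutoff ze" and th: "th > 0" and om: "test_fun om"
 shows "\<exists>C\<ge>0. \<forall>x. norm (fourier (heat th s \<odot> om) x) <= C * prof th x"
proof -
 obtain R where R: "R > 0" "!!xi. norm xi >= R ==> om xi = 0" using test_fun_bound[OF om] by blast
 let ?a = "heat th (s * R powr th) \<odot> radial_cut ze"
 let ?b = "\<lambda>xi::real^'n. ?a ((1 / R) *\<^sub>R xi)"
 have sw: "schwartz om" by (rule schwartz_test_fun[OF om])
 have ia: "L1 ?a" by (rule heat_mult_integrable[OF th test_fun_radial_cut[OF ze]])
 have ib: "L1 ?b" using integrable_affine[OF _ ia, of "1 / R" 0] R(1) by simp
 have "(heat th s \<odot> om) = (?b \<odot> inv_fourier (fourier om))"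
 proof
  fix xi :: "real^'n"
  have "heat th (s * R powr th) ((1 / R) *\<^sub>R xi) = heat th s xi"
   using R(1) th by (subst heat_scale) (auto simp: powr_divide)
  moreover have "radial_cut ze ((1 / R) *\<^sub>R xi) = 1" if "norm xi < R"
   using that R(1) by (intro radial_cut_one[OF ze]) (simp add: field_simps)
  ultimately show "heat th s xi * om xi = ?b xi * inv_fourier (fourier om) xi"
   using R(2)[of xi] by (cases "norm xi < R") (auto simp: inv_fourier_fourier_schwartz[OF sw])
 qed
 then have eq: "fourier (heat th s \<odot> om) x = (LBINT y. inv_fourier ?b (y - x) * fourier om y)" for x
  using fourier_mult_inv_fourier[OF ib schwartz_integrable[OF schwartz_fourier[OF sw]]] by simp
 obtain C1 where C1: "C1 >= 0" "!!s' x. \<bar>s'\<bar> <= \<bar>s * R powr th\<bar> ==> norm (fourier (heat th s' \<odot> radial_cut ze) (x::real^'n)) <= C1 * prof th x"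
  using kernel_bound_low[OF ze th abs_ge_zero, of "s * R powr th", where 'n='n] by blast
 obtain C2 where C2: "C2 >= 0" "!!x::real^'n. prof th (R *\<^sub>R x) <= C2 * prof th x" using prof_scale[OF th R(1)] by blast
 obtain C3 where C3: "C3 >= 0" "!!x. norm (fourier om x) <= C3 * prof th x"
  using rapid_prof[OF schwartz_rapid[OF schwartz_fourier[OF sw]]] by blast
 obtain C4 where C4: "C4 >= 0" "!!x::real^'n. (LBINT y. prof th (x - y) * prof th y) <= C4 * prof th x"
  using prof_convolve(2)[OF th] by blast
 let ?K = "R ^ CARD('n) * C1 * C2"
 have K0: "?K >= 0" using C1 C2 R by auto
 have bb: "norm (inv_fourier ?b x) <= ?K * prof th x" for x
 proof -
  have "norm (inv_fourier ?b x) <= norm (fourier ?b (- x))" by (rule norm_inv_fourier)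
  also have "fourier ?b (- x) = R ^ CARD('n) *\<^sub>R fourier ?a (R *\<^sub>R (- x))"
   using fourier_scale[OF _ ia, of "1 / R" "- x"] R(1) by (simp add: power_divide)
  also have "norm ... <= R ^ CARD('n) * (C1 * prof th (R *\<^sub>R (- x)))"
   using R(1) C1(2)[OF order_refl, of "R *\<^sub>R (- x)"] by (simp add: mult_left_mono)
  also have "... <= R ^ CARD('n) * (C1 * (C2 * prof th (- x)))"
   using R(1) C1 C2 by (intro mult_left_mono) auto
  finally show ?thesis by (simp add: mult_ac)
 qed
 have "norm (fourier (heat th s \<odot> om) x) <= (?K * C3 * C4) * prof th x" for x
 proof -
  have ip: "L1 (\<lambda>y. (?K * C3) * (prof th (x - y) * prof th y))"
   using prof_convolve(1)[OF th, of x] by simp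
  have pb: "norm (inv_fourier ?b (y - x) * fourier om y) <= (?K * C3) * (prof th (x - y) * prof th y)" for y
   using mult_mono[OF bb[of "y - x"] C3(2)[of y] mult_nonneg_nonneg[OF K0 prof_nonneg] norm_ge_zero] by (simp add: norm_mult prof_commute[of th y x] mult_ac)
  have "norm (fourier (heat th s \<odot> om) x) <= (LBINT y. (?K * C3) * (prof th (x - y) * prof th y))"
   unfolding eq
  proof (rule norm_integral_le[OF _ ip pb])
   show "L1 (\<lambda>y. inv_fourier ?b (y - x) * fourier om y)"
   proof (rule Bochner_Integration.integrable_bound[OF ip])
    have [measurable]: "fourier ?b \<in> borel_measurable borel" "fourier om \<in> borel_measurable borel"
     using ib test_fun_integrable[OF om] by auto
    show "(\<lambda>y. inv_fourier ?b (y - x) * fourier om y) \<in> borel_measurable lborel"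
     unfolding inv_fourier_eq by measurable
    show "AE y in lborel. norm (inv_fourier ?b (y - x) * fourier om y) <= norm ((?K * C3) * (prof th (x - y) * prof th y))"
     using pb by (auto intro: order_trans[OF _ abs_ge_self])
   qed
  qed
  also have "... <= (?K * C3) * (C4 * prof th x)"
   using C4(2)[of x] K0 C3(1) by (simp add: mult_left_mono)
  finally show ?thesis by (simp add: mult_ac)
 qed
 moreover have "?K * C3 * C4 >= 0" using K0 C3 C4 by simp
 ultimately show ?thesis by blast
qed

section \<open>The kernel of the semigroup\<close>

lemma heat_decay:
 assumes th: "th > 0"
 shows "\<exists>C\<ge>0. \<forall>xi::real^'n::finite. norm (heat th (- 1) xi) <= C * decay (real m) xi"
proof -
 obtain k :: nat where k: "real m / th <= real k" using real_arch_simple by blast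
 obtain C :: real where C: "C >= 0" "!!t. t >= 0 ==> (1 + t) ^ k * exp (- (1 * t)) <= C" using power_exp_bounded[of 1 k, OF zero_less_one] by blast
 have "norm (heat th (- 1) xi) <= (2 ^ m * C) * decay (real m) xi" for xi :: "real^'n"
 proof -
  let ?r = "norm xi" and ?t = "norm xi powr th"
  have t0: "?t >= 0" by simp
  have "?r = ?t powr (1 / th)" using th by (simp add: powr_powr)
  also have "... <= (1 + ?t) powr (1 / th)" using th by (intro powr_mono2) auto
  finally have r: "?r <= (1 + ?t) powr (1 / th)" .
  have "1 <= (1 + ?t) powr (1 / th)" using th by (intro ge_one_powr_ge_zero) auto
  with r have "1 + ?r <= 2 * (1 + ?t) powr (1 / th)" by simp
  then have "(1 + ?r) ^ m <= (2 * (1 + ?t) powr (1 / th)) ^ m" by (intro power_mono) auto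
  also have "... = 2 ^ m * (1 + ?t) powr (real m / th)"
  proof -
   have "(1 + ?t) powr (1 / th) > 0" by (simp add: add_nonneg_eq_0_iff)
   then have "((1 + ?t) powr (1 / th)) ^ m = ((1 + ?t) powr (1 / th)) powr real m" by (rule powr_realpow[symmetric])
   then show ?thesis by (simp add: power_mult_distrib powr_powr)
  qed
  also have "... <= 2 ^ m * (1 + ?t) powr (real k)" using k by (intro mult_left_mono powr_mono) auto
  also have "... = 2 ^ m * (1 + ?t) ^ k" by (subst powr_realpow) (auto simp: add_pos_nonneg)
  finally have "(1 + ?r) ^ m * exp (- ?t) <= 2 ^ m * ((1 + ?t) ^ k * exp (- (1 * ?t)))"
   by (simp add: mult_right_mono mult.assoc[symmetric])
  also have "... <= 2 ^ m * C" by (intro mult_left_mono C t0) auto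
  finally have "exp (- ?t) <= 2 ^ m * C / (1 + ?r) ^ m" by (subst pos_le_divide_eq) (auto simp: mult.commute)
  then show ?thesis by (simp add: norm_heat decay_power)
 qed
 then show ?thesis using C(1) by (intro exI[of _ "2 ^ m * C"]) auto
qed

lemma heat_integrable:
 assumes th: "th > 0" and t: "t > 0"
 shows "L1 (heat th (- t) :: real^'n::finite => complex)"
proof -
 obtain C where C: "C >= 0" "!!xi::real^'n. norm (heat th (- 1) xi) <= C * decay (real (CARD('n) + 1)) xi"
  using heat_decay[OF th] by blast
 have 1: "L1 (heat th (- 1) :: real^'n => complex)"
  by (rule integrable_decay_bound[OF _ _ C(2)]) auto
 have "heat th (- t) = (\<lambda>xi::real^'n. heat th (- 1) (0 + t powr (1 / th) *\<^sub>R xi))"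
  using th t by (simp add: heat_scale powr_powr fun_eq_iff)
 then show ?thesis using integrable_affine[OF _ 1, of "t powr (1 / th)" 0] t by simp
qed

lemma kernel_bound_heat_one:
 assumes ze: "lp_cutoff ze" and th: "th > 0"
 shows "\<exists>C\<ge>0. \<forall>x::real^'n::finite. norm (fourier (heat th (- 1)) x) <= C * prof th x"
proof -
 let ?N = "CARD('n)"
 let ?cut = "radial_cut ze :: real^'n => complex" and ?ann = "ann ze :: real^'n => complex"
 let ?h = "heat th (- 1) :: real^'n => complex"
 have an: "annular ?ann" by (rule annular_ann[OF ze])
 have tc: "test_fun ?cut" by (rule test_fun_radial_cut[OF ze])
 \<comment> \<open>The annulus of size 2^j contributes 2^(jN) from its volume and, after rescaling
   to time - 2^(j th), the decay 2^(- j th L). This choice of \<open>L\<close> makes the product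
   summable.\<close>
 obtain L :: nat where L: "(real ?N + 1) / th <= real L" using real_arch_simple by blast
 let ?rh = "2 powr (real ?N - th * real L)"
 have "real ?N + 1 <= th * real L" using L th by (simp add: field_simps)
 then have rh: "0 <= ?rh" "?rh < 1" by (auto intro!: two_powr_less_one)
 obtain A where A: "A >= 0" "!!x. norm (fourier (?h \<odot> ?cut) x) <= A * prof th x"
  using kernel_bound_low[OF ze th, of 1, where 'n='n] by (metis abs_minus_cancel abs_one order_refl zero_le_one)
 obtain B where B: "B >= 0" "!!s x. s <= 0 ==> norm (fourier (heat th s \<odot> ?ann) x) <= B * decay (real (?N + 1)) x / (1 + \<bar>s\<bar>) ^ L"
  using annular_heat_bound[OF th order_refl an, of "?N + 1" L] by blast
 have td: "test_fun (\<lambda>xi. ?cut ((1/2) ^ n *\<^sub>R xi))" "test_fun (\<lambda>xi. ?ann ((1/2) ^ n *\<^sub>R xi))" for n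
  by (intro test_fun_dilate tc annular_test_fun[OF an]; simp)+
 have trm: "norm (fourier (\<lambda>xi. ?h xi * ?ann ((1/2) ^ j *\<^sub>R xi)) x) <= B * ?rh ^ j * prof th x" for j x
 proof -
  let ?c = "(1/2) ^ j :: real" and ?C = "2 ^ j :: real"
  have c0: "?c > 0" "?C >= 1" "1 / ?c = ?C" by (auto simp: power_divide)
  let ?s = "- (?C powr th)"
  have "?h xi = heat th ?s (?c *\<^sub>R xi)" for xi
   using c0 th by (subst heat_scale) (auto simp: powr_mult[symmetric] power_mult_distrib[symmetric])
  then have "norm (fourier (\<lambda>xi. ?h xi * ?ann (?c *\<^sub>R xi)) x) = norm (fourier (\<lambda>xi. (heat th ?s \<odot> ?ann) (?c *\<^sub>R xi)) x)" by simp
  also have "... = ?C ^ ?N * norm (fourier (heat th ?s \<odot> ?ann) (?C *\<^sub>R x))"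
   by (subst fourier_scale[OF _ heat_mult_integrable[OF th annular_test_fun[OF an]]]) (simp_all add: power_divide)
  also have "... <= ?C ^ ?N * (B * decay (real (?N + 1)) (?C *\<^sub>R x) / (1 + \<bar>?s\<bar>) ^ L)"
   by (intro mult_left_mono B) auto
  also have "... <= ?C ^ ?N * (B * prof th x / (?C powr th) ^ L)"
  proof (intro mult_left_mono frac_le mult_nonneg_nonneg B power_mono)
   have "decay (real (?N + 1)) (?C *\<^sub>R x) <= decay (real (?N + 1)) x" using c0 by (intro decay_scale_ge) auto
   then show "decay (real (?N + 1)) (?C *\<^sub>R x) <= prof th x" using decay_le_prof[of x th] by linarith
  qed auto
  also have "... = B * (?C ^ ?N / (?C powr th) ^ L) * prof th x" by simp
  also have "?C ^ ?N / (?C powr th) ^ L = ?rh ^ j"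
  proof -
   have "?C ^ ?N / (?C powr th) ^ L = ?C powr (real ?N - th * real L)"
    by (simp add: powr_diff powr_realpow powr_power mult.commute)
   also have "... = (2 powr real j) powr (real ?N - th * real L)" by (simp add: powr_realpow)
   also have "... = ?rh ^ j" by (simp add: powr_powr mult.commute powr_realpow[symmetric])
   finally show ?thesis .
  qed
  finally show ?thesis .
 qed
 let ?C = "A + B * (1 / (1 - ?rh))"
 have C0: "?C >= 0" using A(1) B(1) rh by auto
 have part: "norm (fourier (\<lambda>xi. ?h xi * ?cut ((1/2) ^ n *\<^sub>R xi)) x) <= ?C * prof th x" for n x
 proof -
  have e: "(\<lambda>xi. ?h xi * ?cut ((1/2) ^ n *\<^sub>R xi)) = (\<lambda>xi. ?h xi * ?cut xi + (\<Sum>j<n. ?h xi * ?ann ((1/2) ^ Suc j *\<^sub>R xi)))"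
   by (subst cut_telescope_up) (simp add: distrib_left sum_distrib_left)
  have "fourier (\<lambda>xi. ?h xi * ?cut ((1/2) ^ n *\<^sub>R xi)) x = fourier (?h \<odot> ?cut) x + (\<Sum>j<n. fourier (\<lambda>xi. ?h xi * ?ann ((1/2) ^ Suc j *\<^sub>R xi)) x)"
  proof -
   have i: "L1 (\<lambda>xi. ?h xi * ?ann ((1/2) ^ Suc j *\<^sub>R xi))" for j
    by (rule heat_mult_integrable[OF th td(2)])
   show ?thesis unfolding e
    by (subst fourier_add[OF heat_mult_integrable[OF th tc] Bochner_Integration.integrable_sum[OF i]], subst fourier_sum[OF i]) (rule refl)
  qed
  then have 1: "norm (fourier (\<lambda>xi. ?h xi * ?cut ((1/2) ^ n *\<^sub>R xi)) x) <= A * prof th x + (\<Sum>j<n. B * ?rh ^ Suc j * prof th x)"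
   by (simp only:) (intro norm_triangle_mono A sum_norm_le trm)
  have 2: "(\<Sum>j<n. B * ?rh ^ Suc j * prof th x) = B * prof th x * (\<Sum>j<n. ?rh ^ Suc j)"
   by (subst sum_distrib_left) (intro sum.cong refl, simp only: mult_ac)
  have "(\<Sum>j<n. ?rh ^ Suc j) <= (\<Sum>j<n. ?rh ^ j)" using rh by (intro sum_mono) (simp add: mult_left_le_one_le)
  with geometric_sum_bound[OF rh, of n] have "(\<Sum>j<n. ?rh ^ Suc j) <= 1 / (1 - ?rh)" by linarith
  then have 3: "B * prof th x * (\<Sum>j<n. ?rh ^ Suc j) <= B * prof th x * (1 / (1 - ?rh))"
   using B(1) by (intro mult_left_mono) auto
  have 4: "A * prof th x + B * prof th x * (1 / (1 - ?rh)) = ?C * prof th x" by (simp add: distrib_right)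
  show ?thesis using 1 2 3 4 by linarith
 qed
 have "norm (fourier ?h x) <= ?C * prof th x" for x
 proof -
  have hi: "L1 ?h" using heat_integrable[OF th, of 1] by simp
  have cc: "continuous_on UNIV ?cut" using smooth_on_continuous smooth_radial_cut[OF ze] by blast
  then have [measurable]: "?cut \<in> borel_measurable borel" by (rule borel_measurable_continuous_onI)
  have "(\<lambda>n. fourier (\<lambda>xi. ?h xi * ?cut ((1/2) ^ n *\<^sub>R xi)) x) \<longlonglongrightarrow> fourier (\<lambda>xi. ?h xi * ?cut (0 *\<^sub>R xi)) x"
   unfolding fourier_def
  proof (rule integral_dominated_convergence[where w="\<lambda>xi. norm (?h xi)"])
   show "AE xi in lborel. (\<lambda>n. cis (- (xi \<bullet> x)) * (?h xi * ?cut ((1/2) ^ n *\<^sub>R xi))) \<longlonglongrightarrow> cis (- (xi \<bullet> x)) * (?h xi * ?cut (0 *\<^sub>R xi))"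
    by (intro AE_I2 tendsto_mult tendsto_const continuous_on_tendsto_compose[OF cc] tendsto_scaleR LIMSEQ_power_zero) auto
   show "AE xi in lborel. norm (cis (- (xi \<bullet> x)) * (?h xi * ?cut ((1/2) ^ n *\<^sub>R xi))) <= norm (?h xi)" for n
    by (intro AE_I2) (simp add: norm_mult mult_left_le[OF norm_radial_cut_le[OF ze]])
  qed (use hi in auto)
  then have "(\<lambda>n. norm (fourier (\<lambda>xi. ?h xi * ?cut ((1/2) ^ n *\<^sub>R xi)) x)) \<longlonglongrightarrow> norm (fourier ?h x)"
   using radial_cut_one[OF ze, of "0 :: real^'n"] by (intro tendsto_norm) simp
  then show ?thesis using part LIMSEQ_le_const2 by blast
 qed
 then show ?thesis using C0 by blast
qed

lemma kernel_bound_heat: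
 assumes ze: "lp_cutoff ze" and th: "th > 0"
 shows "\<exists>C\<ge>0. \<forall>t>0. \<forall>x::real^'n::finite. norm (fourier (heat th (- t)) x)
  <= C * (1 / (t powr (1 / th)) ^ CARD('n) * prof th ((1 / t powr (1 / th)) *\<^sub>R x))"
proof -
 obtain C where C: "C >= 0" "!!x::real^'n. norm (fourier (heat th (- 1)) x) <= C * prof th x"
  using kernel_bound_heat_one[OF assms] by blast
 have "norm (fourier (heat th (- t)) x) <= C * (1 / (t powr (1 / th)) ^ CARD('n) * prof th ((1 / t powr (1 / th)) *\<^sub>R x))"
  if t: "t > 0" for t and x :: "real^'n"
 proof -
  let ?c = "t powr (1 / th)"
  have c: "?c > 0" using t by simp
  have "heat th (- t) = (\<lambda>xi::real^'n. heat th (- 1) (?c *\<^sub>R xi))"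
   using th t by (simp add: heat_scale powr_powr fun_eq_iff)
  then have "fourier (heat th (- t)) x = fourier (\<lambda>xi. heat th (- 1) (?c *\<^sub>R xi)) x" by simp
  also have "... = (1 / ?c ^ CARD('n)) *\<^sub>R fourier (heat th (- 1)) ((1 / ?c) *\<^sub>R x)"
   using c heat_integrable[OF th, of 1] by (subst fourier_scale) auto
  also have "norm ... <= (1 / ?c ^ CARD('n)) * (C * prof th ((1 / ?c) *\<^sub>R x))"
   using c C(2) by (simp add: divide_right_mono)
  finally show ?thesis by (simp add: mult_ac)
 qed
 then show ?thesis using C(1) by blast
qed

section \<open>Functions that are small up to an integrable part\<close>

text \<open>The class contains every \<open>L\<^sup>p\<close> with \<open>1 \<le> p < \<infinity>\<close> but no nonzero polynomial. This is what
  excludes the polynomial ambiguity in recovering \<open>\<mu>\<close> from \<open>S(t)\<mu>\<close>.\<close>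

definition tame :: "(real^'n::finite => complex) => bool" where
 "tame g \<longleftrightarrow> g \<in> borel_measurable borel \<and>
  (\<forall>e>0. \<exists>G. L1 G \<and> (\<forall>x. 0 <= G x) \<and> (AE x in lborel. norm (g x) <= e + (G x :: real)))"

lemma tame_measurable: "tame g ==> g \<in> borel_measurable borel"
 by (simp add: tame_def)

lemma tame_add:
 assumes "tame f" "tame g" shows "tame (\<lambda>x. f x + g x)"
 unfolding tame_def
proof (intro conjI allI impI)
 show "(\<lambda>x. f x + g x) \<in> borel_measurable borel" using assms by (auto simp: tame_def)
 fix e :: real assume e: "e > 0"
 obtain F where F: "L1 F" "!!x. 0 <= F x" "AE x in lborel. norm (f x) <= e / 2 + F x"
  using assms(1) e unfolding tame_def by (meson half_gt_zero)
 obtain G where G: "L1 G" "!!x. 0 <= G x" "AE x in lborel. norm (g x) <= e / 2 + G x"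
  using assms(2) e unfolding tame_def by (meson half_gt_zero)
 have "AE x in lborel. norm (f x + g x) <= e + (F x + G x)"
  using F(3) G(3)
 proof eventually_elim
  case (elim x)
  then show ?case using norm_triangle_ineq[of "f x" "g x"] by linarith
 qed
 then show "\<exists>G. L1 G \<and> (\<forall>x. 0 <= G x) \<and> (AE x in lborel. norm (f x + g x) <= e + G x)"
  using F G by (intro exI[of _ "\<lambda>x. F x + G x"]) auto
qed

lemma tame_uminus: "tame g ==> tame (\<lambda>x. - g x)"
 by (simp add: tame_def)

lemma tame_AE_cong:
 assumes "tame f" "g \<in> borel_measurable borel" "AE x in lborel. f x = g x" shows "tame g"
 unfolding tame_def
proof (intro conjI allI impI assms(2))
 fix e :: real assume "e > 0"
 then obtain F where F: "L1 F" "!!x. 0 <= F x" "AE x in lborel. norm (f x) <= e + F x"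
  using assms(1) unfolding tame_def by meson
 have "AE x in lborel. norm (g x) <= e + F x" using F(3) assms(3) by eventually_elim simp
 then show "\<exists>G. L1 G \<and> (\<forall>x. 0 <= G x) \<and> (AE x in lborel. norm (g x) <= e + G x)" using F by blast
qed

text \<open>Above the level \<open>e\<close> one has (a/e)^(p - 1) >= 1. Splitting at a free level
  that is chosen later takes the place of Hoelder's inequality in the estimates that follow.\<close>

lemma young_split: assumes "p >= 1" "e > 0" "a >= (0::real)" shows "a <= e + e powr (1 - p) * a powr p"
proof (cases "a <= e")
 case True then show ?thesis using assms by (simp add: add_increasing2)
next
 case False
 have "(e / a) powr (p - 1) <= 1" using False assms by (intro powr_le1) auto
 then have "(a / e) powr (p - 1) >= 1" using False assms by (intro ge_one_powr_ge_zero) auto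
 then have "a * 1 <= a * (a / e) powr (p - 1)" using assms by (intro mult_left_mono) auto
 also have "... = e powr (1 - p) * a powr p"
  using False assms by (simp add: powr_divide powr_diff field_simps)
 finally show ?thesis using assms by simp
qed

lemma tame_Lp:
 assumes "p >= 1" "g \<in> borel_measurable borel" "L1 (\<lambda>x. norm (g x) powr p)"
 shows "tame g"
 unfolding tame_def
proof (intro conjI allI impI)
 fix e :: real assume e: "e > 0"
 have "norm (g x) <= e + e powr (1 - p) * norm (g x) powr p" for x
  using young_split[OF assms(1) e] by simp
 then show "\<exists>G. L1 G \<and> (\<forall>x. 0 <= G x) \<and> (AE x in lborel. norm (g x) <= e + G x)"
  using assms(3) by (intro exI[of _ "\<lambda>x. e powr (1 - p) * norm (g x) powr p"]) auto
qed (rule assms(2))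

lemma tame_prof_integrable:
 fixes g h :: "real^'n::finite => complex"
 assumes th: "th > 0" and g: "tame g" and [measurable]: "h \<in> borel_measurable borel" and h: "!!x. norm (h x) <= C * prof th x"
 shows "L1 (g \<odot> h)"
proof -
 have [measurable]: "g \<in> borel_measurable borel" by (rule tame_measurable[OF g])
 obtain G where G: "L1 G" "!!x. 0 <= G x" "AE x in lborel. norm (g x) <= 1 + G x"
  using g unfolding tame_def by (meson zero_less_one)
 have C0: "C >= 0" using h[of 0] prof_pos[of th "0 :: real^'n"] by (smt (verit) mult_neg_pos norm_ge_zero)
 show ?thesis
 proof (rule Bochner_Integration.integrable_bound)
  show "L1 (\<lambda>x. C * prof th x + C * G x)" using integrable_prof[OF th] G(1) by auto
  show "AE x in lborel. norm (g x * h x) <= norm (C * prof th x + C * G x)"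
   using G(3)
  proof eventually_elim
   case (elim x)
   have "norm (g x * h x) <= (1 + G x) * (C * prof th x)"
    unfolding norm_mult using elim h G(2) by (intro mult_mono) auto
   also have "... <= C * prof th x + C * G x"
   proof -
    have "G x * prof th x <= G x" by (intro mult_left_le prof_le_one th G)
    from mult_left_mono[OF this C0] show ?thesis by (simp add: algebra_simps)
   qed
   finally show ?case by simp
  qed
 qed measurable
qed

text \<open>The averaging profile has constant mass and height at most 2^(-nN). The part of
  \<open>g\<close> below \<open>e\<close> contributes at most \<open>e\<close> times the mass, the
  integrable part at most 2^(-nN) times its integral, both uniformly in the centre \<open>y\<close>.
  Averages of a nonzero constant would not tend to 0.\<close>

lemma tame_spread:
 fixes g :: "real^'n::finite => complex"
 assumes th: "th > 0" and g: "tame g"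
 shows "\<exists>\<delta>. \<delta> \<longlonglongrightarrow> 0 \<and> (\<forall>n y. (\<integral>\<^sup>+x. ennreal (norm (g x) * ((1 / 2 ^ n) ^ CARD('n) * prof th ((1 / 2 ^ n) *\<^sub>R (x - y)))) \<partial>lborel) <= ennreal (\<delta> n) \<and> \<delta> n >= 0)"
proof -
 have [measurable]: "g \<in> borel_measurable borel" by (rule tame_measurable[OF g])
 let ?Q = "\<lambda>n y x. (1 / 2 ^ n) ^ CARD('n) * prof th ((1 / 2 ^ n) *\<^sub>R (x - y :: real^'n))"
 let ?I = "LBINT x. prof th (x :: real^'n)"
 have I0: "?I >= 0" by (intro integral_nonneg_AE) auto
 let ?S = "\<lambda>n. SUP y. (\<integral>\<^sup>+x. ennreal (norm (g x) * ?Q n y x) \<partial>lborel)"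
 have Q: "(\<integral>\<^sup>+x. ennreal (?Q n y x) \<partial>lborel) = ennreal ?I" for n y
 proof -
  have "(\<integral>\<^sup>+x. ennreal (?Q n y x) \<partial>lborel) = ennreal ((1 / 2 ^ n) ^ CARD('n)) * (\<integral>\<^sup>+x. ennreal (prof th (- ((1 / 2 ^ n) *\<^sub>R y) + (1 / 2 ^ n) *\<^sub>R x)) \<partial>lborel)"
   by (subst nn_integral_cmult[symmetric]) (auto simp: ennreal_mult scaleR_right_diff_distrib)
  also have "... = ennreal ((1 / 2 ^ n) ^ CARD('n)) * (ennreal (1 / \<bar>1 / 2 ^ n\<bar> ^ CARD('n)) * (\<integral>\<^sup>+x. ennreal (prof th (x :: real^'n)) \<partial>lborel))"
   by (subst nn_integral_affine) auto
  also have "... = (\<integral>\<^sup>+x. ennreal (prof th (x :: real^'n)) \<partial>lborel)"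
   by (simp add: mult.assoc[symmetric] ennreal_mult[symmetric])
  also have "... = ennreal ?I" by (rule nn_integral_eq_integral[OF integrable_prof[OF th]]) auto
  finally show ?thesis .
 qed
 have bound: "?S n <= ennreal (e * ?I + (1 / 2 ^ CARD('n)) ^ n * (LBINT x. G x))"
  if e: "e > 0" and G: "L1 G" "!!x. 0 <= G x" "AE x in lborel. norm (g x) <= e + G x" for e G n
 proof (rule SUP_least)
  fix y
  have [measurable]: "G \<in> borel_measurable borel" using G(1) by auto
  have "(\<integral>\<^sup>+x. ennreal (norm (g x) * ?Q n y x) \<partial>lborel) <= (\<integral>\<^sup>+x. ennreal e * ennreal (?Q n y x) + ennreal ((1 / 2 ^ CARD('n)) ^ n) * ennreal (G x) \<partial>lborel)"
  proof (rule nn_integral_mono_AE)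
   show "AE x in lborel. ennreal (norm (g x) * ?Q n y x) <= ennreal e * ennreal (?Q n y x) + ennreal ((1 / 2 ^ CARD('n)) ^ n) * ennreal (G x)"
    using G(3)
   proof eventually_elim
    case (elim x)
    have "?Q n y x <= (1 / 2 ^ n) ^ CARD('n)" using prof_le_one[OF th] by (intro mult_left_le) auto
    also have "... = (1 / 2 ^ CARD('n)) ^ n" by (simp add: power_divide power_mult[symmetric] mult.commute)
    finally have q: "?Q n y x <= (1 / 2 ^ CARD('n)) ^ n" .
    have "norm (g x) * ?Q n y x <= (e + G x) * ?Q n y x" using elim by (intro mult_right_mono) auto
    also have "... <= e * ?Q n y x + (1 / 2 ^ CARD('n)) ^ n * G x"
     using mult_left_mono[OF q G(2)[of x]] by (simp only: distrib_right mult.commute[of "G x"])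
    finally have "ennreal (norm (g x) * ?Q n y x) <= ennreal (e * ?Q n y x + (1 / 2 ^ CARD('n)) ^ n * G x)" by (rule ennreal_leI)
    then show ?case using e G(2)[of x] by (simp add: ennreal_plus[symmetric] ennreal_mult[symmetric] del: ennreal_plus)
   qed
  qed
  also have "... = ennreal e * ennreal ?I + ennreal ((1 / 2 ^ CARD('n)) ^ n) * ennreal (LBINT x. G x)"
   using G by (subst nn_integral_add) (auto simp: nn_integral_cmult Q nn_integral_eq_integral)
  also have "... = ennreal (e * ?I + (1 / 2 ^ CARD('n)) ^ n * (LBINT x. G x))"
   using e I0 G(2) by (simp add: ennreal_plus[symmetric] ennreal_mult[symmetric] integral_nonneg_AE del: ennreal_plus)
  finally show "(\<integral>\<^sup>+x. ennreal (norm (g x) * ?Q n y x) \<partial>lborel) <= ennreal (e * ?I + (1 / 2 ^ CARD('n)) ^ n * (LBINT x. G x))" .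
 qed
 let ?\<delta> = "\<lambda>n. enn2real (?S n)"
 have fin: "?S n < \<infinity>" for n
 proof -
  obtain G where G: "L1 G" "!!x. 0 <= G x" "AE x in lborel. norm (g x) <= 1 + G x"
   using g unfolding tame_def by (meson zero_less_one)
  show ?thesis using bound[OF zero_less_one G, of n] by (rule order_le_less_trans) simp
 qed
 have "?\<delta> \<longlonglongrightarrow> 0"
 proof (rule LIMSEQ_I)
  fix r :: real assume r: "r > 0"
  \<comment> \<open>The added 1 keeps the division in \<open>e\<close> safe when only nonnegativity
    of the mass is known.\<close>
  define J where "J = ?I + 1"
  have J: "J > 0" unfolding J_def by (intro add_nonneg_pos I0) auto
  define e where "e = r / (2 * J)"
  have e: "e > 0" using r J by (simp add: e_def)
  have "e * ?I <= e * J" using e by (intro mult_left_mono) (auto simp: J_def)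
  also have "e * J = r / 2" using J by (simp add: e_def)
  finally have eI: "e * ?I <= r / 2" .
  obtain G where G: "L1 G" "!!x. 0 <= G x" "AE x in lborel. norm (g x) <= e + G x"
   using g e unfolding tame_def by meson
  have "(\<lambda>n. (1 / 2 ^ CARD('n)) ^ n * (LBINT x. G x)) \<longlonglongrightarrow> 0 * (LBINT x. G x)"
   by (intro tendsto_intros LIMSEQ_power_zero) (auto simp: one_less_power)
  then have "\<forall>\<^sub>F n in sequentially. (1 / 2 ^ CARD('n)) ^ n * (LBINT x. G x) < r / 2"
   using r by (intro order_tendstoD(2)) auto
  then obtain n0 where n0: "!!n. n >= n0 ==> (1 / 2 ^ CARD('n)) ^ n * (LBINT x. G x) < r / 2"
   unfolding eventually_sequentially by blast
  have "norm (?\<delta> n - 0) < r" if "n >= n0" for n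
  proof -
   have "?\<delta> n <= e * ?I + (1 / 2 ^ CARD('n)) ^ n * (LBINT x. G x)"
    by (intro enn2real_leI bound[OF e G] add_nonneg_nonneg mult_nonneg_nonneg I0 integral_nonneg_AE) (use e G(2) in auto)
   then show ?thesis using n0[OF that] eI by simp
  qed
  then show "\<exists>no. \<forall>n\<ge>no. norm (?\<delta> n - 0) < r" by blast
 qed
 moreover have "(\<integral>\<^sup>+x. ennreal (norm (g x) * ?Q n y x) \<partial>lborel) <= ennreal (?\<delta> n)" for n y
 proof -
  have "(\<integral>\<^sup>+x. ennreal (norm (g x) * ?Q n y x) \<partial>lborel) <= ?S n" by (rule SUP_upper) simp
  also have "... = ennreal (?\<delta> n)" using fin[of n] by (simp add: less_top)
  finally show ?thesis .
 qed
 ultimately show ?thesis by (intro exI[of _ ?\<delta>]) auto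
qed

section \<open>Jets at the origin\<close>

text \<open>One functional is eliminated at a time. If \<open>l j\<close> is nonzero at some
  \<open>w\<close> killed by the others, subtracting the multiple (A w / l j w) of
  \<open>l j\<close> from \<open>A\<close> reduces to the remaining ones; otherwise they already
  suffice. The vector space enters through a predicate and explicit operations because test
  functions form only part of a function type.\<close>

lemma linear_combination_of_functionals:
 fixes A :: "'v => complex" and l :: "'i => 'v => complex"
  and add :: "'v => 'v => 'v" and scl :: "complex => 'v => 'v"
 assumes I: "finite I"
  and V: "!!u v. V u ==> V v ==> V (add u v)" "!!c v. V v ==> V (scl c v)"
  and l: "!!i u v. i \<in> I ==> V u ==> V v ==> l i (add u v) = l i u + l i v" "!!i c v. i \<in> I ==> V v ==> l i (scl c v) = c * l i v"
  and A: "!!u v. V u ==> V v ==> A (add u v) = A u + A v" "!!c v. V v ==> A (scl c v) = c * A v"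
  and K: "!!v. V v ==> (!!i. i \<in> I ==> l i v = 0) ==> A v = 0"
 shows "\<exists>c. \<forall>v. V v --> A v = (\<Sum>i\<in>I. c i * l i v)"
 using I l A K
proof (induction I arbitrary: A rule: finite_induct)
 case empty
 then show ?case by auto
next
 case (insert j I)
 show ?case
 proof (cases "\<exists>w. V w \<and> (\<forall>i\<in>I. l i w = 0) \<and> l j w \<noteq> 0")
  case False
  then have "!!v. V v ==> (!!i. i \<in> I ==> l i v = 0) ==> A v = 0" using insert.prems(5) by blast
  then obtain c where c: "!!v. V v ==> A v = (\<Sum>i\<in>I. c i * l i v)"
   using insert.IH[of A] insert.prems by blast
  have "A v = (\<Sum>i\<in>insert j I. (c(j := 0)) i * l i v)" if "V v" for v
  proof -
   have "(\<Sum>i\<in>I. (c(j := 0)) i * l i v) = (\<Sum>i\<in>I. c i * l i v)" using insert.hyps by (intro sum.cong) auto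
   then show ?thesis using c[OF that] insert.hyps by simp
  qed
  then show ?thesis by blast
 next
  case True
  then obtain w where w: "V w" "!!i. i \<in> I ==> l i w = 0" "l j w \<noteq> 0" by blast
  let ?k = "A w / l j w"
  let ?A = "\<lambda>v. A v - ?k * l j v"
  have "\<exists>c. \<forall>v. V v --> ?A v = (\<Sum>i\<in>I. c i * l i v)"
  proof (rule insert.IH)
   show "?A (add u v) = ?A u + ?A v" if "V u" "V v" for u v
    using insert.prems(1,3) that by (simp add: algebra_simps)
   show "?A (scl c v) = c * ?A v" if "V v" for c v
    using insert.prems(2,4) that by (simp add: algebra_simps)
   show "?A v = 0" if v: "V v" "!!i. i \<in> I ==> l i v = 0" for v
   proof -
    let ?u = "add v (scl (- (l j v / l j w)) w)"
    have "V ?u" using V v(1) w(1) by blast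
    moreover have "l i ?u = 0" if "i \<in> insert j I" for i
     using that insert.prems(1,2) V v w by auto
    ultimately have "A ?u = 0" by (rule insert.prems(5))
    then show ?thesis using insert.prems(3,4) V v w by (simp add: field_simps)
   qed
  qed (use insert.prems(1,2) in auto)
  then obtain c where c: "!!v. V v ==> ?A v = (\<Sum>i\<in>I. c i * l i v)" by blast
  have "A v = (\<Sum>i\<in>insert j I. (c(j := ?k)) i * l i v)" if "V v" for v
  proof -
   have "(\<Sum>i\<in>I. (c(j := ?k)) i * l i v) = (\<Sum>i\<in>I. c i * l i v)" using insert.hyps by (intro sum.cong) auto
   then show ?thesis using c[OF that] insert.hyps by (simp add: algebra_simps)
  qed
  then show ?thesis by blast
 qed
qed

text \<open>The first derivatives are homogeneous of degree one less and vanish by induction, so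
  \<open>P\<close> is constant, and a constant that is homogeneous of positive degree is 0. In
  degree 0, continuity along the ray to the origin gives P(x) = P(0).\<close>

lemma homogeneous_zero:
 fixes P :: "real^'n::finite => complex"
 assumes "smooth_on UNIV P" "!!c x. c > 0 ==> P (c *\<^sub>R x) = of_real c ^ d * P x"
  and "!!js. length js = d ==> iter_partial js P 0 = 0"
 shows "P x = 0"
 using assms
proof (induction d arbitrary: P x)
 case 0
 have "(\<lambda>n. P ((1 / real (Suc n)) *\<^sub>R x)) \<longlonglongrightarrow> P (0 *\<^sub>R x)"
  by (intro continuous_on_tendsto_compose[OF smooth_on_continuous[OF 0(1)]] tendsto_scaleR tendsto_const
    LIMSEQ_inverse_real_of_nat[unfolded inverse_eq_divide]) auto
 moreover have "P ((1 / real (Suc n)) *\<^sub>R x) = P x" for n using 0(2)[of "1 / real (Suc n)" x] by simp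
 ultimately have "P x = P 0" using LIMSEQ_const_iff[of "P x" "P 0"] by simp
 also have "... = 0" using 0(3)[of "[]"] by simp
 finally show ?case .
next
 case (Suc d)
 have z: "partial i P y = 0" for i y
 proof (rule Suc.IH)
  show "smooth_on UNIV (partial i P)" using Suc.prems(1) by (rule smooth_on_partial)
  show "partial i P (c *\<^sub>R x) = of_real c ^ d * partial i P x" if c: "c > 0" for c x
  proof -
   have "(\<lambda>x. P (c *\<^sub>R x)) = (\<lambda>x. of_real c ^ Suc d * P x)" using Suc.prems(2)[OF c] by (simp add: fun_eq_iff)
   then have "partial i (\<lambda>x. P (c *\<^sub>R x)) x = partial i (\<lambda>x. of_real c ^ Suc d * P x) x" by simp
   then have "of_real c * partial i P (c *\<^sub>R x) = of_real c * (of_real c ^ d * partial i P x)"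
    unfolding partial_dilate_smooth[OF Suc.prems(1)] partial_mult_smooth[OF smooth_on_const Suc.prems(1)] by simp
   then show ?thesis using c by simp
  qed
  show "iter_partial js (partial i P) 0 = 0" if "length js = d" for js
   using Suc.prems(3)[of "js @ [i]"] that by (simp add: iter_partial_snoc)
 qed
 have "(P has_derivative (\<lambda>h. 0)) (at y within UNIV)" for y
  using has_derivative_partial[OF smooth_on_differentiable[OF Suc.prems(1)], of y] by (simp add: z)
 then obtain c where c: "!!y. P y = c" using has_derivative_zero_constant[of UNIV P] by auto
 have "P (2 *\<^sub>R 0) = of_real 2 ^ Suc d * P 0" by (rule Suc.prems(2)) simp
 then have "c = 2 ^ Suc d * c" using c by simp
 moreover have "(2 :: complex) ^ Suc d \<noteq> 1" by (metis norm_numeral norm_power norm_one one_less_numeral_iff one_less_power order_less_irrefl semiring_norm(76) zero_less_Suc)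
 ultimately show ?case using c by (metis mult_cancel_right1)
qed

text \<open>The first derivatives vanish to one order less; the mean value theorem along the segment
  from the origin adds the missing factor |x|.\<close>

lemma taylor_bound:
 fixes f :: "real^'n::finite => complex"
 assumes "test_fun f" "!!is. length is < a ==> iter_partial is f 0 = 0"
 shows "\<exists>C\<ge>0. \<forall>x. norm (f x) <= C * norm x ^ a"
 using assms
proof (induction a arbitrary: f)
 case 0
 then show ?case using test_fun_sup[OF 0(1)] by (metis mult.right_neutral power_0)
next
 case (Suc a)
 have "\<forall>i. \<exists>C. C >= 0 \<and> (\<forall>x. norm (partial i f x) <= C * norm x ^ a)"
 proof
  fix i
  have "iter_partial is (partial i f) 0 = 0" if "length is < a" for "is"
   using Suc.prems(2)[of "is @ [i]"] that by (simp add: iter_partial_snoc)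
  then show "\<exists>C. C >= 0 \<and> (\<forall>x. norm (partial i f x) <= C * norm x ^ a)"
   using Suc.IH[OF test_fun_partial[OF Suc.prems(1)]] by blast
 qed
 from choice[OF this] obtain C where C: "!!i. C i >= 0" "!!i x. norm (partial i f x) <= C i * norm x ^ a" by blast
 have sm: "smooth_on UNIV f" using Suc.prems(1) by (simp add: test_fun_def)
 have "norm (f x) <= (\<Sum>i\<in>UNIV. C i) * norm x ^ Suc a" for x
 proof -
  have D: "((\<lambda>s. f (s *\<^sub>R x)) has_derivative (\<lambda>v. \<Sum>i\<in>UNIV. (v *\<^sub>R x) $ i *\<^sub>R partial i f (s *\<^sub>R x))) (at s)" for s
  proof -
   have "((\<lambda>s. s *\<^sub>R x) has_derivative (\<lambda>v. v *\<^sub>R x)) (at s)" by (auto intro!: derivative_eq_intros)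
   from has_derivative_compose[OF this has_derivative_partial[OF smooth_on_differentiable[OF sm]]] show ?thesis by simp
  qed
  have "continuous_on {0..1} (\<lambda>s. f (s *\<^sub>R x))"
   using D has_derivative_continuous by (intro continuous_at_imp_continuous_on) blast
  from mvt_general[OF zero_less_one this D] obtain s where s: "0 < s" "s < 1"
   "norm (f (1 *\<^sub>R x) - f (0 *\<^sub>R x)) <= norm (\<Sum>i\<in>UNIV. ((1 - 0) *\<^sub>R x) $ i *\<^sub>R partial i f (s *\<^sub>R x))" by auto
  have "f 0 = 0" using Suc.prems(2)[of "[]"] by simp
  with s(3) have "norm (f x) <= norm (\<Sum>i\<in>UNIV. x $ i *\<^sub>R partial i f (s *\<^sub>R x))" by simp
  also have "... <= (\<Sum>i\<in>UNIV. norm x * (C i * norm x ^ a))"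
  proof (rule sum_norm_le)
   fix i
   have "norm (partial i f (s *\<^sub>R x)) <= C i * norm (s *\<^sub>R x) ^ a" by (rule C)
   also have "... <= C i * norm x ^ a"
    using C(1)[of i] s by (intro mult_left_mono power_mono) (auto simp: mult_left_le_one_le)
   finally show "norm (x $ i *\<^sub>R partial i f (s *\<^sub>R x)) <= norm x * (C i * norm x ^ a)"
    using component_le_norm_cart[of x i] by (simp add: mult_mono)
  qed
  also have "... = (\<Sum>i\<in>UNIV. C i) * norm x ^ Suc a" by (simp add: sum_distrib_right sum_distrib_left mult_ac)
  finally show ?thesis .
 qed
 then show ?case using C(1) by (intro exI[of _ "\<Sum>i\<in>UNIV. C i"]) (auto intro: sum_nonneg)
qed

text \<open>On the support |x| < 2 / 2^n the function is O(2^(-na)), and each derivative costs at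
  most a factor 2^n: on \<open>Ph\<close> by dilation, on \<open>f\<close> because the order of
  vanishing drops by one.\<close>

lemma localized_derivative_bound:
 fixes f Ph :: "real^'n::finite => complex"
 assumes "test_fun f" "test_fun Ph" "!!x. norm x >= 2 ==> Ph x = 0"
  and "!!is. length is < a ==> iter_partial is f 0 = 0"
 shows "\<exists>C\<ge>0. \<forall>n x. norm (iter_partial js (\<lambda>x. f x * Ph (2 ^ n *\<^sub>R x)) x) <= C * ((2 ^ n) ^ length js / (2 ^ n) ^ a)"
 using assms
proof (induction js arbitrary: f Ph a rule: rev_induct)
 case Nil
 obtain C where C: "C >= 0" "!!x. norm (f x) <= C * norm x ^ a" using taylor_bound[OF Nil(1,4)] by blast
 obtain D where D: "D >= 0" "!!x. norm (Ph x) <= D" using test_fun_sup[OF Nil(2)] by blast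
 have "norm (f x * Ph (2 ^ n *\<^sub>R x)) <= (C * 2 ^ a * D) * (1 / (2 ^ n) ^ a)" for n x
 proof (cases "norm (2 ^ n *\<^sub>R x) < 2")
  case False then show ?thesis using Nil(3) C D by simp
 next
  case True
  then have "norm x <= 2 / 2 ^ n" by (simp add: field_simps)
  then have "norm x ^ a <= (2 / 2 ^ n) ^ a" by (intro power_mono) auto
  then have "norm (f x) <= C * (2 / 2 ^ n) ^ a" using C by (meson mult_left_mono order_trans)
  then have "norm (f x) * norm (Ph (2 ^ n *\<^sub>R x)) <= (C * (2 / 2 ^ n) ^ a) * D" using C D by (intro mult_mono) auto
  then show ?thesis by (simp add: norm_mult power_divide mult_ac)
 qed
 then show ?case using C D by (intro exI[of _ "C * 2 ^ a * D"]) auto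
next
 case (snoc i js)
 have s: "smooth_on UNIV f" "smooth_on UNIV Ph" using snoc.prems by (auto simp: test_fun_def)
 have p: "iter_partial (js @ [i]) (\<lambda>x. f x * Ph (2 ^ n *\<^sub>R x)) x =
  iter_partial js (\<lambda>x. partial i f x * Ph (2 ^ n *\<^sub>R x)) x + 2 ^ n * iter_partial js (\<lambda>x. f x * partial i Ph (2 ^ n *\<^sub>R x)) x" for n x
 proof -
  have d: "smooth_on UNIV (\<lambda>x. Ph (2 ^ n *\<^sub>R x))" "smooth_on UNIV (\<lambda>x. partial i Ph (2 ^ n *\<^sub>R x))"
   using s by (auto intro: smooth_on_dilate smooth_on_partial)
  have "partial i (\<lambda>x. f x * Ph (2 ^ n *\<^sub>R x)) = (\<lambda>x. partial i f x * Ph (2 ^ n *\<^sub>R x) + 2 ^ n * (f x * partial i Ph (2 ^ n *\<^sub>R x)))"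
   unfolding partial_mult_smooth[OF s(1) d(1)] partial_dilate_smooth[OF s(2)] by (simp add: fun_eq_iff)
  then show ?thesis unfolding iter_partial_snoc using s d
   by (simp add: iter_partial_add iter_partial_cmult smooth_on_mult smooth_on_partial)
 qed
 \<comment> \<open>The sphere |x| = 2 needs an argument: the derivative is supported in the closed
   ball, and continuity from outside removes the sphere itself.\<close>
 have z: "partial i Ph x = 0" if "norm x >= 2" for x
 proof -
  have "{x. Ph x \<noteq> 0} \<subseteq> cball 0 2" using snoc.prems(3) by force
  from iter_partial_support[OF this closed_cball, of "[i]"]
  have *: "!!y. partial i Ph y \<noteq> 0 ==> norm y <= 2" by (auto simp: partial_def)
  show ?thesis
  proof (rule ccontr)
   assume nz: "partial i Ph x \<noteq> 0"
   have "continuous_on UNIV (partial i Ph)" using s(2) by (intro smooth_on_continuous smooth_on_partial)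
   then have "(\<lambda>n. partial i Ph ((1 + 1 / real (Suc n)) *\<^sub>R x)) \<longlonglongrightarrow> partial i Ph ((1 + 0) *\<^sub>R x)"
    by (intro continuous_on_tendsto_compose[of UNIV "partial i Ph"] tendsto_scaleR tendsto_add tendsto_const
      LIMSEQ_inverse_real_of_nat[unfolded inverse_eq_divide]) auto
   moreover have "partial i Ph ((1 + 1 / real (Suc n)) *\<^sub>R x) = 0" for n
   proof (rule ccontr)
    assume "partial i Ph ((1 + 1 / real (Suc n)) *\<^sub>R x) \<noteq> 0"
    from *[OF this] have "(1 + 1 / real (Suc n)) * norm x <= 2" by simp
    moreover have "(1 + 1 / real (Suc n)) * norm x > 1 * norm x" using that by (intro mult_strict_right_mono) auto
    ultimately show False using that by simp
   qed
   ultimately have "partial i Ph x = 0" using LIMSEQ_const_iff[of 0 "partial i Ph x"] by simp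
   then show False using nz by simp
  qed
 qed
 \<comment> \<open>For a = 0 truncated subtraction leaves a - 1 = 0 and the claim is empty; the
   comparison of powers below distinguishes that case.\<close>
 have v: "iter_partial is (partial i f) 0 = 0" if "length is < a - 1" for "is"
  using snoc.prems(4)[of "is @ [i]"] that by (simp add: iter_partial_snoc)
 obtain C1 where C1: "C1 >= 0" "!!n x. norm (iter_partial js (\<lambda>x. partial i f x * Ph (2 ^ n *\<^sub>R x)) x) <= C1 * ((2 ^ n) ^ length js / (2 ^ n) ^ (a - 1))"
  using snoc.IH[OF test_fun_partial[OF snoc.prems(1), of i] snoc.prems(2,3) v] by blast
 obtain C2 where C2: "C2 >= 0" "!!n x. norm (iter_partial js (\<lambda>x. f x * partial i Ph (2 ^ n *\<^sub>R x)) x) <= C2 * ((2 ^ n) ^ length js / (2 ^ n) ^ a)"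
  using snoc.IH[OF snoc.prems(1) test_fun_partial[OF snoc.prems(2)] z snoc.prems(4)] by blast
 have "norm (iter_partial (js @ [i]) (\<lambda>x. f x * Ph (2 ^ n *\<^sub>R x)) x) <= (C1 + C2) * ((2 ^ n) ^ length (js @ [i]) / (2 ^ n) ^ a)" for n x
 proof -
  let ?q = "2 ^ n :: real"
  have q: "?q >= 1" by simp
  have "(?q ^ length js / ?q ^ (a - 1)) <= ?q ^ Suc (length js) / ?q ^ a"
   using q by (cases a) (auto simp: divide_right_mono mult_le_cancel_right1)
  then have 1: "norm (iter_partial js (\<lambda>x. partial i f x * Ph (?q *\<^sub>R x)) x) <= C1 * (?q ^ Suc (length js) / ?q ^ a)"
   using C1 by (meson mult_left_mono order_trans)
  have "?q * norm (iter_partial js (\<lambda>x. f x * partial i Ph (?q *\<^sub>R x)) x) <= ?q * (C2 * (?q ^ length js / ?q ^ a))"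
   by (intro mult_left_mono C2) auto
  then have 2: "norm (2 ^ n * iter_partial js (\<lambda>x. f x * partial i Ph (?q *\<^sub>R x)) x) <= C2 * (?q ^ Suc (length js) / ?q ^ a)"
   by (simp add: norm_mult norm_power mult_ac)
  show ?thesis unfolding p using norm_triangle_mono[OF 1 2] by (simp add: distrib_right add_divide_distrib)
 qed
 then show ?case using C1(1) C2(1) by (intro exI[of _ "C1 + C2"]) auto
qed

subsection \<open>Monomials\<close>

text \<open>Monomials are indexed by the lists that index derivatives, so \<open>mon is\<close> is,
  up to a power of the imaginary unit, the symbol of \<open>iter_partial is\<close>. Permuted lists
  give the same monomial.\<close>

primrec mon :: "'n list => real^'n::finite => complex" where
 "mon [] x = 1"
| "mon (i # is) x = of_real (x $ i) * mon is x"

lemma smooth_on_mon: "smooth_on UNIV (mon is)"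
proof (induction "is")
 case (Cons i "is")
 then have "smooth_on UNIV (\<lambda>x. complex_of_real (x $ i) * mon is x)" by (intro smooth_on_mult) auto
 moreover have "mon (i # is) = (\<lambda>x. complex_of_real (x $ i) * mon is x)" by (simp add: fun_eq_iff)
 ultimately show ?case by simp
next
 case Nil
 have "mon [] = (\<lambda>x. 1)" by (simp add: fun_eq_iff)
 then show ?case by simp
qed

lemma mon_scale: "mon is (c *\<^sub>R x) = of_real c ^ length is * mon is x"
 by (induction "is") auto

lemma mon_snoc: "mon (is @ [i]) x = of_real (x $ i) * mon is x"
 by (induction "is") auto

lemma schwartz_mon: "schwartz f ==> schwartz (mon is \<odot> f)"
proof (induction "is")
 case (Cons i "is")
 from schwartz_coord[OF Cons.IH[OF Cons.prems], of i] show ?case by (simp add: mult.assoc)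
qed simp

lemma inv_fourier_cmult: "inv_fourier (\<lambda>x. c * f x) = (\<lambda>xi. c * inv_fourier f xi)"
 for f :: "real^'n::finite => complex"
 by (simp add: inv_fourier_eq[abs_def] fourier_cmult)

lemma partial_inv_fourier:
 fixes w :: "real^'n::finite => complex"
 assumes "schwartz w"
 shows "partial i (inv_fourier w) = inv_fourier (\<lambda>x. \<i> * (of_real (x $ i) * w x))"
proof
 fix x :: "real^'n"
 let ?k = "inverse (complex_of_real ((2 * pi) ^ CARD('n)))"
 have e: "inv_fourier f = (\<lambda>x. ?k * fourier f ((-1) *\<^sub>R x))" for f :: "real^'n => complex"
  by (simp add: fun_eq_iff inv_fourier_eq divide_inverse mult.commute)
 have s: "smooth_on UNIV (fourier w)" by (intro schwartz_smooth schwartz_fourier assms)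
 have "partial i (inv_fourier w) x = ?k * (of_real (-1) * partial i (fourier w) ((-1) *\<^sub>R x))"
  unfolding e partial_mult_smooth[OF smooth_on_const smooth_on_dilate[OF s]] partial_dilate_smooth[OF s] by simp
 also have "... = inv_fourier (\<lambda>x. \<i> * (of_real (x $ i) * w x)) x"
  unfolding e partial_fourier_schwartz[OF assms] fourier_cmult by simp
 finally show "partial i (inv_fourier w) x = inv_fourier (\<lambda>x. \<i> * (of_real (x $ i) * w x)) x" .
qed

lemma iter_partial_inv_fourier:
 fixes w :: "real^'n::finite => complex"
 assumes "schwartz w"
 shows "iter_partial is (inv_fourier w) = inv_fourier (\<lambda>x. \<i> ^ length is * (mon is x * w x))"
 using assms
proof (induction "is" arbitrary: w rule: rev_induct)
 case (snoc i "is")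
 have "iter_partial (is @ [i]) (inv_fourier w) = iter_partial is (inv_fourier (\<lambda>x. \<i> * (of_real (x $ i) * w x)))"
  unfolding iter_partial_snoc partial_inv_fourier[OF snoc.prems] ..
 also have "... = inv_fourier (\<lambda>x. \<i> ^ length is * (mon is x * (\<i> * (of_real (x $ i) * w x))))"
  by (intro snoc.IH schwartz_cmult schwartz_coord snoc.prems)
 finally show ?case by (simp add: mon_snoc mult_ac)
qed simp

lemma inv_fourier_at_zero: "inv_fourier f 0 = (LBINT x. f x) / of_real ((2 * pi) ^ CARD('n))"
 for f :: "real^'n::finite => complex"
 by (simp add: inv_fourier_def)

lemma moment_integrable_bounded_support:
 fixes b :: "real^'n::finite => complex"
 assumes "L1 b" "!!xi. norm xi >= R ==> b xi = 0"
 shows "L1 (\<lambda>xi. (1 + norm xi)^2 * norm (b xi))"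
proof (rule Bochner_Integration.integrable_bound[OF integrable_mult_right[OF integrable_norm[OF assms(1)], of "(1 + \<bar>R\<bar>)^2"]])
 have [measurable]: "b \<in> borel_measurable borel" using assms by auto
 show "(\<lambda>xi. (1 + norm xi)^2 * norm (b xi)) \<in> borel_measurable lborel" by measurable
 have "(1 + norm xi)^2 * norm (b xi) <= (1 + \<bar>R\<bar>)^2 * norm (b xi)" for xi
 proof (cases "norm xi >= R")
  case False
  then show ?thesis by (intro mult_right_mono power_mono) auto
 qed (use assms(2) in simp)
 then show "AE xi in lborel. norm ((1 + norm xi)^2 * norm (b xi)) <= norm ((1 + \<bar>R\<bar>)^2 * norm (b xi))" by (simp add: abs_mult)
qed

lemma mon_bounded_support_integrable:
 fixes b :: "real^'n::finite => complex"
 assumes "L1 b" "!!xi. norm xi >= R ==> b xi = 0"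
 shows "L1 (mon is \<odot> b)"
proof (induction "is")
 case Nil
 then show ?case using assms by simp
next
 case (Cons i "is")
 have "L1 (\<lambda>xi. of_real (xi $ i) * (mon is xi * b xi))"
 proof (rule Bochner_Integration.integrable_bound[OF integrable_mult_right[OF integrable_norm[OF Cons], of "\<bar>R\<bar>"]])
  have [measurable]: "(mon is \<odot> b) \<in> borel_measurable borel" using Cons by auto
  show "(\<lambda>xi. of_real (xi $ i) * (mon is xi * b xi)) \<in> borel_measurable lborel" by measurable
  have "\<bar>xi $ i\<bar> * norm (mon is xi * b xi) <= \<bar>R\<bar> * norm (mon is xi * b xi)" for xi
  proof (cases "norm xi >= R")
   case False
   then show ?thesis using component_le_norm_cart[of xi i] by (intro mult_right_mono) auto
  qed (use assms(2) in simp)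
  then show "AE xi in lborel. norm (of_real (xi $ i) * (mon is xi * b xi)) <= norm (\<bar>R\<bar> * norm (mon is xi * b xi))"
   by (simp add: norm_mult mult.assoc)
 qed
 then show ?case by (simp add: mult.assoc)
qed

text \<open>Meant for b = heat(s) om, which is integrable with bounded support but may be singular
  at 0: its transform is smooth, though in general not rapidly decreasing.\<close>

lemma iter_partial_fourier_bounded_support:
 fixes b :: "real^'n::finite => complex"
 assumes "L1 b" "!!xi. norm xi >= R ==> b xi = 0"
 shows "iter_partial is (fourier b) = fourier (\<lambda>xi. (- \<i>) ^ length is * (mon is xi * b xi))"
  and "iter_partial is (fourier b) differentiable (at x)"
proof -
 have m: "L1 (\<lambda>xi. (- \<i>) ^ length is * (mon is xi * b xi))" for "is"
  using mon_bounded_support_integrable[OF assms] by simp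
 have z: "(- \<i>) ^ length is * (mon is xi * b xi) = 0" if "norm xi >= R" for xi "is" using assms(2)[OF that] by simp
 show e: "iter_partial is (fourier b) = fourier (\<lambda>xi. (- \<i>) ^ length is * (mon is xi * b xi))" for "is"
 proof (induction "is")
  case (Cons i "is")
  show ?case unfolding iter_partial_Cons Cons
  proof
   fix xi
   have "partial i (fourier (\<lambda>xi. (- \<i>) ^ length is * (mon is xi * b xi))) xi = fourier (\<lambda>x. - \<i> * of_real (x $ i) * ((- \<i>) ^ length is * (mon is x * b x))) xi"
    using m[of "is"] by (intro fourier_has_derivative(2) moment_integrable_bounded_support[OF m z]) auto
   then show "partial i (fourier (\<lambda>xi. (- \<i>) ^ length is * (mon is xi * b xi))) xi = fourier (\<lambda>xi. (- \<i>) ^ length (i # is) * (mon (i # is) xi * b xi)) xi"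
    by (simp add: mult_ac)
  qed
 qed simp
 show "iter_partial is (fourier b) differentiable (at x)"
  unfolding e using m[of "is"] by (intro fourier_has_derivative(1) moment_integrable_bounded_support[OF m z]) auto
qed

lemma smooth_on_fourier_bounded_support:
 fixes b :: "real^'n::finite => complex"
 assumes "L1 b" "!!xi. norm xi >= R ==> b xi = 0"
 shows "smooth_on UNIV (fourier b)"
 unfolding smooth_on_def using iter_partial_fourier_bounded_support(2)[OF assms] by blast

text \<open>The outermost derivative of \<open>f\<close> is moved first and so becomes the innermost
  one of \<open>Ph\<close>; hence \<open>rev\<close>.\<close>

lemma integral_by_parts:
 fixes f Ph :: "real^'n::finite => complex"
 assumes "test_fun Ph" "smooth_on UNIV f"
 shows "(LBINT x. Ph x * iter_partial is f x) = (-1) ^ length is * (LBINT x. iter_partial (rev is) Ph x * f x)"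
 using assms(1)
proof (induction "is" arbitrary: Ph)
 case Nil
 then show ?case by simp
next
 case (Cons i "is")
 let ?g = "iter_partial is f"
 have g: "smooth_on UNIV ?g" by (rule smooth_on_iter_partial[OF assms(2)])
 have sP: "smooth_on UNIV Ph" using Cons.prems by (simp add: test_fun_def)
 have t1: "test_fun (Ph \<odot> ?g)" "test_fun (partial i Ph \<odot> ?g)" "test_fun (Ph \<odot> partial i ?g)"
  using Cons.prems g by (auto intro!: test_fun_mult' test_fun_partial smooth_on_partial)
 obtain C where C: "C >= 0" "!!x. norm (partial i (Ph \<odot> ?g) x) <= C * decay (real (CARD('n) + 1)) x"
  using rapid_decay[OF rapid_test_fun[OF test_fun_partial[OF t1(1)]]] by blast
 have "(LBINT x. partial i (Ph \<odot> ?g) x) = 0"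
  using t1(1) C(2) by (intro integral_partial(2)[where a="real (CARD('n) + 1)" and C=C] test_fun_integrable)
   (auto simp: test_fun_def intro: smooth_on_differentiable)
 then have "(LBINT x. Ph x * partial i ?g x) = - (LBINT x. partial i Ph x * ?g x)"
  unfolding partial_mult_smooth[OF sP g] using test_fun_integrable[OF t1(2)] test_fun_integrable[OF t1(3)]
  by (simp add: add_eq_0_iff2)
 also have "... = - ((-1) ^ length is * (LBINT x. iter_partial (rev is) (partial i Ph) x * f x))"
  using Cons.IH[OF test_fun_partial[OF Cons.prems]] by simp
 finally show ?case by (simp add: iter_partial_Cons iter_partial_snoc del: iter_partial.simps(2))
qed

subsection \<open>Tails of mollified functions\<close>

lemma inv_fourier_mult_fourier:
 fixes a b :: "real^'n::finite => complex"
 assumes a: "L1 a" and b: "L1 b"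
 shows "inv_fourier (a \<odot> fourier b) xi = (LBINT y. inv_fourier a (xi - y) * b y)"
proof -
 let ?k = "complex_of_real ((2 * pi) ^ CARD('n))"
 have k: "?k \<noteq> 0" by simp
 let ?b = "\<lambda>x. b (0 + (-1) *\<^sub>R x)"
 have ib: "L1 ?b" by (intro integrable_affine b) simp
 have fb: "fourier b x = ?k * inv_fourier ?b x" for x
 proof -
  have "fourier b x = fourier ?b (- x)"
   using fourier_scale[OF _ b, of "-1" "- x"] by simp
  then show ?thesis using k by (simp add: inv_fourier_eq)
 qed
 have "inv_fourier (a \<odot> fourier b) xi = fourier (\<lambda>x. ?k * (a x * inv_fourier ?b x)) (- xi) / ?k"
  by (subst inv_fourier_eq) (simp only: fb mult.left_commute)
 also have "... = fourier (a \<odot> inv_fourier ?b) (- xi)" using k by (simp add: fourier_cmult)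
 also have "... = (LBINT y. inv_fourier a (y + xi) * ?b y)"
  using fourier_mult_inv_fourier[OF a ib, of "- xi"] by simp
 also have "... = (LBINT y. (\<lambda>y. inv_fourier a (xi - y) * b y) (0 + (-1) *\<^sub>R y))" by (simp add: add.commute)
 also have "... = (LBINT y. inv_fourier a (xi - y) * b y)"
 proof (subst integral_affine)
  have m: "fourier a \<in> borel_measurable borel" "b \<in> borel_measurable borel" using a b by auto
  show "L1 (\<lambda>y. inv_fourier a (xi - y) * b y)"
  proof (rule Bochner_Integration.integrable_bound[OF integrable_mult_right[OF integrable_norm[OF b], of "LBINT x. norm (a x)"]])
   show "(\<lambda>y. inv_fourier a (xi - y) * b y) \<in> borel_measurable lborel" unfolding inv_fourier_eq using m by measurable
   have "norm (inv_fourier a (xi - y)) <= (LBINT x. norm (a x))" for y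
    using norm_inv_fourier[of a "xi - y"] norm_fourier_le[of a "- (xi - y)"] by linarith
   then show "AE y in lborel. norm (inv_fourier a (xi - y) * b y) <= norm ((LBINT x. norm (a x)) * norm (b y))"
    by (simp add: norm_mult mult_right_mono abs_mult integral_nonneg_AE)
  qed
 qed auto
 finally show ?thesis .
qed

text \<open>The inverse transform is \<open>b\<close> mollified at scale \<open>ep\<close>. Since
  \<open>b\<close> lives in |xi| < 5/6 and \<open>p\<close> in |xi| >= 3/2, only the rapidly
  decreasing tail of the mollifier is seen, which is smaller than any power of \<open>ep\<close>. A
  derivative of the mollified function costs 1/ep, so the induction is over all powers
  \<open>L\<close>.\<close>

lemma mollified_tail:
 fixes et p b :: "real^'n::finite => complex"
 assumes b: "L1 b" "!!xi. norm xi >= 5/6 ==> b xi = 0"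
  and "test_fun et" "smooth_on UNIV p" "!!js. \<exists>C. \<forall>xi. norm (iter_partial js p xi) <= C" "!!xi. norm xi < 3/2 ==> p xi = 0"
 shows "\<exists>C\<ge>0. \<forall>ep xi. 0 < ep --> ep <= 1 -->
  (1 + norm xi) ^ k * norm (iter_partial is (\<lambda>xi. p xi * inv_fourier (\<lambda>x. et (ep *\<^sub>R x) * fourier b x) xi) xi) <= C * ep ^ L"
 using assms(3-)
proof (induction "is" arbitrary: et p L rule: rev_induct)
 case Nil
 let ?N = "CARD('n)"
 \<comment> \<open>N powers pay for the normalisation ep^(-N), \<open>L\<close> powers give the gain
   and \<open>k\<close> powers the weight.\<close>
 let ?M = "?N + L + k"
 let ?I = "LBINT y. norm (b y)"
 have I0: "?I >= 0" by (intro integral_nonneg_AE) auto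
 obtain D where D: "!!xi. norm (p xi) <= D" using Nil(3)[of "[]"] by auto
 have D0: "D >= 0" using D[of 0] norm_ge_zero order_trans by blast
 have set: "schwartz et" by (rule schwartz_test_fun[OF Nil(1)])
 obtain C where C: "C >= 0" "!!u. norm (inv_fourier et u) <= C * decay (real ?M) u"
  using rapid_decay[OF schwartz_rapid[OF schwartz_inv_fourier[OF set]]] by blast
 have "(1 + norm xi) ^ k * norm (p xi * inv_fourier (\<lambda>x. et (ep *\<^sub>R x) * fourier b x) xi) <= (D * C * 4 ^ ?M * ?I) * ep ^ L"
  if e: "0 < ep" "ep <= 1" for ep xi
 proof (cases "norm xi < 3/2")
  case True
  then show ?thesis using Nil(4) D0 C(1) I0 e by simp
 next
  case False
  let ?a = "\<lambda>x. et (ep *\<^sub>R x)"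
  have ia: "L1 ?a" by (intro test_fun_integrable test_fun_dilate Nil(1)) (use e in auto)
  have k: "norm (inv_fourier ?a (xi - y) * b y) <= C * 4 ^ ?M * (ep ^ L / (1 + norm xi) ^ k) * norm (b y)" for y
  proof (cases "norm y >= 5/6")
   case True then show ?thesis using b(2) by simp
  next
   case y: False
   \<comment> \<open>With |y| < 5/6 and |xi| >= 3/2 the distance is comparable to 1 + |xi|, since
     |xi| - 5/6 >= (1 + |xi|)/4.\<close>
   have d: "norm (xi - y) >= (1 + norm xi) / 4" using norm_triangle_ineq2[of xi y] False y by simp
   have "inv_fourier ?a (xi - y) = (1 / ep ^ ?N) *\<^sub>R inv_fourier et ((1 / ep) *\<^sub>R (xi - y))"
   proof -
    have "fourier ?a (- (xi - y)) = (1 / \<bar>ep\<bar> ^ ?N) *\<^sub>R fourier et ((1 / ep) *\<^sub>R (- (xi - y)))"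
     by (rule fourier_scale[OF _ test_fun_integrable[OF Nil(1)]]) (use e in simp)
    then show ?thesis
     unfolding inv_fourier_eq scaleR_minus_right using e by (simp add: scaleR_conv_of_real del: minus_diff_eq)
   qed
   then have "norm (inv_fourier ?a (xi - y)) <= (1 / ep ^ ?N) * (C * decay (real ?M) ((1 / ep) *\<^sub>R (xi - y)))"
    using C(2)[of "(1 / ep) *\<^sub>R (xi - y)"] e by (simp add: divide_right_mono)
   also have "decay (real ?M) ((1 / ep) *\<^sub>R (xi - y)) <= 4 ^ ?M * ep ^ ?M / (1 + norm xi) ^ ?M"
   proof -
    have "(1 + norm xi) / (4 * ep) <= 1 + norm ((1 / ep) *\<^sub>R (xi - y))" 
    proof -
     have "norm ((1 / ep) *\<^sub>R (xi - y)) = norm (xi - y) / ep" using e by (simp only: norm_scaleR) simp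
     moreover have "(1 + norm xi) / 4 / ep <= norm (xi - y) / ep" using e by (intro divide_right_mono d) auto
     ultimately show ?thesis using e by simp
    qed
    then have "((1 + norm xi) / (4 * ep)) ^ ?M <= (1 + norm ((1 / ep) *\<^sub>R (xi - y))) ^ ?M"
     using e by (intro power_mono) auto
    then have "1 / (1 + norm ((1 / ep) *\<^sub>R (xi - y))) ^ ?M <= 1 / ((1 + norm xi) / (4 * ep)) ^ ?M"
     using e by (intro divide_left_mono mult_pos_pos zero_less_power) (auto simp: add_pos_nonneg)
    then show ?thesis unfolding decay_power using e by (simp add: power_divide power_mult_distrib)
   qed
   then have "(1 / ep ^ ?N) * (C * decay (real ?M) ((1 / ep) *\<^sub>R (xi - y))) <= (1 / ep ^ ?N) * (C * (4 ^ ?M * ep ^ ?M / (1 + norm xi) ^ ?M))"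
    using C(1) e by (intro mult_left_mono) auto
   also have "... = C * 4 ^ ?M * (ep ^ (L + k) / (1 + norm xi) ^ ?M)"
    using e by (simp add: power_add)
   also have "... <= C * 4 ^ ?M * (ep ^ L / (1 + norm xi) ^ k)"
    using C(1) e by (intro mult_left_mono frac_le power_decreasing power_increasing) auto
   finally show ?thesis unfolding norm_mult by (intro mult_right_mono) auto
  qed
  have "norm (inv_fourier (?a \<odot> fourier b) xi) <= (LBINT y. norm (inv_fourier ?a (xi - y) * b y))"
   unfolding inv_fourier_mult_fourier[OF ia b(1)] by (rule integral_norm_bound)
  also have "... <= (LBINT y. C * 4 ^ ?M * (ep ^ L / (1 + norm xi) ^ k) * norm (b y))"
  proof (cases "L1 (\<lambda>y. norm (inv_fourier ?a (xi - y) * b y))")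
   case True
   then show ?thesis using k b(1) by (intro integral_mono) auto
  next
   \<comment> \<open>A Bochner integral that does not exist has the value 0, so the inequality
     persists.\<close>
   case False
   then show ?thesis using C(1) e by (simp add: not_integrable_integral_eq I0)
  qed
  also have "... = C * 4 ^ ?M * (ep ^ L / (1 + norm xi) ^ k) * ?I" by simp
  finally have X: "norm (inv_fourier (?a \<odot> fourier b) xi) <= C * 4 ^ ?M * (ep ^ L / (1 + norm xi) ^ k) * ?I" .
  have "(1 + norm xi) ^ k * norm (p xi * inv_fourier (?a \<odot> fourier b) xi) <= (1 + norm xi) ^ k * (D * (C * 4 ^ ?M * (ep ^ L / (1 + norm xi) ^ k) * ?I))"
   unfolding norm_mult using D0 by (intro mult_left_mono mult_mono D X) auto
  also have "... = (D * C * 4 ^ ?M * ?I) * ep ^ L" by simp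
  finally show ?thesis .
 qed
 then show ?case using D0 C(1) I0 by (intro exI[of _ "D * C * 4 ^ ?M * ?I"]) auto
next
 case (snoc i "is")
 let ?X = "\<lambda>et ep. inv_fourier (\<lambda>x. et (ep *\<^sub>R x) * fourier b x)"
 let ?et' = "\<lambda>y. \<i> * (of_real (y $ i) * et y)"
 have sF: "smooth_on UNIV (fourier b)" by (rule smooth_on_fourier_bounded_support[OF b])
 have t': "test_fun ?et'" by (intro test_fun_cmult test_fun_mult snoc.prems) auto
 have sX: "schwartz (\<lambda>x. et (ep *\<^sub>R x) * fourier b x)" if "test_fun et" "ep > 0" for ep et
  by (intro schwartz_test_fun test_fun_mult' sF test_fun_dilate that) (use that in auto)
 have p: "iter_partial (is @ [i]) (p \<odot> ?X et ep) xi = iter_partial is (partial i p \<odot> ?X et ep) xi + of_real (1 / ep) * iter_partial is (\<lambda>xi. p xi * ?X ?et' ep xi) xi"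
  if e: "ep > 0" for ep xi
 proof -
  have s1: "smooth_on UNIV (?X et ep)" "smooth_on UNIV (?X ?et' ep)"
   by (intro schwartz_smooth schwartz_inv_fourier sX e snoc.prems t')+
  have "partial i (?X et ep) = inv_fourier (\<lambda>x. of_real (1 / ep) * (?et' (ep *\<^sub>R x) * fourier b x))"
   unfolding partial_inv_fourier[OF sX[OF snoc.prems(1) e]] using e by (simp add: mult_ac)
  also have "... = (\<lambda>xi. of_real (1 / ep) * ?X ?et' ep xi)"
   by (rule inv_fourier_cmult)
  finally have "partial i (p \<odot> ?X et ep) = (\<lambda>xi. partial i p xi * ?X et ep xi + of_real (1 / ep) * (p xi * ?X ?et' ep xi))"
   unfolding partial_mult_smooth[OF snoc.prems(2) s1(1)] by (simp add: fun_eq_iff)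
  then show ?thesis unfolding iter_partial_snoc
   using iter_partial_add[OF smooth_on_mult[OF open_UNIV smooth_on_partial[OF snoc.prems(2)] s1(1)] smooth_on_mult[OF open_UNIV smooth_on_const smooth_on_mult[OF open_UNIV snoc.prems(2) s1(2)]]]
    iter_partial_cmult[OF smooth_on_mult[OF open_UNIV snoc.prems(2) s1(2)]] by (simp only:)
 qed
 have pp: "smooth_on UNIV (partial i p)" "!!js. \<exists>C. \<forall>xi. norm (iter_partial js (partial i p) xi) <= C" "!!xi. norm xi < 3/2 ==> partial i p xi = 0"
  using snoc.prems(2) smooth_on_partial snoc.prems(3) partial_cong_open[of "ball 0 (3/2)" _ p "\<lambda>_. 0" i] snoc.prems(4)
  by (auto simp: iter_partial_snoc[symmetric])
 obtain C1 where C1: "C1 >= 0" "!!ep xi. 0 < ep ==> ep <= 1 ==> (1 + norm xi) ^ k * norm (iter_partial is (partial i p \<odot> ?X et ep) xi) <= C1 * ep ^ L"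
  using snoc.IH[OF snoc.prems(1) pp, of L] by blast
 \<comment> \<open>One power more than the goal, to be spent on the factor 1/ep in the product rule
   \<open>p\<close>.\<close>
 obtain C2 where C2: "C2 >= 0" "!!ep xi. 0 < ep ==> ep <= 1 ==> (1 + norm xi) ^ k * norm (iter_partial is (\<lambda>xi. p xi * ?X ?et' ep xi) xi) <= C2 * ep ^ Suc L"
  using snoc.IH[OF t' snoc.prems(2,3,4), of "Suc L"] by blast
 have "(1 + norm xi) ^ k * norm (iter_partial (is @ [i]) (p \<odot> ?X et ep) xi) <= (C1 + C2) * ep ^ L" if e: "0 < ep" "ep <= 1" for ep xi
 proof -
  let ?A = "norm (iter_partial is (partial i p \<odot> ?X et ep) xi)" and ?B = "norm (iter_partial is (\<lambda>xi. p xi * ?X ?et' ep xi) xi)"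
  have "norm (iter_partial (is @ [i]) (p \<odot> ?X et ep) xi) <= ?A + \<bar>1 / ep\<bar> * ?B"
   by (rule norm_add_of_real_mult[OF p[OF e(1)]])
  then have "(1 + norm xi) ^ k * norm (iter_partial (is @ [i]) (p \<odot> ?X et ep) xi) <= (1 + norm xi) ^ k * (?A + \<bar>1 / ep\<bar> * ?B)"
   by (intro mult_left_mono) auto
  also have "... = (1 + norm xi) ^ k * ?A + (1 / ep) * ((1 + norm xi) ^ k * ?B)" using e by (simp add: distrib_left)
  also have "... <= C1 * ep ^ L + (1 / ep) * (C2 * ep ^ Suc L)"
   using e by (intro add_mono mult_left_mono C1 C2) auto
  also have "... = (C1 + C2) * ep ^ L" using e by (simp add: distrib_right)
  finally show ?thesis .
 qed
 then show ?case using C1(1) C2(1) by (intro exI[of _ "C1 + C2"]) auto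
qed

section \<open>The initial datum in terms of the semigroup\<close>

text \<open>Covers functions that are not integrable as well, since their Bochner integral is 0 by
  convention.\<close>

lemma integral_norm_bound_ennreal_general:
 fixes f :: "'a => 'b::{banach, second_countable_topology}"
 shows "ennreal (norm (integral\<^sup>L M f)) <= (\<integral>\<^sup>+x. ennreal (norm (f x)) \<partial>M)"
 by (cases "integrable M f") (auto intro: integral_norm_bound_ennreal simp: not_integrable_integral_eq)

lemma integrable_dominated:
 fixes f :: "'a => 'b::{banach, second_countable_topology}" and w :: "'a => real"
 assumes "integrable M w" "f \<in> borel_measurable M" "!!x. norm (f x) <= w x"
 shows "integrable M f"
 by (rule Bochner_Integration.integrable_bound[OF assms(1,2)]) (use assms(3) in \<open>auto intro: order_trans[OF _ abs_ge_self]\<close>)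

lemma multiplier_eq: "multiplier m f ph = f (fourier (m \<odot> inv_fourier ph))"
 by (simp add: multiplier_def dist_inv_fourier_def dist_mult_def dist_fourier_def)

lemma heat_uminus: "heat th (- t) = (\<lambda>xi. complex_of_real (exp (- t * norm xi powr th)))"
 by (simp add: heat_def fun_eq_iff)

lemma has_semigroup_value_limit:
 assumes "has_semigroup_value th t f g" "schwartz ph" "space_cutoff et"
 shows "((\<lambda>ep. f (\<lambda>x. et (ep *\<^sub>R x) * fourier (heat th (- t) \<odot> inv_fourier ph) x)) \<longlongrightarrow> regular_dist g ph) (at_right 0)"
 using assms unfolding has_semigroup_value_def heat_uminus[symmetric] multiplier_eq dist_mult_def by blast

lemma regular_dist_borel:
 assumes "g \<in> borel_measurable borel" "ph \<in> borel_measurable borel"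
 shows "regular_dist g ph = (LBINT x. g x * ph x)"
 unfolding regular_dist_def using assms by (intro integral_completion) simp

lemma iter_partial_const: "iter_partial is (\<lambda>_::real^'n::finite. c) = (\<lambda>_. if is = [] then c else 0)"
proof (induction "is")
 case (Cons i "is")
 then show ?case unfolding iter_partial_Cons by simp
qed simp

lemma iter_partial_sum:
 fixes f :: "'i => real^'n::finite => complex"
 assumes "!!a. a \<in> I ==> smooth_on UNIV (f a)"
 shows "iter_partial is (\<lambda>x. \<Sum>a\<in>I. f a x) = (\<lambda>x. \<Sum>a\<in>I. iter_partial is (f a) x)"
 using assms
proof (induction I rule: infinite_finite_induct)
 case (insert a I)
 have "smooth_on UNIV (\<lambda>x. \<Sum>a\<in>I. f a x)" using insert.prems by (intro smooth_on_sum) auto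
 then show ?case using insert iter_partial_add[of "f a" "\<lambda>x. \<Sum>a\<in>I. f a x" "is"] by simp
qed (auto simp: iter_partial_const)

locale semigroup_trace =
 fixes ze :: "real => real" and th t :: real and \<mu> :: "'n::finite dist" and g :: "real^'n => complex"
 assumes ze: "lp_cutoff ze" and th: "th > 0" and \<mu>: "tempered \<mu>" and g: "tame g"
  and sv: "has_semigroup_value th t \<mu> g"
begin

abbreviation "bump \<equiv> radial_cut ze :: real^'n => complex"

lemma bump_test: "test_fun bump"
 by (rule test_fun_radial_cut[OF ze])

lemma bump_smooth: "smooth_on UNIV bump"
 by (rule smooth_radial_cut[OF ze])

lemma g_measurable [measurable]: "g \<in> borel_measurable borel"
 by (rule tame_measurable[OF g])

text \<open>Meaningful on all test functions: the transform in the integral is in general not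
  Schwartz, but it is bounded by \<open>prof\<close>, against which a tame \<open>g\<close> is
  integrable.\<close>

definition defect :: "(real^'n => complex) => complex" where
 "defect om = \<mu> (fourier om) - (LBINT x. g x * fourier (heat th t \<odot> om) x)"

lemma pairing_integrable:
 assumes "test_fun om" shows "L1 (\<lambda>x. g x * fourier (\<lambda>xi. heat th t xi * om xi) x)"
proof -
 obtain C where "!!x. norm (fourier (heat th t \<odot> om) x) <= C * prof th x"
  using kernel_bound_test_fun[OF ze th assms] by blast
 then show ?thesis
  by (intro tame_prof_integrable[OF th g] fourier_measurable heat_mult_integrable[OF th assms])
qed

lemma defect_add:
 assumes "test_fun u" "test_fun v" shows "defect (\<lambda>xi. u xi + v xi) = defect u + defect v"
proof -
 have "\<mu> (fourier (\<lambda>xi. u xi + v xi)) = \<mu> (fourier u) + \<mu> (fourier v)"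
  unfolding fourier_add[OF test_fun_integrable[OF assms(1)] test_fun_integrable[OF assms(2)]]
  by (intro tempered_add[OF \<mu>] schwartz_fourier schwartz_test_fun assms)
 moreover have "fourier (\<lambda>xi. heat th t xi * (u xi + v xi)) = (\<lambda>x. fourier (heat th t \<odot> u) x + fourier (heat th t \<odot> v) x)"
  unfolding distrib_left by (intro fourier_add heat_mult_integrable th assms)
 ultimately show ?thesis
  unfolding defect_def using pairing_integrable[OF assms(1)] pairing_integrable[OF assms(2)] by (simp add: distrib_left)
qed

lemma defect_cmult:
 assumes "test_fun u" shows "defect (\<lambda>xi. c * u xi) = c * defect u"
proof -
 have "\<mu> (fourier (\<lambda>xi. c * u xi)) = c * \<mu> (fourier u)"
  unfolding fourier_cmult by (intro tempered_cmult[OF \<mu>] schwartz_fourier schwartz_test_fun assms)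
 moreover have "fourier (\<lambda>xi. heat th t xi * (c * u xi)) = (\<lambda>x. c * fourier (heat th t \<odot> u) x)"
  unfolding mult.left_commute[of _ c] by (rule fourier_cmult)
 ultimately show ?thesis unfolding defect_def by (simp add: mult.left_commute[of _ c] right_diff_distrib)
qed

text \<open>Away from the origin heat(t) om is a test function, so its transform may be used to test
  S(t)mu. The symbols cancel, and only the removal of the cut-off remains.\<close>

lemma defect_annular:
 assumes "annular om" shows "defect om = 0"
proof -
 let ?ps = "fourier (heat th t \<odot> om)"
 have s: "schwartz (heat th t \<odot> om)" "schwartz ?ps" "schwartz om"
  using annular_test_fun annular_heat assms by (blast intro: schwartz_test_fun schwartz_fourier)+
 have e: "(heat th (- t) \<odot> inv_fourier ?ps) = om"
  unfolding inv_fourier_fourier_schwartz[OF s(1)] by (simp add: mult.assoc[symmetric])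
 have 1: "((\<lambda>ep. \<mu> (\<lambda>x. bump (ep *\<^sub>R x) * fourier om x)) \<longlongrightarrow> regular_dist g ?ps) (at_right 0)"
  using has_semigroup_value_limit[OF sv s(2) space_cutoff_radial_cut[OF ze]] unfolding e .
 have 2: "((\<lambda>ep. \<mu> (\<lambda>x. bump (ep *\<^sub>R x) * fourier om x)) \<longlongrightarrow> \<mu> (fourier om)) (at_right 0)"
  by (intro tempered_cutoff[OF \<mu> space_cutoff_radial_cut[OF ze]] schwartz_fourier s)
 have "regular_dist g ?ps = \<mu> (fourier om)" by (rule tendsto_unique[OF _ 1 2]) simp
 then show ?thesis unfolding defect_def
  using regular_dist_borel[OF g_measurable schwartz_measurable[OF s(2)]] by simp
qed

text \<open>Localising to frequencies of size 2^(-n) replaces the kernel by an average over width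
  2^n, with rescaled time still bounded by |t|. Such averages of a tame function tend to 0 by
  \<open>tame_spread\<close>.\<close>

lemma pairing_localized:
 assumes "test_fun om"
 shows "(\<lambda>n. LBINT x. g x * fourier (\<lambda>xi. heat th t xi * (om xi * bump (2 ^ n *\<^sub>R xi))) x) \<longlonglongrightarrow> 0"
proof -
 let ?N = "CARD('n)"
 have sw: "schwartz om" by (rule schwartz_test_fun[OF assms])
 have Fi: "L1 (fourier om)" by (rule schwartz_integrable[OF schwartz_fourier[OF sw]])
 then have [measurable]: "fourier om \<in> borel_measurable borel" by auto
 let ?b = "\<lambda>n xi. heat th t xi * bump (2 ^ n *\<^sub>R xi)"
 have td: "test_fun (\<lambda>xi. bump (2 ^ n *\<^sub>R xi))" for n by (rule test_fun_dilate[OF bump_test]) simp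
 have bi: "L1 (?b n)" for n by (rule heat_mult_integrable[OF th td])
 have [measurable]: "inv_fourier (?b n) \<in> borel_measurable borel" for n
 proof -
  have "fourier (?b n) \<in> borel_measurable borel" using bi by (rule fourier_measurable)
  then show ?thesis unfolding inv_fourier_eq[abs_def] by measurable
 qed
 obtain C where C: "C >= 0" "!!s x. \<bar>s\<bar> <= \<bar>t\<bar> ==> norm (fourier (heat th s \<odot> bump) x) <= C * prof th x"
  using kernel_bound_low[OF ze th abs_ge_zero, of t, where 'n='n] by blast
 obtain \<delta> where \<delta>: "\<delta> \<longlonglongrightarrow> 0" "!!n y. (\<integral>\<^sup>+x. ennreal (norm (g x) * ((1 / 2 ^ n) ^ ?N * prof th ((1 / 2 ^ n) *\<^sub>R (x - y)))) \<partial>lborel) <= ennreal (\<delta> n)" "!!n. \<delta> n >= 0"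
  using tame_spread[OF th g] by blast
 let ?Q = "\<lambda>n x y. (1 / 2 ^ n) ^ ?N * prof th ((1 / 2 ^ n) *\<^sub>R (x - y))"
 have kb: "norm (inv_fourier (?b n) (y - x)) <= C * ?Q n x y" for n x y
 proof -
  let ?c = "2 ^ n :: real" and ?s = "t * (1 / 2 ^ n) powr th"
  have p1: "(1 / ?c) powr th <= 1" using th by (intro powr_le1) auto
  have s: "\<bar>?s\<bar> <= \<bar>t\<bar>" using p1 by (simp add: abs_mult mult_left_le)
  have be: "?b n = (\<lambda>xi. (heat th ?s \<odot> bump) (?c *\<^sub>R xi))"
   using th by (simp add: heat_scale powr_mult[symmetric] mult.assoc)
  have "norm (inv_fourier (?b n) (y - x)) <= norm (fourier (?b n) (- (y - x)))" by (rule norm_inv_fourier)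
  also have "fourier (?b n) (- (y - x)) = (1 / \<bar>?c\<bar> ^ ?N) *\<^sub>R fourier (heat th ?s \<odot> bump) ((1 / ?c) *\<^sub>R (- (y - x)))"
   unfolding be by (rule fourier_scale) (simp_all add: heat_mult_integrable[OF th bump_test])
  also have "norm ... = (1 / ?c ^ ?N) * norm (fourier (heat th ?s \<odot> bump) ((1 / ?c) *\<^sub>R (- (y - x))))" by simp
  also have "... <= (1 / ?c ^ ?N) * (C * prof th ((1 / ?c) *\<^sub>R (- (y - x))))"
   by (intro mult_left_mono C(2) s) simp
  finally show ?thesis by (simp add: power_divide mult_ac)
 qed
 let ?I = "LBINT y. norm (fourier om y)"
 have I0: "?I >= 0" by (intro integral_nonneg_AE) auto
 have main: "norm (LBINT x. g x * fourier (\<lambda>xi. heat th t xi * (om xi * bump (2 ^ n *\<^sub>R xi))) x) <= C * ?I * \<delta> n" for n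
 proof -
  let ?h = "fourier (\<lambda>xi. heat th t xi * (om xi * bump (2 ^ n *\<^sub>R xi)))"
  have twn: "test_fun (\<lambda>xi. om xi * bump (2 ^ n *\<^sub>R xi))"
   using td assms by (intro test_fun_mult') (auto simp: test_fun_def)
  have [measurable]: "?h \<in> borel_measurable borel" by (intro fourier_measurable heat_mult_integrable[OF th twn])
  have he: "?h x = (LBINT y. inv_fourier (?b n) (y - x) * fourier om y)" for x
   using fourier_mult_inv_fourier[OF bi[of n] Fi, of x] unfolding inv_fourier_fourier_schwartz[OF sw] by (simp add: mult_ac)
  have hx: "ennreal (norm (?h x)) <= (\<integral>\<^sup>+y. ennreal (C * ?Q n x y * norm (fourier om y)) \<partial>lborel)" for x
  proof -
   have "ennreal (norm (?h x)) <= (\<integral>\<^sup>+y. ennreal (norm (inv_fourier (?b n) (y - x) * fourier om y)) \<partial>lborel)"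
    unfolding he by (rule integral_norm_bound_ennreal_general)
   also have "... <= (\<integral>\<^sup>+y. ennreal (C * ?Q n x y * norm (fourier om y)) \<partial>lborel)"
    unfolding norm_mult by (intro nn_integral_mono ennreal_leI mult_right_mono kb) auto
   finally show ?thesis .
  qed
  have "ennreal (norm (LBINT x. g x * ?h x)) <= (\<integral>\<^sup>+x. ennreal (norm (g x * ?h x)) \<partial>lborel)"
   by (rule integral_norm_bound_ennreal_general)
  also have "... <= (\<integral>\<^sup>+x. \<integral>\<^sup>+y. ennreal (norm (g x)) * ennreal (C * ?Q n x y * norm (fourier om y)) \<partial>lborel \<partial>lborel)"
   using hx by (intro nn_integral_mono) (simp add: norm_mult ennreal_mult nn_integral_cmult mult_left_mono)
  also have "... = (\<integral>\<^sup>+y. \<integral>\<^sup>+x. ennreal (norm (g x)) * ennreal (C * ?Q n x y * norm (fourier om y)) \<partial>lborel \<partial>lborel)"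
   by (rule lborel_pair.Fubini') measurable
  also have "... = (\<integral>\<^sup>+y. ennreal (C * norm (fourier om y)) * (\<integral>\<^sup>+x. ennreal (norm (g x) * ?Q n x y) \<partial>lborel) \<partial>lborel)"
   using C(1) by (intro nn_integral_cong) (subst nn_integral_cmult[symmetric], auto simp: ennreal_mult[symmetric] mult_ac)
  also have "... <= (\<integral>\<^sup>+y. ennreal (C * norm (fourier om y)) * ennreal (\<delta> n) \<partial>lborel)"
   by (intro nn_integral_mono mult_left_mono \<delta>) auto
  also have "... = (\<integral>\<^sup>+y. ennreal (C * \<delta> n * norm (fourier om y)) \<partial>lborel)"
   using C(1) \<delta>(3) by (intro nn_integral_cong) (simp add: ennreal_mult[symmetric] mult_ac)
  also have "... = ennreal (C * \<delta> n * ?I)"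
   using C(1) \<delta>(3) Fi by (subst nn_integral_eq_integral) auto
  finally show ?thesis using C(1) \<delta>(3) I0 by (simp add: mult_ac)
 qed
 have "(\<lambda>n. C * ?I * \<delta> n) \<longlonglongrightarrow> 0" using tendsto_mult_right_zero[OF \<delta>(1)] by simp
 then show ?thesis by (rule Lim_null_comparison[rotated]) (use main in auto)
qed

text \<open>By \<open>defect_annular\<close> only the part of \<open>om\<close> near the origin
  counts. As the localisation shrinks, the datum part vanishes because \<open>om\<close> is flat
  beyond the order \<open>k\<close> of the distribution, and the pairing part by
  \<open>pairing_localized\<close>.\<close>

lemma defect_flat:
 "\<exists>K. \<forall>om. test_fun om --> (\<forall>is. length is < K --> iter_partial is om 0 = 0) --> defect om = 0"
proof -
 have T: "tempered (dist_fourier \<mu>)" by (rule tempered_dist_fourier[OF \<mu>])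
 obtain C k where C: "!!ph. schwartz ph ==> norm (dist_fourier \<mu> ph) <= C * schwartz_norm k ph"
  using T unfolding tempered_def by blast
 have "defect om = 0" if w: "test_fun om" and flat: "!!is. length is < Suc k ==> iter_partial is om 0 = 0" for om
 proof -
  let ?w = "\<lambda>n xi. om xi * bump (2 ^ n *\<^sub>R xi)"
  have td: "test_fun (\<lambda>xi. bump (2 ^ n *\<^sub>R xi))" for n by (rule test_fun_dilate[OF bump_test]) simp
  have tw: "test_fun (?w n)" for n using td w by (intro test_fun_mult') (auto simp: test_fun_def)
  have eq: "defect om = defect (?w n)" for n
  proof -
   have r: "om xi - ?w n xi = 0" if "norm xi < 1 / 2 ^ n" for xi
   proof -
    have "norm (2 ^ n *\<^sub>R xi) <= 3 / 2" using that by (simp add: field_simps)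
    then show ?thesis using radial_cut_one[OF ze, of "2 ^ n *\<^sub>R xi"] by simp
   qed
   have an: "annular (\<lambda>xi. om xi - ?w n xi)"
    unfolding annular_def using r test_fun_diff[OF w tw] by (intro conjI exI[of _ "1 / 2 ^ n"]) auto
   have "defect (\<lambda>xi. (om xi - ?w n xi) + ?w n xi) = defect (\<lambda>xi. om xi - ?w n xi) + defect (?w n)"
    by (intro defect_add tw test_fun_diff w)
   then show ?thesis using defect_annular[OF an] by simp
  qed
  have "\<forall>js. \<exists>D. D >= 0 \<and> (\<forall>n x. norm (iter_partial js (?w n) x) <= D * ((2 ^ n) ^ length js / (2 ^ n) ^ Suc k))"
   using localized_derivative_bound[OF w bump_test _ flat, of "Suc k"] radial_cut_zero[OF ze] by force
  from choice[OF this] obtain D where D: "!!js. D js >= 0"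
   "!!js n x. norm (iter_partial js (?w n) x) <= D js * ((2 ^ n) ^ length js / (2 ^ n) ^ Suc k)" by blast
  let ?M = "\<Sum>js\<in>{js::'n list. length js <= k}. D js"
  have M0: "?M >= 0" by (intro sum_nonneg D)
  \<comment> \<open>The supports lie in |x| <= 5/3, where the weight is at most 3^k; one order of
    flatness beyond \<open>k\<close> leaves 2^(-n).\<close>
  have sn: "schwartz_norm k (?w n) <= 3 ^ k * ?M * (1 / 2 ^ n)" for n
  proof (rule schwartz_norm_le)
   fix "is" :: "'n list" and x :: "real^'n" assume l: "length is <= k"
   show "(1 + norm x) ^ k * norm (iter_partial is (?w n) x) <= 3 ^ k * ?M * (1 / 2 ^ n)"
   proof (cases "norm x <= 5/3")
    case False
    have "{x. ?w n x \<noteq> 0} \<subseteq> cball 0 (5/3)"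
    proof
     fix x assume "x \<in> {x. ?w n x \<noteq> 0}"
     then have "norm (2 ^ n *\<^sub>R x) < 5/3" using radial_cut_zero[OF ze, of "2 ^ n *\<^sub>R x"] by force
     moreover have "norm x <= 2 ^ n * norm x" by (simp add: mult_le_cancel_right1)
     ultimately show "x \<in> cball 0 (5/3)" by simp
    qed
    from iter_partial_support[OF this closed_cball, of "is"] False
    have "iter_partial is (?w n) x = 0" by auto
    then show ?thesis using M0 by simp
   next
    case True
    have "(2 ^ n) ^ length is / (2 ^ n) ^ Suc k <= (2 ^ n) ^ k / ((2 ^ n) ^ Suc k :: real)"
     using l by (intro divide_right_mono power_increasing) auto
    also have "... = 1 / 2 ^ n" by simp
    finally have r: "(2 ^ n) ^ length is / (2 ^ n) ^ Suc k <= (1 / 2 ^ n :: real)" .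
    have "D is <= ?M" using l D(1) finite_lists_le by (intro member_le_sum) auto
    then have "D is * ((2 ^ n) ^ length is / (2 ^ n) ^ Suc k) <= ?M * (1 / 2 ^ n)"
     using r M0 by (intro mult_mono) auto
    with D(2)[of "is" n x] have "norm (iter_partial is (?w n) x) <= ?M * (1 / 2 ^ n)" by linarith
    then have "(1 + norm x) ^ k * norm (iter_partial is (?w n) x) <= 3 ^ k * (?M * (1 / 2 ^ n))"
     using True M0 by (intro mult_mono power_mono) auto
    then show ?thesis by (simp only: mult.assoc)
   qed
  qed
  have "(\<lambda>n. \<mu> (fourier (?w n))) \<longlonglongrightarrow> 0"
  proof (rule Lim_null_comparison)
   have "norm (\<mu> (fourier (?w n))) <= \<bar>C\<bar> * (3 ^ k * ?M) * (1 / 2) ^ n" for n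
   proof -
    have sw: "schwartz (?w n)" by (rule schwartz_test_fun[OF tw])
    have "norm (\<mu> (fourier (?w n))) <= C * schwartz_norm k (?w n)" using C[OF sw] by (simp add: dist_fourier_def)
    also have "... <= \<bar>C\<bar> * schwartz_norm k (?w n)" using schwartz_norm_nonneg[OF sw] by (intro mult_right_mono) auto
    also have "... <= \<bar>C\<bar> * (3 ^ k * ?M * (1 / 2 ^ n))" by (intro mult_left_mono sn) auto
    finally show ?thesis by (simp add: power_divide mult_ac)
   qed
   then show "\<forall>\<^sub>F n in sequentially. norm (\<mu> (fourier (?w n))) <= \<bar>C\<bar> * (3 ^ k * ?M) * (1 / 2) ^ n" by simp
   show "(\<lambda>n. \<bar>C\<bar> * (3 ^ k * ?M) * (1 / 2) ^ n) \<longlonglongrightarrow> 0"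
    by (intro tendsto_mult_right_zero LIMSEQ_power_zero) auto
  qed
  from tendsto_diff[OF this pairing_localized[OF w]] have "(\<lambda>n. defect (?w n)) \<longlonglongrightarrow> 0"
   unfolding defect_def by simp
  then show ?thesis using eq LIMSEQ_const_iff[of "defect om" 0] by simp
 qed
 then show ?thesis by blast
qed

text \<open>The analogue of the theorem that a distribution supported at one point is a combination
  of derivatives of the point mass.\<close>

lemma defect_jet:
 "\<exists>K c. \<forall>om. test_fun om --> defect om = (\<Sum>is\<in>{is. length is < K}. c is * iter_partial is om 0)"
proof -
 obtain K where K: "!!om. test_fun om ==> (!!is. length is < K ==> iter_partial is om 0 = 0) ==> defect om = 0"
  using defect_flat by blast
 have "finite {is :: 'n list. length is < K}" by (rule finite_subset[OF _ finite_lists_le[of K]]) auto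
 then have "\<exists>c. \<forall>om. test_fun om --> defect om = (\<Sum>is\<in>{is. length is < K}. c is * iter_partial is om 0)"
 proof (rule linear_combination_of_functionals[where add="\<lambda>u v x. u x + v x" and scl="\<lambda>c v x. c * v x" and V=test_fun and l="\<lambda>is om. iter_partial is om 0" and A=defect])
  show "iter_partial is (\<lambda>x. u x + v x) 0 = iter_partial is u 0 + iter_partial is v 0" if "test_fun u" "test_fun v" for "is" u v
   using that by (simp add: iter_partial_add test_fun_def)
  show "iter_partial is (\<lambda>x. c * v x) 0 = c * iter_partial is v 0" if "test_fun v" for "is" v c
   using that by (simp add: iter_partial_cmult test_fun_def)
  show "defect v = 0" if "test_fun v" "!!is. is \<in> {is. length is < K} ==> iter_partial is v 0 = 0" for v
   using K that by simp
 qed (auto intro: test_fun_add test_fun_cmult defect_add defect_cmult)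
 then show ?thesis by blast
qed

text \<open>With the frequency cut-off the functions \<open>F\<^sup>-\<^sup>1(\<eta>(\<epsilon>x) S(t)\<psi>)\<close> are legitimate arguments of \<open>defect\<close>, and
 the existence of \<open>S(t)\<mu>\<close> says that \<open>defect\<close> tends to zero along them.\<close>

lemma defect_mollified:
 assumes w: "test_fun om" and supp: "!!xi. norm xi >= 5/6 ==> om xi = 0"
 defines "Ps \<equiv> fourier (heat th (- t) \<odot> om)"
 shows "(\<lambda>n. defect (\<lambda>xi. bump xi * inv_fourier (\<lambda>x. bump ((1 / real (Suc n)) *\<^sub>R x) * Ps x) xi)) \<longlonglongrightarrow> 0"
  and "schwartz (\<lambda>x. bump ((1 / real (Suc n)) *\<^sub>R x) * Ps x)"
proof -
 let ?e = "\<lambda>n. 1 / real (Suc n)"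
 let ?b = "heat th (- t) \<odot> om"
 let ?w = "\<lambda>n x. bump (?e n *\<^sub>R x) * Ps x"
 let ?X = "\<lambda>n. inv_fourier (?w n)"
 have elim: "?e \<longlonglongrightarrow> 0" using LIMSEQ_inverse_real_of_nat by (simp add: inverse_eq_divide)
 have e01: "0 < ?e n" "?e n <= 1" for n by auto
 have bi: "L1 ?b" by (rule heat_mult_integrable[OF th w])
 have bs: "?b xi = 0" if "norm xi >= 5/6" for xi using supp[OF that] by simp
 have bc: "continuous_on UNIV ?b"
  using heat_continuous[OF th] smooth_on_continuous w by (intro continuous_on_mult) (auto simp: test_fun_def)
 have Pss: "smooth_on UNIV Ps" unfolding Ps_def by (rule smooth_on_fourier_bounded_support[OF bi bs])
 have Psm [measurable]: "Ps \<in> borel_measurable borel" by (intro borel_measurable_continuous_onI smooth_on_continuous Pss)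
 obtain C2 where C2: "C2 >= 0" "!!x. norm (Ps x) <= C2 * prof th x"
  unfolding Ps_def using kernel_bound_test_fun[OF ze th w] by blast
 have Psi: "L1 Ps"
  by (rule Bochner_Integration.integrable_bound[OF integrable_mult_right[OF integrable_prof[OF th], of C2]])
   (use C2 in \<open>auto intro: order_trans[OF _ abs_ge_self]\<close>)
 have tw: "test_fun (?w n)" for n
  by (intro test_fun_mult' Pss test_fun_dilate bump_test) simp
 show sw: "schwartz (?w n)" for n by (rule schwartz_test_fun[OF tw])
 have sX: "schwartz (?X n)" for n by (rule schwartz_inv_fourier[OF sw])
 have cX: "test_fun (bump \<odot> ?X n)" for n by (intro test_fun_mult' bump_test schwartz_smooth sX)
 have swo: "schwartz om" by (rule schwartz_test_fun[OF w])
 let ?lim = "LBINT x. g x * fourier om x"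
 \<comment> \<open>The assumption on S(t)mu, tested with F om and read along ep = 1/(n + 1).\<close>
 have 1: "(\<lambda>n. \<mu> (?w n)) \<longlonglongrightarrow> ?lim"
 proof -
  have "((\<lambda>ep. \<mu> (\<lambda>x. bump (ep *\<^sub>R x) * Ps x)) \<longlongrightarrow> regular_dist g (fourier om)) (at_right 0)"
   using has_semigroup_value_limit[OF sv schwartz_fourier[OF swo] space_cutoff_radial_cut[OF ze]]
   unfolding inv_fourier_fourier_schwartz[OF swo] Ps_def .
  moreover have "filterlim ?e (at_right 0) sequentially"
   using elim unfolding filterlim_at by auto
  ultimately have "(\<lambda>n. \<mu> (?w n)) \<longlonglongrightarrow> regular_dist g (fourier om)" by (rule filterlim_compose)
  then show ?thesis using regular_dist_borel[OF g_measurable schwartz_measurable[OF schwartz_fourier[OF swo]]] by simp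
 qed
 have T: "tempered (dist_fourier \<mu>)" by (rule tempered_dist_fourier[OF \<mu>])
 \<comment> \<open>The high-frequency remainder. \<open>om\<close> lives in |xi| < 5/6 while
   \<open>?p\<close> vanishes for |xi| < 3/2, so \<open>mollified_tail\<close> makes its
   contribution negligible for the datum.\<close>
 let ?p = "\<lambda>xi. 1 - bump xi"
 have sp: "smooth_on UNIV ?p" by (intro smooth_on_diff bump_smooth) auto
 have pb: "\<exists>C. \<forall>xi. norm (iter_partial js ?p xi) <= C" for js
 proof -
  have sm: "smooth_on UNIV (\<lambda>xi. (-1) * bump xi)" by (intro smooth_on_mult bump_smooth) auto
  have e: "iter_partial js ?p = (\<lambda>xi. (if js = [] then 1 else 0) + (-1) * iter_partial js bump xi)"
   using iter_partial_add[OF smooth_on_const sm, of js 1] unfolding iter_partial_cmult[OF bump_smooth] iter_partial_const by simp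
  obtain C where C: "!!xi. norm (iter_partial js bump xi) <= C" using test_fun_iter_partial_bounded[OF bump_test] by blast
  have "norm (iter_partial js ?p xi) <= 1 + C" for xi
   unfolding e by (rule norm_triangle_mono) (use C in \<open>auto simp: norm_mult\<close>)
  then show ?thesis by blast
 qed
 have p0: "?p xi = 0" if "norm xi < 3/2" for xi using radial_cut_one[OF ze, of xi] that by simp
 have pX: "schwartz (?p \<odot> ?X n)" for n
  using schwartz_diff[OF sX[of n] schwartz_test_fun[OF cX[of n]]] by (simp add: left_diff_distrib)
 have 2: "(\<lambda>n. dist_fourier \<mu> (?p \<odot> ?X n)) \<longlonglongrightarrow> 0"
 proof (rule tempered_small[OF T _ _ elim])
  show "\<forall>\<^sub>F n in sequentially. schwartz (?p \<odot> ?X n)" using pX by simp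
  fix k "is"
  obtain C where C: "C >= 0" "!!ep xi. 0 < ep ==> ep <= 1 ==>
   (1 + norm xi) ^ k * norm (iter_partial is (\<lambda>xi. ?p xi * inv_fourier (\<lambda>x. bump (ep *\<^sub>R x) * fourier ?b x) xi) xi) <= C * ep ^ 1"
   using mollified_tail[OF bi bs bump_test sp pb p0, of k "is" 1] by blast
  have "(1 + norm xi) ^ k * norm (iter_partial is (?p \<odot> ?X n) xi) <= C * ?e n" for n xi
   using C(2)[OF e01[of n], of xi] unfolding Ps_def by (simp only: power_one_right)
  then show "\<exists>C\<ge>0. \<forall>\<^sub>F n in sequentially. \<forall>xi. (1 + norm xi) ^ k * norm (iter_partial is (?p \<odot> ?X n) xi) <= C * ?e n"
   using C(1) by (intro exI[of _ C]) auto
 qed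
 have split: "\<mu> (?w n) = \<mu> (fourier (bump \<odot> ?X n)) + dist_fourier \<mu> (?p \<odot> ?X n)" for n
 proof -
  have "\<mu> (?w n) = dist_fourier \<mu> (?X n)" unfolding dist_fourier_def fourier_inv_fourier_schwartz[OF sw] ..
  also have "?X n = (\<lambda>xi. bump xi * ?X n xi + ?p xi * ?X n xi)" by (simp add: algebra_simps)
  also have "dist_fourier \<mu> ... = dist_fourier \<mu> (bump \<odot> ?X n) + dist_fourier \<mu> (?p \<odot> ?X n)"
   by (rule tempered_add[OF T schwartz_test_fun[OF cX] pX])
  finally show ?thesis by (simp add: dist_fourier_def)
 qed
 have 3: "(\<lambda>n. \<mu> (fourier (bump \<odot> ?X n))) \<longlonglongrightarrow> ?lim"
 proof -
  have "(\<lambda>n. \<mu> (?w n) - dist_fourier \<mu> (?p \<odot> ?X n)) \<longlonglongrightarrow> ?lim - 0" by (rule tendsto_diff[OF 1 2])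
  moreover have "\<mu> (?w n) - dist_fourier \<mu> (?p \<odot> ?X n) = \<mu> (fourier (bump \<odot> ?X n))" for n
   unfolding split by (simp only: add_diff_cancel_right')
  ultimately show ?thesis by (simp only: diff_zero)
 qed
 let ?a = "heat th t \<odot> bump"
 have ai: "L1 ?a" by (rule heat_mult_integrable[OF th bump_test])
 obtain C1 where C1: "C1 >= 0" "!!x. norm (fourier ?a x) <= C1 * prof th x"
  using kernel_bound_test_fun[OF ze th bump_test] by blast
 have kb: "norm (inv_fourier ?a (y - x)) <= C1 * prof th (x - y)" for x y
  using order_trans[OF norm_inv_fourier C1(2)[of "- (y - x)"]] by simp
 have [measurable]: "inv_fourier ?a \<in> borel_measurable borel"
  using fourier_measurable[OF ai] unfolding inv_fourier_eq[abs_def] by measurable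
 have [measurable]: "bump \<in> borel_measurable borel" by (intro borel_measurable_continuous_onI smooth_on_continuous bump_smooth)
 obtain C4 where C4: "C4 >= 0" "!!x::real^'n. (LBINT y. prof th (x - y) * prof th y) <= C4 * prof th x"
  using prof_convolve(2)[OF th] by blast
 let ?H = "\<lambda>n. fourier (\<lambda>xi. heat th t xi * (bump xi * ?X n xi))"
 have He: "?H n x = (LBINT y. inv_fourier ?a (y - x) * ?w n y)" for n x
  using fourier_mult_inv_fourier[OF ai schwartz_integrable[OF sw[of n]], of x] by (simp add: mult.assoc)
 have dom: "norm (inv_fourier ?a (y - x) * ?w n y) <= (C1 * C2) * (prof th (x - y) * prof th y)" for n x y
 proof -
  have "norm (?w n y) <= norm (Ps y)" unfolding norm_mult by (intro mult_left_le_one_le norm_radial_cut_le[OF ze]) auto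
  then have "norm (?w n y) <= C2 * prof th y" using C2(2)[of y] by linarith
  from mult_mono[OF kb this mult_nonneg_nonneg[OF C1(1) prof_nonneg] norm_ge_zero]
  show ?thesis unfolding norm_mult by (simp only: mult_ac)
 qed
 have di: "L1 (\<lambda>y. (C1 * C2) * (prof th (x - y) * prof th y))" for x :: "real^'n"
  by (intro integrable_mult_right prof_convolve(1)[OF th])
 \<comment> \<open>A majorant independent of \<open>n\<close> and integrable against the tame
   \<open>g\<close>; it permits the passage to the limit in the pairing.\<close>
 have Hb: "norm (?H n x) <= (C1 * C2 * C4) * prof th x" for n x
 proof -
  have "norm (?H n x) <= (LBINT y. (C1 * C2) * (prof th (x - y) * prof th y))"
   unfolding He
  proof (rule norm_integral_le[OF _ di dom])
   have [measurable]: "?w n \<in> borel_measurable borel" by (rule schwartz_measurable[OF sw])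
   show "L1 (\<lambda>y. inv_fourier ?a (y - x) * ?w n y)"
    by (rule integrable_dominated[OF di[of x] _ dom]) measurable
  qed
  also have "... <= (C1 * C2) * (C4 * prof th x)" using C4(2)[of x] C1(1) C2(1) by (simp add: mult_left_mono)
  finally show ?thesis by (simp add: mult.assoc)
 qed
 have Hlim: "(\<lambda>n. ?H n x) \<longlonglongrightarrow> fourier om x" for x
 proof -
  have "(\<lambda>n. LBINT y. inv_fourier ?a (y - x) * ?w n y) \<longlonglongrightarrow> (LBINT y. inv_fourier ?a (y - x) * (bump (0 *\<^sub>R y) * Ps y))"
  proof (rule integral_dominated_convergence[OF _ _ di])
   show "AE y in lborel. (\<lambda>n. inv_fourier ?a (y - x) * ?w n y) \<longlonglongrightarrow> inv_fourier ?a (y - x) * (bump (0 *\<^sub>R y) * Ps y)"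
    by (intro AE_I2 tendsto_mult tendsto_const continuous_on_tendsto_compose[OF smooth_on_continuous[OF bump_smooth]] tendsto_scaleR elim) auto
   show "AE y in lborel. norm (inv_fourier ?a (y - x) * ?w n y) <= (C1 * C2) * (prof th (x - y) * prof th y)" for n
    using dom by simp
  qed measurable
  moreover have "(LBINT y. inv_fourier ?a (y - x) * (bump (0 *\<^sub>R y) * Ps y)) = fourier (?a \<odot> inv_fourier Ps) x"
   using fourier_mult_inv_fourier[OF ai Psi, of x] radial_cut_one[OF ze, of "0::real^'n"] by simp
  moreover have "(?a \<odot> inv_fourier Ps) = om"
  proof
   fix xi
   obtain B where "!!xi. norm (?b xi) <= B"
   proof -
    have "compact (?b ` cball 0 1)" using bc by (intro compact_continuous_image) (auto intro: continuous_on_subset)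
    then obtain B where B: "!!xi. norm xi <= 1 ==> norm (?b xi) <= B" by (force dest!: compact_imp_bounded simp: bounded_iff)
    have "norm (?b xi) <= \<bar>B\<bar>" for xi
     using B[of xi] supp[of xi] by (cases "norm xi <= 1") auto
    then show ?thesis by (rule that)
   qed
   then have "inv_fourier Ps xi = ?b xi" using fourier_inversion[OF bc _ bi] Psi unfolding Ps_def by blast
   moreover have "bump xi * om xi = om xi" using supp[of xi] radial_cut_one[OF ze, of xi] by (cases "norm xi >= 5/6") auto
   ultimately show "?a xi * inv_fourier Ps xi = om xi"
    using heat_cancel(2)[of th t xi] by (simp add: mult.assoc mult.left_commute[of "bump xi"]) (simp add: mult.assoc[symmetric])
  qed
  ultimately show ?thesis unfolding He by simp
 qed
 have 4: "(\<lambda>n. LBINT x. g x * ?H n x) \<longlonglongrightarrow> ?lim"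
 proof (rule integral_dominated_convergence)
  have hm: "?H n \<in> borel_measurable borel" for n
   using heat_mult_integrable[OF th cX] by (rule fourier_measurable)
  show "(g \<odot> fourier om) \<in> borel_measurable lborel" using schwartz_measurable[OF schwartz_fourier[OF swo]] by measurable
  show "(g \<odot> ?H n) \<in> borel_measurable lborel" for n using hm[of n] by measurable
  have "L1 (\<lambda>x. g x * of_real ((C1 * C2 * C4) * prof th x))"
   by (rule tame_prof_integrable[OF th g, where C="C1 * C2 * C4"]) (use C1 C2 C4 in \<open>auto simp: norm_mult\<close>)
  then show "L1 (\<lambda>x. norm (g x * of_real ((C1 * C2 * C4) * prof th x)))" by (rule integrable_norm)
  show "AE x in lborel. (\<lambda>n. g x * ?H n x) \<longlonglongrightarrow> g x * fourier om x"
   by (intro AE_I2 tendsto_mult tendsto_const Hlim)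
  have nn: "norm (complex_of_real ((C1 * C2 * C4) * prof th x)) = (C1 * C2 * C4) * prof th x" for x :: "real^'n"
   unfolding norm_of_real using C1 C2 C4 by (intro abs_of_nonneg mult_nonneg_nonneg) auto
  show "AE x in lborel. norm (g x * ?H n x) <= norm (g x * of_real ((C1 * C2 * C4) * prof th x))" for n
   unfolding norm_mult[of "g _"] nn by (intro AE_I2 mult_left_mono Hb) auto
 qed
 show "(\<lambda>n. defect (bump \<odot> ?X n)) \<longlonglongrightarrow> 0"
  using tendsto_diff[OF 3 4] unfolding defect_def by simp
qed

lemma bump_near_zero: "norm x < 1 ==> bump x = 1"
 by (rule radial_cut_one[OF ze]) simp

text \<open>Integrating by parts against \<open>\<partial>\<^sup>j\<^sup>s S(t)\<psi>\<close>, whose order matches the degree of the polynomial belonging to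
 \<open>defect\<close>, isolates the top homogeneous part of that polynomial.\<close>

lemma defect_top_coefficient:
 assumes jet: "!!om. test_fun om ==> defect om = (\<Sum>is\<in>{is. length is < Suc d}. c is * iter_partial is om 0)"
  and js: "length (js :: 'n list) = d"
 shows "(\<Sum>is\<in>{is. length is = d}. c is * iter_partial (rev js) (mon is) 0) = 0"
proof -
 let ?e = "\<lambda>n. 1 / real (Suc n)"
 let ?k = "complex_of_real ((2 * pi) ^ CARD('n))"
 have k0: "?k \<noteq> 0" by simp
 have elim: "?e \<longlonglongrightarrow> 0" using LIMSEQ_inverse_real_of_nat by (simp add: inverse_eq_divide)
 let ?u = "\<lambda>xi::real^'n. bump (2 *\<^sub>R xi)"
 \<comment> \<open>The monomial factor makes the transform of heat(-t) om, up to a power of the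
   imaginary unit, the derivative \<open>js\<close> of the integrable function
   \<open>?U\<close>.\<close>
 let ?om = "mon js \<odot> ?u"
 have t0: "test_fun ?u" by (rule test_fun_dilate[OF bump_test]) simp
 have tw: "test_fun ?om" using test_fun_mult[OF smooth_on_mon t0, of js] by simp
 have s0: "?u xi = 0" if "norm xi >= 5/6" for xi using that by (intro radial_cut_zero[OF ze]) simp
 have sw: "?om xi = 0" if "norm xi >= 5/6" for xi using s0[OF that] by simp
 let ?b = "heat th (- t) \<odot> ?u"
 let ?Ps = "fourier (heat th (- t) \<odot> ?om)" and ?U = "fourier ?b"
 have bi: "L1 ?b" by (rule heat_mult_integrable[OF th t0])
 have bs: "?b xi = 0" if "norm xi >= 5/6" for xi using s0[OF that] by simp
 have bc: "continuous_on UNIV ?b"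
  using heat_continuous[OF th] smooth_on_continuous t0 by (intro continuous_on_mult) (auto simp: test_fun_def)
 obtain B where B: "!!xi. norm (?b xi) <= B"
 proof -
  have "compact (?b ` cball 0 1)" using bc by (intro compact_continuous_image) (auto intro: continuous_on_subset)
  then obtain B where B: "!!xi. norm xi <= 1 ==> norm (?b xi) <= B" by (force dest!: compact_imp_bounded simp: bounded_iff)
  have "norm (?b xi) <= \<bar>B\<bar>" for xi using B[of xi] bs[of xi] by (cases "norm xi <= 1") auto
  then show ?thesis by (rule that)
 qed
 have Ps0s: "smooth_on UNIV ?U" by (rule smooth_on_fourier_bounded_support[OF bi bs])
 then have [measurable]: "?U \<in> borel_measurable borel" by (intro borel_measurable_continuous_onI smooth_on_continuous)
 obtain C2 where C2: "C2 >= 0" "!!x. norm (?U x) <= C2 * prof th x"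
  using kernel_bound_test_fun[OF ze th t0] by blast
 have Ps0i: "L1 ?U"
  by (rule Bochner_Integration.integrable_bound[OF integrable_mult_right[OF integrable_prof[OF th], of C2]])
   (use C2 in \<open>auto intro: order_trans[OF _ abs_ge_self]\<close>)
 \<comment> \<open>Inversion at the origin, where symbol and cut-off are both 1. As this integral is
   not 0, the limits below retain the derivatives of the monomials.\<close>
 have intPs0: "(LBINT x. ?U x) = ?k"
 proof -
  have "inv_fourier ?U 0 = ?b 0" by (rule fourier_inversion[OF bc B bi Ps0i])
  then show ?thesis using k0 th bump_near_zero[of 0] by (simp add: inv_fourier_at_zero heat_def)
 qed
 have Pse: "?Ps x = \<i> ^ d * iter_partial js ?U x" for x
 proof -
  have "iter_partial js ?U = fourier (\<lambda>xi. (- \<i>) ^ length js * (mon js xi * ?b xi))"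
   by (rule iter_partial_fourier_bounded_support(1)[OF bi bs])
  also have "(\<lambda>xi. (- \<i>) ^ length js * (mon js xi * ?b xi)) = (\<lambda>xi. (- \<i>) ^ d * (heat th (- t) xi * ?om xi))"
   by (simp only: js mult_ac)
  finally have "iter_partial js ?U = fourier (\<lambda>xi. (- \<i>) ^ d * (heat th (- t) xi * ?om xi))" .
  then have "\<i> ^ d * iter_partial js ?U x = (\<i> ^ d * (- \<i>) ^ d) * ?Ps x" by (simp add: fourier_cmult)
  also have "\<i> ^ d * (- \<i>) ^ d = 1" by (simp add: power_mult_distrib[symmetric])
  finally show ?thesis by simp
 qed
 let ?X = "\<lambda>n. inv_fourier (\<lambda>x. bump (?e n *\<^sub>R x) * ?Ps x)"
 have sX: "schwartz (\<lambda>x. bump (?e n *\<^sub>R x) * ?Ps x)" for n by (rule defect_mollified(2)[OF tw sw])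
 let ?Ph = "\<lambda>is x. mon is x * bump x"
 have tPh: "test_fun (?Ph is)" for "is" by (rule test_fun_mult[OF smooth_on_mon bump_test])
 let ?D = "\<lambda>is. iter_partial (rev js) (?Ph is)"
 let ?J = "\<lambda>is n. LBINT x. ?D is (?e n *\<^sub>R x) * ?U x"
 have J: "?J is \<longlonglongrightarrow> ?D is 0 * ?k" for "is"
 proof -
  have tD: "test_fun (?D is)" by (rule test_fun_iter_partial[OF tPh])
  then have cD: "continuous_on UNIV (?D is)" by (auto simp: test_fun_def intro: smooth_on_continuous)
  then have [measurable]: "?D is \<in> borel_measurable borel" by (rule borel_measurable_continuous_onI)
  obtain M where M: "M >= 0" "!!x. norm (?D is x) <= M" using test_fun_sup[OF tD] by blast
  have "?J is \<longlonglongrightarrow> (LBINT x. ?D is (0 *\<^sub>R x) * ?U x)"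
  proof (rule integral_dominated_convergence[where w="\<lambda>x. M * norm (?U x)"])
   show "L1 (\<lambda>x. M * norm (?U x))" by (intro integrable_mult_right integrable_norm Ps0i)
   show "AE x in lborel. (\<lambda>n. ?D is (?e n *\<^sub>R x) * ?U x) \<longlonglongrightarrow> ?D is (0 *\<^sub>R x) * ?U x"
    by (intro AE_I2 tendsto_mult tendsto_const continuous_on_tendsto_compose[OF cD] tendsto_scaleR elim) auto
   show "AE x in lborel. norm (?D is (?e n *\<^sub>R x) * ?U x) <= M * norm (?U x)" for n
    unfolding norm_mult by (intro AE_I2 mult_right_mono M) auto
  qed measurable
  then show ?thesis using intPs0 by simp
 qed
 \<comment> \<open>A derivative at 0 of an inverse transform is a moment. Rescaling the monomial
   gives ep^(- length is), and moving the \<open>d\<close> derivatives onto the dilated factor gives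
   ep^d; only lists of length \<open>d\<close> survive the limit.\<close>
 have term_eq: "iter_partial is (bump \<odot> ?X n) 0 = \<i> ^ length is * \<i> ^ d * (-1) ^ d * (of_real (?e n) ^ (d - length is) * ?J is n) / ?k"
  if l: "length is <= d" for "is" n
 proof -
  let ?ep = "?e n"
  have "?ep \<noteq> 0" by simp
  then have e0: "complex_of_real ?ep \<noteq> 0" by (simp only: of_real_eq_0_iff not_False_eq_True)
  have "iter_partial is (bump \<odot> ?X n) 0 = iter_partial is (?X n) 0"
   by (rule iter_partial_cong_open[of "ball 0 1"]) (auto simp: bump_near_zero)
  also have "... = (LBINT x. \<i> ^ length is * (mon is x * (bump (?ep *\<^sub>R x) * ?Ps x))) / ?k"
   unfolding iter_partial_inv_fourier[OF sX] inv_fourier_at_zero ..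
  also have "(\<lambda>x. \<i> ^ length is * (mon is x * (bump (?ep *\<^sub>R x) * ?Ps x))) =
    (\<lambda>x. (\<i> ^ length is * \<i> ^ d / of_real ?ep ^ length is) * (?Ph is (?ep *\<^sub>R x) * iter_partial js ?U x))"
  proof
   fix x
   have "mon is x = mon is (?ep *\<^sub>R x) / of_real ?ep ^ length is" using e0 by (simp only: mon_scale nonzero_mult_div_cancel_left power_not_zero not_False_eq_True)
   then show "\<i> ^ length is * (mon is x * (bump (?ep *\<^sub>R x) * ?Ps x)) =
    (\<i> ^ length is * \<i> ^ d / of_real ?ep ^ length is) * (?Ph is (?ep *\<^sub>R x) * iter_partial js ?U x)"
    unfolding Pse by (simp only: times_divide_eq_left times_divide_eq_right mult_ac)
  qed
  also have "(LBINT x. (\<i> ^ length is * \<i> ^ d / of_real ?ep ^ length is) * (?Ph is (?ep *\<^sub>R x) * iter_partial js ?U x))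
    = (\<i> ^ length is * \<i> ^ d / of_real ?ep ^ length is) * (LBINT x. ?Ph is (?ep *\<^sub>R x) * iter_partial js ?U x)"
   by (rule integral_mult_right_zero)
  also have "(LBINT x. ?Ph is (?ep *\<^sub>R x) * iter_partial js ?U x) = (-1) ^ d * (LBINT x. iter_partial (rev js) (\<lambda>x. ?Ph is (?ep *\<^sub>R x)) x * ?U x)"
   using integral_by_parts[OF test_fun_dilate[OF tPh, of ?ep "is"] Ps0s, of js] js by simp
  also have "(\<lambda>x. iter_partial (rev js) (\<lambda>x. ?Ph is (?ep *\<^sub>R x)) x * ?U x) = (\<lambda>x. of_real ?ep ^ d * (?D is (?ep *\<^sub>R x) * ?U x))"
   using iter_partial_dilate[of "?Ph is" "rev js" ?ep] tPh[of "is"] js by (simp add: test_fun_def mult.assoc)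
  also have "(LBINT x. of_real ?ep ^ d * (?D is (?ep *\<^sub>R x) * ?U x)) = of_real ?ep ^ d * ?J is n"
   by (rule integral_mult_right_zero)
  also have "(\<i> ^ length is * \<i> ^ d / of_real ?ep ^ length is) * ((-1) ^ d * (of_real ?ep ^ d * ?J is n)) / ?k
   = \<i> ^ length is * \<i> ^ d * (-1) ^ d * (of_real ?ep ^ (d - length is) * ?J is n) / ?k"
  proof -
   have "complex_of_real ?ep ^ d = of_real ?ep ^ (d - length is) * of_real ?ep ^ length is"
    unfolding power_add[symmetric] using l by simp
   then have h: "complex_of_real ?ep ^ d / of_real ?ep ^ length is = of_real ?ep ^ (d - length is)"
    using e0 by (simp only: nonzero_mult_div_cancel_right power_not_zero not_False_eq_True)
   have gen: "(a / q) * (m * (p * J)) / k = a * m * ((p / q) * J) / k" for a q m p J k :: complex by simp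
   show ?thesis unfolding gen h ..
  qed
  finally show ?thesis .
 qed
 let ?L = "\<lambda>is. if length is = d then \<i> ^ d * \<i> ^ d * (-1) ^ d * ?D is 0 else 0"
 have lim: "(\<lambda>n. iter_partial is (bump \<odot> ?X n) 0) \<longlonglongrightarrow> ?L is" if l: "length is <= d" for "is"
 proof -
  have "(\<lambda>n. \<i> ^ length is * \<i> ^ d * (-1) ^ d * (of_real (?e n) ^ (d - length is) * ?J is n) / ?k) \<longlonglongrightarrow>
    \<i> ^ length is * \<i> ^ d * (-1) ^ d * (of_real 0 ^ (d - length is) * (?D is 0 * ?k)) / ?k"
   by (intro tendsto_divide tendsto_mult tendsto_const tendsto_power tendsto_of_real elim J k0)
  moreover have "\<i> ^ length is * \<i> ^ d * (-1) ^ d * (of_real 0 ^ (d - length is) * (?D is 0 * ?k)) / ?k = ?L is"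
   using l k0 by (cases "length is = d") auto
  ultimately show ?thesis unfolding term_eq[OF l] by simp
 qed
 have "(\<lambda>n. \<Sum>is\<in>{is. length is < Suc d}. c is * iter_partial is (bump \<odot> ?X n) 0) \<longlonglongrightarrow> (\<Sum>is\<in>{is. length is < Suc d}. c is * ?L is)"
  by (intro tendsto_sum tendsto_mult tendsto_const lim) simp
 moreover have "defect (bump \<odot> ?X n) = (\<Sum>is\<in>{is. length is < Suc d}. c is * iter_partial is (bump \<odot> ?X n) 0)" for n
  by (intro jet test_fun_mult' bump_test schwartz_smooth schwartz_inv_fourier sX)
 ultimately have "(\<lambda>n. defect (bump \<odot> ?X n)) \<longlonglongrightarrow> (\<Sum>is\<in>{is. length is < Suc d}. c is * ?L is)" by (simp only:)
 from LIMSEQ_unique[OF this defect_mollified(1)[OF tw sw]]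
 have "(\<Sum>is\<in>{is. length is < Suc d}. c is * ?L is) = 0" .
 also have "(\<Sum>is\<in>{is. length is < Suc d}. c is * ?L is) = (\<Sum>is\<in>{is. length is = d}. c is * ?L is)"
  by (rule sum.mono_neutral_right) (auto intro: finite_subset[OF _ finite_lists_le[of d]])
 also have "... = (\<Sum>is\<in>{is. length is = d}. (\<i> ^ d * \<i> ^ d * (-1) ^ d) * (c is * iter_partial (rev js) (mon is) 0))"
 proof (rule sum.cong[OF refl])
  fix "is" :: "'n list" assume "is \<in> {is. length is = d}"
  moreover have "?D is 0 = iter_partial (rev js) (mon is) 0"
   by (rule iter_partial_cong_open[of "ball 0 1"]) (auto simp: bump_near_zero)
  ultimately show "c is * ?L is = (\<i> ^ d * \<i> ^ d * (-1) ^ d) * (c is * iter_partial (rev js) (mon is) 0)" by (simp add: mult_ac)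
 qed
 also have "... = (\<i> ^ d * \<i> ^ d * (-1) ^ d) * (\<Sum>is\<in>{is. length is = d}. c is * iter_partial (rev js) (mon is) 0)"
  by (rule sum_distrib_left[symmetric])
 finally show ?thesis by simp
qed

text \<open>All derivatives of order \<open>d\<close> of the homogeneous polynomial with
  coefficients \<open>c\<close> vanish at 0, so the polynomial vanishes. By inversion its share of
  \<open>defect\<close> is a constant multiple of the integral of that polynomial against F om. The
  single coefficients may remain nonzero, because permuted lists name the same monomial.\<close>

lemma defect_lower_order:
 assumes jet: "!!om. test_fun om ==> defect om = (\<Sum>is\<in>{is. length is < Suc d}. c is * iter_partial is om 0)"
  and w: "test_fun om"
 shows "defect om = (\<Sum>is\<in>{is. length is < d}. c is * iter_partial is om 0)"
proof -
 let ?T = "{is :: 'n list. length is = d}"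
 have fin: "finite ?T" by (rule finite_subset[OF _ finite_lists_le[of d]]) auto
 let ?P = "\<lambda>x. \<Sum>is\<in>?T. c is * mon is x"
 have sP: "smooth_on UNIV (\<lambda>x. c is * mon is x)" for "is" :: "'n list" by (intro smooth_on_mult smooth_on_mon) auto
 have P0: "?P x = 0" for x
 proof (rule homogeneous_zero[of ?P d])
  show "smooth_on UNIV ?P" by (intro smooth_on_sum sP) auto
  show "?P (r *\<^sub>R x) = of_real r ^ d * ?P x" if "r > 0" for r x
   by (simp add: mon_scale sum_distrib_left mult_ac)
  show "iter_partial js ?P 0 = 0" if l: "length js = d" for js
  proof -
   have "iter_partial js ?P 0 = (\<Sum>is\<in>?T. c is * iter_partial (rev (rev js)) (mon is) 0)"
    by (subst iter_partial_sum[OF sP]) (simp add: iter_partial_cmult[OF smooth_on_mon])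
   also have "... = 0" by (rule defect_top_coefficient[OF jet]) (use l in auto)
   finally show ?thesis .
  qed
 qed
 have sw: "schwartz om" by (rule schwartz_test_fun[OF w])
 let ?W = "fourier om" and ?k = "complex_of_real ((2 * pi) ^ CARD('n))"
 have sF: "schwartz ?W" by (rule schwartz_fourier[OF sw])
 have "(\<Sum>is\<in>?T. c is * iter_partial is om 0) = (\<Sum>is\<in>?T. LBINT x. \<i> ^ d / ?k * (c is * mon is x * ?W x))"
 proof (rule sum.cong[OF refl])
  fix "is" :: "'n list" assume "is \<in> ?T"
  then have l: "length is = d" by simp
  have "iter_partial is om 0 = iter_partial is (inv_fourier ?W) 0" unfolding inv_fourier_fourier_schwartz[OF sw] ..
  also have "... = (LBINT x. \<i> ^ d * (mon is x * ?W x)) / ?k"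
   unfolding iter_partial_inv_fourier[OF sF] inv_fourier_at_zero l ..
  finally show "c is * iter_partial is om 0 = (LBINT x. \<i> ^ d / ?k * (c is * mon is x * ?W x))"
   by (simp add: mult.assoc)
 qed
 also have "... = (LBINT x. (\<Sum>is\<in>?T. \<i> ^ d / ?k * (c is * mon is x * ?W x)))"
 proof (rule Bochner_Integration.integral_sum[symmetric])
  fix "is" :: "'n list"
  show "L1 (\<lambda>x. \<i> ^ d / ?k * (c is * mon is x * ?W x))"
   unfolding mult.assoc by (intro integrable_mult_right schwartz_integrable schwartz_mon sF)
 qed
 also have "... = (LBINT x. \<i> ^ d / ?k * (?P x * ?W x))"
  by (simp only: sum_distrib_left[symmetric] sum_distrib_right[symmetric])
 also have "... = 0" by (simp only: P0) simp
 finally have top: "(\<Sum>is\<in>?T. c is * iter_partial is om 0) = 0" .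
 have fin2: "finite {is :: 'n list. length is < d}" by (rule finite_subset[OF _ finite_lists_le[of d]]) auto
 have "{is :: 'n list. length is < Suc d} = {is. length is < d} \<union> ?T" by auto
 then have "defect om = (\<Sum>is\<in>{is. length is < d} \<union> ?T. c is * iter_partial is om 0)" using jet[OF w] by simp
 also have "... = (\<Sum>is\<in>{is. length is < d}. c is * iter_partial is om 0) + (\<Sum>is\<in>?T. c is * iter_partial is om 0)"
  using fin fin2 by (intro sum.union_disjoint) auto
 finally show ?thesis using top by simp
qed

theorem initial_datum_pairing:
 assumes "test_fun om"
 shows "\<mu> (fourier om) = (LBINT x. g x * fourier (heat th t \<odot> om) x)"
proof -
 obtain K c where jet: "!!om. test_fun om ==> defect om = (\<Sum>is\<in>{is. length is < K}. c is * iter_partial is om 0)"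
  using defect_jet by blast
 \<comment> \<open>Each use of \<open>defect_lower_order\<close> lowers the order of the jet by one;
   truncated subtraction keeps the statement stable once the order is 0.\<close>
 have "defect om = (\<Sum>is\<in>{is. length is < K - m}. c is * iter_partial is om 0)" if "test_fun om" for m om
  using that
 proof (induction m arbitrary: om)
  case 0
  then show ?case using jet by simp
 next
  case (Suc m)
  show ?case
  proof (cases "K - m")
   case 0
   then show ?thesis using Suc.IH[OF Suc.prems] by simp
  next
   case (Suc d)
   have "defect om' = (\<Sum>is\<in>{is. length is < Suc d}. c is * iter_partial is om' 0)" if "test_fun om'" for om'
    using Suc.IH[OF that] Suc by simp
   from defect_lower_order[OF this Suc.prems] Suc show ?thesis
    by (simp add: diff_Suc)
  qed
 qed
 from this[OF assms, of K] have "defect om = 0" by simp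
 then show ?thesis by (simp add: defect_def)
qed

end

section \<open>The semigroup on functions\<close>

definition heat_kernel :: "real => real => real^'n::finite => complex" where
 "heat_kernel th s = inv_fourier (heat th (- s))"

definition heat_conv :: "real => real => (real^'n::finite => complex) => real^'n => complex" where
 "heat_conv th s f x = (LBINT y. heat_kernel th s (x - y) * f y)"

lemma continuous_heat_kernel:
 "th > 0 ==> s > 0 ==> continuous_on UNIV (heat_kernel th s :: real^'n::finite => complex)"
 unfolding heat_kernel_def inv_fourier_eq[abs_def]
 by (intro continuous_intros continuous_on_compose2[OF continuous_fourier[OF heat_integrable]]) auto

lemma heat_kernel_measurable: "th > 0 ==> s > 0 ==> heat_kernel th s \<in> borel_measurable borel"
 by (intro borel_measurable_continuous_onI continuous_heat_kernel)

lemma heat_kernel_bound: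
 assumes "lp_cutoff ze" "th > 0"
 shows "\<exists>C\<ge>0. \<forall>s>0. \<forall>x::real^'n::finite. norm (heat_kernel th s x)
  <= C * ((1 / s powr (1 / th)) ^ CARD('n) * prof th ((1 / s powr (1 / th)) *\<^sub>R x))"
proof -
 obtain C where C: "C >= 0" "!!s x. s > 0 ==> norm (fourier (heat th (- s)) (x::real^'n))
  <= C * (1 / (s powr (1 / th)) ^ CARD('n) * prof th ((1 / s powr (1 / th)) *\<^sub>R x))"
  using kernel_bound_heat[OF assms, where 'n='n] by blast
 have "norm (heat_kernel th s x) <= C * ((1 / s powr (1 / th)) ^ CARD('n) * prof th ((1 / s powr (1 / th)) *\<^sub>R x))"
  if "s > 0" for s and x :: "real^'n"
  using order_trans[OF norm_inv_fourier C(2)[OF that, of "- x"]] unfolding heat_kernel_def by (simp add: power_divide)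
 then show ?thesis using C(1) by blast
qed

lemma heat_kernel_bound_prof:
 assumes "lp_cutoff ze" "th > 0" "s > 0"
 shows "\<exists>C\<ge>0. \<forall>x::real^'n::finite. norm (heat_kernel th s x) <= C * prof th x"
proof -
 let ?c = "1 / s powr (1 / th)"
 have c: "?c > 0" using assms by simp
 obtain C where C: "C >= 0" "!!x::real^'n. norm (heat_kernel th s x) <= C * (?c ^ CARD('n) * prof th (?c *\<^sub>R x))"
  using heat_kernel_bound[OF assms(1,2)] assms(3) by blast
 obtain D where D: "D >= 0" "!!x::real^'n. prof th (?c *\<^sub>R x) <= D * prof th x"
  using prof_scale[OF assms(2) c] by blast
 have "norm (heat_kernel th s x) <= (C * ?c ^ CARD('n) * D) * prof th x" for x :: "real^'n"
 proof -
  have "C * (?c ^ CARD('n) * prof th (?c *\<^sub>R x)) <= C * (?c ^ CARD('n) * (D * prof th x))"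
   using C(1) c by (intro mult_left_mono D) auto
  with C(2)[of x] show ?thesis by (simp only: mult.assoc)
 qed
 moreover have "C * ?c ^ CARD('n) * D >= 0" using C(1) D(1) c by (intro mult_nonneg_nonneg zero_le_power) auto
 ultimately show ?thesis by blast
qed

text \<open>The growth condition under which \<open>S(t)f\<close> exists for all \<open>t > 0\<close>.\<close>

definition prof_integrable :: "real => (real^'n::finite => complex) => bool" where
 "prof_integrable th f \<longleftrightarrow> f \<in> borel_measurable borel \<and> L1 (\<lambda>y. prof th y * norm (f y))"

lemma tame_prof_integrable': "th > 0 ==> tame f ==> prof_integrable th f"
proof -
 assume th: "th > 0" and f: "tame f"
 have "L1 (\<lambda>x. f x * of_real (prof th x))"
  by (rule tame_prof_integrable[OF th f, where C=1]) auto
 from integrable_norm[OF this] have "L1 (\<lambda>x. prof th x * norm (f x))"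
  by (simp add: norm_mult mult.commute)
 then show ?thesis using tame_measurable[OF f] by (simp add: prof_integrable_def)
qed

lemma prof_translate':
 fixes x y :: "real^'n::finite"
 assumes "th > 0"
 shows "prof th (x - y) <= (1 + norm x) powr (real CARD('n) + min (th / 2) 1) * prof th y"
 using prof_translate[OF assms, of "- y" x] by simp

lemma heat_conv_integrand_bound:
 fixes x y :: "real^'n::finite" and f :: "real^'n => complex"
 assumes "th > 0" "!!x::real^'n. norm (heat_kernel th s x) <= C * prof th x" "C >= 0"
 shows "norm (heat_kernel th s (x - y) * f y) <= C * (1 + norm x) powr (real CARD('n) + min (th / 2) 1) * (prof th y * norm (f y))"
proof -
 have "norm (heat_kernel th s (x - y)) <= C * ((1 + norm x) powr (real CARD('n) + min (th / 2) 1) * prof th y)"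
  using assms(2)[of "x - y"] mult_left_mono[OF prof_translate'[OF assms(1), of x y] assms(3)] by linarith
 from mult_right_mono[OF this, of "norm (f y)"] show ?thesis by (simp add: norm_mult mult.assoc)
qed

lemma continuous_heat_conv:
 fixes f :: "real^'n::finite => complex"
 assumes ze: "lp_cutoff ze" and th: "th > 0" and s: "s > 0" and f: "prof_integrable th f"
 shows "continuous_on UNIV (heat_conv th s f)"
proof (rule continuous_on_sequentiallyI)
 fix u :: "nat => real^'n" and a assume u: "u \<longlonglongrightarrow> a"
 let ?p = "real CARD('n) + min (th / 2) 1"
 obtain C where C: "C >= 0" "!!x::real^'n. norm (heat_kernel th s x) <= C * prof th x"
  using heat_kernel_bound_prof[OF ze th s] by blast
 have [measurable]: "f \<in> borel_measurable borel" "(heat_kernel th s :: real^'n => complex) \<in> borel_measurable borel"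
  using f heat_kernel_measurable[OF th s] by (auto simp: prof_integrable_def)
 obtain B where B: "!!n. norm (u n) <= B" using convergent_imp_Bseq[OF convergentI[OF u]] by (auto simp: Bseq_def)
 show "(\<lambda>n. heat_conv th s f (u n)) \<longlonglongrightarrow> heat_conv th s f a"
  unfolding heat_conv_def
 proof (rule integral_dominated_convergence[where w="\<lambda>y. C * (1 + B) powr ?p * (prof th y * norm (f y))"])
  show "L1 (\<lambda>y. C * (1 + B) powr ?p * (prof th y * norm (f y)))"
   using f by (intro integrable_mult_right) (simp add: prof_integrable_def)
  show "AE y in lborel. (\<lambda>n. heat_kernel th s (u n - y) * f y) \<longlonglongrightarrow> heat_kernel th s (a - y) * f y"
   by (intro AE_I2 tendsto_mult tendsto_const continuous_on_tendsto_compose[OF continuous_heat_kernel[OF th s]] tendsto_diff u) auto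
  fix n
  have "(1 + norm (u n)) powr ?p <= (1 + B) powr ?p" using B[of n] th by (intro powr_mono2) auto
  then have "C * (1 + norm (u n)) powr ?p * (prof th y * norm (f y)) <= C * (1 + B) powr ?p * (prof th y * norm (f y))" for y
   using C(1) by (intro mult_right_mono mult_left_mono) auto
  with heat_conv_integrand_bound[OF th C(2,1), of "u n" _ f]
  show "AE y in lborel. norm (heat_kernel th s (u n - y) * f y) <= C * (1 + B) powr ?p * (prof th y * norm (f y))"
   by (intro AE_I2) (rule order_trans)
 qed measurable
qed

text \<open>The integral of |k(x - y) h(x)| over x is again bounded by a multiple of prof(y),
  against which \<open>f\<close> is integrable. Hence Fubini applies and the convolution moves from
  \<open>f\<close> to \<open>h\<close>.\<close>

lemma prof_convolution_pair:
 fixes k :: "real^'n::finite => complex"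
 assumes th: "th > 0" and f: "prof_integrable th f" and k: "k \<in> borel_measurable borel" "!!x. norm (k x) <= C * prof th x" "C >= 0"
  and h: "h \<in> borel_measurable borel" "!!x. norm (h x) <= D * prof th x" "D >= 0"
 shows "integrable (lborel \<Otimes>\<^sub>M lborel) (\<lambda>(y, x). k (x - y) * f y * h x)"
  and "L1 (\<lambda>x. (LBINT y. k (x - y) * f y) * h x)"
  and "(LBINT x. (LBINT y. k (x - y) * f y) * h x) = (LBINT y. f y * (LBINT x. k (x - y) * h x))"
proof -
 have [measurable]: "f \<in> borel_measurable borel" "k \<in> borel_measurable borel" "h \<in> borel_measurable borel"
  using f k h by (auto simp: prof_integrable_def)
 obtain C4 where C4: "C4 >= 0" "!!x::real^'n. (LBINT y. prof th (x - y) * prof th y) <= C4 * prof th x"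
  using prof_convolve(2)[OF th] by blast
 let ?F = "\<lambda>(y, x). k (x - y) * f y * h x"
 show I: "integrable (lborel \<Otimes>\<^sub>M lborel) ?F"
 proof (rule integrable_pairI)
  have in1: "(\<integral>\<^sup>+x. ennreal (norm (k (x - y) * f y * h x)) \<partial>lborel) <= ennreal (C * D * C4 * (prof th y * norm (f y)))" for y
  proof -
   have "(\<integral>\<^sup>+x. ennreal (norm (k (x - y) * f y * h x)) \<partial>lborel) <= (\<integral>\<^sup>+x. ennreal (C * D * norm (f y) * (prof th (y - x) * prof th x)) \<partial>lborel)"
   proof (intro nn_integral_mono ennreal_leI)
    fix x
    have "norm (k (x - y)) * norm (h x) <= (C * prof th (x - y)) * (D * prof th x)" using k h by (intro mult_mono) auto
    from mult_right_mono[OF this, of "norm (f y)"]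
    show "norm (k (x - y) * f y * h x) <= C * D * norm (f y) * (prof th (y - x) * prof th x)"
     unfolding prof_commute[of th y x] norm_mult by (simp only: mult_ac) simp
   qed
   also have "... = ennreal (C * D * norm (f y) * (LBINT x. prof th (y - x) * prof th x))"
    using k(3) h(3) prof_convolve(1)[OF th, of y] by (subst nn_integral_eq_integral) auto
   also have "... <= ennreal (C * D * norm (f y) * (C4 * prof th y))"
    using k(3) h(3) by (intro ennreal_leI mult_left_mono C4) auto
   finally show ?thesis by (simp add: mult_ac)
  qed
  have "(\<integral>\<^sup>+y. \<integral>\<^sup>+x. ennreal (norm (?F (y, x))) \<partial>lborel \<partial>lborel) <= (\<integral>\<^sup>+y. ennreal (C * D * C4 * (prof th y * norm (f y))) \<partial>lborel)"
   using in1 by (intro nn_integral_mono) simp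
  also have "... < \<infinity>"
   using f k(3) h(3) C4(1) by (subst nn_integral_eq_integral) (auto simp: prof_integrable_def)
  finally show "(\<integral>\<^sup>+y. \<integral>\<^sup>+x. ennreal (norm (?F (y, x))) \<partial>lborel \<partial>lborel) < \<infinity>" .
 qed measurable
 have I': "integrable (lborel \<Otimes>\<^sub>M lborel) (\<lambda>(x, y). k (x - y) * f y * h x)"
  using lborel_pair.integrable_product_swap[OF I] by (simp add: case_prod_beta)
 have e: "(LBINT y. k (x - y) * f y * h x) = (LBINT y. k (x - y) * f y) * h x" for x by simp
 show "L1 (\<lambda>x. (LBINT y. k (x - y) * f y) * h x)"
  using lborel_pair.integrable_fst'[OF I'] unfolding prod.case e .
 have "(LBINT x. (LBINT y. k (x - y) * f y) * h x) = (LBINT x. (LBINT y. k (x - y) * f y * h x))" unfolding e ..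
 also have "... = (LBINT y. (LBINT x. k (x - y) * f y * h x))"
  by (rule lborel_pair.Fubini_integral[OF I])
 also have "... = (LBINT y. f y * (LBINT x. k (x - y) * h x))"
  by (subst integral_mult_right_zero[symmetric]) (simp only: mult_ac)
 finally show "(LBINT x. (LBINT y. k (x - y) * f y) * h x) = (LBINT y. f y * (LBINT x. k (x - y) * h x))" .
qed

lemma prof_convolution_bound:
 fixes k h :: "real^'n::finite => complex"
 assumes th: "th > 0" and k: "k \<in> borel_measurable borel" "!!x. norm (k x) <= C * prof th x" "C >= 0"
  and h: "h \<in> borel_measurable borel" "!!x. norm (h x) <= D * prof th x" "D >= 0"
 shows "\<exists>B\<ge>0. \<forall>y. norm (LBINT x. k (x - y) * h x) <= B * prof th y"
proof -
 have [measurable]: "k \<in> borel_measurable borel" "h \<in> borel_measurable borel" using k h by auto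
 obtain C4 where C4: "C4 >= 0" "!!x::real^'n. (LBINT y. prof th (x - y) * prof th y) <= C4 * prof th x"
  using prof_convolve(2)[OF th] by blast
 have "norm (LBINT x. k (x - y) * h x) <= (C * D * C4) * prof th y" for y
 proof -
  have w: "L1 (\<lambda>x. (C * D) * (prof th (y - x) * prof th x))" by (intro integrable_mult_right prof_convolve(1)[OF th])
  have b: "norm (k (x - y) * h x) <= (C * D) * (prof th (y - x) * prof th x)" for x
   using mult_mono[OF k(2)[of "x - y"] h(2)[of x] mult_nonneg_nonneg[OF k(3) prof_nonneg] norm_ge_zero]
   unfolding norm_mult prof_commute[of th y x] by (simp only: mult_ac)
  have "norm (LBINT x. k (x - y) * h x) <= (LBINT x. (C * D) * (prof th (y - x) * prof th x))"
   by (rule norm_integral_le[OF integrable_dominated[OF w _ b] w b]) measurable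
  also have "... <= (C * D) * (C4 * prof th y)" using C4(2)[of y] k(3) h(3) by (simp add: mult_left_mono)
  finally show ?thesis by (simp add: mult.assoc)
 qed
 then show ?thesis using k(3) h(3) C4(1) by (intro exI[of _ "C * D * C4"]) auto
qed

lemma schwartz_prof: assumes "schwartz ph" obtains D where "D >= 0" "!!x. norm (ph x) <= D * prof th x"
 using rapid_prof[OF schwartz_rapid[OF assms]] by blast

lemma heat_conv_adjoint:
 fixes f h :: "real^'n::finite => complex"
 assumes ze: "lp_cutoff ze" and th: "th > 0" and s: "s > 0" and f: "prof_integrable th f"
  and h: "h \<in> borel_measurable borel" "!!x. norm (h x) <= D * prof th x" "D >= 0"
 shows "L1 (heat_conv th s f \<odot> h)"
  and "(LBINT x. heat_conv th s f x * h x) = (LBINT y. f y * fourier (heat th (- s) \<odot> inv_fourier h) y)"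
  and "\<exists>B\<ge>0. \<forall>y. norm (fourier (heat th (- s) \<odot> inv_fourier h) y) <= B * prof th y"
proof -
 obtain C where C: "C >= 0" "!!x::real^'n. norm (heat_kernel th s x) <= C * prof th x"
  using heat_kernel_bound_prof[OF ze th s] by blast
 have hi: "L1 h"
  by (rule integrable_dominated[OF integrable_mult_right[OF integrable_prof[OF th], of D]]) (use h in auto)
 note P = prof_convolution_pair[OF th f heat_kernel_measurable[OF th s] C(2,1) h]
 have F: "fourier (heat th (- s) \<odot> inv_fourier h) y = (LBINT x. heat_kernel th s (x - y) * h x)" for y
  unfolding heat_kernel_def by (rule fourier_mult_inv_fourier[OF heat_integrable[OF th s] hi])
 show "L1 (heat_conv th s f \<odot> h)"
  using P(2) unfolding heat_conv_def .
 show "(LBINT x. heat_conv th s f x * h x) = (LBINT y. f y * fourier (heat th (- s) \<odot> inv_fourier h) y)"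
  using P(3) unfolding heat_conv_def F .
 show "\<exists>B\<ge>0. \<forall>y. norm (fourier (heat th (- s) \<odot> inv_fourier h) y) <= B * prof th y"
  unfolding F by (rule prof_convolution_bound[OF th heat_kernel_measurable[OF th s] C(2,1) h])
qed

text \<open>The symbol is transposed onto the test function, whose image is bounded by
  \<open>prof\<close>; removing the cut-off is then dominated convergence. \<open>f0\<close> is
  Lebesgue measurable only, and \<open>f\<close> is the Borel version in which the convolution is
  written.\<close>

lemma has_semigroup_value_heat_conv:
 fixes f f0 :: "real^'n::finite => complex"
 assumes ze: "lp_cutoff ze" and th: "th > 0" and s: "s > 0" and f: "prof_integrable th f"
  and f0: "f0 \<in> borel_measurable lebesgue" "AE x in lebesgue. f0 x = f x"
 shows "has_semigroup_value th s (regular_dist f0) (heat_conv th s f)"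
 unfolding has_semigroup_value_def
proof (intro conjI allI impI)
 show cont: "continuous_on UNIV (heat_conv th s f)" by (rule continuous_heat_conv[OF ze th s f])
 then have [measurable]: "heat_conv th s f \<in> borel_measurable borel" by (rule borel_measurable_continuous_onI)
 have [measurable]: "f \<in> borel_measurable borel" using f by (simp add: prof_integrable_def)
 fix ph :: "real^'n => complex" assume ph: "schwartz ph"
 have [measurable]: "ph \<in> borel_measurable borel" by (rule schwartz_measurable[OF ph])
 obtain D where D: "D >= 0" "!!x. norm (ph x) <= D * prof th x" using schwartz_prof[OF ph] by blast
 note A = heat_conv_adjoint[OF ze th s f schwartz_measurable[OF ph] D(2,1)]
 show "integrable lebesgue (heat_conv th s f \<odot> ph)"
  using A(1) by (subst integrable_completion) auto
 fix et :: "real^'n => complex" assume et: "space_cutoff et"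
 have tet: "test_fun et" by (rule space_cutoff_test_fun[OF et])
 have cet: "continuous_on UNIV et" using tet by (auto simp: test_fun_def intro: smooth_on_continuous)
 then have [measurable]: "et \<in> borel_measurable borel" by (rule borel_measurable_continuous_onI)
 have et0: "et 0 = 1" using et unfolding space_cutoff_def by auto
 obtain M where M: "M >= 0" "!!x. norm (et x) <= M" using test_fun_sup[OF tet] by blast
 let ?Ps = "fourier (heat th (- s) \<odot> inv_fourier ph)"
 obtain B where B: "B >= 0" "!!y. norm (?Ps y) <= B * prof th y" using A(3) by blast
 obtain K where K: "!!x. norm (inv_fourier ph x) <= K" using schwartz_bounded[OF schwartz_inv_fourier[OF ph]] by blast
 have [measurable]: "inv_fourier ph \<in> borel_measurable borel" by (rule schwartz_measurable[OF schwartz_inv_fourier[OF ph]])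
 have "L1 (heat th (- s) \<odot> inv_fourier ph)"
 proof (rule integrable_dominated)
  show "L1 (\<lambda>xi. norm (heat th (- s) xi :: complex) * K)"
   by (rule integrable_mult_left[OF integrable_norm[OF heat_integrable[OF th s]]])
  show "norm (heat th (- s) xi * inv_fourier ph xi) <= norm (heat th (- s) xi) * K" for xi
   unfolding norm_mult by (intro mult_left_mono K) auto
 qed measurable
 then have [measurable]: "?Ps \<in> borel_measurable borel" by (rule fourier_measurable)
 have rd: "regular_dist f0 h = (LBINT x. f x * h x)" if [measurable]: "h \<in> borel_measurable borel" for h
 proof -
  have "regular_dist f0 h = (\<integral>x. f x * h x \<partial>lebesgue)" unfolding regular_dist_def
  proof (rule integral_cong_AE)
   have "h \<in> borel_measurable lebesgue" by (rule measurable_completion) simp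
   then show "(f0 \<odot> h) \<in> borel_measurable lebesgue" using f0(1) by (intro borel_measurable_times)
   show "(f \<odot> h) \<in> borel_measurable lebesgue" by (rule measurable_completion) simp
   show "AE x in lebesgue. f0 x * h x = f x * h x" using f0(2) by eventually_elim simp
  qed
  then show ?thesis by (simp add: integral_completion)
 qed
 have m: "multiplier (\<lambda>xi. complex_of_real (exp (- s * norm xi powr th))) (dist_mult (\<lambda>x. et (ep *\<^sub>R x)) (regular_dist f0)) ph
  = (LBINT x. f x * (et (ep *\<^sub>R x) * ?Ps x))" for ep
  unfolding multiplier_eq heat_uminus[symmetric] dist_mult_def by (rule rd) measurable
 have lim: "regular_dist (heat_conv th s f) ph = (LBINT x. f x * ?Ps x)"
  using regular_dist_borel[of "heat_conv th s f" ph] A(2) by simp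
 show "((\<lambda>ep. multiplier (\<lambda>xi. complex_of_real (exp (- s * norm xi powr th))) (dist_mult (\<lambda>x. et (ep *\<^sub>R x)) (regular_dist f0)) ph)
   \<longlongrightarrow> regular_dist (heat_conv th s f) ph) (at_right 0)"
  unfolding m lim tendsto_at_iff_sequentially comp_def
 proof (intro allI impI)
  fix X :: "nat => real" assume X: "X \<longlonglongrightarrow> 0"
  have "(\<lambda>n. LBINT x. f x * (et (X n *\<^sub>R x) * ?Ps x)) \<longlonglongrightarrow> (LBINT x. f x * (et (0 *\<^sub>R x) * ?Ps x))"
  proof (rule integral_dominated_convergence[where w="\<lambda>x. (M * B) * (prof th x * norm (f x))"])
   show "L1 (\<lambda>x. (M * B) * (prof th x * norm (f x)))"
    using f by (intro integrable_mult_right) (simp add: prof_integrable_def)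
   show "AE x in lborel. (\<lambda>n. f x * (et (X n *\<^sub>R x) * ?Ps x)) \<longlonglongrightarrow> f x * (et (0 *\<^sub>R x) * ?Ps x)"
    by (intro AE_I2 tendsto_mult tendsto_const continuous_on_tendsto_compose[OF cet] tendsto_scaleR X) auto
   fix n
   have "norm (f x) * (norm (et (X n *\<^sub>R x)) * norm (?Ps x)) <= norm (f x) * (M * (B * prof th x))" for x
    using M B by (intro mult_left_mono mult_mono) auto
   then show "AE x in lborel. norm (f x * (et (X n *\<^sub>R x) * ?Ps x)) <= (M * B) * (prof th x * norm (f x))"
    unfolding norm_mult by (simp add: mult_ac)
  qed measurable
  then show "(\<lambda>n. LBINT x. f x * (et (X n *\<^sub>R x) * ?Ps x)) \<longlonglongrightarrow> (LBINT x. f x * ?Ps x)"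
   using et0 by simp
 qed
qed

section \<open>Uniqueness of the value of the semigroup\<close>

lemma iter_partial_translate:
 fixes f :: "real^'n::finite => complex"
 assumes "smooth_on UNIV f"
 shows "iter_partial is (\<lambda>x. f (x - a)) = (\<lambda>x. iter_partial is f (x - a))"
  and "(\<lambda>x. iter_partial is f (x - a)) differentiable (at x)"
proof -
 have D: "((\<lambda>x. iter_partial is f (x - a)) has_derivative (\<lambda>h. \<Sum>i\<in>UNIV. h $ i *\<^sub>R partial i (iter_partial is f) (x - a))) (at x)" for "is" x
 proof -
  have "((\<lambda>x. x - a) has_derivative (\<lambda>h. h)) (at x)" by (auto intro!: derivative_eq_intros)
  from has_derivative_compose[OF this has_derivative_partial[OF smooth_on_differentiable[OF smooth_on_iter_partial[OF assms]]]]
  show ?thesis by simp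
 qed
 show "(\<lambda>x. iter_partial is f (x - a)) differentiable (at x)" using D by (auto simp: differentiable_def)
 show "iter_partial is (\<lambda>x. f (x - a)) = (\<lambda>x. iter_partial is f (x - a))"
 proof (induction "is")
  case (Cons i "is")
  show ?case unfolding iter_partial_Cons Cons
   by (rule ext) (simp add: partial_eqI[OF D] axis_def if_distrib[where f="\<lambda>c. c *\<^sub>R _"] cong: if_cong)
 qed simp
qed

lemma test_fun_translate:
 assumes "test_fun om" shows "test_fun (\<lambda>x. om (x - a))"
proof -
 obtain R where R: "R > 0" "!!x. norm x >= R ==> om x = 0" using test_fun_bound[OF assms] by blast
 have s: "smooth_on UNIV om" using assms by (simp add: test_fun_def)
 show ?thesis
 proof (rule test_funI[of _ "R + norm a"])
  show "smooth_on UNIV (\<lambda>x. om (x - a))"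
   unfolding smooth_on_def iter_partial_translate(1)[OF s] using iter_partial_translate(2)[OF s] by blast
  show "om (x - a) = 0" if "R + norm a <= norm x" for x
   using that norm_triangle_ineq2[of x a] by (intro R(2)) linarith
 qed
qed

text \<open>The conjugate of g(a) times a bump around \<open>a\<close> makes the real part of the
  integrand nonnegative. A zero integral then forces that real part to vanish almost everywhere,
  hence by continuity at \<open>a\<close>.\<close>

lemma continuous_eq_0_if_test:
 fixes g :: "real^'n::finite => complex"
 assumes ze: "lp_cutoff ze" and g: "continuous_on UNIV g"
  and z: "!!ph. test_fun ph ==> (LBINT x. g x * ph x) = 0"
  and i: "!!ph. test_fun ph ==> L1 (g \<odot> ph)"
 shows "g a = 0"
proof (rule ccontr)
 assume nz: "g a \<noteq> 0"
 let ?c = "cnj (g a)"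
 have cu: "continuous_on UNIV (\<lambda>x. Re (?c * g x))" by (intro continuous_intros g)
 have pos: "Re (?c * g a) > 0" using nz by (simp add: complex_neq_0 power2_eq_square)
 have "((\<lambda>x. Re (?c * g x)) \<longlongrightarrow> Re (?c * g a)) (at a)" using cu by (simp add: continuous_on_def)
 from order_tendstoD(1)[OF this pos] obtain r where r: "r > 0" "!!x. x \<noteq> a ==> dist x a < r ==> 0 < Re (?c * g x)"
  unfolding eventually_at by blast
 then have r': "0 < Re (?c * g x)" if "dist x a < r" for x using that pos by (cases "x = a") auto
 \<comment> \<open>Scales the radius 5/3, beyond which the cut-off vanishes, to
   \<open>r\<close>.\<close>
 let ?k = "5 / (3 * r)"
 let ?ph = "\<lambda>x. ?c * radial_cut ze (?k *\<^sub>R (x - a))"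
 have t1: "test_fun (\<lambda>x::real^'n. radial_cut ze (?k *\<^sub>R (x - a)))"
  using test_fun_translate[OF test_fun_dilate[OF test_fun_radial_cut[OF ze], of ?k], of a] r(1) by simp
 have t: "test_fun ?ph" by (rule test_fun_cmult[OF t1])
 let ?h = "\<lambda>x. Re (g x * ?ph x)"
 have he: "?h x = Re (?c * g x) * ze (norm (?k *\<^sub>R (x - a)))" for x
  unfolding radial_cut_def by (simp add: algebra_simps)
 have hi: "L1 ?h" using i[OF t] by (rule integrable_Re)
 have h0: "(LBINT x. ?h x) = 0" using integral_Re[OF i[OF t]] z[OF t] by (simp only: zero_complex.sel)
 have hn: "?h x >= 0" for x
 proof (cases "dist x a < r")
  case True
  then show ?thesis unfolding he using r'[OF True] lp_cutoff_bounds[OF ze, of "norm (?k *\<^sub>R (x - a))"] by simp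
 next
  case False
  then have "norm (?k *\<^sub>R (x - a)) >= 5/3" using r(1) unfolding norm_scaleR dist_norm by (simp add: field_simps)
  then show ?thesis unfolding he using lp_cutoff_zero[OF ze] by simp
 qed
 have "AE x in lborel. ?h x = 0" using integral_nonneg_eq_0_iff_AE[OF hi] hn h0 by simp
 then have "AE x in lebesgue. x \<in> {x. ?h x = 0}" using AE_completion by auto
 moreover have "closed {x. ?h x = 0}"
 proof -
  have "continuous_on UNIV ?ph" using t by (auto simp: test_fun_def intro: smooth_on_continuous)
  from continuous_on_Re[OF continuous_on_mult[OF g this]] have "continuous_on UNIV ?h" .
  then show ?thesis by (intro closed_Collect_eq) auto
 qed
 ultimately have "a \<in> {x. ?h x = 0}" by (rule mem_closed_if_AE_lebesgue[rotated])
 moreover have "?h a = Re (?c * g a)" unfolding he using lp_cutoff_one[OF ze, of 0] by simp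
 ultimately show False using pos by simp
qed

text \<open>This is what gives the definite description in \<open>frac_semigroup\<close> its
  meaning.\<close>

lemma has_semigroup_value_unique:
 fixes g1 g2 :: "real^'n::finite => complex"
 assumes ze: "lp_cutoff ze" and 1: "has_semigroup_value th t f g1" and 2: "has_semigroup_value th t f g2"
 shows "g1 = g2"
proof
 fix a :: "real^'n"
 have c: "continuous_on UNIV g1" "continuous_on UNIV g2" using 1 2 by (auto simp: has_semigroup_value_def)
 then have [measurable]: "g1 \<in> borel_measurable borel" "g2 \<in> borel_measurable borel" by (auto intro: borel_measurable_continuous_onI)
 have I: "L1 (g1 \<odot> ph)" "L1 (g2 \<odot> ph)" if "test_fun ph" for ph
 proof -
  have s: "schwartz ph" by (rule schwartz_test_fun[OF that])
  have [measurable]: "ph \<in> borel_measurable borel" by (rule schwartz_measurable[OF s])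
  have "integrable lebesgue (g1 \<odot> ph)" "integrable lebesgue (g2 \<odot> ph)"
   using 1 2 s unfolding has_semigroup_value_def by auto
  then show "L1 (g1 \<odot> ph)" "L1 (g2 \<odot> ph)"
   by (subst (asm) (1 2) integrable_completion, auto)+
 qed
 have "g1 a - g2 a = 0"
 proof (rule continuous_eq_0_if_test[OF ze, of "\<lambda>x. g1 x - g2 x"])
  show "continuous_on UNIV (\<lambda>x. g1 x - g2 x)" using c by (intro continuous_intros)
  fix ph :: "real^'n => complex" assume t: "test_fun ph"
  have s: "schwartz ph" by (rule schwartz_test_fun[OF t])
  show "L1 (\<lambda>x. (g1 x - g2 x) * ph x)" using I[OF t] by (simp add: left_diff_distrib)
  have "regular_dist g1 ph = regular_dist g2 ph"
   by (rule tendsto_unique[OF _ has_semigroup_value_limit[OF 1 s space_cutoff_radial_cut[OF ze]] has_semigroup_value_limit[OF 2 s space_cutoff_radial_cut[OF ze]]]) simp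
  then show "(LBINT x. (g1 x - g2 x) * ph x) = 0"
   using I[OF t] schwartz_measurable[OF s] by (simp add: regular_dist_borel left_diff_distrib)
 qed
 then show "g1 a = g2 a" by simp
qed

lemma frac_semigroup_eqI:
 "lp_cutoff ze ==> has_semigroup_value th t f g ==> frac_semigroup th t f = g"
 unfolding frac_semigroup_def by (rule the_equality) (auto intro: has_semigroup_value_unique)

lemma frac_semigroup_value:
 "lp_cutoff ze ==> semigroup_defined th t f ==> has_semigroup_value th t f (frac_semigroup th t f)"
 using frac_semigroup_eqI unfolding semigroup_defined_def by metis

section \<open>Integral operators bounded by Young's inequality\<close>

text \<open>For Q > 0 the level a = (Q/A)^(1/r) makes both terms equal, whence the factor 2.\<close>

lemma young_opt:
 fixes v A Q r :: real
 assumes r: "r >= 1" and A: "A > 0" and Q: "Q >= 0" and v: "!!a. a > 0 ==> v <= a * A + a powr (1 - r) * Q"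
 shows "v <= 2 * A powr (1 - 1 / r) * Q powr (1 / r)"
proof (cases "Q = 0")
 case True
 have "v <= 0"
 proof (rule ccontr)
  assume "\<not> v <= 0"
  then show False using v[of "v / (2 * A)"] A True by simp
 qed
 then show ?thesis using True by simp
next
 case False
 then have Q: "Q > 0" using Q by simp
 define a where "a = (Q / A) powr (1 / r)"
 have la: "ln a = (ln Q - ln A) / r" unfolding a_def using A Q by (simp add: ln_powr ln_div)
 have a: "a > 0" using A Q by (simp add: a_def)
 have "a * A = exp (ln a + ln A)" using a A by (simp add: exp_add)
 also have "ln a + ln A = (1 - 1 / r) * ln A + (1 / r) * ln Q" unfolding la using r by (simp add: field_simps)
 also have "exp ... = A powr (1 - 1 / r) * Q powr (1 / r)" using A Q by (simp add: exp_add powr_def)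
 finally have 1: "a * A = A powr (1 - 1 / r) * Q powr (1 / r)" .
 have "a powr (1 - r) * Q = exp ((1 - r) * ln a + ln Q)" using a Q by (simp add: exp_add powr_def)
 also have "(1 - r) * ln a + ln Q = (1 - 1 / r) * ln A + (1 / r) * ln Q" unfolding la using r by (simp add: field_simps)
 also have "exp ... = A powr (1 - 1 / r) * Q powr (1 / r)" using A Q by (simp add: exp_add powr_def)
 finally have 2: "a powr (1 - r) * Q = A powr (1 - 1 / r) * Q powr (1 / r)" .
 show ?thesis using v[OF a] unfolding 1 2 by (simp add: mult_ac)
qed

lemma ennreal_enn2real_le: "ennreal (enn2real x) <= x"
 by (cases x) auto

text \<open>\<open>young_split\<close> is used at the variable level a om(z). The weight lets the
  level follow the size of \<open>H\<close>, for instance the norm of a time slice.\<close>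

lemma young_integral_split:
 fixes E H om :: "'z => real"
 assumes [measurable]: "E \<in> borel_measurable P" "H \<in> borel_measurable P" "om \<in> borel_measurable P"
  and nn: "!!z. E z >= 0" "!!z. H z >= 0" "!!z. om z > 0" and r: "r >= 1" and a: "a > 0"
 shows "(\<integral>\<^sup>+z. ennreal (E z * H z) \<partial>P) <= ennreal a * (\<integral>\<^sup>+z. ennreal (E z * om z) \<partial>P)
  + ennreal (a powr (1 - r)) * (\<integral>\<^sup>+z. ennreal (E z * (om z powr (1 - r) * H z powr r)) \<partial>P)"
proof -
 have "E z * H z <= a * (E z * om z) + a powr (1 - r) * (E z * (om z powr (1 - r) * H z powr r))" for z
  using mult_left_mono[OF young_split[OF r mult_pos_pos[OF a nn(3)[of z]] nn(2)[of z]] nn(1)[of z]] a nn(3)[of z]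
  by (simp add: powr_mult algebra_simps)
 then have "(\<integral>\<^sup>+z. ennreal (E z * H z) \<partial>P) <= (\<integral>\<^sup>+z. ennreal a * ennreal (E z * om z) + ennreal (a powr (1 - r)) * ennreal (E z * (om z powr (1 - r) * H z powr r)) \<partial>P)"
  using nn a by (intro nn_integral_mono) (simp add: ennreal_mult[symmetric] ennreal_plus[symmetric] less_imp_le del: ennreal_plus)
 also have "... = ennreal a * (\<integral>\<^sup>+z. ennreal (E z * om z) \<partial>P)
  + ennreal (a powr (1 - r)) * (\<integral>\<^sup>+z. ennreal (E z * (om z powr (1 - r) * H z powr r)) \<partial>P)"
  by (simp add: nn_integral_add nn_integral_cmult)
 finally show ?thesis .
qed

lemma young_integral:
 fixes E H om :: "'z => real"
 assumes meas: "E \<in> borel_measurable P" "H \<in> borel_measurable P" "om \<in> borel_measurable P"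
  and nn: "!!z. E z >= 0" "!!z. H z >= 0" "!!z. om z > 0" and r: "r >= 1"
  and A: "(\<integral>\<^sup>+z. ennreal (E z * om z) \<partial>P) <= ennreal A" "A > 0"
  and Q: "(\<integral>\<^sup>+z. ennreal (E z * (om z powr (1 - r) * H z powr r)) \<partial>P) <= ennreal Q" "Q >= 0"
 shows "(\<integral>\<^sup>+z. ennreal (E z * H z) \<partial>P) <= ennreal (2 * A powr (1 - 1 / r) * Q powr (1 / r))"
proof -
 let ?V = "\<integral>\<^sup>+z. ennreal (E z * H z) \<partial>P"
 have s: "?V <= ennreal (a * A + a powr (1 - r) * Q)" if "a > 0" for a
 proof -
  have "?V <= ennreal a * ennreal A + ennreal (a powr (1 - r)) * ennreal Q"
   using young_integral_split[OF meas nn r that] A(1) Q(1)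
   by (meson add_mono mult_left_mono order_trans zero_le)
  then show ?thesis using that A Q by (simp add: ennreal_mult ennreal_plus)
 qed
 have "?V < \<infinity>" using s[of 1] by (rule le_less_trans) auto
 then obtain v where v: "v >= 0" "?V = ennreal v" by (cases ?V) auto
 have "v <= 2 * A powr (1 - 1 / r) * Q powr (1 / r)"
 proof (rule young_opt[OF r A(2) Q(2)])
  fix a :: real assume a: "a > 0"
  have "a * A + a powr (1 - r) * Q >= 0" using a A Q by auto
  with s[OF a] show "v <= a * A + a powr (1 - r) * Q" unfolding v(2) by (simp add: ennreal_le_iff)
 qed
 then show ?thesis unfolding v(2) by (rule ennreal_leI)
qed

text \<open>A weighted Schur test: \<open>A\<close> bounds the weighted row integrals of the kernel,
  \<open>I\<close> the column integrals, \<open>W\<close> the weighted r-th power of the density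
  \<open>H\<close>. The source space \<open>P\<close> is abstract since it is space for the term
  with u(t) and space-time for the Duhamel term.\<close>

locale schur = sigma_finite_measure P
 for P :: "'z measure" +
 fixes E :: "real^'n::finite => 'z => real" and om H :: "'z => real" and A I W r :: real
 assumes E_meas: "(\<lambda>(x, z). E x z) \<in> borel_measurable (lborel \<Otimes>\<^sub>M P)" and E_nonneg: "!!x z. E x z >= 0"
  and om_meas [measurable]: "om \<in> borel_measurable P" and om_pos: "!!z. om z > 0"
  and H_meas [measurable]: "H \<in> borel_measurable P" and H_nonneg: "!!z. H z >= 0"
  and r: "r >= 1" and A: "A > 0" "!!x. (\<integral>\<^sup>+z. ennreal (E x z * om z) \<partial>P) <= ennreal A"
  and I: "I >= 0" "!!z. z \<in> space P ==> (\<integral>\<^sup>+x. ennreal (E x z) \<partial>lborel) <= ennreal I"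
  and W: "W >= 0" "(\<integral>\<^sup>+z. ennreal (om z powr (1 - r) * H z powr r) \<partial>P) <= ennreal W"
begin

sublocale pair: pair_sigma_finite "lborel :: (real^'n) measure" P ..

lemma E_meas' [measurable (raw)]:
 assumes [measurable]: "f \<in> borel_measurable N" "g \<in> measurable N P"
 shows "(\<lambda>a. E (f a) (g a)) \<in> borel_measurable N"
proof -
 have "(\<lambda>a. (f a, g a)) \<in> measurable N (lborel \<Otimes>\<^sub>M P)" by measurable
 from measurable_compose[OF this E_meas] show ?thesis by simp
qed

definition V :: "real^'n => ennreal" where "V x = (\<integral>\<^sup>+z. ennreal (E x z * H z) \<partial>P)"

text \<open>The r-th power counterpart of \<open>V\<close>: integrable over x by Tonelli, and in
  control of \<open>V\<close> through the level splitting.\<close>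

definition Q :: "real^'n => ennreal" where "Q x = (\<integral>\<^sup>+z. ennreal (E x z * (om z powr (1 - r) * H z powr r)) \<partial>P)"

lemma V_measurable [measurable]: "V \<in> borel_measurable borel"
 and Q_measurable [measurable]: "Q \<in> borel_measurable borel"
 unfolding V_def[abs_def] Q_def[abs_def] by measurable

lemma Q_integral: "(\<integral>\<^sup>+x. Q x \<partial>lborel) <= ennreal (I * W)"
proof -
 have "(\<integral>\<^sup>+x. Q x \<partial>lborel) = (\<integral>\<^sup>+z. \<integral>\<^sup>+x. ennreal (E x z * (om z powr (1 - r) * H z powr r)) \<partial>lborel \<partial>P)"
  unfolding Q_def by (rule pair.Fubini'[symmetric]) measurable
 also have "... = (\<integral>\<^sup>+z. (\<integral>\<^sup>+x. ennreal (E x z) \<partial>lborel) * ennreal (om z powr (1 - r) * H z powr r) \<partial>P)"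
  using E_nonneg by (intro nn_integral_cong) (simp add: ennreal_mult nn_integral_multc)
 also have "... <= (\<integral>\<^sup>+z. ennreal I * ennreal (om z powr (1 - r) * H z powr r) \<partial>P)"
  by (intro nn_integral_mono mult_right_mono I(2)) auto
 also have "... = ennreal I * (\<integral>\<^sup>+z. ennreal (om z powr (1 - r) * H z powr r) \<partial>P)" by (rule nn_integral_cmult) measurable
 also have "... <= ennreal I * ennreal W" by (intro mult_left_mono W) auto
 finally show ?thesis using I W by (simp add: ennreal_mult)
qed

lemma Q_finite_AE: "AE x in lborel. Q x \<noteq> \<infinity>"
 using Q_integral by (intro nn_integral_PInf_AE) (auto simp: top_unique)

lemma Q_real: "L1 (\<lambda>x. enn2real (Q x))"
proof (rule integrableI_nonneg)
 have "(\<integral>\<^sup>+x. ennreal (enn2real (Q x)) \<partial>lborel) <= (\<integral>\<^sup>+x. Q x \<partial>lborel)" by (intro nn_integral_mono ennreal_enn2real_le)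
 from le_less_trans[OF order_trans[OF this Q_integral] ennreal_less_top]
 show "(\<integral>\<^sup>+x. ennreal (enn2real (Q x)) \<partial>lborel) < \<infinity>" by simp
qed auto

lemma V_split: assumes a: "a > 0" shows "V x <= ennreal (a * A) + ennreal (a powr (1 - r)) * Q x"
proof -
 have "V x <= ennreal a * (\<integral>\<^sup>+z. ennreal (E x z * om z) \<partial>P) + ennreal (a powr (1 - r)) * Q x"
  unfolding V_def Q_def by (rule young_integral_split) (use E_nonneg H_nonneg om_pos r a in auto)
 also have "... <= ennreal a * ennreal A + ennreal (a powr (1 - r)) * Q x" by (intro add_right_mono mult_left_mono A) auto
 finally show ?thesis using a A by (simp add: ennreal_mult)
qed

lemma V_finite_AE: "AE x in lborel. V x \<noteq> \<infinity>"
 using Q_finite_AE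
proof eventually_elim
 case (elim x)
 then have "ennreal (1 * A) + ennreal (1 powr (1 - r)) * Q x < \<infinity>" by (simp add: ennreal_mult_less_top less_top)
 with V_split[of 1 x] show ?case by (auto simp: top_unique)
qed

context
 fixes La assumes La: "\<forall>x. \<forall>z\<in>space P. E x z <= La" "La > 0"
begin

lemma Q_bound: "Q x <= ennreal (La * W)"
proof -
 have "Q x <= (\<integral>\<^sup>+z. ennreal La * ennreal (om z powr (1 - r) * H z powr r) \<partial>P)"
  unfolding Q_def using La by (intro nn_integral_mono) (simp add: ennreal_mult[symmetric] mult_right_mono ennreal_leI)
 also have "... = ennreal La * (\<integral>\<^sup>+z. ennreal (om z powr (1 - r) * H z powr r) \<partial>P)" by (rule nn_integral_cmult) measurable
 also have "... <= ennreal La * ennreal W" by (intro mult_left_mono W) auto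
 finally show ?thesis using La W by (simp add: ennreal_mult)
qed

lemma V_real: "V x = ennreal (enn2real (V x))"
 and V_le: "enn2real (V x) <= 2 * A powr (1 - 1 / r) * enn2real (Q x) powr (1 / r)"
proof -
 have q: "Q x = ennreal (enn2real (Q x))" using Q_bound[of x] by (metis ennreal_enn2real ennreal_less_top le_less_trans)
 have "V x <= ennreal (2 * A powr (1 - 1 / r) * enn2real (Q x) powr (1 / r))"
  unfolding V_def
 proof (rule young_integral[OF _ _ _ _ _ _ r A(2,1)])
  show "(\<integral>\<^sup>+z. ennreal (E x z * (om z powr (1 - r) * H z powr r)) \<partial>P) <= ennreal (enn2real (Q x))"
   using q unfolding Q_def by simp
 qed (use E_nonneg H_nonneg om_pos in auto)
 then show "V x = ennreal (enn2real (V x))" "enn2real (V x) <= 2 * A powr (1 - 1 / r) * enn2real (Q x) powr (1 / r)"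
  by (metis ennreal_enn2real ennreal_less_top le_less_trans) (use \<open>V x <= _\<close> A in \<open>auto intro: enn2real_leI\<close>)
qed

text \<open>The exponent is raised from \<open>r\<close> to \<open>p\<close> by Q^(p/r) <= (La
  W)^(p/r - 1) Q, because \<open>Q\<close> is bounded by La W and has integral at most I W.\<close>

lemma V_Lp:
 assumes p: "p >= r"
 shows "L1 (\<lambda>x. enn2real (V x) powr p)"
  and "(LBINT x. enn2real (V x) powr p) <= 2 powr p * A powr (p * (1 - 1 / r)) * (La * W) powr (p / r - 1) * (I * W)"
proof -
 let ?c = "2 powr p * A powr (p * (1 - 1 / r)) * (La * W) powr (p / r - 1)"
 have b: "enn2real (V x) powr p <= ?c * enn2real (Q x)" for x
 proof -
  let ?q = "enn2real (Q x)"
  have ql: "?q <= La * W" using Q_bound[of x] La W by (intro enn2real_leI) auto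
  have "enn2real (V x) powr p <= (2 * A powr (1 - 1 / r) * ?q powr (1 / r)) powr p"
   using V_le[of x] p r by (intro powr_mono2) auto
  also have "... = 2 powr p * A powr (p * (1 - 1 / r)) * ?q powr (p / r)"
   by (simp add: powr_mult powr_powr mult.commute)
  also have "?q powr (p / r) = ?q powr (p / r - 1) * ?q"
   by (cases "?q = 0") (use powr_add[of ?q "p / r - 1" 1] enn2real_nonneg[of "Q x"] in auto)
  also have "2 powr p * A powr (p * (1 - 1 / r)) * (?q powr (p / r - 1) * ?q) <= 2 powr p * A powr (p * (1 - 1 / r)) * ((La * W) powr (p / r - 1) * ?q)"
   using ql p r by (intro mult_left_mono mult_right_mono powr_mono2) (auto simp: field_simps)
  finally show ?thesis by (simp only: mult.assoc)
 qed
 have qi: "L1 (\<lambda>x. ?c * enn2real (Q x))" by (intro integrable_mult_right Q_real)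
 show i: "L1 (\<lambda>x. enn2real (V x) powr p)"
  by (rule integrable_dominated[OF qi]) (use b in auto)
 have "(LBINT x. enn2real (Q x)) <= I * W"
 proof -
  have "ennreal (LBINT x. enn2real (Q x)) = (\<integral>\<^sup>+x. ennreal (enn2real (Q x)) \<partial>lborel)"
   by (rule nn_integral_eq_integral[symmetric]) (auto intro: Q_real)
  also have "... <= (\<integral>\<^sup>+x. Q x \<partial>lborel)" by (intro nn_integral_mono ennreal_enn2real_le)
  also note Q_integral
  finally show ?thesis using I W by (simp add: ennreal_le_iff)
 qed
 moreover have "?c >= 0" by simp
 moreover have "(LBINT x. enn2real (V x) powr p) <= (LBINT x. ?c * enn2real (Q x))" by (rule integral_mono[OF i qi b])
 ultimately show "(LBINT x. enn2real (V x) powr p) <= ?c * (I * W)"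
  using mult_left_mono[of "LBINT x. enn2real (Q x)" "I * W" ?c] unfolding integral_mult_right_zero by linarith
qed

end

context
 fixes K :: "real^'n => 'z => complex" and F :: "'z => complex" and C :: real
 assumes K_meas: "(\<lambda>(x, z). K x z) \<in> borel_measurable (lborel \<Otimes>\<^sub>M P)"
  and K_bound: "\<forall>x. \<forall>z\<in>space P. norm (K x z) <= C * E x z" and C: "C >= 0"
  and F_meas [measurable]: "F \<in> borel_measurable P" and F_bound: "!!z. norm (F z) = H z"
begin

lemma K_meas':
 assumes [measurable]: "f \<in> borel_measurable N" "g \<in> measurable N P"
 shows "(\<lambda>a. K (f a) (g a)) \<in> borel_measurable N"
proof -
 have "(\<lambda>a. (f a, g a)) \<in> measurable N (lborel \<Otimes>\<^sub>M P)" by measurable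
 from measurable_compose[OF this K_meas] show ?thesis by simp
qed

lemma operator_measurable: "(\<lambda>x. \<integral>z. K x z * F z \<partial>P) \<in> borel_measurable borel"
 using K_meas'[measurable (raw)] by measurable

lemma operator_nn: "(\<integral>\<^sup>+z. ennreal (norm (K x z * F z)) \<partial>P) <= ennreal C * V x"
proof -
 note K_meas' [measurable (raw)]
 have "(\<integral>\<^sup>+z. ennreal (norm (K x z * F z)) \<partial>P) <= (\<integral>\<^sup>+z. ennreal C * ennreal (E x z * H z) \<partial>P)"
 proof (intro nn_integral_mono)
  fix z assume "z \<in> space P"
  from mult_right_mono[OF K_bound[rule_format, OF this, of x] H_nonneg[of z]]
  show "ennreal (norm (K x z * F z)) <= ennreal C * ennreal (E x z * H z)"
   using C E_nonneg H_nonneg by (simp add: ennreal_mult[symmetric] norm_mult F_bound mult.assoc ennreal_leI)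
 qed
 then show ?thesis unfolding V_def by (subst (asm) nn_integral_cmult) measurable
qed

lemma operator_bound: "ennreal (norm (\<integral>z. K x z * F z \<partial>P)) <= ennreal C * V x"
 by (rule order_trans[OF integral_norm_bound_ennreal_general operator_nn])

lemma operator_integrable_AE: "AE x in lborel. integrable P (K x \<odot> F)"
 using V_finite_AE
proof eventually_elim
 case (elim x)
 note K_meas' [measurable (raw)]
 from elim have "ennreal C * V x < \<infinity>" by (simp add: ennreal_mult_less_top less_top)
 with operator_nn[of x] have "(\<integral>\<^sup>+z. ennreal (norm (K x z * F z)) \<partial>P) < \<infinity>" by (rule le_less_trans)
 then show ?case by (intro integrableI_bounded) auto
qed

text \<open>Splitting at level \<open>a\<close> leaves the constant C a A, made at most
  \<open>e\<close>, and a multiple of the integrable \<open>Q\<close>. No height bound is available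
  in the application, where the kernel of S(t - tau) concentrates as tau tends to t.\<close>

lemma operator_tame: "tame (\<lambda>x. \<integral>z. K x z * F z \<partial>P)"
 unfolding tame_def
proof (intro conjI allI impI operator_measurable)
 fix e :: real assume e: "e > 0"
 define a where "a = e / (C * A + 1)"
 have a: "a > 0" "C * (a * A) <= e"
 proof -
  have "C * A >= 0" using C A(1) by simp
  then show "a > 0" unfolding a_def using e by (intro divide_pos_pos) auto
  have "C * (a * A) = (C * A) * e / (C * A + 1)" unfolding a_def by simp
  also have "... <= e" using \<open>C * A >= 0\<close> e by (simp add: divide_le_eq distrib_left mult.commute)
  finally show "C * (a * A) <= e" .
 qed
 let ?G = "\<lambda>x. C * (a powr (1 - r) * enn2real (Q x))"
 have "L1 ?G" by (intro integrable_mult_right Q_real)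
 moreover have "?G x >= 0" for x using C by simp
 moreover have "AE x in lborel. norm (\<integral>z. K x z * F z \<partial>P) <= e + ?G x"
  using Q_finite_AE
 proof eventually_elim
  case (elim x)
  then have q: "Q x = ennreal (enn2real (Q x))" by (simp add: less_top)
  have "ennreal (norm (\<integral>z. K x z * F z \<partial>P)) <= ennreal C * (ennreal (a * A) + ennreal (a powr (1 - r)) * ennreal (enn2real (Q x)))"
   unfolding q[symmetric] by (rule order_trans[OF operator_bound mult_left_mono[OF V_split[OF a(1)]]]) simp
  also have "... = ennreal (C * (a * A) + ?G x)"
   using a A C by (simp add: ennreal_mult[symmetric] ennreal_plus[symmetric] distrib_left del: ennreal_plus)
  finally have "norm (\<integral>z. K x z * F z \<partial>P) <= C * (a * A) + ?G x"
   using a A C by (subst (asm) ennreal_le_iff) auto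
  with a(2) show ?case by linarith
 qed
 ultimately show "\<exists>G. L1 G \<and> (\<forall>x. 0 <= G x) \<and> (AE x in lborel. norm (\<integral>z. K x z * F z \<partial>P) <= e + G x)" by blast
qed

text \<open>At level 1 the integral of |K F| is at most C (A + Q(x)). Against a bounded integrable
  \<open>ps\<close> both parts are integrable, so Fubini applies.\<close>

lemma operator_adjoint:
 fixes ps :: "real^'n => complex"
 assumes ps: "L1 ps" "!!x. norm (ps x) <= B"
 shows "L1 (\<lambda>x. (\<integral>z. K x z * F z \<partial>P) * ps x)"
  and "(LBINT x. (\<integral>z. K x z * F z \<partial>P) * ps x) = (\<integral>z. F z * (LBINT x. K x z * ps x) \<partial>P)"
proof -
 note K_meas' [measurable (raw)]
 have [measurable]: "ps \<in> borel_measurable borel" using ps(1) by auto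
 have B: "B >= 0" using ps(2)[of 0] norm_ge_zero order_trans by blast
 let ?f = "\<lambda>(x, z). K x z * F z * ps x"
 have "integrable (lborel \<Otimes>\<^sub>M P) ?f"
 proof (rule integrableI_bounded)
  have "(\<integral>\<^sup>+y. ennreal (norm (?f y)) \<partial>(lborel \<Otimes>\<^sub>M P)) = (\<integral>\<^sup>+x. \<integral>\<^sup>+z. ennreal (norm (?f (x, z))) \<partial>P \<partial>lborel)"
   by (rule nn_integral_fst[symmetric]) measurable
  also have "... = (\<integral>\<^sup>+x. (\<integral>\<^sup>+z. ennreal (norm (K x z * F z)) \<partial>P) * ennreal (norm (ps x)) \<partial>lborel)"
   by (intro nn_integral_cong) (simp add: norm_mult ennreal_mult nn_integral_multc)
  also have "... <= (\<integral>\<^sup>+x. ennreal (C * A) * ennreal (norm (ps x)) + ennreal (C * B) * Q x \<partial>lborel)"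
  proof (intro nn_integral_mono)
   fix x
   have "(\<integral>\<^sup>+z. ennreal (norm (K x z * F z)) \<partial>P) <= ennreal C * (ennreal A + Q x)"
    using operator_nn[of x] mult_left_mono[OF V_split[of 1 x], of "ennreal C"] by (auto intro: order_trans)
   then have "(\<integral>\<^sup>+z. ennreal (norm (K x z * F z)) \<partial>P) * ennreal (norm (ps x)) <= ennreal C * (ennreal A + Q x) * ennreal (norm (ps x))"
    by (rule mult_right_mono) simp
   also have "... = ennreal C * ennreal A * ennreal (norm (ps x)) + ennreal C * ennreal (norm (ps x)) * Q x" by (simp add: algebra_simps)
   also have "... <= ennreal C * ennreal A * ennreal (norm (ps x)) + ennreal C * ennreal B * Q x"
    using ps(2)[of x] by (intro add_left_mono mult_right_mono mult_left_mono ennreal_leI) auto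
   finally show "(\<integral>\<^sup>+z. ennreal (norm (K x z * F z)) \<partial>P) * ennreal (norm (ps x)) <= ennreal (C * A) * ennreal (norm (ps x)) + ennreal (C * B) * Q x"
    using C A B by (simp add: ennreal_mult)
  qed
  also have "... = ennreal (C * A) * (\<integral>\<^sup>+x. ennreal (norm (ps x)) \<partial>lborel) + ennreal (C * B) * (\<integral>\<^sup>+x. Q x \<partial>lborel)"
   by (simp add: nn_integral_add nn_integral_cmult)
  also have "... < \<infinity>"
   using ps(1) Q_integral by (auto simp: integrable_iff_bounded ennreal_mult_less_top less_top[symmetric] top_unique ennreal_mult_eq_top_iff)
  finally show "(\<integral>\<^sup>+y. ennreal (norm (?f y)) \<partial>(lborel \<Otimes>\<^sub>M P)) < \<infinity>" .
 qed measurable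
 note J = this
 have e: "(\<integral>z. K x z * F z * ps x \<partial>P) = (\<integral>z. K x z * F z \<partial>P) * ps x" for x by simp
 show "L1 (\<lambda>x. (\<integral>z. K x z * F z \<partial>P) * ps x)"
  using pair.integrable_fst'[OF J] unfolding prod.case e .
 have "(LBINT x. (\<integral>z. K x z * F z \<partial>P) * ps x) = (\<integral>z. (LBINT x. K x z * F z * ps x) \<partial>P)"
  using pair.Fubini_integral[OF J] unfolding e by simp
 also have "... = (\<integral>z. F z * (LBINT x. K x z * ps x) \<partial>P)"
  by (subst integral_mult_right_zero[symmetric]) (simp only: mult_ac)
 finally show "(LBINT x. (\<integral>z. K x z * F z \<partial>P) * ps x) = (\<integral>z. F z * (LBINT x. K x z * ps x) \<partial>P)" .
qed

lemma operator_Lp: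
 assumes La: "\<forall>x. \<forall>z\<in>space P. E x z <= La" "La > 0" and p: "p >= r"
 shows "L1 (\<lambda>x. norm (\<integral>z. K x z * F z \<partial>P) powr p)"
  and "(LBINT x. norm (\<integral>z. K x z * F z \<partial>P) powr p)
   <= C powr p * (2 powr p * A powr (p * (1 - 1 / r)) * (La * W) powr (p / r - 1) * (I * W))"
proof -
 have b: "norm (norm (\<integral>z. K x z * F z \<partial>P) powr p) <= C powr p * enn2real (V x) powr p" for x
 proof -
  have "ennreal (norm (\<integral>z. K x z * F z \<partial>P)) <= ennreal (C * enn2real (V x))"
   using operator_bound[of x] V_real[OF La, of x] C by (metis ennreal_mult enn2real_nonneg)
  then have "norm (\<integral>z. K x z * F z \<partial>P) <= C * enn2real (V x)" using C by (subst (asm) ennreal_le_iff) auto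
  then have "norm (\<integral>z. K x z * F z \<partial>P) powr p <= (C * enn2real (V x)) powr p" using p r by (intro powr_mono2) auto
  then show ?thesis by (simp add: powr_mult)
 qed
 have vi: "L1 (\<lambda>x. C powr p * enn2real (V x) powr p)" by (intro integrable_mult_right V_Lp(1)[OF La p])
 show i: "L1 (\<lambda>x. norm (\<integral>z. K x z * F z \<partial>P) powr p)"
  by (rule integrable_dominated[OF vi _ b])
   (use measurable_compose[OF operator_measurable, where g="\<lambda>c. norm c powr p"] in simp)
 have "(LBINT x. norm (\<integral>z. K x z * F z \<partial>P) powr p) <= (LBINT x. C powr p * enn2real (V x) powr p)"
  using b by (intro integral_mono[OF i vi]) simp
 also have "... = C powr p * (LBINT x. enn2real (V x) powr p)" by simp
 also have "... <= C powr p * (2 powr p * A powr (p * (1 - 1 / r)) * (La * W) powr (p / r - 1) * (I * W))"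
  by (intro mult_left_mono V_Lp(2)[OF La p]) auto
 finally show "(LBINT x. norm (\<integral>z. K x z * F z \<partial>P) powr p)
   <= C powr p * (2 powr p * A powr (p * (1 - 1 / r)) * (La * W) powr (p / r - 1) * (I * W))" .
qed

end

end

section \<open>Dyadic sums in time\<close>

text \<open>The terms grow geometrically until they reach 1, so the sum is comparable to its last
  nonzero term. The induction carries the bound y R^n / (R - 1) along: it yields the final bound at
  every step that adds a term.\<close>

lemma geometric_sum_below:
 fixes y R :: real
 assumes y: "y >= 0" and R: "R > 1"
 shows "(\<Sum>j<n. if y * R ^ j < 1 then y * R ^ j else 0) <= R / (R - 1)"
proof -
 have "(\<Sum>j<n. if y * R ^ j < 1 then y * R ^ j else 0) <= y * R ^ n / (R - 1)
  \<and> (\<Sum>j<n. if y * R ^ j < 1 then y * R ^ j else 0) <= R / (R - 1)"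
 proof (induction n)
  case (Suc n)
  have e: "y * R ^ n / (R - 1) + y * R ^ n = y * R ^ Suc n / (R - 1)" using R by (simp add: field_simps)
  have m: "y * R ^ n / (R - 1) <= y * R ^ Suc n / (R - 1)" unfolding e[symmetric] using y R by simp
  have l: "y * R ^ Suc n / (R - 1) <= R / (R - 1)" if "y * R ^ n < 1"
   using R that by (intro divide_right_mono) (auto simp: mult.left_commute mult_le_cancel_left1)
  show ?case using Suc e m l by (auto simp del: power_Suc)
 qed (use y R in auto)
 then show ?thesis by blast
qed

text \<open>If \<open>h\<close> exceeded its mean by at least 1 at almost every point, so would the
  mean itself. The added b - a is this slack of 1 in \<open>h\<close>, which makes the contradiction
  strict.\<close>

lemma below_average_point:
 fixes h :: "real => real"
 assumes ab: "a < b" and h: "L1 (\<lambda>t. indicator {a<..<b} t * h t)"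
  and R: "AE t in lborel. t \<in> {a<..<b} --> R t"
 shows "\<exists>t\<in>{a<..<b}. R t \<and> h t * (b - a) <= (LBINT t. indicator {a<..<b} t * h t) + (b - a)"
proof (rule ccontr)
 let ?i = "LBINT t. indicator {a<..<b} t * h t"
 let ?k = "?i / (b - a) + 1"
 assume "\<not> ?thesis"
 then have n: "?k <= h t" if "t \<in> {a<..<b}" "R t" for t
  using that ab by (auto simp: not_le field_simps)
 have "(LBINT t. indicator {a<..<b} t * ?k) <= ?i"
 proof (rule integral_mono_AE[OF _ h])
  show "AE t in lborel. indicator {a<..<b} t * ?k <= indicator {a<..<b} t * h t"
   using R by eventually_elim (use n in \<open>auto simp: indicator_def\<close>)
  show "L1 (\<lambda>t. indicator {a<..<b} t * ?k)"
   using ab by (intro integrable_mult_left integrable_real_indicator) auto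
 qed
 moreover have "(LBINT t. indicator {a<..<b} t * ?k) = (b - a) * ?k" using ab by simp
 moreover have "(b - a) * ?k = ?i + (b - a)" using ab by (simp add: distrib_left)
 ultimately show False using ab by linarith
qed

text \<open>The intervals (c rh^(j+1), c rh^j) are disjoint and of length comparable to rh^j. Hence
  rh^j h(t_j) is at most a multiple of the integral of \<open>h\<close> over the j-th interval plus
  rh^j, and both are summable.\<close>

lemma good_times:
 fixes h :: "real => real"
 assumes rh: "0 < rh" "rh < 1" and c: "0 < c" "c <= T" and [measurable]: "h \<in> borel_measurable borel" and h0: "!!t. h t >= 0"
  and h: "L1 (\<lambda>t. indicator {0<..<T} t * h t)"
  and R: "AE t in lborel. t \<in> {0<..<T} --> R t"
 shows "\<exists>t. (\<forall>j. 0 < t j \<and> t j < c * rh ^ j \<and> R (t j)) \<and> summable (\<lambda>j. rh ^ j * h (t j))"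
proof -
 let ?J = "\<lambda>j. {c * rh ^ Suc j<..<c * rh ^ j}"
 let ?a = "\<lambda>j. LBINT t. indicator (?J j) t * h t"
 have lt: "c * rh ^ Suc j < c * rh ^ j" for j using rh c by simp
 have le: "c * rh ^ j <= T" for j using order_trans[OF mult_left_le[OF power_le_one[of rh j], of c]] c rh by simp
 have sub: "?J j \<subseteq> {0<..<T}" for j
 proof
  fix x assume "x \<in> ?J j"
  then show "x \<in> {0<..<T}" using le[of j] mult_pos_pos[OF c(1) zero_less_power[OF rh(1), of "Suc j"]] by (auto simp del: power_Suc)
 qed
 have J: "L1 (indicator (?J j) \<odot> h)" for j
  by (rule integrable_dominated[OF h]) (use sub[of j] h0 in \<open>auto simp: indicator_def simp del: power_Suc\<close>)
 have RJ: "AE t in lborel. t \<in> ?J j --> R t" for j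
  using R by eventually_elim (use sub[of j] in blast)
 have "\<exists>t. \<forall>j. t j \<in> ?J j \<and> R (t j) \<and> h (t j) * (c * rh ^ j - c * rh ^ Suc j) <= ?a j + (c * rh ^ j - c * rh ^ Suc j)"
  by (rule choice) (use below_average_point[OF lt J RJ] in blast)
 then obtain t where t: "!!j. t j \<in> ?J j" "!!j. R (t j)"
  "!!j. h (t j) * (c * rh ^ j - c * rh ^ Suc j) <= ?a j + (c * rh ^ j - c * rh ^ Suc j)" by blast
 have a0: "?a j >= 0" for j using h0 by (intro Bochner_Integration.integral_nonneg) simp
 have "summable ?a"
 proof (rule summableI_nonneg_bounded[OF a0])
  fix n
  have disj: "(\<Sum>j<n. indicator (?J j) x :: real) <= indicator {c * rh ^ n<..<T} x" for x
  proof (induction n)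
   case (Suc n)
   have "(indicator {c * rh ^ n<..<T} x :: real) + indicator (?J n) x <= indicator {c * rh ^ Suc n<..<T} x"
    using lt[of n] le[of n] by (auto simp: indicator_def simp del: power_Suc)
   with Suc show ?case by simp
  qed simp
  have "(\<Sum>j<n. ?a j) = (LBINT x. (\<Sum>j<n. indicator (?J j) x * h x))"
   by (rule Bochner_Integration.integral_sum[symmetric]) (rule J)
  also have "... <= (LBINT x. indicator {0<..<T} x * h x)"
  proof (rule integral_mono[OF Bochner_Integration.integrable_sum[OF J] h])
   fix x
   have "(\<Sum>j<n. indicator (?J j) x :: real) <= indicator {0<..<T} x"
    using mult_nonneg_nonneg[OF less_imp_le[OF c(1)] zero_le_power[OF less_imp_le[OF rh(1)], of n]]
    by (intro order_trans[OF disj]) (auto simp: indicator_def)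
   from mult_right_mono[OF this h0[of x]] show "(\<Sum>j<n. indicator (?J j) x * h x) <= indicator {0<..<T} x * h x"
    by (simp only: sum_distrib_right)
  qed
  finally show "(\<Sum>j<n. ?a j) <= (LBINT x. indicator {0<..<T} x * h x)" .
 qed
 then have s: "summable (\<lambda>j. ?a j / (c * (1 - rh)) + rh ^ j)"
  using rh by (intro summable_add summable_divide summable_geometric) auto
 have b: "rh ^ j * h (t j) <= ?a j / (c * (1 - rh)) + rh ^ j" for j
 proof -
  have "(rh ^ j * h (t j)) * (c * (1 - rh)) <= ?a j + rh ^ j * (c * (1 - rh))"
   using t(3)[of j] by (simp add: algebra_simps)
  then show ?thesis using c rh by (simp add: field_simps)
 qed
 have "summable (\<lambda>j. rh ^ j * h (t j))"
  by (rule summable_comparison_test'[OF s, of 0]) (use b rh h0 in auto)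
 moreover have "0 < t j \<and> t j < c * rh ^ j" for j using t(1)[of j] sub[of j] by auto
 ultimately show ?thesis using t(2) by blast
qed

text \<open>Terms of a convergent series are eventually below 1, where a larger exponent makes them
  smaller.\<close>

lemma summable_powr_mono:
 fixes a :: "nat => real"
 assumes a: "!!j. a j >= 0" and s: "summable (\<lambda>j. a j powr s)" "0 < s" "s <= q"
 shows "summable (\<lambda>j. a j powr q)"
proof (rule summable_comparison_test_ev[OF _ s(1)])
 have "eventually (\<lambda>j. a j powr s < 1) sequentially"
  using summable_LIMSEQ_zero[OF s(1)] by (rule order_tendstoD) simp
 then show "eventually (\<lambda>j. norm (a j powr q) <= a j powr s) sequentially"
 proof eventually_elim
  case (elim j)
  have "a j <= 1"
  proof (rule ccontr)
   assume "\<not> a j <= 1"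
   then have "1 < a j powr s" using s(2) by (simp add: gr_one_powr)
   with elim show False by simp
  qed
  then show ?case using a[of j] s by (cases "a j = 0") (auto intro!: powr_mono')
 qed
qed

lemma nn_integral_powr_minus_half:
 fixes T :: real
 assumes "T > 0"
 shows "(\<integral>\<^sup>+t. ennreal (indicator {0<..<T} t * (if t > 0 then t powr (- 1 / 2) else 1)) \<partial>lborel) <= ennreal (2 * T powr (1 / 2))"
proof -
 have "((\<lambda>t. t powr (- 1 / 2)) has_integral (T powr (- 1 / 2 + 1) / (- 1 / 2 + 1))) {0..T}"
  using assms by (intro has_integral_powr_from_0) auto
 then have "((\<lambda>t. if t \<in> {0..T} then t powr (- 1 / 2) else 0) has_integral (2 * T powr (1 / 2))) UNIV"
  by (subst has_integral_restrict_UNIV) (simp add: mult.commute)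
 then have e: "(\<integral>\<^sup>+t. ennreal (if t \<in> {0..T} then t powr (- 1 / 2) else 0) \<partial>lborel) = ennreal (2 * T powr (1 / 2))"
  by (intro nn_integral_has_integral_lborel) auto
 show ?thesis unfolding e[symmetric] by (intro nn_integral_mono ennreal_leI) (auto simp: indicator_def)
qed

text \<open>Hardy's inequality along a geometric sequence. Splitting with the weight t^(-1/2),
  integrable at 0, bounds the j-th term by a multiple of T_j^(-e) times the integral of t^e w^s over
  (0, T_j). At fixed t the sum over j is geometric, since only T_j > t count.\<close>

lemma summable_hardy:
 fixes w :: "real => real"
 assumes rh: "0 < rh" "rh < 1" and c: "0 < c" "c <= T" and s: "s > 1"
  and [measurable]: "w \<in> borel_measurable borel" and w: "!!t. w t >= 0"
  and ws: "L1 (\<lambda>t. indicator {0<..<T} t * w t powr s)"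
 shows "summable (\<lambda>j. ((c * rh ^ j) powr (1 / s - 1) * (LBINT t. indicator {0<..<c * rh ^ j} t * w t)) powr s)"
proof -
 \<comment> \<open>The power left by the weight, (t^(-1/2))^(1 - s) = t^e, is positive because s >
   1.\<close>
 define e where "e = (s - 1) / 2"
 have e: "e > 0" using s by (simp add: e_def)
 let ?T = "\<lambda>j. c * rh ^ j"
 let ?W = "\<lambda>j. LBINT t. indicator {0<..<?T j} t * w t"
 \<comment> \<open>The value 1 for t <= 0 keeps the weight positive everywhere; the integrals run
   over positive t.\<close>
 let ?om = "\<lambda>t::real. if t > 0 then t powr (- 1 / 2) else 1 :: real"
 have T: "?T j > 0" "?T j <= T" for j
  using order_trans[OF mult_left_le[OF power_le_one[of rh j], of c]] c rh by auto
 let ?q = "\<lambda>j t. indicator {0<..<?T j} t * (t powr e * w t powr s)"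
 let ?Q = "\<lambda>j. LBINT t. ?q j t"
 have qi: "L1 (?q j)" for j
 proof (rule integrable_dominated[OF integrable_mult_right[OF ws, of "T powr e"]])
  fix t
  show "norm (?q j t) <= T powr e * (indicator {0<..<T} t * w t powr s)"
   using T[of j] e by (auto simp: indicator_def intro!: mult_right_mono powr_mono2)
 qed measurable
 have Q0: "?Q j >= 0" for j by (intro Bochner_Integration.integral_nonneg) auto
 have W0: "?W j >= 0" for j using w by (intro Bochner_Integration.integral_nonneg) auto
 have bound: "(?T j powr (1 / s - 1) * ?W j) powr s <= 2 powr (2 * s - 1) * (?T j powr (- e) * ?Q j)" for j
 proof -
  have n1: "(\<integral>\<^sup>+t. ennreal (indicator {0<..<?T j} t * w t) \<partial>lborel) <= ennreal (2 * (2 * ?T j powr (1 / 2)) powr (1 - 1 / s) * ?Q j powr (1 / s))"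
  proof (rule young_integral[where om="?om"])
   show "(\<integral>\<^sup>+t. ennreal (indicator {0<..<?T j} t * ?om t) \<partial>lborel) <= ennreal (2 * ?T j powr (1 / 2))"
    by (rule nn_integral_powr_minus_half[OF T(1)])
   have "(\<integral>\<^sup>+t. ennreal (indicator {0<..<?T j} t * (?om t powr (1 - s) * w t powr s)) \<partial>lborel) = (\<integral>\<^sup>+t. ennreal (?q j t) \<partial>lborel)"
   proof (intro nn_integral_cong)
    fix t :: real
    have "- 1 / 2 * (1 - s) = e" by (simp add: e_def field_simps)
    then have "(t powr (- 1 / 2)) powr (1 - s) = t powr e" by (simp only: powr_powr)
    then show "ennreal (indicator {0<..<?T j} t * (?om t powr (1 - s) * w t powr s)) = ennreal (?q j t)"
     by (auto simp: indicator_def)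
   qed
   also have "... = ennreal (?Q j)" by (rule nn_integral_eq_integral[OF qi]) auto
   finally show "(\<integral>\<^sup>+t. ennreal (indicator {0<..<?T j} t * (?om t powr (1 - s) * w t powr s)) \<partial>lborel) <= ennreal (?Q j)" by simp
  qed (use s w T[of j] Q0[of j] c rh in auto)
  have n2: "ennreal (?W j) <= (\<integral>\<^sup>+t. ennreal (indicator {0<..<?T j} t * w t) \<partial>lborel)"
   using integral_norm_bound_ennreal_general[of lborel "\<lambda>t. indicator {0<..<?T j} t * w t"] w W0[of j] by simp
  have "?W j <= 2 * (2 * ?T j powr (1 / 2)) powr (1 - 1 / s) * ?Q j powr (1 / s)"
   using order_trans[OF n2 n1] by (subst (asm) ennreal_le_iff) auto
  then have "(?T j powr (1 / s - 1) * ?W j) powr s <= (?T j powr (1 / s - 1) * (2 * (2 * ?T j powr (1 / 2)) powr (1 - 1 / s) * ?Q j powr (1 / s))) powr s"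
   using s W0[of j] by (intro powr_mono2 mult_left_mono mult_nonneg_nonneg) auto
  also have "... = ?T j powr ((1 / s - 1) * s) * (2 powr s * ((2 powr ((1 - 1 / s) * s) * ?T j powr (1 / 2 * (1 - 1 / s) * s)) * ?Q j powr (1 / s * s)))"
   using T[of j] Q0[of j] by (simp add: powr_mult powr_powr del: mult_1)
  also have "... = ?T j powr (1 - s) * (2 powr s * ((2 powr (s - 1) * ?T j powr e) * ?Q j powr 1))"
  proof -
   have ee: "(1 / s - 1) * s = 1 - s" "(1 - 1 / s) * s = s - 1" "1 / 2 * (1 - 1 / s) * s = e" "1 / s * s = 1"
    using s by (auto simp: e_def field_simps)
   show ?thesis unfolding ee ..
  qed
  also have "... = (2 powr s * 2 powr (s - 1)) * ((?T j powr (1 - s) * ?T j powr e) * ?Q j)"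
   using Q0[of j] by (simp only: powr_one mult_ac)
  also have "2 powr s * 2 powr (s - 1) = 2 powr (2 * s - 1)" by (simp add: powr_add[symmetric])
  also have "?T j powr (1 - s) * ?T j powr e = ?T j powr (- e)"
  proof -
   have ee: "1 - s + e = - e" by (simp add: e_def field_simps)
   show ?thesis unfolding powr_add[symmetric] ee ..
  qed
  finally show ?thesis .
 qed
 define R where "R = rh powr (- e)"
 have R: "R > 1" unfolding R_def using powr_less_mono2_neg[of "- e" rh 1] rh e by simp
 have sQ: "summable (\<lambda>j. ?T j powr (- e) * ?Q j)"
 proof (rule summableI_nonneg_bounded)
  fix n
  have "(\<Sum>j<n. ?T j powr (- e) * ?Q j) = (LBINT t. (\<Sum>j<n. ?T j powr (- e) * ?q j t))"
   using qi by (subst Bochner_Integration.integral_sum) auto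
  also have "... <= (LBINT t. R / (R - 1) * (indicator {0<..<T} t * w t powr s))"
  proof (rule integral_mono)
   fix t
   show "(\<Sum>j<n. ?T j powr (- e) * ?q j t) <= R / (R - 1) * (indicator {0<..<T} t * w t powr s)"
   proof (cases "t \<in> {0<..<T}")
    case True
    \<comment> \<open>With this y one has y R^j = (t / T_j)^e, so y R^j < 1 encodes t < T_j.\<close>
    let ?y = "(t / c) powr e"
    have "?T j powr (- e) * ?q j t <= (if ?y * R ^ j < 1 then ?y * R ^ j else 0) * w t powr s" for j
    proof -
     have "R ^ j = (rh ^ j) powr (- e)" unfolding R_def using rh
      by (simp add: powr_realpow[symmetric] powr_powr mult.commute)
     then have k: "?y * R ^ j = (t / ?T j) powr e"
      using True c rh by (simp add: powr_divide powr_mult powr_minus field_simps)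
     have "(t / ?T j) powr e < 1" if "t < ?T j"
      using True T[of j] that powr_less_mono2[OF e, of "t / ?T j" 1] by auto
     then have "?T j powr (- e) * (indicator {0<..<?T j} t * t powr e) <= (if ?y * R ^ j < 1 then ?y * R ^ j else 0)"
      unfolding k using True T[of j] by (auto simp: indicator_def powr_divide powr_minus field_simps)
     from mult_right_mono[OF this, of "w t powr s"] show ?thesis by (simp add: mult_ac)
    qed
    then have "(\<Sum>j<n. ?T j powr (- e) * ?q j t) <= (\<Sum>j<n. if ?y * R ^ j < 1 then ?y * R ^ j else 0) * w t powr s"
     unfolding sum_distrib_right by (rule sum_mono)
    also have "... <= R / (R - 1) * w t powr s" by (intro mult_right_mono geometric_sum_below R) auto
    finally show ?thesis using True by simp
   next
    case False
    have "?q j t = 0" for j using False T(2)[of j] by (auto simp: indicator_def)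
    then have "(\<Sum>j<n. ?T j powr (- e) * ?q j t) = 0" by (simp only: mult_zero_right sum.neutral_const)
    then show ?thesis using False by simp
   qed
  qed (use qi ws in auto)
  finally show "(\<Sum>j<n. ?T j powr (- e) * ?Q j) <= (LBINT t. R / (R - 1) * (indicator {0<..<T} t * w t powr s))" .
 qed (use Q0 in auto)
 show ?thesis
  by (rule summable_comparison_test'[OF summable_mult[OF sQ, of "2 powr (2 * s - 1)"], of 0]) (use bound in auto)
qed

section \<open>Frequency-localised heat kernels\<close>

text \<open>Joint measurability in time and space, which integration over the space-time slab
  requires.\<close>

lemma inv_fourier_heat_measurable:
 fixes b :: "real^'n::finite => complex"
 assumes [measurable]: "b \<in> borel_measurable borel" "f \<in> borel_measurable M" "g \<in> borel_measurable M"
 shows "(\<lambda>a. inv_fourier (heat th (f a) \<odot> b) (g a)) \<in> borel_measurable M"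
proof -
 have "(\<lambda>p. LBINT xi. cis (snd p \<bullet> xi) * (of_real (exp (fst p * norm xi powr th)) * b xi)) \<in> borel_measurable (borel \<Otimes>\<^sub>M borel)"
  by measurable
 from measurable_compose[OF measurable_Pair[OF assms(2,3)] this]
 have "(\<lambda>a. LBINT xi. cis (g a \<bullet> xi) * (of_real (exp (f a * norm xi powr th)) * b xi)) \<in> borel_measurable M" by simp
 then show ?thesis unfolding inv_fourier_def heat_def by measurable
qed

definition block_kernel :: "(real => real) => real => nat => real => real^'n::finite => complex" where
 "block_kernel ze th j s = inv_fourier (heat th s \<odot> lp_symbol ze j)"

lemma lp_symbol_0: "lp_symbol ze 0 = radial_cut ze"
 by (simp add: lp_symbol_def radial_cut_def fun_eq_iff)

lemma lp_symbol_pos: "j > 0 ==> lp_symbol ze j xi = ann ze ((1 / 2 ^ j) *\<^sub>R xi)"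
 by (simp add: lp_symbol_def ann_def radial_cut_def)

lemma test_fun_lp_symbol: assumes "lp_cutoff ze" shows "test_fun (lp_symbol ze j :: real^'n::finite => complex)"
proof (cases "j = 0")
 case True
 then show ?thesis using test_fun_radial_cut[OF assms] by (simp add: lp_symbol_0)
next
 case False
 then have "lp_symbol ze j = (\<lambda>xi::real^'n. ann ze ((1 / 2 ^ j) *\<^sub>R xi))" by (simp add: lp_symbol_pos fun_eq_iff)
 moreover have "test_fun (\<lambda>xi::real^'n. ann ze ((1 / 2 ^ j) *\<^sub>R xi))"
  by (rule test_fun_dilate[OF annular_test_fun[OF annular_ann[OF assms]]]) simp
 ultimately show ?thesis by metis
qed

text \<open>Rescaling by 2^j moves the annulus to unit size and the time to s 2^(j th), at most 1 by
  assumption, where the growing symbol is harmless. The block j = 0 is a ball instead of an annulus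
  and relies on \<open>kernel_bound_low\<close>.\<close>

lemma block_kernel_bound:
 assumes ze: "lp_cutoff ze" and th: "th > 0"
 shows "\<exists>C\<ge>0. \<forall>j s. 0 <= s --> s <= (2 powr (- th)) ^ j -->
  (\<forall>x::real^'n::finite. norm (block_kernel ze th j s x) <= C * ((2 ^ j) ^ CARD('n) * prof th (2 ^ j *\<^sub>R x)))"
proof -
 obtain C0 where C0: "C0 >= 0" "!!s x. \<bar>s\<bar> <= 1 ==> norm (fourier (heat th s \<odot> radial_cut ze) (x::real^'n)) <= C0 * prof th x"
  using kernel_bound_low[OF ze th, of 1] by auto
 obtain C1 where C1: "C1 >= 0" "!!s x. s <= 1 ==> norm (fourier (heat th s \<odot> ann ze) (x::real^'n)) <= C1 * decay (real (CARD('n) + 1)) x / (1 + \<bar>s\<bar>) ^ 0"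
  using annular_heat_bound[OF th _ annular_ann[OF ze], of 1 "CARD('n) + 1" 0] by auto
 have "norm (block_kernel ze th j s x) <= (C0 + C1) * ((2 ^ j) ^ CARD('n) * prof th (2 ^ j *\<^sub>R x))"
  if s: "0 <= s" "s <= (2 powr (- th)) ^ j" for j s and x :: "real^'n"
 proof (cases "j = 0")
  case True
  have "norm (block_kernel ze th j s x) <= C0 * prof th x"
   using order_trans[OF norm_inv_fourier C0(2)[of s "- x"]] s True by (simp add: block_kernel_def lp_symbol_0)
  also have "... <= (C0 + C1) * prof th x" using C1(1) by (intro mult_right_mono) auto
  finally show ?thesis using True by simp
 next
  case False
  let ?c = "1 / 2 ^ j :: real"
  let ?s = "s * (2 ^ j) powr th"
  have "?s <= (2 powr (- th)) ^ j * (2 ^ j) powr th" using s by (intro mult_right_mono) auto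
  also have "... = 1" by (simp add: powr_realpow[symmetric] powr_powr powr_add[symmetric] mult.commute)
  finally have s1: "?s <= 1" .
  have "heat th s xi = heat th ?s (?c *\<^sub>R xi)" for xi :: "real^'n"
   using th by (subst heat_scale) (auto simp: powr_divide)
  then have "block_kernel ze th j s = inv_fourier (\<lambda>xi::real^'n. (heat th ?s \<odot> ann ze) (?c *\<^sub>R xi))"
   unfolding block_kernel_def using False by (simp only: lp_symbol_pos neq0_conv)
  then have "norm (block_kernel ze th j s x) <= norm (fourier (\<lambda>xi::real^'n. (heat th ?s \<odot> ann ze) (?c *\<^sub>R xi)) (- x))"
   using norm_inv_fourier by metis
  also have "... = norm ((1 / \<bar>?c\<bar> ^ CARD('n)) *\<^sub>R fourier (\<lambda>et::real^'n. heat th ?s et * ann ze et) ((1 / ?c) *\<^sub>R (- x)))"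
   by (subst fourier_scale) (use heat_mult_integrable[OF th annular_test_fun[OF annular_ann[OF ze]]] in auto)
  also have "... = (2 ^ j) ^ CARD('n) * norm (fourier (\<lambda>et::real^'n. heat th ?s et * ann ze et) (2 ^ j *\<^sub>R (- x)))"
   by (simp add: power_divide)
  also have "... <= (2 ^ j) ^ CARD('n) * ((C0 + C1) * prof th (2 ^ j *\<^sub>R x))"
  proof (intro mult_left_mono)
   have "norm (fourier (\<lambda>et::real^'n. heat th ?s et * ann ze et) (2 ^ j *\<^sub>R (- x))) <= C1 * decay (real (CARD('n) + 1)) (2 ^ j *\<^sub>R (- x))"
    using C1(2)[OF s1, of "2 ^ j *\<^sub>R (- x)"] unfolding power_0 div_by_1 .
   also have "... <= C1 * prof th (2 ^ j *\<^sub>R (- x))" by (intro mult_left_mono decay_le_prof C1(1))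
   also have "... = C1 * prof th (2 ^ j *\<^sub>R x)" by simp
   also have "... <= (C0 + C1) * prof th (2 ^ j *\<^sub>R x)" using C0(1) by (intro mult_right_mono) auto
   finally show "norm (fourier (\<lambda>et::real^'n. heat th ?s et * ann ze et) (2 ^ j *\<^sub>R (- x))) <= (C0 + C1) * prof th (2 ^ j *\<^sub>R x)" .
  qed auto
  finally show ?thesis by (simp only: mult.left_commute)
 qed
 then show ?thesis using C0(1) C1(1) by (intro exI[of _ "C0 + C1"]) auto
qed

section \<open>Mild solutions with Borel data\<close>

text \<open>The summand \<open>1\<close> keeps the weights in the application of Young's inequality positive; it is
  harmless because time ranges over a bounded interval.\<close>

definition slice_norm :: "real => (real^'n::finite => real => complex) => real => real" where
 "slice_norm p U t = (LBINT x. norm (U x t) powr p) powr (1 / p) + 1"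

definition nonlin :: "real => (real^'n::finite => real => complex) => real => real^'n => complex" where
 "nonlin ga U ta y = complex_of_real (norm (U y ta) powr (ga - 1)) * U y ta"

lemma norm_nonlin: "norm (nonlin ga U ta y) = norm (U y ta) powr ga"
 using powr_add[of "norm (U y ta)" "ga - 1" 1] by (cases "U y ta = 0") (auto simp: nonlin_def norm_mult)

text \<open>Points are pairs (tau, y), so that the Duhamel term becomes one integral operator on
  space-time.\<close>

definition slab :: "real => (real \<times> (real^'n::finite)) measure" where
 "slab t = restrict_space lborel {0<..<t} \<Otimes>\<^sub>M lborel"

lemma sigma_finite_time: "sigma_finite_measure (restrict_space lborel {0<..<t::real})"
 by (intro sigma_finite_measure_restrict_space sigma_finite_lborel) simp

lemma sigma_finite_slab: "sigma_finite_measure (slab t)"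
 unfolding slab_def by (intro sigma_finite_pair_measure sigma_finite_time sigma_finite_lborel)

lemma space_slab: "z \<in> space (slab t) \<longleftrightarrow> fst z \<in> {0<..<t}"
 by (cases z) (simp add: slab_def space_pair_measure space_restrict_space)

lemma fst_slab [measurable (raw)]: "f \<in> measurable N (slab t) ==> (\<lambda>a. fst (f a)) \<in> borel_measurable N"
 and snd_slab [measurable (raw)]: "f \<in> measurable N (slab t) ==> (\<lambda>a. snd (f a)) \<in> borel_measurable N"
proof -
 assume f: "f \<in> measurable N (slab t)"
 have "fst \<in> measurable (slab t) (restrict_space lborel {0<..<t})" "snd \<in> measurable (slab t) lborel"
  unfolding slab_def by measurable
 from measurable_compose[OF f this(1)] measurable_compose[OF f this(2)]
 show "(\<lambda>a. fst (f a)) \<in> borel_measurable N" "(\<lambda>a. snd (f a)) \<in> borel_measurable N"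
  by (auto simp: measurable_restrict_space2_iff)
qed

text \<open>The \<open>itself\<close> argument carries the dimension, which the type of
  \<open>th\<close> does not show.\<close>

definition prof_mass :: "'n::finite itself => real => real" where
 "prof_mass _ th = (LBINT y. prof th (y :: real^'n))"

lemma scaled_prof_mass:
 fixes x :: "real^'n::finite"
 assumes th: "th > 0" and c: "c > 0"
 shows "(\<integral>\<^sup>+y. ennreal (c ^ CARD('n) * prof th (c *\<^sub>R (x - y))) \<partial>lborel) = ennreal (prof_mass TYPE('n) th)"
proof -
 have "(\<integral>\<^sup>+y. ennreal (c ^ CARD('n) * prof th (c *\<^sub>R (x - y))) \<partial>lborel)
   = ennreal (c ^ CARD('n)) * (\<integral>\<^sup>+y. ennreal (prof th (c *\<^sub>R x + (- c) *\<^sub>R y)) \<partial>lborel)"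
  using c by (subst nn_integral_cmult[symmetric]) (auto simp: ennreal_mult scaleR_diff_right)
 also have "... = ennreal (c ^ CARD('n)) * (ennreal (1 / \<bar>- c\<bar> ^ CARD('n)) * (\<integral>\<^sup>+y. ennreal (prof th (y :: real^'n)) \<partial>lborel))"
  using c by (subst nn_integral_affine) auto
 also have "... = (\<integral>\<^sup>+y. ennreal (prof th (y :: real^'n)) \<partial>lborel)"
  using c by (simp add: mult.assoc[symmetric] ennreal_mult[symmetric])
 also have "... = ennreal (LBINT y. prof th (y :: real^'n))"
  using integrable_prof[OF th] by (intro nn_integral_eq_integral) auto
 finally show ?thesis unfolding prof_mass_def .
qed

lemma prof_mass_pos:
 assumes "th > 0" shows "prof_mass TYPE('n::finite) th > 0"
proof -
 have "(LBINT y. prof th (y :: real^'n)) \<noteq> 0"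
 proof
  assume "(LBINT y. prof th (y :: real^'n)) = 0"
  then have "AE y in lborel. prof th (y :: real^'n) = 0"
   using integral_nonneg_eq_0_iff_AE[of lborel "prof th :: real^'n => real"] integrable_prof[OF assms] by simp
  then have "AE y in (lborel :: (real^'n) measure). False" by eventually_elim (use prof_pos less_irrefl in metis)
  then show False by (simp add: eventually_False ae_filter_eq_bot_iff)
 qed
 moreover have "(LBINT y. prof th (y :: real^'n)) >= 0" by (intro Bochner_Integration.integral_nonneg) simp
 ultimately show ?thesis unfolding prof_mass_def by linarith
qed

text \<open>The hypotheses after passing to Borel data: every slice of \<open>U\<close>, not just
  almost every one, lies in L^p, and the semigroup inside the Duhamel integral is written as a
  convolution.\<close>

locale mild_core =
 fixes ze :: "real => real" and th ga p q T :: real and \<mu> :: "'n::finite dist" and U :: "real^'n => real => complex"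
 assumes ze: "lp_cutoff ze" and th: "th > 0" and ga: "ga > 1" "ga <= p" "ga < q" and T: "T > 0"
  and rel: "th / (ga - 1) - th / q - real CARD('n) / p = 0" and \<mu>: "tempered \<mu>"
  and U_meas: "(\<lambda>(x, t). U x t) \<in> borel_measurable (borel \<Otimes>\<^sub>M borel)"
  and U_Lp: "!!t. L1 (\<lambda>x. norm (U x t) powr p)"
  and U_Lq: "L1 (\<lambda>t. indicator {0<..<T} t * slice_norm p U t powr q)"
  and solution: "AE t in lborel. t \<in> {0<..<T} --> (\<exists>g. has_semigroup_value th t \<mu> g \<and>
   (AE x in lborel. U x t = g x + (\<integral>ta. heat_conv th (t - ta) (nonlin ga U ta) x \<partial>restrict_space lborel {0<..<t})))"
begin

lemma U_meas' [measurable (raw)]: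
 assumes [measurable]: "f \<in> borel_measurable N" "g \<in> borel_measurable N"
 shows "(\<lambda>a. U (f a) (g a)) \<in> borel_measurable N"
 using measurable_compose[OF measurable_Pair[OF assms] U_meas] by simp

lemma nonlin_meas [measurable (raw)]:
 assumes [measurable]: "f \<in> borel_measurable N" "g \<in> borel_measurable N"
 shows "(\<lambda>a. nonlin ga U (f a) (g a)) \<in> borel_measurable N"
 unfolding nonlin_def by measurable

abbreviation "m \<equiv> slice_norm p U"
abbreviation "w t \<equiv> m t powr ga"
abbreviation "W t \<equiv> LBINT ta. indicator {0<..<t} ta * w ta"
abbreviation "r \<equiv> p / ga"

lemma r: "r >= 1" using ga by simp

lemma mass_pos: "prof_mass TYPE('n) th > 0" by (rule prof_mass_pos[OF th])

lemma m_ge_1: "m t >= 1" by (simp add: slice_norm_def)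

lemma m_pos: "m t > 0" using m_ge_1[of t] by linarith

lemma w_ge_1: "w t >= 1" using m_ge_1[of t] ga by (simp add: ge_one_powr_ge_zero)

lemma m_meas [measurable]: "m \<in> borel_measurable borel"
 unfolding slice_norm_def[abs_def] by measurable

lemma slice_le: "(LBINT x. norm (U x t) powr p) <= m t powr p"
proof -
 let ?i = "LBINT x. norm (U x t) powr p"
 have "?i >= 0" by (intro Bochner_Integration.integral_nonneg) simp
 then have "?i = (?i powr (1 / p)) powr p" using ga by (simp add: powr_powr)
 also have "... <= m t powr p" using ga unfolding slice_norm_def by (intro powr_mono2) auto
 finally show ?thesis .
qed

lemma slice_nn: "(\<integral>\<^sup>+x. ennreal (norm (U x t) powr p) \<partial>lborel) <= ennreal (m t powr p)"
 by (subst nn_integral_eq_integral[OF U_Lp]) (auto intro: ennreal_leI slice_le)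

lemma w_integrable:
 assumes "t <= T" shows "L1 (\<lambda>ta. indicator {0<..<t} ta * w ta)"
proof (rule integrable_dominated[OF U_Lq])
 fix ta
 have "w ta <= m ta powr q" using m_ge_1[of ta] ga by (intro powr_mono) auto
 then show "norm (indicator {0<..<t} ta * w ta) <= indicator {0<..<T} ta * m ta powr q"
  using assms by (auto simp: indicator_def)
qed measurable

lemma W_pos: assumes "0 < t" "t <= T" shows "W t > 0"
proof -
 have "(LBINT ta. indicator {0<..<t} ta * 1) <= W t"
  using assms by (intro integral_mono w_integrable mult_left_mono w_ge_1) auto
 then show ?thesis using assms by simp
qed

lemma W_nn: assumes "0 < t" "t <= T" shows "(\<integral>\<^sup>+ta. ennreal (w ta) \<partial>restrict_space lborel {0<..<t}) = ennreal (W t)"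
proof -
 have "(\<integral>\<^sup>+ta. ennreal (w ta) \<partial>restrict_space lborel {0<..<t}) = (\<integral>\<^sup>+ta. ennreal (indicator {0<..<t} ta * w ta) \<partial>lborel)"
  by (subst nn_integral_restrict_space) (auto intro!: nn_integral_cong simp: indicator_def)
 also have "... = ennreal (W t)" by (rule nn_integral_eq_integral[OF w_integrable[OF assms(2)]]) auto
 finally show ?thesis .
qed

text \<open>\<open>L\<close> is the reciprocal width of the kernel: (t - tau)^(-1/th) for the
  semigroup, the constant 2^j for a frequency block. With weight w = m^ga and r = p/ga, the integral
  of w^(1 - r) |U|^p over a slice is at most m^(ga (1 - r) + p) = m^ga, so the row bound and the
  power bound are both multiples of W(t).\<close>

lemma schur_slab:
 fixes L :: "real => real"
 assumes t: "0 < t" "t <= T" and L_meas [measurable]: "L \<in> borel_measurable borel" and L: "!!ta. L ta >= 0" "!!ta. 0 < ta ==> ta < t ==> L ta > 0"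
 shows "schur (slab t) (\<lambda>x::real^'n. \<lambda>z. L (fst z) ^ CARD('n) * prof th (L (fst z) *\<^sub>R (x - snd z)))
  (\<lambda>z. w (fst z)) (\<lambda>z. norm (U (snd z) (fst z)) powr ga) (prof_mass TYPE('n) th * W t) (prof_mass TYPE('n) th) (W t) r"
proof (intro schur.intro schur_axioms.intro sigma_finite_slab r)
 interpret M: sigma_finite_measure "restrict_space lborel {0<..<t}" by (rule sigma_finite_time)
 have [measurable_cong]: "sets (slab t :: (real \<times> (real^'n)) measure) = sets (restrict_space lborel {0<..<t} \<Otimes>\<^sub>M lborel)" by (simp only: slab_def)
 have wM [measurable]: "w \<in> borel_measurable (restrict_space lborel {0<..<t})" by (intro measurable_restrict_space1) measurable
 show "(\<lambda>(x::real^'n, z). L (fst z) ^ CARD('n) * prof th (L (fst z) *\<^sub>R (x - snd z))) \<in> borel_measurable (lborel \<Otimes>\<^sub>M slab t)"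
  unfolding case_prod_beta by (measurable; (rule measurable_snd)?)
 show "(\<lambda>z. w (fst z)) \<in> borel_measurable (slab t :: (real \<times> (real^'n)) measure)"
  "(\<lambda>z. norm (U (snd z) (fst z)) powr ga) \<in> borel_measurable (slab t)" by measurable
 show "0 <= L (fst z) ^ CARD('n) * prof th (L (fst z) *\<^sub>R (x - snd z))" for x :: "real^'n" and z using L by simp
 show "0 < w (fst z)" for z :: "real \<times> (real^'n)" using w_ge_1[of "fst z"] by linarith
 show "0 < prof_mass TYPE('n) th * W t" by (intro mult_pos_pos mass_pos W_pos t)
 show "0 <= prof_mass TYPE('n) th" "0 <= W t" using mass_pos W_pos[OF t] by linarith+
 show "(\<integral>\<^sup>+x. ennreal (L (fst z) ^ CARD('n) * prof th (L (fst z) *\<^sub>R (x - snd z))) \<partial>lborel) <= ennreal (prof_mass TYPE('n) th)"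
  if "z \<in> space (slab t)" for z :: "real \<times> (real^'n)"
 proof -
  have "prof th (c *\<^sub>R (x - y)) = prof th (c *\<^sub>R (y - x))" for c and x y :: "real^'n"
   using prof_commute[of th "c *\<^sub>R x" "c *\<^sub>R y"] by (simp add: scaleR_diff_right)
  then show ?thesis using scaled_prof_mass[OF th L(2), of "fst z" "snd z"] that unfolding space_slab by simp
 qed
 show "(\<integral>\<^sup>+z. ennreal (L (fst z) ^ CARD('n) * prof th (L (fst z) *\<^sub>R (x - snd z)) * w (fst z)) \<partial>slab t) <= ennreal (prof_mass TYPE('n) th * W t)" for x :: "real^'n"
 proof -
  have "(\<integral>\<^sup>+z. ennreal (L (fst z) ^ CARD('n) * prof th (L (fst z) *\<^sub>R (x - snd z)) * w (fst z)) \<partial>slab t)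
   = (\<integral>\<^sup>+ta. \<integral>\<^sup>+y. ennreal (L ta ^ CARD('n) * prof th (L ta *\<^sub>R (x - y)) * w ta) \<partial>lborel \<partial>restrict_space lborel {0<..<t})"
   unfolding slab_def by (subst lborel.nn_integral_fst[symmetric]) (auto simp: slab_def[symmetric])
  also have "... = (\<integral>\<^sup>+ta. ennreal (prof_mass TYPE('n) th) * ennreal (w ta) \<partial>restrict_space lborel {0<..<t})"
  proof (intro nn_integral_cong)
   fix ta assume "ta \<in> space (restrict_space lborel {0<..<t})"
   then have "L ta > 0" using L(2) by (simp add: space_restrict_space)
   then show "(\<integral>\<^sup>+y. ennreal (L ta ^ CARD('n) * prof th (L ta *\<^sub>R (x - y)) * w ta) \<partial>lborel) = ennreal (prof_mass TYPE('n) th) * ennreal (w ta)"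
    using scaled_prof_mass[OF th, of "L ta" x] by (simp add: ennreal_mult nn_integral_multc)
  qed
  also have "... = ennreal (prof_mass TYPE('n) th) * ennreal (W t)" unfolding W_nn[OF t, symmetric] by (rule nn_integral_cmult) measurable
  finally show ?thesis using mass_pos W_pos[OF t] by (simp add: ennreal_mult)
 qed
 show "(\<integral>\<^sup>+z. ennreal (w (fst z) powr (1 - r) * (norm (U (snd z) (fst z)) powr ga) powr r) \<partial>(slab t :: (real \<times> (real^'n)) measure)) <= ennreal (W t)"
 proof -
  have "(\<integral>\<^sup>+z. ennreal (w (fst z) powr (1 - r) * (norm (U (snd z) (fst z)) powr ga) powr r) \<partial>(slab t :: (real \<times> (real^'n)) measure))
   = (\<integral>\<^sup>+ta. \<integral>\<^sup>+y. ennreal (w ta powr (1 - r) * norm (U y ta) powr p) \<partial>lborel \<partial>restrict_space lborel {0<..<t})"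
   unfolding slab_def using ga by (subst lborel.nn_integral_fst[symmetric]) (auto simp: slab_def[symmetric] powr_powr)
  also have "... <= (\<integral>\<^sup>+ta. ennreal (w ta) \<partial>restrict_space lborel {0<..<t})"
  proof (intro nn_integral_mono)
   fix ta
   have "(\<integral>\<^sup>+y. ennreal (w ta powr (1 - r) * norm (U y ta) powr p) \<partial>lborel) = ennreal (w ta powr (1 - r)) * (\<integral>\<^sup>+y. ennreal (norm (U y ta) powr p) \<partial>lborel)"
    by (subst nn_integral_cmult[symmetric]) (auto simp: ennreal_mult)
   also have "... <= ennreal (w ta powr (1 - r)) * ennreal (m ta powr p)" by (intro mult_left_mono slice_nn) auto
   also have "... = ennreal (w ta)"
   proof -
    have "ga * (1 - r) + p = ga" using ga by (simp add: field_simps)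
    then show ?thesis by (simp add: ennreal_mult[symmetric] powr_powr powr_add[symmetric])
   qed
   finally show "(\<integral>\<^sup>+y. ennreal (w ta powr (1 - r) * norm (U y ta) powr p) \<partial>lborel) <= ennreal (w ta)" .
  qed
  finally show ?thesis unfolding W_nn[OF t] .
 qed
qed auto

text \<open>On a single slice the constant weight \<open>m t\<close> makes the power bound m^(1 - p)
  m^p = m.\<close>

lemma schur_slice:
 fixes c :: real
 assumes c: "c > 0"
 shows "schur lborel (\<lambda>x y :: real^'n. c ^ CARD('n) * prof th (c *\<^sub>R (x - y))) (\<lambda>y. m t) (\<lambda>y. norm (U y t)) (prof_mass TYPE('n) th * m t) (prof_mass TYPE('n) th) (m t) p"
proof (intro schur.intro schur_axioms.intro sigma_finite_lborel)
 note mp = mass_pos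
 show "(\<lambda>(x, y). c ^ CARD('n) * prof th (c *\<^sub>R (x - y :: real^'n))) \<in> borel_measurable (lborel \<Otimes>\<^sub>M lborel)" by measurable
 show "0 < prof_mass TYPE('n) th * m t" by (intro mult_pos_pos mp m_pos)
 show "0 <= prof_mass TYPE('n) th" "0 <= m t" using mp m_pos[of t] by linarith+
 show "(\<integral>\<^sup>+x. ennreal (c ^ CARD('n) * prof th (c *\<^sub>R (x - y))) \<partial>lborel) <= ennreal (prof_mass TYPE('n) th)" for y :: "real^'n"
 proof -
  have "prof th (c *\<^sub>R (x - y)) = prof th (c *\<^sub>R (y - x))" for x :: "real^'n"
   using prof_commute[of th "c *\<^sub>R x" "c *\<^sub>R y"] by (simp add: scaleR_diff_right)
  then show ?thesis using scaled_prof_mass[OF th c, of y] by simp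
 qed
 show "(\<integral>\<^sup>+y. ennreal (c ^ CARD('n) * prof th (c *\<^sub>R (x - y)) * m t) \<partial>lborel) <= ennreal (prof_mass TYPE('n) th * m t)" for x :: "real^'n"
  using scaled_prof_mass[OF th c, of x] c mp m_pos[of t] by (simp add: ennreal_mult less_imp_le nn_integral_multc)
 show "(\<integral>\<^sup>+y. ennreal (m t powr (1 - p) * norm (U y t) powr p) \<partial>lborel) <= ennreal (m t)"
 proof -
  have "(\<integral>\<^sup>+y. ennreal (m t powr (1 - p) * norm (U y t) powr p) \<partial>lborel) = ennreal (m t powr (1 - p)) * (\<integral>\<^sup>+y. ennreal (norm (U y t) powr p) \<partial>lborel)"
   by (subst nn_integral_cmult[symmetric]) (auto simp: ennreal_mult)
  also have "... <= ennreal (m t powr (1 - p)) * ennreal (m t powr p)" by (intro mult_left_mono slice_nn) auto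
  also have "... = ennreal (m t)" using m_pos[of t] by (simp add: ennreal_mult[symmetric] powr_add[symmetric])
  finally show ?thesis .
 qed
qed (use ga c m_pos in auto)

end

lemma powr_add_le:
 fixes a b e :: real
 assumes "a >= 0" "b >= 0" "e >= 0"
 shows "(a + b) powr e <= 2 powr e * (a powr e + b powr e)"
proof -
 have "(a + b) powr e <= (2 * max a b) powr e" using assms by (intro powr_mono2) auto
 also have "... = 2 powr e * max a b powr e" by (simp add: powr_mult)
 also have "... <= 2 powr e * (a powr e + b powr e)" by (intro mult_left_mono) (auto simp: max_def)
 finally show ?thesis .
qed

lemma norm_diff_powr_le:
 fixes a b :: complex
 assumes "e >= 0"
 shows "norm (a - b) powr e <= 2 powr e * (norm a powr e + norm b powr e)"
 using powr_mono2[OF assms norm_ge_zero norm_triangle_ineq4[of a b]] powr_add_le[OF norm_ge_zero[of a] norm_ge_zero[of b] assms]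
 by linarith

lemma heat_kernel_pair_measurable [measurable (raw)]:
 assumes [measurable]: "f \<in> borel_measurable M" "g \<in> borel_measurable M"
 shows "(\<lambda>a. heat_kernel th (f a) (g a :: real^'n::finite)) \<in> borel_measurable M"
 using inv_fourier_heat_measurable[of "\<lambda>_. 1" "\<lambda>a. - f a" M g th] by (simp add: heat_kernel_def)

lemma block_kernel_measurable:
 assumes ze: "lp_cutoff ze" and [measurable]: "f \<in> borel_measurable M" "g \<in> borel_measurable M"
 shows "(\<lambda>a. block_kernel ze th j (f a) (g a :: real^'n::finite)) \<in> borel_measurable M"
proof -
 have "(lp_symbol ze j :: real^'n => complex) \<in> borel_measurable borel"
  by (rule schwartz_measurable[OF schwartz_test_fun[OF test_fun_lp_symbol[OF ze]]])
 from inv_fourier_heat_measurable[OF this assms(2,3)] show ?thesis unfolding block_kernel_def .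
qed

lemma heat_test_inversion:
 fixes om :: "real^'n::finite => complex"
 assumes ze: "lp_cutoff ze" and th: "th > 0" and om: "test_fun om"
 shows "L1 (fourier (heat th t \<odot> om))"
  and "inv_fourier (fourier (heat th t \<odot> om)) = (heat th t \<odot> om)"
proof -
 let ?b = "heat th t \<odot> om"
 have i: "L1 ?b" by (rule heat_mult_integrable[OF th om])
 obtain C where C: "C >= 0" "!!x. norm (fourier ?b x) <= C * prof th x" using kernel_bound_test_fun[OF ze th om] by blast
 show fi: "L1 (fourier ?b)"
  by (rule integrable_dominated[OF integrable_mult_right[OF integrable_prof[OF th], of C] _ C(2)]) (simp add: i)
 have com: "continuous_on UNIV om" using om by (auto simp: test_fun_def intro: smooth_on_continuous)
 obtain M where M: "M >= 0" "!!x. norm (om x) <= M" using test_fun_sup[OF om] by blast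
 obtain R where R: "R > 0" "!!xi. norm xi >= R ==> om xi = 0" using test_fun_bound[OF om] by blast
 show "inv_fourier (fourier ?b) = ?b"
 proof
  fix xi
  show "inv_fourier (fourier ?b) xi = ?b xi"
  proof (rule fourier_inversion[OF _ _ i fi])
   show "continuous_on UNIV ?b" by (intro continuous_on_mult heat_continuous th com)
   show "norm (?b x) <= exp (\<bar>t\<bar> * R powr th) * M" for x
   proof (cases "norm x >= R")
    case False
    have "t * norm x powr th <= \<bar>t\<bar> * norm x powr th" by (intro mult_right_mono) auto
    also have "... <= \<bar>t\<bar> * R powr th" using False th by (intro mult_left_mono powr_mono2) auto
    finally show ?thesis unfolding norm_mult norm_heat by (intro mult_mono M) auto
   qed (use R M in simp)
  qed
 qed
qed

section \<open>Frequency blocks of the datum\<close>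

context mild_core
begin

text \<open>The trace g, equal to U(t) minus the Duhamel term, is tame: the first by its L^p bound,
  the second by \<open>operator_tame\<close>. So the pairing formula applies. In the Duhamel term
  the symbols of S(t - tau) and of the inverse of S(t) combine to exp(tau |xi|^th), which no longer
  contains t.\<close>

lemma mild_datum_pairing:
 assumes t: "0 < t" "t < T" and sv: "has_semigroup_value th t \<mu> g"
  and eq: "AE x in lborel. U x t = g x + (\<integral>ta. heat_conv th (t - ta) (nonlin ga U ta) x \<partial>restrict_space lborel {0<..<t})"
  and om: "test_fun om"
 shows "\<mu> (fourier om) = (LBINT x. U x t * fourier (heat th t \<odot> om) x)
  - (\<integral>z. nonlin ga U (fst z) (snd z) * fourier (heat th (fst z) \<odot> om) (snd z) \<partial>slab t)"
proof -
 define L where "L ta = 1 / (t - ta) powr (1 / th)" for ta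
 have [measurable]: "L \<in> borel_measurable borel" unfolding L_def[abs_def] by measurable
 have L: "L ta >= 0" "ta < t ==> L ta > 0" for ta by (simp_all add: L_def)
 interpret h: schur "slab t" "\<lambda>x::real^'n. \<lambda>z. L (fst z) ^ CARD('n) * prof th (L (fst z) *\<^sub>R (x - snd z))"
  "\<lambda>z. w (fst z)" "\<lambda>z. norm (U (snd z) (fst z)) powr ga" "prof_mass TYPE('n) th * W t" "prof_mass TYPE('n) th" "W t" r
  using t L by (intro schur_slab) auto
 let ?K = "\<lambda>x z. heat_kernel th (t - fst z) (x - snd z :: real^'n)"
 let ?F = "\<lambda>z. nonlin ga U (fst z) (snd z)"
 let ?D = "\<lambda>x. \<integral>z. ?K x z * ?F z \<partial>slab t"
 let ?ps = "fourier (heat th t \<odot> om)"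
 obtain C where C: "C >= 0" "!!s x. s > 0 ==> norm (heat_kernel th s (x::real^'n)) <= C * ((1 / s powr (1 / th)) ^ CARD('n) * prof th ((1 / s powr (1 / th)) *\<^sub>R x))"
  using heat_kernel_bound[OF ze th] by blast
 have Km: "(\<lambda>(x, z). ?K x z) \<in> borel_measurable (lborel \<Otimes>\<^sub>M slab t)" unfolding case_prod_beta by measurable
 have Kb: "\<forall>x. \<forall>z\<in>space (slab t). norm (?K x z) <= C * (L (fst z) ^ CARD('n) * prof th (L (fst z) *\<^sub>R (x - snd z)))"
  unfolding L_def by (intro allI ballI C(2)) (simp add: space_slab)
 have Fm: "?F \<in> borel_measurable (slab t)" by measurable
 note op = Km Kb C(1) Fm norm_nonlin
 \<comment> \<open>The space-time integral agrees with the iterated one wherever it converges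
   absolutely, that is, at almost every x.\<close>
 have nest: "AE x in lborel. ?D x = (\<integral>ta. heat_conv th (t - ta) (nonlin ga U ta) x \<partial>restrict_space lborel {0<..<t})"
  using h.operator_integrable_AE[OF op]
 proof eventually_elim
  case (elim x)
  interpret time: sigma_finite_measure "restrict_space lborel {0<..<t}" by (rule sigma_finite_time)
  interpret tx: pair_sigma_finite "restrict_space lborel {0<..<t}" "lborel :: (real^'n) measure" ..
  show ?case using tx.integral_fst'[OF elim[unfolded slab_def]] unfolding slab_def heat_conv_def by simp
 qed
 have D: "tame ?D" by (rule h.operator_tame[OF op])
 have U: "tame (\<lambda>x. U x t)" using ga U_Lp[of t] by (intro tame_Lp[of p]) auto
 have [measurable]: "g \<in> borel_measurable borel" using sv by (intro borel_measurable_continuous_onI) (simp add: has_semigroup_value_def)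
 have ge: "AE x in lborel. U x t + - ?D x = g x" using eq nest by eventually_elim simp
 have g: "tame g" by (rule tame_AE_cong[OF tame_add[OF U tame_uminus[OF D]] _ ge]) measurable
 interpret semigroup_trace ze th t \<mu> g by unfold_locales (rule ze th \<mu> g sv)+
 have psi: "L1 ?ps" by (rule heat_test_inversion[OF ze th om])
 then have [measurable]: "?ps \<in> borel_measurable borel" by auto
 obtain B where B: "B >= 0" "!!x. norm (?ps x) <= B * prof th x" using kernel_bound_test_fun[OF ze th om] by blast
 have psb: "norm (?ps x) <= B" for x
  using B(2)[of x] mult_left_mono[OF prof_le_one[OF th, of x] B(1)] by simp
 have Ui: "L1 (\<lambda>x. U x t * ?ps x)" by (rule tame_prof_integrable[OF th U _ B(2)]) measurable
 have kernel: "(LBINT x. ?K x z * ?ps x) = fourier (heat th (fst z) \<odot> om) (snd z)" if "z \<in> space (slab t)" for z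
 proof -
  have s: "t - fst z > 0" using that unfolding space_slab by simp
  have "(LBINT x. ?K x z * ?ps x) = fourier (\<lambda>xi. heat th (- (t - fst z)) xi * (heat th t xi * om xi)) (snd z)"
   using fourier_mult_inv_fourier[OF heat_integrable[OF th s] psi, of "snd z"]
   unfolding heat_test_inversion(2)[OF ze th om] heat_kernel_def by simp
  also have "(\<lambda>xi. heat th (- (t - fst z)) xi * (heat th t xi * om xi)) = (heat th (fst z) \<odot> om)"
   by (simp add: mult.assoc[symmetric] heat_add[symmetric])
  finally show ?thesis .
 qed
 have "\<mu> (fourier om) = (LBINT x. g x * ?ps x)" by (rule initial_datum_pairing[OF om])
 also have "... = (LBINT x. U x t * ?ps x - ?D x * ?ps x)"
  using tame_measurable[OF D] by (intro integral_cong_AE) (use ge in \<open>auto elim!: eventually_mono simp: left_diff_distrib[symmetric]\<close>)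
 also have "... = (LBINT x. U x t * ?ps x) - (LBINT x. ?D x * ?ps x)"
  by (rule Bochner_Integration.integral_diff[OF Ui h.operator_adjoint(1)[OF op psi psb]])
 also have "(LBINT x. ?D x * ?ps x) = (\<integral>z. ?F z * (LBINT x. ?K x z * ?ps x) \<partial>slab t)"
  by (rule h.operator_adjoint(2)[OF op psi psb])
 also have "... = (\<integral>z. ?F z * fourier (heat th (fst z) \<odot> om) (snd z) \<partial>slab t)"
  by (intro Bochner_Integration.integral_cong refl) (simp only: kernel)
 finally show ?thesis .
qed

definition block_fun :: "nat => real => real^'n => complex" where
 "block_fun j t x = (LBINT y. block_kernel ze th j t (x - y) * U y t)
  - (\<integral>z. block_kernel ze th j (fst z) (x - snd z) * nonlin ga U (fst z) (snd z) \<partial>slab t)"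

text \<open>For t <= 2^(-th j) all times in (0, t) are within reach of
  \<open>block_kernel_bound\<close>. The factor 2^(jN(ga - 1)) is the height 2^(jN) of the kernel
  raised to p/r - 1 = ga - 1, the cost of passing from L^(p/ga) to L^p. The constant is uniform in
  j, t and g, so blocks may be estimated at different times.\<close>

lemma block_fun_bounds:
 "\<exists>B\<ge>0. \<forall>j t g. 0 < t --> t < T --> t <= (2 powr (- th)) ^ j --> has_semigroup_value th t \<mu> g -->
  (AE x in lborel. U x t = g x + (\<integral>ta. heat_conv th (t - ta) (nonlin ga U ta) x \<partial>restrict_space lborel {0<..<t})) -->
  in_Lp p (block_fun j t) \<and> represents (block_fun j t) (lp_block ze j \<mu>) \<and>
  (\<integral>x. norm (block_fun j t x) powr p \<partial>lebesgue) <= B * (m t powr p + ((2 ^ j) ^ CARD('n)) powr (ga - 1) * W t powr p)"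
proof -
 obtain C where C: "C >= 0" "!!j s x. 0 <= s ==> s <= (2 powr (- th)) ^ j ==>
   norm (block_kernel ze th j s (x::real^'n)) <= C * ((2 ^ j) ^ CARD('n) * prof th (2 ^ j *\<^sub>R x))"
  using block_kernel_bound[OF ze th, where 'n='n] by metis
 let ?I = "prof_mass TYPE('n) th"
 let ?B = "2 powr p * (C powr p * 2 powr p * (?I powr p + ?I powr (p * (1 - 1 / r) + 1)))"
 have "in_Lp p (block_fun j t) \<and> represents (block_fun j t) (lp_block ze j \<mu>) \<and>
  (\<integral>x. norm (block_fun j t x) powr p \<partial>lebesgue) <= ?B * (m t powr p + ((2 ^ j) ^ CARD('n)) powr (ga - 1) * W t powr p)"
  if t: "0 < t" "t < T" and tj: "t <= (2 powr (- th)) ^ j" and sv: "has_semigroup_value th t \<mu> g"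
   and eq: "AE x in lborel. U x t = g x + (\<integral>ta. heat_conv th (t - ta) (nonlin ga U ta) x \<partial>restrict_space lborel {0<..<t})" for j t g
 proof -
  let ?c = "2 ^ j :: real"
  let ?La = "?c ^ CARD('n)"
  interpret b: schur "slab t" "\<lambda>x::real^'n. \<lambda>z. ?La * prof th (?c *\<^sub>R (x - snd z))"
   "\<lambda>z. w (fst z)" "\<lambda>z. norm (U (snd z) (fst z)) powr ga" "?I * W t" ?I "W t" r
   using t by (intro schur_slab[where L="\<lambda>_. ?c"]) auto
  interpret u: schur lborel "\<lambda>x y :: real^'n. ?La * prof th (?c *\<^sub>R (x - y))" "\<lambda>y. m t" "\<lambda>y. norm (U y t)" "?I * m t" ?I "m t" p
   by (rule schur_slice) simp

  let ?K = "\<lambda>x z. block_kernel ze th j (fst z) (x - snd z :: real^'n)" and ?k = "\<lambda>x y. block_kernel ze th j t (x - y :: real^'n)"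
  let ?F = "\<lambda>z. nonlin ga U (fst z) (snd z)"
  have Km: "(\<lambda>(x, z). ?K x z) \<in> borel_measurable (lborel \<Otimes>\<^sub>M slab t)"
   unfolding case_prod_beta by (intro block_kernel_measurable ze) measurable
  have km: "(\<lambda>(x, y). ?k x y) \<in> borel_measurable (lborel \<Otimes>\<^sub>M lborel)"
   unfolding case_prod_beta by (intro block_kernel_measurable ze) measurable
  have Kb: "\<forall>x. \<forall>z\<in>space (slab t). norm (?K x z) <= C * (?La * prof th (?c *\<^sub>R (x - snd z)))"
   using tj by (intro allI ballI C(2)) (auto simp: space_slab)
  have kb: "\<forall>x. \<forall>y\<in>space lborel. norm (?k x y) <= C * (?La * prof th (?c *\<^sub>R (x - y)))"
   using t tj by (intro allI ballI C(2)) auto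
  have Fm: "?F \<in> borel_measurable (slab t)" by measurable
  note opb = Km Kb C(1) Fm norm_nonlin
  have Um: "(\<lambda>y. U y t) \<in> borel_measurable lborel" by measurable
  note opu = km kb C(1) Um refl
  let ?u = "\<lambda>x. LBINT y. ?k x y * U y t" and ?b = "\<lambda>x. \<integral>z. ?K x z * ?F z \<partial>slab t"
  have um: "?u \<in> borel_measurable borel" by (rule u.operator_measurable[OF opu])
  have bm: "?b \<in> borel_measurable borel" by (rule b.operator_measurable[OF opb])
  have G: "block_fun j t = (\<lambda>x. ?u x - ?b x)" by (simp add: block_fun_def fun_eq_iff)
  have [measurable]: "block_fun j t \<in> borel_measurable borel" unfolding G by (rule borel_measurable_diff[OF um bm])
  have La: "?La * prof th x <= ?La" for x :: "real^'n" using prof_le_one[OF th, of x] by simp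
  have Lau: "\<forall>x. \<forall>y\<in>space lborel. ?La * prof th (?c *\<^sub>R (x - y :: real^'n)) <= ?La"
   and Lab: "\<forall>x::real^'n. \<forall>z\<in>space (slab t). ?La * prof th (?c *\<^sub>R (x - snd z)) <= ?La" using La by blast+
  have La0: "?La > 0" by simp
  have pr: "p >= r" using ga by (simp add: field_simps)
  have W: "W t > 0" using W_pos[of t] t by simp
  note ub = u.operator_Lp[OF opu Lau La0 order_refl] and bb = b.operator_Lp[OF opb Lab La0 pr]
  have dom: "norm (norm (block_fun j t x) powr p) <= 2 powr p * (norm (?u x) powr p + norm (?b x) powr p)" for x
   unfolding G using norm_diff_powr_le[of p "?u x" "?b x"] ga by simp
  have domi: "L1 (\<lambda>x. 2 powr p * (norm (?u x) powr p + norm (?b x) powr p))"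
   by (intro integrable_mult_right Bochner_Integration.integrable_add ub bb)
  have Gi: "L1 (\<lambda>x. norm (block_fun j t x) powr p)"
   by (rule integrable_dominated[OF domi _ dom]) measurable
  have Lp: "in_Lp p (block_fun j t)"
   unfolding in_Lp_def using Gi by (auto simp: integrable_completion intro: measurable_completion)
  have u_le: "(LBINT x. norm (?u x) powr p) <= C powr p * 2 powr p * ?I powr p * m t powr p"
  proof -
   have "(?I * m t) powr (p * (1 - 1 / p)) * (?La * m t) powr (p / p - 1) * (?I * m t) = ?I powr p * m t powr p"
   proof -
    have "(?I * m t) powr (p * (1 - 1 / p)) * (?I * m t) powr 1 = (?I * m t) powr p"
     unfolding powr_add[symmetric] using ga by (simp add: field_simps)
    then show ?thesis using ga mass_pos m_pos[of t] by (simp add: powr_mult)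
   qed
   then show ?thesis using ub(2) by (simp only: mult.assoc)
  qed
  have b_le: "(LBINT x. norm (?b x) powr p) <= C powr p * 2 powr p * ?I powr (p * (1 - 1 / r) + 1) * (?La powr (ga - 1) * W t powr p)"
  proof -
   have "p / r = ga" using ga by simp
   then have e: "p * (1 - 1 / r) + (ga - 1) + 1 = p" by (simp add: right_diff_distrib)
   have "W t powr (p * (1 - 1 / r)) * W t powr (ga - 1) * W t powr 1 = W t powr p"
    unfolding powr_add[symmetric] e ..
   then have "(?I * W t) powr (p * (1 - 1 / r)) * (?La * W t) powr (p / r - 1) * (?I * W t) = ?I powr (p * (1 - 1 / r) + 1) * (?La powr (ga - 1) * W t powr p)"
    using mass_pos W unfolding \<open>p / r = ga\<close> powr_mult powr_add by (simp only: powr_one_gt_zero_iff powr_one less_imp_le mult_ac)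
   then show ?thesis using bb(2) by (simp only: mult.assoc)
  qed
  have Gle: "(LBINT x. norm (block_fun j t x) powr p) <= ?B * (m t powr p + ?La powr (ga - 1) * W t powr p)"
  proof -
   have "(LBINT x. norm (block_fun j t x) powr p) <= (LBINT x. 2 powr p * (norm (?u x) powr p + norm (?b x) powr p))"
    by (rule integral_mono[OF Gi domi]) (use dom in auto)
   also have "... = 2 powr p * ((LBINT x. norm (?u x) powr p) + (LBINT x. norm (?b x) powr p))"
    using ub(1) bb(1) by simp
   also have "... <= 2 powr p * (C powr p * 2 powr p * ?I powr p * m t powr p + C powr p * 2 powr p * ?I powr (p * (1 - 1 / r) + 1) * (?La powr (ga - 1) * W t powr p))"
    by (intro mult_left_mono add_mono u_le b_le) auto
   also have "... <= 2 powr p * (C powr p * 2 powr p * (?I powr p + ?I powr (p * (1 - 1 / r) + 1)) * m t powr p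
    + C powr p * 2 powr p * (?I powr p + ?I powr (p * (1 - 1 / r) + 1)) * (?La powr (ga - 1) * W t powr p))"
    by (intro mult_left_mono add_mono mult_right_mono) auto
   also have "... = ?B * (m t powr p + ?La powr (ga - 1) * W t powr p)" by (simp only: algebra_simps)
   finally show ?thesis .
  qed
  have "represents (block_fun j t) (lp_block ze j \<mu>)"
   unfolding represents_def
  proof (intro allI impI)
   fix ph :: "real^'n => complex" assume ph: "schwartz ph"
   have phi: "L1 ph" by (rule schwartz_integrable[OF ph])
   have [measurable]: "ph \<in> borel_measurable borel" by (rule schwartz_measurable[OF ph])
   obtain M where M: "!!x. norm (ph x) <= M" using schwartz_bounded[OF ph] by blast
   have i: "L1 (?u \<odot> ph)" "L1 (?b \<odot> ph)"
    using u.operator_adjoint(1)[OF opu phi M] b.operator_adjoint(1)[OF opb phi M] by auto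
   then have ii: "L1 (block_fun j t \<odot> ph)" unfolding G by (simp add: left_diff_distrib)
   let ?om = "lp_symbol ze j \<odot> inv_fourier ph"
   have tom: "test_fun ?om" by (rule test_fun_mult'[OF schwartz_smooth[OF schwartz_inv_fourier[OF ph]] test_fun_lp_symbol[OF ze]])
   have k: "fourier (heat th s \<odot> ?om) y = (LBINT x. block_kernel ze th j s (x - y) * ph x)" for s y
    using fourier_mult_inv_fourier[OF heat_mult_integrable[OF th test_fun_lp_symbol[OF ze, of j], of s] phi, of y]
    unfolding block_kernel_def by (simp only: mult.assoc)
   have "lp_block ze j \<mu> ph = \<mu> (fourier ?om)" unfolding lp_block_def multiplier_eq ..
   also have "... = (LBINT y. U y t * (LBINT x. ?k x y * ph x)) - (\<integral>z. ?F z * (LBINT x. ?K x z * ph x) \<partial>slab t)"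
    unfolding mild_datum_pairing[OF t sv eq tom] k ..
   also have "... = (LBINT x. ?u x * ph x) - (LBINT x. ?b x * ph x)"
    unfolding u.operator_adjoint(2)[OF opu phi M] b.operator_adjoint(2)[OF opb phi M] ..
   also have "... = (LBINT x. block_fun j t x * ph x)"
    unfolding G left_diff_distrib by (rule Bochner_Integration.integral_diff[OF i, symmetric])
   also have "... = regular_dist (block_fun j t) ph" by (rule regular_dist_borel[symmetric]) measurable
   finally show "integrable lebesgue (block_fun j t \<odot> ph) \<and> lp_block ze j \<mu> ph = regular_dist (block_fun j t) ph"
    using ii by (simp add: integrable_completion)
  qed
  moreover have "(\<integral>x. norm (block_fun j t x) powr p \<partial>lebesgue) = (LBINT x. norm (block_fun j t x) powr p)"
   by (rule integral_completion) (use Gi in auto)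
  ultimately show ?thesis using Lp Gle by metis
 qed
 then show ?thesis by (intro exI[of _ ?B]) auto
qed

end

section \<open>Summation over the blocks\<close>

context mild_core
begin

lemma W_mono: assumes "0 < t" "t <= t'" "t' <= T" shows "W t <= W t'"
 using assms by (intro integral_mono w_integrable) (auto simp: indicator_def)

theorem initial_datum_besov: "\<mu> \<in> besov_space ze (- th / q) p q"
proof -
 define rh where "rh = 2 powr (- th)"
 have rh: "0 < rh" "rh < 1" unfolding rh_def using th powr_less_mono[of "- th" 0 2] by auto
 \<comment> \<open>c <= T keeps the times inside (0, T), and c <= 1 keeps t_j below 2^(-th j), as
   the block estimate requires.\<close>
 define c where "c = min 1 T"
 have c: "0 < c" "c <= T" "c <= 1" using T by (auto simp: c_def)
 let ?T = "\<lambda>j. c * rh ^ j"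
 have Tj: "?T j > 0" "?T j <= T" "?T j <= rh ^ j" for j
  using c rh order_trans[OF mult_left_le[OF power_le_one[of rh j], of c]] mult_right_mono[of c 1 "rh ^ j"] by auto
 let ?R = "\<lambda>t. \<exists>g. has_semigroup_value th t \<mu> g \<and>
   (AE x in lborel. U x t = g x + (\<integral>ta. heat_conv th (t - ta) (nonlin ga U ta) x \<partial>restrict_space lborel {0<..<t}))"
 have "\<exists>t. (\<forall>j. 0 < t j \<and> t j < c * rh ^ j \<and> ?R (t j)) \<and> summable (\<lambda>j. rh ^ j * (m (t j) powr q))"
  by (rule good_times[OF rh c(1,2) _ _ U_Lq solution]) auto
 then obtain t :: "nat => real" where t: "!!j. 0 < t j" "!!j. t j < c * rh ^ j" "!!j. ?R (t j)"
  and sm: "summable (\<lambda>j. rh ^ j * (m (t j) powr q))" by blast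
 obtain B where B: "B >= 0" and bB: "!!j t g. [|0 < t; t < T; t <= (2 powr (- th)) ^ j; has_semigroup_value th t \<mu> g;
  AE x in lborel. U x t = g x + (\<integral>ta. heat_conv th (t - ta) (nonlin ga U ta) x \<partial>restrict_space lborel {0<..<t})|] ==>
  in_Lp p (block_fun j t) \<and> represents (block_fun j t) (lp_block ze j \<mu>) \<and>
  (\<integral>x. norm (block_fun j t x) powr p \<partial>lebesgue) <= B * (m t powr p + ((2 ^ j) ^ CARD('n)) powr (ga - 1) * W t powr p)"
  using block_fun_bounds by blast
 let ?g = "\<lambda>j. block_fun j (t j)"
 let ?X = "\<lambda>j. \<integral>x. norm (?g j x) powr p \<partial>lebesgue"
 have g: "in_Lp p (?g j)" "represents (?g j) (lp_block ze j \<mu>)"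
  "?X j <= B * (m (t j) powr p + ((2 ^ j) ^ CARD('n)) powr (ga - 1) * W (t j) powr p)" for j
 proof -
  have lt: "t j < T" "t j <= (2 powr (- th)) ^ j" using t(2)[of j] Tj[of j] unfolding rh_def by linarith+
  obtain g where sv: "has_semigroup_value th (t j) \<mu> g"
   and eq: "AE x in lborel. U x (t j) = g x + (\<integral>ta. heat_conv th (t j - ta) (nonlin ga U ta) x \<partial>restrict_space lborel {0<..<t j})"
   using t(3)[of j] by blast
  from bB[OF t(1) lt sv eq] show "in_Lp p (?g j)" "represents (?g j) (lp_block ze j \<mu>)"
   "?X j <= B * (m (t j) powr p + ((2 ^ j) ^ CARD('n)) powr (ga - 1) * W (t j) powr p)" by blast+
 qed
 \<comment> \<open>With w = m^ga this gives w^s = m^q, which is integrable over (0, T).\<close>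
 define s where "s = q / ga"
 have s: "s > 1" "s <= q" using ga by (auto simp: s_def field_simps mult_le_cancel_left1)
 let ?h = "\<lambda>j. ?T j powr (1 / s - 1) * W (?T j)"
 have "L1 (\<lambda>t. indicator {0<..<T} t * w t powr s)"
  using U_Lq ga by (simp add: powr_powr s_def)
 then have "summable (\<lambda>j. ?h j powr s)"
  by (intro summable_hardy[OF rh c(1,2) s(1)]) auto
 \<comment> \<open>Hardy's inequality yields s-th powers; the Besov sum asks for the larger exponent
   q.\<close>
 then have sh: "summable (\<lambda>j. ?h j powr q)"
  using s W_pos[OF Tj(1,2)] by (intro summable_powr_mono[of ?h s q]) (auto simp: less_imp_le)
 let ?K = "(2 * B) powr (q / p)"
 have bound: "(2 powr (- th / q * real j) * Lp_norm p (?g j)) powr q <= ?K * (rh ^ j * (m (t j) powr q)) + ?K * (c powr (q - ga) * (?h j powr q))" for j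
 proof -
  let ?La = "(2 ^ j) ^ CARD('n) :: real"
  have X0: "?X j >= 0" by (intro Bochner_Integration.integral_nonneg) simp
  have rhj: "rh ^ j = 2 powr (- th * real j)" unfolding rh_def by (simp add: powr_realpow[symmetric] powr_powr)
  have W0: "W (t j) >= 0" using W_pos[of "t j"] t(1,2)[of j] Tj(2)[of j] by linarith
  have WT: "W (t j) <= W (?T j)" using t(1,2)[of j] Tj(2)[of j] by (intro W_mono) auto
  have "?X j powr (q / p) <= (B * (m (t j) powr p + ?La powr (ga - 1) * W (t j) powr p)) powr (q / p)"
   using g(3)[of j] X0 ga by (intro powr_mono2) auto
  also have "... = B powr (q / p) * (m (t j) powr p + ?La powr (ga - 1) * W (t j) powr p) powr (q / p)" by (simp add: powr_mult)
  also have "... <= B powr (q / p) * (2 powr (q / p) * ((m (t j) powr p) powr (q / p) + (?La powr (ga - 1) * W (t j) powr p) powr (q / p)))"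
   using ga by (intro mult_left_mono powr_add_le) auto
  also have "(m (t j) powr p) powr (q / p) = m (t j) powr q" using ga by (simp add: powr_powr)
  also have "(?La powr (ga - 1) * W (t j) powr p) powr (q / p) = ?La powr ((ga - 1) * (q / p)) * W (t j) powr q"
   using ga by (simp add: powr_mult powr_powr)
  also have "B powr (q / p) * (2 powr (q / p) * (m (t j) powr q + ?La powr ((ga - 1) * (q / p)) * W (t j) powr q))
   = ?K * (m (t j) powr q + ?La powr ((ga - 1) * (q / p)) * W (t j) powr q)"
   by (simp add: powr_mult mult_ac)
  also have "... <= ?K * (m (t j) powr q + ?La powr ((ga - 1) * (q / p)) * W (?T j) powr q)"
   using W0 WT ga by (intro mult_left_mono add_left_mono powr_mono2) auto
  finally have X: "?X j powr (q / p) <= ?K * (m (t j) powr q + ?La powr ((ga - 1) * (q / p)) * W (?T j) powr q)" .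
  \<comment> \<open>The scaling relation turns the dyadic factor 2^(jN(ga - 1)q/p) into 2^(j th (q -
    ga + 1)), a power of the time scale.\<close>
  have e: "real CARD('n) * ((ga - 1) * (q / p)) = th * (q - ga + 1)"
  proof -
   have "real CARD('n) / p = th / (ga - 1) - th / q" using rel by simp
   then have "real CARD('n) / p * ((ga - 1) * q) = (th / (ga - 1) - th / q) * ((ga - 1) * q)" by simp
   also have "... = th * (q - ga + 1)" using ga by (simp add: field_simps)
   finally show ?thesis by (simp add: field_simps)
  qed
  \<comment> \<open>The Besov weight rh^j and the height of the kernel combine to T_j^(ga - q),
    exactly the weight T_j^((1/s - 1) q) in Hardy's sum.\<close>
  have L: "rh ^ j * ?La powr ((ga - 1) * (q / p)) = c powr (q - ga) * ?T j powr (ga - q)"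
  proof -
   have l: "?La = 2 powr (real j * real CARD('n))" by (simp add: powr_realpow[symmetric] powr_powr power_mult[symmetric])
   have "rh ^ j * ?La powr ((ga - 1) * (q / p)) = 2 powr (- th * real j + real j * (real CARD('n) * ((ga - 1) * (q / p))))"
    unfolding rhj l by (simp only: powr_powr powr_add mult.assoc)
   also have "... = 2 powr (- th * real j * (ga - q))" unfolding e by (simp add: algebra_simps)
   also have "... = (rh ^ j) powr (ga - q)" unfolding rhj powr_powr ..
   also have "... = c powr (q - ga) * ?T j powr (ga - q)"
    using c rh powr_add[of c "q - ga" "ga - q"] by (simp add: powr_mult mult.assoc[symmetric])
   finally show ?thesis .
  qed
  have h: "?h j powr q = ?T j powr (ga - q) * W (?T j) powr q"
  proof -
   have "(1 / s - 1) * q = ga - q" using ga by (simp add: s_def field_simps)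
   then show ?thesis by (simp add: powr_mult powr_powr)
  qed
  have "(2 powr (- th / q * real j) * Lp_norm p (?g j)) powr q = rh ^ j * ?X j powr (q / p)"
   unfolding Lp_norm_def rhj using ga by (simp add: powr_mult powr_powr)
  also have "... <= rh ^ j * (?K * (m (t j) powr q + ?La powr ((ga - 1) * (q / p)) * W (?T j) powr q))"
   using X rh by (intro mult_left_mono) auto
  also have "... = ?K * (rh ^ j * (m (t j) powr q)) + ?K * ((rh ^ j * ?La powr ((ga - 1) * (q / p))) * W (?T j) powr q)"
   by (simp only: algebra_simps)
  also have "... = ?K * (rh ^ j * (m (t j) powr q)) + ?K * (c powr (q - ga) * (?h j powr q))"
   unfolding L h by (simp only: mult.assoc)
  finally show ?thesis .
 qed
 have "summable (\<lambda>j. (2 powr (- th / q * real j) * Lp_norm p (?g j)) powr q)"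
  by (rule summable_comparison_test'[where N=0, OF summable_add[OF summable_mult[OF sm, of ?K] summable_mult[OF summable_mult[OF sh, of "c powr (q - ga)"], of ?K]]])
   (use bound in auto)
 then show ?thesis unfolding besov_space_def using \<mu> g(1,2) by (intro CollectI conjI exI[of _ ?g] allI) auto
qed

end

section \<open>Borel representatives\<close>

lemma lborel_pair_AE_swap:
 fixes P :: "'a::euclidean_space \<times> 'b::euclidean_space => bool"
 assumes "AE z in lborel. P z"
 shows "AE t in lborel. AE x in lborel. P (x, t)"
proof -
 have "AE z in distr (lborel \<Otimes>\<^sub>M lborel) (lborel \<Otimes>\<^sub>M lborel) (\<lambda>(t :: 'b, x :: 'a). (x, t)). P z"
  using assms unfolding lborel_prod[symmetric] by (subst (asm) lborel_pair.distr_pair_swap)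
 from AE_distrD[OF measurable_pair_swap' this]
 have "AE z in lborel \<Otimes>\<^sub>M lborel. P (snd z, fst z)" by (simp add: case_prod_beta)
 from lborel_pair.AE_pair[OF this] show ?thesis by simp
qed

lemma lborel_AE_ex:
 assumes "AE x in (lborel :: 'a::euclidean_space measure). P x" shows "\<exists>x. P x"
proof (rule ccontr)
 assume "\<nexists>x. P x"
 with assms have "AE x in (lborel :: 'a measure). False" by simp
 then show False by (simp add: eventually_False ae_filter_eq_bot_iff)
qed

lemma lebesgue_measurable_AE_cong:
 fixes f g :: "'a::euclidean_space => 'b::topological_space"
 assumes g: "g \<in> borel_measurable lebesgue" and ae: "AE x in lebesgue. f x = g x"
 shows "f \<in> borel_measurable lebesgue"
proof (rule measurableI)
 fix A :: "'b set" assume A: "A \<in> sets borel"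
 show "f -` A \<inter> space lebesgue \<in> sets lebesgue"
  by (rule completion.in_sets_AE[OF _ measurable_sets[OF g A]]) (use ae in \<open>auto elim!: eventually_mono\<close>)
qed simp

text \<open>Completeness of Lebesgue measure makes \<open>f\<close> measurable on \<open>S\<close>
  because it agrees there almost everywhere with \<open>g\<close>. This serves integrands that come
  from a definite description.\<close>

lemma integral_lebesgue_on_AE_borel:
 fixes f g :: "real => complex"
 assumes g: "g \<in> borel_measurable borel" and S: "S \<in> sets borel" and ae: "AE x in lborel. x \<in> S --> f x = g x"
 shows "(\<integral>x. f x \<partial>lebesgue_on S) = (\<integral>x. g x \<partial>restrict_space lborel S)"
proof -
 have gm: "(\<lambda>x. indicator S x *\<^sub>R g x) \<in> borel_measurable lborel" using g S by simp
 have gl: "(\<lambda>x. indicator S x *\<^sub>R g x) \<in> borel_measurable lebesgue" by (rule measurable_completion[OF gm])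
 have ae': "AE x in lebesgue. indicator S x *\<^sub>R f x = indicator S x *\<^sub>R g x"
  unfolding AE_completion_iff using ae by eventually_elim (auto simp: indicator_def)
 have "(\<integral>x. f x \<partial>lebesgue_on S) = (\<integral>x. indicator S x *\<^sub>R f x \<partial>lebesgue)"
  using S by (intro integral_restrict_space) (auto intro: sets_completionI_sets)
 also have "... = (\<integral>x. indicator S x *\<^sub>R g x \<partial>lebesgue)"
  by (rule integral_cong_AE[OF lebesgue_measurable_AE_cong[OF gl ae'] gl ae'])
 also have "... = (LBINT x. indicator S x *\<^sub>R g x)" by (rule integral_completion[OF gm])
 also have "... = (\<integral>x. g x \<partial>restrict_space lborel S)" using S by (intro integral_restrict_space[symmetric]) simp
 finally show ?thesis .
qed

lemma lebesgue_borel_representative: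
 fixes f :: "'a::euclidean_space => complex"
 assumes f: "f \<in> borel_measurable lebesgue"
 obtains g where "g \<in> borel_measurable borel" "AE x in lborel. f x = g x"
proof -
 obtain a where a: "a \<in> borel_measurable lborel" "AE x in lborel. Re (f x) = a x"
  using completion_ex_borel_measurable_real[of "\<lambda>x. Re (f x)" lborel] f by (auto intro: measurable_compose[OF _ borel_measurable_Re])
 obtain b where b: "b \<in> borel_measurable lborel" "AE x in lborel. Im (f x) = b x"
  using completion_ex_borel_measurable_real[of "\<lambda>x. Im (f x)" lborel] f by (auto intro: measurable_compose[OF _ borel_measurable_Im])
 have "(\<lambda>x. Complex (a x) (b x)) \<in> borel_measurable borel"
  unfolding Complex_eq using a(1) b(1) by measurable
 moreover have "AE x in lborel. f x = Complex (a x) (b x)"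
  using a(2) b(2) by eventually_elim (simp add: complex_eq_iff)
 ultimately show ?thesis by (rule that)
qed

theorem corollary1p12:
  fixes \<gamma> \<theta> p q T :: real
    and \<zeta> :: "real \<Rightarrow> real"
    and \<mu> :: "'n::finite dist"
    and u :: "real^'n \<Rightarrow> real \<Rightarrow> complex"
  assumes "lp_cutoff \<zeta>"
    and "\<gamma> > 1" and "\<theta> > 0"
    and "real CARD('n) * (\<gamma> - 1) / \<theta> < p" and "\<gamma> \<le> p" and "\<gamma> < q"
    and "\<theta> / (\<gamma> - 1) - \<theta> / q - real CARD('n) / p = 0"
    and "tempered \<mu>"
    and "T > 0"
    and "in_Lq_Lp q T p u"
    and "mild_solution \<theta> \<gamma> T \<mu> u"
  shows "\<mu> \<in> besov_space \<zeta> (- \<theta> / q) p q \<and>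
         (besov_space \<zeta> (- \<theta> / q) p q :: 'n dist set) =
           besov_space \<zeta> (real CARD('n) / p - \<theta> / (\<gamma> - 1))
             (real CARD('n) * q * (\<gamma> - 1) / (\<theta> * (q - \<gamma> + 1))) q"
proof -
 note \<zeta> = assms(1) and \<theta> = assms(3) and \<gamma> = assms(2,5,6) and rel = assms(7) and T = assms(9)
 define I where "I = {0<..<T}"
 define S where "S = (UNIV :: (real^'n) set) \<times> I"
 have I [measurable]: "I \<in> sets borel" and "I \<in> sets lebesgue" by (auto simp: I_def)
 note I = this
 have S: "S \<in> sets lebesgue" unfolding S_def I_def
  by (rule sets_completionI_sets) (simp add: borel_open open_Times)
 have um: "(\<lambda>(x, t). u x t) \<in> borel_measurable (lebesgue_on S)"
  and uLp: "AE t in lebesgue_on I. in_Lp p (\<lambda>x. u x t)"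
  and uLq: "integrable (lebesgue_on I) (\<lambda>t. Lp_norm p (\<lambda>x. u x t) powr q)"
  using assms(10) unfolding in_Lq_Lp_def S_def I_def by auto
 obtain U0 :: "(real^'n) \<times> real => complex" where [measurable]: "U0 \<in> borel_measurable borel"
  and U0: "AE z in lborel. (if z \<in> S then (\<lambda>(x, t). u x t) z else 0) = U0 z"
  using lebesgue_borel_representative[OF borel_measurable_if_I[OF um S]] by blast
 have U0m [measurable (raw)]: "(\<lambda>a. U0 (f a, g a)) \<in> borel_measurable M"
  if [measurable]: "f \<in> borel_measurable M" "g \<in> borel_measurable M" for f g and M :: "'z measure"
  by (rule measurable_compose[of _ M borel]) (auto simp: borel_prod[symmetric])
 \<comment> \<open>Times at which the Borel slice has finite L^p norm. Setting \<open>U\<close> to 0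
   elsewhere puts every slice in L^p and affects only a null set of times in (0, T).\<close>
 define G where "G = {t \<in> I. (\<integral>\<^sup>+x. ennreal (norm (U0 (x, t)) powr p) \<partial>lborel) < \<infinity>}"
 define U where "U x t = (if t \<in> G then U0 (x, t) else 0)" for x t
 have G [measurable]: "G \<in> sets borel"
  unfolding G_def using I by measurable
 have Um: "(\<lambda>(x, t). U x t) \<in> borel_measurable (borel \<Otimes>\<^sub>M borel)"
  unfolding U_def case_prod_beta by measurable
 have Um' [measurable (raw)]: "(\<lambda>a. U (f a) (g a)) \<in> borel_measurable M"
  if [measurable]: "f \<in> borel_measurable M" "g \<in> borel_measurable M" for f g and M :: "'z measure"
  using measurable_compose[OF measurable_Pair[OF that] Um] by simp
 have U_Lp: "L1 (\<lambda>x. norm (U x t) powr p)" for t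
 proof (cases "t \<in> G")
  case True
  then have "(\<integral>\<^sup>+x. ennreal (norm (norm (U x t) powr p)) \<partial>lborel) < \<infinity>" by (simp add: U_def G_def)
  then show ?thesis by (intro integrableI_bounded) auto
 qed (simp add: U_def)
 define good where "good t \<longleftrightarrow> t \<in> I \<and> in_Lp p (\<lambda>x. u x t) \<and> (AE x in lborel. u x t = U x t)" for t
 have slices: "AE t in lborel. AE x in lborel. t \<in> I --> u x t = U0 (x, t)"
  using lborel_pair_AE_swap[OF U0] by (auto simp: S_def elim!: eventually_mono)
 have Lp_slices: "AE t in lborel. t \<in> I --> in_Lp p (\<lambda>x. u x t)"
  using uLp I by (simp add: AE_restrict_space_iff AE_completion_iff)
 have good: "AE t in lborel. t \<in> I --> good t"
  using slices Lp_slices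
 proof eventually_elim
  case (elim t)
  show ?case
  proof
   assume t: "t \<in> I"
   have L: "in_Lp p (\<lambda>x. u x t)" using elim(2) t by simp
   have ae: "AE x in lborel. u x t = U0 (x, t)" using elim(1) t by simp
   have "integrable lebesgue (\<lambda>x. norm (U0 (x, t)) powr p)"
   proof (rule integrable_cong_AE_imp)
    show "integrable lebesgue (\<lambda>x. norm (u x t) powr p)" using L by (simp add: in_Lp_def)
    show "(\<lambda>x. norm (U0 (x, t)) powr p) \<in> borel_measurable lebesgue" by (rule measurable_completion) measurable
    show "AE x in lebesgue. norm (u x t) powr p = norm (U0 (x, t)) powr p"
     unfolding AE_completion_iff using ae by eventually_elim simp
   qed
   then have "L1 (\<lambda>x. norm (U0 (x, t)) powr p)" by (subst (asm) integrable_completion) auto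
   then have "t \<in> G" unfolding G_def using t by (simp add: integrable_iff_bounded)
   then show "good t" unfolding good_def using t L ae by (simp add: U_def)
  qed
 qed
 have slice_eq: "Lp_norm p (\<lambda>x. u x t) = slice_norm p U t - 1" if "good t" for t
 proof -
  have "(\<integral>x. norm (u x t) powr p \<partial>lebesgue) = (\<integral>x. norm (U x t) powr p \<partial>lebesgue)"
  proof (rule integral_cong_AE)
   show "(\<lambda>x. norm (u x t) powr p) \<in> borel_measurable lebesgue" using that by (auto simp: good_def in_Lp_def)
   show "(\<lambda>x. norm (U x t) powr p) \<in> borel_measurable lebesgue" by (rule measurable_completion) measurable
   show "AE x in lebesgue. norm (u x t) powr p = norm (U x t) powr p"
    unfolding AE_completion_iff using that by (auto simp: good_def elim!: eventually_mono)
  qed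
  also have "... = (LBINT x. norm (U x t) powr p)" by (rule integral_completion) measurable
  finally show ?thesis by (simp add: Lp_norm_def slice_norm_def)
 qed
 have sm [measurable]: "slice_norm p U \<in> borel_measurable borel"
  unfolding slice_norm_def[abs_def] by measurable
 have U_Lq: "L1 (\<lambda>t. indicator {0<..<T} t * slice_norm p U t powr q)"
 proof -
  have "integrable lebesgue (\<lambda>t. indicator I t *\<^sub>R (Lp_norm p (\<lambda>x. u x t) powr q))"
   using uLq I by (subst (asm) integrable_restrict_space) auto
  then have "integrable lebesgue (\<lambda>t. indicator I t * ((slice_norm p U t - 1) powr q))"
  proof (rule integrable_cong_AE_imp)
   show "(\<lambda>t. indicator I t * ((slice_norm p U t - 1) powr q)) \<in> borel_measurable lebesgue"
    using I by (intro measurable_completion) measurable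
   show "AE t in lebesgue. indicator I t *\<^sub>R (Lp_norm p (\<lambda>x. u x t) powr q) = indicator I t * ((slice_norm p U t - 1) powr q)"
    unfolding AE_completion_iff using good by eventually_elim (auto simp: slice_eq indicator_def)
  qed
  then have "L1 (\<lambda>t. indicator I t * ((slice_norm p U t - 1) powr q))"
   using I by (subst (asm) integrable_completion) auto
  moreover have "L1 (indicator I :: real => real)"
   using T by (intro integrable_real_indicator) (auto simp: I_def)
  ultimately have d: "L1 (\<lambda>t. 2 powr q * (indicator I t * ((slice_norm p U t - 1) powr q) + indicator I t))"
   by (intro integrable_mult_right Bochner_Integration.integrable_add)
  show ?thesis unfolding I_def[symmetric]
  proof (rule integrable_dominated[OF d])
   fix t
   have "slice_norm p U t powr q <= 2 powr q * ((slice_norm p U t - 1) powr q + 1)"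
    using powr_add_le[of "slice_norm p U t - 1" 1 q] \<gamma> by (simp add: slice_norm_def)
   from mult_left_mono[OF this, of "indicator I t"]
   show "norm (indicator I t * slice_norm p U t powr q) <= 2 powr q * (indicator I t * ((slice_norm p U t - 1) powr q) + indicator I t)"
    by (simp add: algebra_simps)
  qed measurable
 qed
 have nonlin_prof: "prof_integrable \<theta> (nonlin \<gamma> U \<tau>)" for \<tau>
 proof (rule tame_prof_integrable'[OF \<theta> tame_Lp[of "p / \<gamma>"]])
  show "nonlin \<gamma> U \<tau> \<in> borel_measurable borel" unfolding nonlin_def[abs_def] by measurable
  show "L1 (\<lambda>x. norm (nonlin \<gamma> U \<tau> x) powr (p / \<gamma>))"
   using U_Lp \<gamma> by (simp add: norm_nonlin powr_powr)
 qed (use \<gamma> in auto)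
 have semigroup: "frac_semigroup \<theta> s (regular_dist (nonlin \<gamma> u \<tau>)) = heat_conv \<theta> s (nonlin \<gamma> U \<tau>)"
  if "good \<tau>" "s > 0" for s \<tau>
 proof (rule frac_semigroup_eqI[OF \<zeta> has_semigroup_value_heat_conv[OF \<zeta> \<theta> that(2) nonlin_prof]])
  have [measurable]: "(\<lambda>y. u y \<tau>) \<in> borel_measurable lebesgue" using that(1) by (auto simp: good_def in_Lp_def)
  show "nonlin \<gamma> u \<tau> \<in> borel_measurable lebesgue" unfolding nonlin_def[abs_def] by measurable
  show "AE x in lebesgue. nonlin \<gamma> u \<tau> x = nonlin \<gamma> U \<tau> x"
   unfolding AE_completion_iff using that(1) by (auto simp: good_def nonlin_def elim!: eventually_mono)
 qed
 have duhamel: "(\<integral>\<tau>. frac_semigroup \<theta> (t - \<tau>) (regular_dist (nonlin \<gamma> u \<tau>)) x \<partial>lebesgue_on {0<..<t})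
  = (\<integral>\<tau>. heat_conv \<theta> (t - \<tau>) (nonlin \<gamma> U \<tau>) x \<partial>restrict_space lborel {0<..<t})" if "t \<in> I" for t x
 proof (rule integral_lebesgue_on_AE_borel)
  show "(\<lambda>\<tau>. heat_conv \<theta> (t - \<tau>) (nonlin \<gamma> U \<tau>) x) \<in> borel_measurable borel"
   unfolding heat_conv_def nonlin_def by measurable
  show "AE \<tau> in lborel. \<tau> \<in> {0<..<t} --> frac_semigroup \<theta> (t - \<tau>) (regular_dist (nonlin \<gamma> u \<tau>)) x = heat_conv \<theta> (t - \<tau>) (nonlin \<gamma> U \<tau>) x"
   using good by eventually_elim (use that in \<open>auto simp: semigroup I_def\<close>)
 qed simp
 have "AE z in lborel. z \<in> S --> semigroup_defined \<theta> (snd z) \<mu> \<and> u (fst z) (snd z) = frac_semigroup \<theta> (snd z) \<mu> (fst z)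
  + (\<integral>\<tau>. frac_semigroup \<theta> (snd z - \<tau>) (regular_dist (nonlin \<gamma> u \<tau>)) (fst z) \<partial>lebesgue_on {0<..<snd z})"
  using assms(11) S unfolding mild_solution_def S_def[unfolded I_def, symmetric] nonlin_def[abs_def] case_prod_beta
  by (simp add: AE_restrict_space_iff AE_completion_iff imp_conjR)
 from lborel_pair_AE_swap[OF this] have sol: "AE t in lborel. AE x in lborel. t \<in> I --> semigroup_defined \<theta> t \<mu> \<and> u x t = frac_semigroup \<theta> t \<mu> x
  + (\<integral>\<tau>. frac_semigroup \<theta> (t - \<tau>) (regular_dist (nonlin \<gamma> u \<tau>)) x \<partial>lebesgue_on {0<..<t})"
  by (simp add: S_def)
 have solution: "AE t in lborel. t \<in> {0<..<T} --> (\<exists>g. has_semigroup_value \<theta> t \<mu> g \<and>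
   (AE x in lborel. U x t = g x + (\<integral>\<tau>. heat_conv \<theta> (t - \<tau>) (nonlin \<gamma> U \<tau>) x \<partial>restrict_space lborel {0<..<t})))"
  using sol good
 proof eventually_elim
  case (elim t)
  show ?case
  proof
   assume "t \<in> {0<..<T}"
   then have t: "t \<in> I" by (simp add: I_def)
   \<comment> \<open>That S(t)mu is defined does not depend on x, so a single point from a set of
     full measure decides it.\<close>
   have "semigroup_defined \<theta> t \<mu>" using lborel_AE_ex[OF elim(1)] t by blast
   then have "has_semigroup_value \<theta> t \<mu> (frac_semigroup \<theta> t \<mu>)" by (rule frac_semigroup_value[OF \<zeta>])
   moreover have "AE x in lborel. u x t = U x t" using elim(2) t by (simp add: good_def)
   with elim(1) have "AE x in lborel. U x t = frac_semigroup \<theta> t \<mu> x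
     + (\<integral>\<tau>. heat_conv \<theta> (t - \<tau>) (nonlin \<gamma> U \<tau>) x \<partial>restrict_space lborel {0<..<t})"
    by eventually_elim (use t duhamel[OF t] in simp)
   ultimately show "\<exists>g. has_semigroup_value \<theta> t \<mu> g \<and>
    (AE x in lborel. U x t = g x + (\<integral>\<tau>. heat_conv \<theta> (t - \<tau>) (nonlin \<gamma> U \<tau>) x \<partial>restrict_space lborel {0<..<t}))" by blast
  qed
 qed
 interpret mild_core \<zeta> \<theta> \<gamma> p q T \<mu> U
  by unfold_locales (fact \<zeta> \<theta> \<gamma> rel T assms(8) Um U_Lp U_Lq solution)+
 have pq: "p > 0" "q > 0" "q - \<gamma> + 1 > 0" "\<gamma> - 1 > 0" using \<gamma> by auto
 \<comment> \<open>The scaling relation solved for the regularity and then for the integrability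
   exponent; the two Besov spaces have identical parameters.\<close>
 have e1: "- \<theta> / q = real CARD('n) / p - \<theta> / (\<gamma> - 1)" using rel by simp
 have e2: "p = real CARD('n) * q * (\<gamma> - 1) / (\<theta> * (q - \<gamma> + 1))"
 proof -
  have "real CARD('n) / p = \<theta> / (\<gamma> - 1) - \<theta> / q" using rel by simp
  also have "... = \<theta> * (q - \<gamma> + 1) / (q * (\<gamma> - 1))" using pq by (simp add: field_simps)
  finally have "real CARD('n) * (q * (\<gamma> - 1)) = \<theta> * (q - \<gamma> + 1) * p"
   using pq by (subst (asm) frac_eq_eq) auto
  moreover have "\<theta> * (q - \<gamma> + 1) \<noteq> 0" using pq \<theta> by simp
  ultimately show ?thesis by (subst eq_divide_eq) (simp add: mult_ac)
 qed
 show ?thesis using initial_datum_besov unfolding e1[symmetric] e2[symmetric] by simp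
qed

end
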